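(* Consider the sdRKDG scheme (defined in the context) for the hyperbolic conservation law $\partial_t u+\nabla\cdot f(u)=0$, $u(x,0)=u_0(x)$, in $d$ space dimensions, on quasi-uniform meshes, with the following assumptions: 1. $f$ is Lipschitz continuous. 2. The numerical flux $\widehat{f\cdot\nu_{e,K}}(u_h)$ has the following properties: (a) Consistency: if $u_h=u_h^{\mathrm{int}}=u_h^{\mathrm{ext}}$, then $\widehat{f\cdot\nu_{e,K}}(u_h)=f(u_h)\cdot\nu_{e,K}$. (b) Lipschitz continuity: $|\widehat{f\cdot\nu_{e,K}}(u_h)-\widehat{f\cdot\nu_{e,K}}(v_h)|\le C\|u_h-v_h\|_{L^\infty(\widehat{B}_K)}$ with a constant $C$ independent of the mesh, where $\widehat{B}_K=K\cup K^{\mathrm{ext}}$ is the union of $K$ and its neighboring cell $K^{\mathrm{ext}}$. 3. The CFL condition $\Delta t/h\le\lambda_0$ holds, where $\lambda_0$ is a fixed constant. If $u_h^n$ converges boundedly almost everywhere to a function $u$ as $\Delta t,h\to0$, then the limit $u$ is a weak solution to the conservation law, namely $$\int_{\mathbb{R}^d}u_0(x)\,\phi(x,0)\,\mathrm{d}x+\int_{\mathbb{R}^d\times\mathbb{R}^+}u\,\phi_t\,\mathrm{d}x\,\mathrm{d}t+\int_{\mathbb{R}^d\times\mathbb{R}^+}f(u)\cdot\nabla\phi\,\mathrm{d}x\,\mathrm{d}t=0\qquad\forall\,\phi\in C_0^\infty(\mathbb{R}^d\times\mathbb{R}^+).$$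
   Context: Meshes. $\mathcal{T}_h=\{K\}$ is a partition of the $d$-dimensional spatial domain into cells $K$; $h_K$ is the diameter of $K$ and $h=\max_{K\in\mathcal{T}_h}h_K$. $\partial K$ is the boundary of $K$; for each edge (face) $e$ of $K$, written $e\in\partial K$, $\nu_{e,K}$ is the unit outward normal along $e$ with respect to $K$, and $K^{\mathrm{ext}}$ is the cell on the other side of $e$. Spaces. For an integer $\ell\ge0$, $\mathcal{V}_h^\ell=\{v_h: v_h|_K\in\mathcal{P}^\ell(K)\ \forall K\in\mathcal{T}_h\}$, where $\mathcal{P}^\ell(K)$ is the space of polynomials of degree up to $\ell$ on $K$. An integer $k\ge1$ is fixed. Numerical flux. For $u_h\in\mathcal{V}_h^k$, $u_h^{\mathrm{int}}$ and $u_h^{\mathrm{ext}}$ denote the limits of $u_h$ along $e$ from the interior and the exterior of $K$, and $\widehat{f\cdot\nu_{e,K}}=\widehat{f\cdot\nu_{e,K}}(u_h)$ is a numerical flux on $e$. It is conservative: if $e$ is shared by $K$ and $K'$, then $\widehat{f\cdot\nu_{e,K}}(u_h)=-\widehat{f\cdot\nu_{e,K'}}(u_h)$ on $e$. An example is the Lax--Friedrichs type flux $\frac12\big(f(u_h^{\mathrm{int}})\cdot\nu_{e,K}+f(u_h^{\mathrm{ext}})\cdot\nu_{e,K}-\alpha_{e,K}(u_h^{\mathrm{ext}}-u_h^{\mathrm{int}})\big)$ with $\alpha_{e,K}=\max|\partial_uf\cdot\nu_{e,K}|$. DG operators. For $\ell\in\{k-1,k\}$ and $u_h\in\mathcal{V}_h^k$,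 $\nabla^{\mathrm{DG}}_\ell\cdot f(u_h)\in\mathcal{V}_h^\ell$ is defined by $$\int_K\nabla^{\mathrm{DG}}_\ell\cdot f(u_h)\,v_h\,\mathrm{d}x=-\int_Kf(u_h)\cdot\nabla v_h\,\mathrm{d}x+\sum_{e\in\partial K}\int_e\widehat{f\cdot\nu_{e,K}}(u_h)\,v_h\,\mathrm{d}l\qquad\forall v_h\in\mathcal{V}_h^\ell,\ \forall K\in\mathcal{T}_h,$$ where on $e\in\partial K$ the trace of $v_h$ is taken from inside $K$. The sdRKDG scheme (Runge--Kutta discontinuous Galerkin scheme with stage-dependent polynomial spaces). Let $A=(a_{ij})_{s\times s}$ (with $a_{ij}=0$ for $i\le j$) and $b=(b_1,\dots,b_s)$ be the Butcher coefficients of an explicit Runge--Kutta method, consistent in the sense that $\sum_{i=1}^s b_i=1$, and let $d_{ij}\in\{k-1,k\}$, $e_i\in\{k-1,k\}$ for $i<s$, and $e_s=k$. With time step $\Delta t$, $u_h^{n+1}\in\mathcal{V}_h^k$ is obtained from $u_h^n\in\mathcal{V}_h^k$ by $$u_h^{(i)}=u_h^n-\Delta t\sum_{j=1}^{i-1}a_{ij}\nabla^{\mathrm{DG}}_{d_{ij}}\cdot f(u_h^{(j)}),\quad i=1,\dots,s,$$ $$u_h^{n+1}=u_h^n-\Delta t\sum_{i=1}^sb_i\nabla^{\mathrm{DG}}_{e_i}\cdot f(u_h^{(i)}).$$ The scheme is started from a numerical approximation $u_h^0\in\mathcal{V}_h^k$ of the initial condition $u_0$; no particular choice is prescribed. Conventions.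 The equation is written for a scalar unknown $u$. "Converges boundedly almost everywhere" means that the numerical solutions, viewed as functions of $(x,t)$, are uniformly bounded and converge almost everywhere. Test functions in $C_0^\infty(\mathbb{R}^d\times\mathbb{R}^+)$ are smooth with compact support and need not vanish at $t=0$. *)

theory Defs
  imports "HOL-Analysis.Analysis"
begin

section \<open>Polytopal meshes of the whole space\<close>

text \<open>
  Cells are closed convex polytopes with nonempty interior and the spatial domain is the whole
  Euclidean space. Hanging nodes are allowed: a face is the interface between two cells whose
  intersection has codimension one. On a face-to-face mesh these are exactly the facets.
  Since cells are convex, a face is determined by the two cells sharing it, so faces are indexed
  by ordered pairs: the pair \<open>(K, K')\<close> is the face of \<open>K\<close> beyond which lies \<open>K'\<close>, the exterior cell.
\<close>

definition mesh :: "'a::euclidean_space set set \<Rightarrow> bool" where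
  "mesh T \<longleftrightarrow>
     (\<forall>K\<in>T. polytope K \<and> interior K \<noteq> {}) \<and>
     \<Union>T = UNIV \<and>
     pairwise (\<lambda>K K'. interior K \<inter> interior K' = {}) T \<and>
     bdd_above (diameter ` T)"

definition mesh_size :: "'a::euclidean_space set set \<Rightarrow> real" where
  "mesh_size T = (SUP K\<in>T. diameter K)"

text \<open>
  A mesh in a quasi-uniform family: \<open>\<sigma>\<close> is the shape-regularity constant (ratio of an
  inscribed ball to the diameter) and also bounds all cell diameters from below by \<open>\<sigma> h\<close>.
  It has to be the same for all meshes of the family.
\<close>

definition quasi_uniform :: "real \<Rightarrow> 'a::euclidean_space set set \<Rightarrow> bool" where
  "quasi_uniform \<sigma> T \<longleftrightarrow>
     (\<forall>K\<in>T. (\<exists>z. cball z (\<sigma> * diameter K) \<subseteq> K) \<and> \<sigma> * mesh_size T \<le> diameter K)"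

definition neighbours :: "'a::euclidean_space set set \<Rightarrow> 'a set \<Rightarrow> 'a set set" where
  "neighbours T K = {K'\<in>T. K' \<noteq> K \<and> aff_dim (K \<inter> K') = int DIM('a) - 1}"

text \<open>
  The unit vector that lies in the normal cone of \<open>K\<close> at every point of the face. It is unique
  because the face has codimension one and \<open>K\<close> has interior points.
\<close>

definition outward_normal :: "'a::euclidean_space set \<Rightarrow> 'a set \<Rightarrow> 'a" where
  "outward_normal K K' =
     (THE \<nu>. norm \<nu> = 1 \<and> (\<forall>x\<in>K \<inter> K'. \<forall>y\<in>K. \<nu> \<bullet> (y - x) \<le> 0))"

text \<open>
  For a unit vector \<open>\<nu>\<close>, the surface measure on the hyperplane \<open>{x. \<nu> \<bullet> x = c}\<close>, obtained by
  orthogonally projecting Lebesgue measure on the slab of thickness one above the hyperplane: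
  a subset of the hyperplane is given the volume of the right prism of height one over it.
  In one dimension it is the unit point mass at \<open>c *\<^sub>R \<nu>\<close>.
\<close>

definition hyperplane_measure :: "'a::euclidean_space \<Rightarrow> real \<Rightarrow> 'a measure" where
  "hyperplane_measure \<nu> c =
     distr (restrict_space lborel {x. c \<le> \<nu> \<bullet> x \<and> \<nu> \<bullet> x \<le> c + 1}) borel
       (\<lambda>x. x - (\<nu> \<bullet> x - c) *\<^sub>R \<nu>)"

text \<open>
  The supremum below is the value of \<open>\<nu> \<bullet> x\<close> on the supporting hyperplane of \<open>K\<close>
  that contains the face.
\<close>

definition face_integral :: "'a::euclidean_space set \<Rightarrow> 'a set \<Rightarrow> ('a \<Rightarrow> real) \<Rightarrow> real" where
  "face_integral K K' g =
     (let \<nu> = outward_normal K K'; c = (SUP y\<in>K. \<nu> \<bullet> y)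
      in LINT x:K \<inter> K'|hyperplane_measure \<nu> c. g x)"


section \<open>Broken polynomial spaces\<close>

definition multi_indices :: "nat \<Rightarrow> ('a::euclidean_space \<Rightarrow> nat) set" where
  "multi_indices l = {\<alpha> \<in> Basis \<rightarrow>\<^sub>E UNIV. (\<Sum>i\<in>Basis. \<alpha> i) \<le> l}"

definition poly_space :: "nat \<Rightarrow> ('a::euclidean_space \<Rightarrow> real) set" where
  "poly_space l =
     range (\<lambda>c x. \<Sum>\<alpha>\<in>multi_indices l. c \<alpha> * (\<Prod>i\<in>Basis. (x \<bullet> i) ^ \<alpha> i))"

text \<open>
  A function in the discontinuous space is stored as the family of its polynomials on the
  individual cells. Each of them is a polynomial on all of space, determined by its values on the
  cell, so for a point \<open>x\<close> of the face shared by \<open>K\<close> and \<open>K'\<close> the interior and exterior limits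
  seen from \<open>K\<close> are \<open>v K x\<close> and \<open>v K' x\<close>.
\<close>

type_synonym 'a broken = "'a set \<Rightarrow> 'a \<Rightarrow> real"

definition broken_poly :: "'a::euclidean_space set set \<Rightarrow> nat \<Rightarrow> 'a broken set" where
  "broken_poly T l = (\<Pi>\<^sub>E K\<in>T. poly_space l)"

text \<open>
  The associated function on space. Its values on cell boundaries, a null set, are taken from an
  unspecified adjacent cell.
\<close>

definition eval_broken :: "'a::euclidean_space set set \<Rightarrow> 'a broken \<Rightarrow> 'a \<Rightarrow> real" where
  "eval_broken T v x = v (SOME K. K \<in> T \<and> x \<in> K) x"

definition Linf_norm :: "'a::euclidean_space set \<Rightarrow> ('a \<Rightarrow> real) \<Rightarrow> real" where
  "Linf_norm S g = Inf {B. 0 \<le> B \<and> (AE x in lebesgue. x \<in> S \<longrightarrow> \<bar>g x\<bar> \<le> B)}"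


section \<open>Numerical fluxes\<close>

text \<open>
  \<open>F K K' u x\<close> is the numerical flux in the direction of the outward normal of \<open>K\<close>, at the
  point \<open>x\<close> of the face shared by \<open>K\<close> and \<open>K'\<close>.
\<close>

type_synonym 'a num_flux = "'a set \<Rightarrow> 'a set \<Rightarrow> 'a broken \<Rightarrow> 'a \<Rightarrow> real"

text \<open>Measurability along faces makes the face integrals of the flux meaningful.\<close>

definition numerical_flux ::
    "'a::euclidean_space set set \<Rightarrow> nat \<Rightarrow> 'a num_flux \<Rightarrow> bool" where
  "numerical_flux T k F \<longleftrightarrow>
     (\<forall>K\<in>T. \<forall>K'\<in>neighbours T K. \<forall>u\<in>broken_poly T k.
        F K K' u \<in> borel_measurable (restrict_space borel (K \<inter> K')) \<and>
        (\<forall>x\<in>K \<inter> K'. F K K' u x = - F K' K u x))"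

definition consistent_flux ::
    "'a::euclidean_space set set \<Rightarrow> nat \<Rightarrow> (real \<Rightarrow> 'a) \<Rightarrow> 'a num_flux \<Rightarrow> bool" where
  "consistent_flux T k f F \<longleftrightarrow>
     (\<forall>K\<in>T. \<forall>K'\<in>neighbours T K. \<forall>u\<in>broken_poly T k.
        (\<forall>x\<in>K \<inter> K'. u K x = u K' x) \<longrightarrow>
        (\<forall>x\<in>K \<inter> K'. F K K' u x = f (u K x) \<bullet> outward_normal K K'))"

definition lipschitz_flux ::
    "real \<Rightarrow> 'a::euclidean_space set set \<Rightarrow> nat \<Rightarrow> 'a num_flux \<Rightarrow> bool" where
  "lipschitz_flux C T k F \<longleftrightarrow>
     (\<forall>K\<in>T. \<forall>K'\<in>neighbours T K. \<forall>u\<in>broken_poly T k. \<forall>v\<in>broken_poly T k. \<forall>x\<in>K \<inter> K'.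
        \<bar>F K K' u x - F K K' v x\<bar>
          \<le> C * Linf_norm (K \<union> K') (\<lambda>y. eval_broken T u y - eval_broken T v y))"


section \<open>The sdRKDG scheme\<close>

definition grad :: "('a::euclidean_space \<Rightarrow> real) \<Rightarrow> 'a \<Rightarrow> 'a" where
  "grad g x = (THE D. GDERIV g x :> D)"

definition dg_div ::
    "'a::euclidean_space set set \<Rightarrow> (real \<Rightarrow> 'a) \<Rightarrow> 'a num_flux \<Rightarrow> nat \<Rightarrow> 'a broken \<Rightarrow> 'a broken" where
  "dg_div T f F l u = (THE w. w \<in> broken_poly T l \<and>
     (\<forall>v\<in>broken_poly T l. \<forall>K\<in>T.
        (LINT x:K|lebesgue. w K x * v K x) =
          - (LINT x:K|lebesgue. f (u K x) \<bullet> grad (v K) x)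
          + (\<Sum>K'\<in>neighbours T K. face_integral K K' (\<lambda>x. F K K' u x * v K x))))"

definition explicit_RK :: "nat \<Rightarrow> (nat \<Rightarrow> nat \<Rightarrow> real) \<Rightarrow> (nat \<Rightarrow> real) \<Rightarrow> bool" where
  "explicit_RK s A b \<longleftrightarrow>
     (\<forall>i\<in>{1..s}. \<forall>j\<in>{1..s}. i \<le> j \<longrightarrow> A i j = 0) \<and> (\<Sum>i=1..s. b i) = 1"

definition stage_degrees :: "nat \<Rightarrow> nat \<Rightarrow> (nat \<Rightarrow> nat \<Rightarrow> nat) \<Rightarrow> (nat \<Rightarrow> nat) \<Rightarrow> bool" where
  "stage_degrees k s d e \<longleftrightarrow>
     (\<forall>i\<in>{1..s}. \<forall>j\<in>{1..<i}. d i j \<in> {k - 1, k}) \<and>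
     (\<forall>i\<in>{1..<s}. e i \<in> {k - 1, k}) \<and> e s = k"

definition sdRKDG_step ::
    "'a::euclidean_space set set \<Rightarrow> (real \<Rightarrow> 'a) \<Rightarrow> 'a num_flux \<Rightarrow> nat \<Rightarrow>
     (nat \<Rightarrow> nat \<Rightarrow> real) \<Rightarrow> (nat \<Rightarrow> real) \<Rightarrow> (nat \<Rightarrow> nat \<Rightarrow> nat) \<Rightarrow> (nat \<Rightarrow> nat) \<Rightarrow>
     real \<Rightarrow> 'a broken \<Rightarrow> 'a broken \<Rightarrow> bool" where
  "sdRKDG_step T f F s A b d e \<tau> u u' \<longleftrightarrow>
     (\<exists>U.
        (\<forall>i\<in>{1..s}. U i =
           (\<lambda>K\<in>T. \<lambda>x. u K x - \<tau> * (\<Sum>j=1..<i. A i j * dg_div T f F (d i j) (U j) K x))) \<and>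
        u' = (\<lambda>K\<in>T. \<lambda>x. u K x - \<tau> * (\<Sum>i=1..s. b i * dg_div T f F (e i) (U i) K x)))"

definition sdRKDG_solution ::
    "'a::euclidean_space set set \<Rightarrow> (real \<Rightarrow> 'a) \<Rightarrow> 'a num_flux \<Rightarrow> nat \<Rightarrow> nat \<Rightarrow>
     (nat \<Rightarrow> nat \<Rightarrow> real) \<Rightarrow> (nat \<Rightarrow> real) \<Rightarrow> (nat \<Rightarrow> nat \<Rightarrow> nat) \<Rightarrow> (nat \<Rightarrow> nat) \<Rightarrow>
     real \<Rightarrow> (nat \<Rightarrow> 'a broken) \<Rightarrow> bool" where
  "sdRKDG_solution T f F k s A b d e \<tau> u \<longleftrightarrow>
     u 0 \<in> broken_poly T k \<and> (\<forall>n. sdRKDG_step T f F s A b d e \<tau> (u n) (u (Suc n)))"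

text \<open>
  The numerical solution as a function of \<open>(x, t)\<close>, for \<open>t \<ge> 0\<close>: it equals the \<open>n\<close>-th
  iterate for \<open>n \<tau> \<le> t < (n + 1) \<tau>\<close>.
\<close>

definition space_time ::
    "'a::euclidean_space set set \<Rightarrow> real \<Rightarrow> (nat \<Rightarrow> 'a broken) \<Rightarrow> 'a \<times> real \<Rightarrow> real" where
  "space_time T \<tau> u = (\<lambda>(x, t). eval_broken T (u (nat \<lfloor>t / \<tau>\<rfloor>)) x)"

definition converges_boundedly_ae ::
    "(nat \<Rightarrow> 'a::euclidean_space \<times> real \<Rightarrow> real) \<Rightarrow> ('a \<times> real \<Rightarrow> real) \<Rightarrow> bool" where
  "converges_boundedly_ae w u \<longleftrightarrow>
     (\<exists>M. \<forall>m x t. 0 \<le> t \<longrightarrow> \<bar>w m (x, t)\<bar> \<le> M) \<and>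
     (AE z in lebesgue. 0 \<le> snd z \<longrightarrow> (\<lambda>m. w m z) \<longlonglongrightarrow> u z)"

definition approximates_initial ::
    "(nat \<Rightarrow> 'a::euclidean_space \<Rightarrow> real) \<Rightarrow> ('a \<Rightarrow> real) \<Rightarrow> bool" where
  "approximates_initial w u0 \<longleftrightarrow>
     (\<forall>R. (\<lambda>m. LINT x:cball 0 R|lebesgue. \<bar>w m x - u0 x\<bar>) \<longlonglongrightarrow> 0)"


section \<open>Weak solutions\<close>

primrec C_k :: "nat \<Rightarrow> ('b::euclidean_space \<Rightarrow> real) \<Rightarrow> bool" where
  "C_k 0 g \<longleftrightarrow> continuous_on UNIV g"
| "C_k (Suc n) g \<longleftrightarrow>
     (\<forall>x. g differentiable (at x)) \<and>
     (\<forall>i\<in>Basis. C_k n (\<lambda>x. frechet_derivative g (at x) i))"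

text \<open>
  Test functions on \<open>t \<ge> 0\<close> are restrictions of smooth compactly supported functions on all of
  space-time, so they need not vanish at \<open>t = 0\<close>.
\<close>

definition test_function :: "('a::euclidean_space \<times> real \<Rightarrow> real) \<Rightarrow> bool" where
  "test_function \<phi> \<longleftrightarrow> (\<forall>n. C_k n \<phi>) \<and> compact (closure {z. \<phi> z \<noteq> 0})"

definition weak_solution ::
    "(real \<Rightarrow> 'a::euclidean_space) \<Rightarrow> ('a \<Rightarrow> real) \<Rightarrow> ('a \<times> real \<Rightarrow> real) \<Rightarrow> bool" where
  "weak_solution f u0 u \<longleftrightarrow>
     (\<forall>\<phi>. test_function \<phi> \<longrightarrow>
        (LINT x|lebesgue. u0 x * \<phi> (x, 0))
        + (LINT (x, t):UNIV \<times> {0..}|lebesgue. u (x, t) * deriv (\<lambda>r. \<phi> (x, r)) t)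
        + (LINT (x, t):UNIV \<times> {0..}|lebesgue. f (u (x, t)) \<bullet> grad (\<lambda>y. \<phi> (y, t)) x) = 0)"

end

theory Submission
  imports Defs
begin

text \<open>
  Testing the scheme with the indicator function of a cell shows that cell averages evolve by a
  conservative flux, a \<open>b\<close>-weighted combination of the numerical fluxes of the stages. Multiply the
  balance of each cell \<open>K\<close> by the value of a test function \<open>\<phi>\<close> at the centre of \<open>K\<close> and
  sum. By conservation, adding \<open>\<phi>\<close> itself under the face integrals changes nothing, so only
  the oscillation of \<open>\<phi>\<close> over the cells, of size \<open>h\<close>, meets the fluxes. Replacing the fluxes
  by \<open>f(c\<^sub>K) \<bullet> \<nu>\<close> for a constant \<open>c\<^sub>K\<close> then turns the face terms, by the divergence theorem
  on \<open>K\<close>, into \<open>f(c\<^sub>K) \<bullet> \<integral>\<nabla>\<phi>\<close>. The error is controlled by the distance of the stages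
  to \<open>c\<^sub>K\<close> on a patch of cells around \<open>K\<close>: the discrete divergence of a constant vanishes, so inverse
  estimates and the CFL condition bound it by the \<open>L\<^sup>1\<close> distance of the numerical solution
  to \<open>c\<^sub>K\<close> on that patch. Choosing \<open>c\<^sub>K\<close> as a value of a continuous \<open>L\<^sup>1\<close> approximation of \<open>u\<close> makes
  the total error arbitrarily small in the limit, and summation by parts in time together with
  dominated convergence identifies the remaining terms.
\<close>


section \<open>Surface measure and anisotropic scaling\<close>

text \<open>Almost everywhere convergence controls neither jumps across faces nor differences
  between nearby cells, whereas the flux error on a face sees the sup norm over a whole patch. This
  is why the reference constants are values of a continuous function \<open>\<gamma>\<close>:
  uniform continuity makes the constants of nearby cells agree up to \<open>\<omega>\<close>, and an
  inverse estimate trades the sup norm for an L1 norm at the price h^(-d). The price is exactly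
  affordable: the oscillation of the test function gives one factor h, the area of a face gives
  h^(d-1), and each cell lies in boundedly many patches. Since \<open>\<gamma>\<close> is fixed
  before the mesh is refined, every constant must be independent of the mesh; the locales for a
  single mesh therefore take the constant \<open>Ci\<close> of the inverse estimates as a parameter.
  Faces carry the volume of the right prism of height one above them, while shifting a cell
  obliquely sweeps out a thin layer over its faces. The divergence theorem compares the two, and the
  tool for this is the scaling of Lebesgue measure under stretching along a unit normal.\<close>

lemma nn_integral_lborel_shift:
  fixes g :: "'a::euclidean_space \<Rightarrow> ennreal"
  assumes [measurable]: "g \<in> borel_measurable borel"
  shows "(\<integral>\<^sup>+x. g (a + x) \<partial>lborel) = (\<integral>\<^sup>+x. g x \<partial>lborel)"
proof -
  have "(\<integral>\<^sup>+x. g x \<partial>lborel) = (\<integral>\<^sup>+x. g x \<partial>(distr lborel borel ((+) a)))"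
    by (simp add: lborel_distr_plus)
  also have "\<dots> = (\<integral>\<^sup>+x. g (a + x) \<partial>lborel)"
    by (subst nn_integral_distr) auto
  finally show ?thesis by simp
qed

lemma integral_lborel_shift:
  fixes g :: "'a::euclidean_space \<Rightarrow> real"
  assumes [measurable]: "g \<in> borel_measurable borel"
  shows "(\<integral>x. g (a + x) \<partial>lborel) = (\<integral>x. g x \<partial>lborel)"
proof -
  have "(\<integral>x. g x \<partial>lborel) = (\<integral>x. g x \<partial>(distr lborel borel ((+) a)))"
    by (simp add: lborel_distr_plus)
  also have "\<dots> = (\<integral>x. g (a + x) \<partial>lborel)"
    by (subst integral_distr) auto
  finally show ?thesis by simp
qed

text \<open>Fubini against the unit ball \<open>B\<close>, which \<open>R\<close> preserves: both \<open>|R\<^sup>-\<^sup>1 A|\<cdot>|B|\<close> and \<open>|A|\<cdot>|B|\<close> equal the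
  measure of \<open>{(x, y). R x \<in> A \<and> y - R x \<in> B}\<close>.\<close>

lemma lborel_distr_isometric_involution:
  fixes R :: "'a::euclidean_space \<Rightarrow> 'a"
  assumes "linear R" and norm: "\<And>x. norm (R x) = norm x" and inv: "\<And>x. R (R x) = x"
  shows "distr lborel borel R = lborel"
proof (rule measure_eqI)
  have [measurable]: "R \<in> borel_measurable borel"
    using \<open>linear R\<close> by (intro borel_measurable_continuous_onI linear_continuous_on linear_conv_bounded_linear[THEN iffD1])
  show "sets (distr lborel borel R) = sets lborel" by simp
  fix A :: "'a set" assume "A \<in> sets (distr lborel borel R)"
  then have A[measurable]: "A \<in> sets borel" by simp
  define B where "B = ball (0::'a) 1"
  have [measurable]: "B \<in> sets borel" unfolding B_def by simp
  have Rm: "(- R x \<in> B) = (x \<in> B)" for x by (simp add: B_def norm)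
  have "emeasure (distr lborel borel R) A * emeasure lborel B
      = (\<integral>\<^sup>+x. indicator A (R x) * emeasure lborel B \<partial>lborel)"
  proof -
    have "emeasure (distr lborel borel R) A = (\<integral>\<^sup>+x. indicator A x \<partial>(distr lborel borel R))" by simp
    also have "\<dots> = (\<integral>\<^sup>+x. indicator A (R x) \<partial>lborel)" by (subst nn_integral_distr) auto
    finally show ?thesis by (simp add: nn_integral_multc)
  qed
  also have "\<dots> = (\<integral>\<^sup>+x. \<integral>\<^sup>+y. indicator A (R x) * indicator B (y - R x) \<partial>lborel \<partial>lborel)"
  proof (rule nn_integral_cong)
    fix x
    have "(\<integral>\<^sup>+y. indicator B (- R x + y) \<partial>lborel) = (\<integral>\<^sup>+y. indicator B y \<partial>(lborel::'a measure))"
      by (rule nn_integral_lborel_shift) simp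
    then show "indicator A (R x) * emeasure lborel B = (\<integral>\<^sup>+y. indicator A (R x) * indicator B (y - R x) \<partial>lborel)"
      by (subst nn_integral_cmult) auto
  qed
  also have "\<dots> = (\<integral>\<^sup>+y. \<integral>\<^sup>+x. indicator A (R x) * indicator B (y - R x) \<partial>lborel \<partial>lborel)"
    by (rule lborel_pair.Fubini'[symmetric]) measurable
  \<comment> \<open>Shifting \<open>x\<close> by \<open>R y\<close> turns \<open>R x\<close> into
    \<open>R x + y\<close> because \<open>R\<close> is an involution, and turns
    \<open>y - R x\<close> into \<open>- R x\<close>, which lies in the ball exactly if
    \<open>x\<close> does.\<close>
  also have "\<dots> = (\<integral>\<^sup>+y. \<integral>\<^sup>+x. indicator A (R x + y) * indicator B x \<partial>lborel \<partial>lborel)"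
  proof (rule nn_integral_cong)
    fix y
    have "(\<integral>\<^sup>+x. indicator A (R (R y + x)) * indicator B (y - R (R y + x)) \<partial>lborel)
       = (\<integral>\<^sup>+x. indicator A (R x) * indicator B (y - R x) \<partial>(lborel::'a measure)) "
      by (rule nn_integral_lborel_shift[where g="\<lambda>x. indicator A (R x) * indicator B (y - R x)"]) measurable
    moreover have "R (R y + x) = R x + y" for x by (simp add: linear_add[OF \<open>linear R\<close>] inv)
    ultimately show "(\<integral>\<^sup>+x. indicator A (R x) * indicator B (y - R x) \<partial>lborel) = (\<integral>\<^sup>+x. indicator A (R x + y) * indicator B x \<partial>lborel)"
      by (simp add: Rm indicator_def)
  qed
  also have "\<dots> = (\<integral>\<^sup>+x. \<integral>\<^sup>+y. indicator A (R x + y) * indicator B x \<partial>lborel \<partial>lborel)"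
    by (rule lborel_pair.Fubini') measurable
  also have "\<dots> = (\<integral>\<^sup>+x. emeasure lborel A * indicator B x \<partial>lborel)"
    by (rule nn_integral_cong, subst nn_integral_multc, measurable)
       (simp add: nn_integral_lborel_shift[where g="indicator A"])
  also have "\<dots> = emeasure lborel A * emeasure lborel B"
    by (subst nn_integral_cmult) auto
  finally have eq: "emeasure (distr lborel borel R) A * emeasure lborel B = emeasure lborel A * emeasure lborel B" .
  have "emeasure lborel B \<noteq> 0"
    using content_ball_gt_0_iff[of "0::'a" 1] unfolding B_def by (auto simp: measure_def)
  moreover have "emeasure lborel B < \<infinity>" unfolding B_def by (rule emeasure_lborel_ball_finite)
  ultimately show "emeasure (distr lborel borel R) A = emeasure lborel A"
    using eq by (auto simp: ennreal_mult_cancel_left mult.commute[of _ "emeasure lborel B"] less_top)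
qed

definition householder :: "'a::euclidean_space \<Rightarrow> 'a \<Rightarrow> 'a" where
  "householder w x = x - (2 * (x \<bullet> w) / (w \<bullet> w)) *\<^sub>R w"

lemma householder:
  shows "linear (householder w)" "householder w (householder w x) = x"
    "norm (householder w x) = norm x"
proof -
  show "linear (householder w)"
    unfolding householder_def
    by (rule linearI) (auto simp: algebra_simps inner_add_left add_divide_distrib)
  show "householder w (householder w x) = x"
    by (cases "w = 0") (auto simp: householder_def algebra_simps inner_diff_left diff_divide_distrib)
  have "householder w x \<bullet> householder w x = x \<bullet> x"
    by (cases "w = 0") (auto simp: householder_def algebra_simps inner_diff_left inner_diff_right diff_divide_distrib inner_commute)
  then show "norm (householder w x) = norm x" by (simp add: norm_eq_sqrt_inner)
qed

text \<open>For unit vectors the squared length of \<open>v - i\<close> is twice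
  \<open>v \<bullet> (v - i)\<close>, so the reflection in the bisecting hyperplane subtracts
  exactly \<open>v - i\<close> from \<open>v\<close>. If \<open>v = i\<close>, the formula subtracts
  a multiple of the zero vector.\<close>

lemma householder_swap:
  assumes "norm v = 1" "norm i = 1"
  shows "householder (v - i) v = i"
proof (cases "v = i")
  case True then show ?thesis by (simp add: householder_def)
next
  case False
  have "(v - i) \<bullet> (v - i) = 2 * (v \<bullet> (v - i))"
    using assms by (simp add: inner_diff_left inner_diff_right inner_commute norm_eq_1)
  moreover have "(v - i) \<bullet> (v - i) \<noteq> 0" using False by simp
  ultimately have "2 * (v \<bullet> (v - i)) / ((v - i) \<bullet> (v - i)) = 1" by (metis divide_self)
  then have "householder (v - i) v = v - 1 *\<^sub>R (v - i)" unfolding householder_def by metis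
  then show ?thesis by simp
qed

text \<open>For a unit vector \<open>\<nu>\<close>, the stretching by the factor \<open>t\<close>
  along \<open>\<nu>\<close> that fixes the hyperplane at height \<open>c\<close>. It carries the
  slab of height one above the hyperplane onto the slab of height \<open>t\<close>, which links thin
  layers to the surface measure.\<close>

definition slab_map :: "'a::euclidean_space \<Rightarrow> real \<Rightarrow> real \<Rightarrow> 'a \<Rightarrow> 'a" where
  "slab_map \<nu> c t y = y + ((t - 1) * (\<nu> \<bullet> y - c)) *\<^sub>R \<nu>"

lemma slab_map_measurable [measurable]: "slab_map \<nu> c t \<in> borel_measurable borel"
  unfolding slab_map_def by (intro borel_measurable_continuous_onI continuous_intros)

text \<open>The reflection that exchanges \<open>\<nu>\<close> with a basis vector preserves
  Lebesgue measure and conjugates the stretching along \<open>\<nu>\<close> into a diagonal affine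
  map with the single nontrivial entry \<open>t\<close>.\<close>

lemma lborel_slab_map:
  fixes \<nu> :: "'a::euclidean_space"
  assumes \<nu>: "norm \<nu> = 1" and t: "t > 0"
  shows "lborel = density (distr lborel borel (slab_map \<nu> c t)) (\<lambda>_. ennreal t)"
proof -
  obtain i :: 'a where i: "i \<in> Basis" using nonempty_Basis by blast
  define R where "R = householder (\<nu> - i)"
  have R: "linear R" "\<And>x. R (R x) = x" "\<And>x. norm (R x) = norm x"
    unfolding R_def by (simp_all add: householder)
  have [measurable]: "R \<in> borel_measurable borel"
    using \<open>linear R\<close> by (intro borel_measurable_continuous_onI linear_continuous_on linear_conv_bounded_linear[THEN iffD1])
  have R\<nu>: "R \<nu> = i" unfolding R_def by (rule householder_swap) (use \<nu> i in auto)
  then have Ri: "R i = \<nu>" using R(2) by metis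
  have inner: "R x \<bullet> R y = x \<bullet> y" for x y
    using R(1,3) orthogonal_transformation[of R] unfolding orthogonal_transformation_def by blast
  define cc where "cc j = (if j = i then t else 1)" for j :: 'a
  \<comment> \<open>Scaling by \<open>t\<close> along \<open>i\<close>; the translation is chosen so
    that points at height \<open>c\<close> stay fixed.\<close>
  define D where "D x = (-((t - 1) * c)) *\<^sub>R i + (\<Sum>j\<in>Basis. (cc j * (x \<bullet> j)) *\<^sub>R j)" for x
  have D: "D x = x + ((t - 1) * (x \<bullet> i - c)) *\<^sub>R i" for x
  proof -
    have "(\<Sum>j\<in>Basis. (cc j * (x \<bullet> j)) *\<^sub>R j) = (\<Sum>j\<in>Basis. (x \<bullet> j) *\<^sub>R j + (if j = i then ((t - 1) * (x \<bullet> i)) *\<^sub>R i else 0))"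
      by (rule sum.cong) (auto simp: cc_def algebra_simps)
    also have "\<dots> = x + ((t - 1) * (x \<bullet> i)) *\<^sub>R i"
      using i by (simp add: sum.distrib euclidean_representation)
    finally show ?thesis by (simp add: D_def algebra_simps)
  qed
  have [measurable]: "D \<in> borel_measurable borel"
    unfolding D_def by measurable
  have eqS: "R (D (R y)) = slab_map \<nu> c t y" for y
  proof -
    have "R y \<bullet> i = \<nu> \<bullet> y" using inner[of y \<nu>] R\<nu> by (simp add: inner_commute)
    then show ?thesis by (simp add: D slab_map_def linear_add[OF R(1)] linear_scale[OF R(1)] R(2) Ri)
  qed
  have prod: "(\<Prod>j\<in>Basis. \<bar>cc j\<bar>) = t"
    using i t by (simp add: cc_def prod.If_cases if_distrib[of abs] cong: if_cong)
  have "lborel = density (distr lborel borel D) (\<lambda>_. (\<Prod>j\<in>Basis. \<bar>cc j\<bar>))"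
    using lborel_affine_euclidean[of cc "(-((t - 1) * c)) *\<^sub>R i"] t unfolding D_def cc_def by force
  then have *: "lborel = density (distr lborel borel D) (\<lambda>_. ennreal t)" by (simp add: prod)
  have RR: "distr lborel borel R = lborel" by (rule lborel_distr_isometric_involution[OF R(1,3,2)])
  have "lborel = distr lborel borel R" by (simp add: RR)
  also have "\<dots> = distr (density (distr lborel borel D) (\<lambda>_. ennreal t)) borel R" using * by simp
  also have "\<dots> = density (distr (distr lborel borel D) borel R) (\<lambda>_. ennreal t)"
    by (subst density_distr) auto
  also have "distr lborel borel D = distr (distr lborel borel R) borel D" by (simp add: RR)
  also have "distr (distr (distr lborel borel R) borel D) borel R = distr lborel borel (slab_map \<nu> c t)"
    by (simp add: distr_distr comp_def eqS)
  finally show ?thesis .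
qed

lemma integral_slab_map:
  fixes g :: "'a::euclidean_space \<Rightarrow> real"
  assumes \<nu>: "norm \<nu> = 1" and t: "t > 0" and [measurable]: "g \<in> borel_measurable borel"
  shows "(\<integral>x. g x \<partial>lborel) = t * (\<integral>y. g (slab_map \<nu> c t y) \<partial>lborel)"
proof -
  have "(\<integral>x. g x \<partial>lborel) = (\<integral>x. g x \<partial>(density (distr lborel borel (slab_map \<nu> c t)) (\<lambda>_. ennreal t)))"
    using lborel_slab_map[OF \<nu> t, of c] by simp
  also have "\<dots> = (\<integral>x. t * g x \<partial>(distr lborel borel (slab_map \<nu> c t)))"
    using t by (subst integral_density) auto
  also have "\<dots> = (\<integral>y. t * g (slab_map \<nu> c t y) \<partial>lborel)"
    by (subst integral_distr) auto
  finally show ?thesis by simp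
qed

section \<open>Projection onto a hyperplane and the slab above it\<close>

definition hproj :: "'a::euclidean_space \<Rightarrow> real \<Rightarrow> 'a \<Rightarrow> 'a" where
  "hproj \<nu> c x = x - (\<nu> \<bullet> x - c) *\<^sub>R \<nu>"

definition slab :: "'a::euclidean_space \<Rightarrow> real \<Rightarrow> real \<Rightarrow> 'a set" where
  "slab \<nu> c t = {x. c \<le> \<nu> \<bullet> x \<and> \<nu> \<bullet> x \<le> c + t}"

lemma slab_measurable [measurable]: "slab \<nu> c t \<in> sets borel"
  unfolding slab_def by measurable

lemma hproj_measurable [measurable]: "hproj \<nu> c \<in> borel_measurable borel"
  unfolding hproj_def by (intro borel_measurable_continuous_onI continuous_intros)

lemma hproj_slab_map:
  assumes "norm \<nu> = 1"
  shows "hproj \<nu> c (slab_map \<nu> c t y) = hproj \<nu> c y"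
    "t > 0 \<Longrightarrow> slab_map \<nu> c t y \<in> slab \<nu> c t \<longleftrightarrow> y \<in> slab \<nu> c 1"
    "\<nu> \<bullet> slab_map \<nu> c t y = c + t * (\<nu> \<bullet> y - c)"
    "slab_map \<nu> c t y = hproj \<nu> c y + (t * (\<nu> \<bullet> y - c)) *\<^sub>R \<nu>"
    "\<nu> \<bullet> hproj \<nu> c y = c"
proof -
  have \<nu>: "\<nu> \<bullet> \<nu> = 1" using assms by (simp add: norm_eq_1)
  show 1: "\<nu> \<bullet> slab_map \<nu> c t y = c + t * (\<nu> \<bullet> y - c)"
    by (simp add: slab_map_def inner_add_right \<nu> algebra_simps)
  then show "hproj \<nu> c (slab_map \<nu> c t y) = hproj \<nu> c y"
    by (simp add: hproj_def) (simp add: slab_map_def algebra_simps)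
  show "slab_map \<nu> c t y \<in> slab \<nu> c t \<longleftrightarrow> y \<in> slab \<nu> c 1" if "t > 0"
  proof -
    have "0 \<le> t * (\<nu> \<bullet> y - c) \<longleftrightarrow> 0 \<le> \<nu> \<bullet> y - c" "t * (\<nu> \<bullet> y - c) \<le> t * 1 \<longleftrightarrow> \<nu> \<bullet> y - c \<le> 1"
      using that by (simp_all only: zero_le_mult_iff mult_le_cancel_left_pos) auto
    then show ?thesis unfolding slab_def mem_Collect_eq 1 by auto
  qed
  show "slab_map \<nu> c t y = hproj \<nu> c y + (t * (\<nu> \<bullet> y - c)) *\<^sub>R \<nu>"
    by (simp add: slab_map_def hproj_def algebra_simps)
  show "\<nu> \<bullet> hproj \<nu> c y = c" by (simp add: hproj_def inner_diff_right \<nu>)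
qed

text \<open>Surface integrals are handled throughout as volume integrals over the slab of height
  one, with an integrand that is constant along \<open>\<nu>\<close>.\<close>

lemma
  assumes [measurable]: "g \<in> borel_measurable borel"
  shows integral_hyperplane_measure:
    "(\<integral>x. g x \<partial>(hyperplane_measure \<nu> c)) = (\<integral>y. indicator (slab \<nu> c 1) y * g (hproj \<nu> c y) \<partial>lborel)"
  and integrable_hyperplane_measure:
    "integrable (hyperplane_measure \<nu> c) g \<longleftrightarrow> integrable lborel (\<lambda>y. indicator (slab \<nu> c 1) y * (g (hproj \<nu> c y) :: real))"
proof -
  have [measurable]: "hproj \<nu> c \<in> restrict_space lborel (slab \<nu> c 1) \<rightarrow>\<^sub>M borel"
    by (rule measurable_restrict_space1) simp
  have *: "hyperplane_measure \<nu> c = distr (restrict_space lborel (slab \<nu> c 1)) borel (hproj \<nu> c)"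
    unfolding hyperplane_measure_def slab_def hproj_def ..
  show "(\<integral>x. g x \<partial>(hyperplane_measure \<nu> c)) = (\<integral>y. indicator (slab \<nu> c 1) y * g (hproj \<nu> c y) \<partial>lborel)"
    unfolding * by (subst integral_distr) (simp_all add: integral_restrict_space)
  show "integrable (hyperplane_measure \<nu> c) g \<longleftrightarrow> integrable lborel (\<lambda>y. indicator (slab \<nu> c 1) y * (g (hproj \<nu> c y) :: real))"
    unfolding * by (subst integrable_distr_eq) (simp_all add: integrable_restrict_space)
qed

section \<open>Quasi-uniform meshes\<close>

locale qu_mesh =
  fixes T :: "'a::euclidean_space set set" and \<sigma> :: real
  assumes mesh: "mesh T" and quasi: "quasi_uniform \<sigma> T" and \<sigma>: "\<sigma> > 0"
begin

abbreviation "h \<equiv> mesh_size T"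

lemma cell: assumes "K \<in> T"
  shows "polytope K" "convex K" "compact K" "closed K" "bounded K" "interior K \<noteq> {}" "K \<noteq> {}"
    "K \<in> sets borel"
proof -
  show 1: "polytope K" and 2: "interior K \<noteq> {}" using assms mesh unfolding mesh_def by auto
  show "convex K" using 1 by (rule polytope_imp_convex)
  show 3: "compact K" using 1 by (rule polytope_imp_compact)
  show "closed K" "bounded K" using 3 by (auto intro: compact_imp_closed compact_imp_bounded)
  show "K \<noteq> {}" using 2 by auto
  show "K \<in> sets borel" using 3 by (simp add: compact_imp_closed)
qed

lemma cover: "\<exists>K\<in>T. x \<in> K"
  using mesh unfolding mesh_def by blast

lemma disjoint_interiors: "K \<in> T \<Longrightarrow> K' \<in> T \<Longrightarrow> K \<noteq> K' \<Longrightarrow> interior K \<inter> interior K' = {}"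
  using mesh unfolding mesh_def pairwise_def by blast

lemma diameter_le: "K \<in> T \<Longrightarrow> diameter K \<le> h"
  unfolding mesh_size_def using mesh unfolding mesh_def by (intro cSUP_upper) auto

lemma diameter_ge: "K \<in> T \<Longrightarrow> \<sigma> * h \<le> diameter K"
  using quasi unfolding quasi_uniform_def by blast

lemma cell_dist: assumes "K \<in> T" "x \<in> K" "y \<in> K" shows "dist x y \<le> h"
  using diameter_bounded_bound[of K x y] cell(5)[of K] diameter_le[of K] assms by linarith

lemma diameter_pos: assumes "K \<in> T" shows "diameter K > 0"
proof -
  obtain x e where e: "e > 0" "cball x e \<subseteq> K"
    using cell(6)[OF assms] by (metis mem_interior_cball ex_in_conv)
  obtain i :: 'a where i: "i \<in> Basis" using nonempty_Basis by blast
  have "x + e *\<^sub>R i \<in> K" "x \<in> K" using e i by (auto simp: subset_eq dist_norm)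
  then have "dist (x + e *\<^sub>R i) x \<le> diameter K"
    using diameter_bounded_bound[OF cell(5)[OF assms]] by blast
  moreover have "dist (x + e *\<^sub>R i) x = e" using e i by (simp add: dist_norm)
  ultimately show ?thesis using e by linarith
qed

lemma h_pos: "h > 0"
proof -
  obtain K where "K \<in> T" using cover by blast
  then show ?thesis using diameter_pos diameter_le by (meson less_le_trans)
qed

section \<open>Inscribed balls and packing\<close>

definition centre :: "'a set \<Rightarrow> 'a" where
  "centre K = (SOME z. cball z (\<sigma> * diameter K) \<subseteq> K)"

lemma centre: assumes "K \<in> T" shows "cball (centre K) (\<sigma> * diameter K) \<subseteq> K"
  using quasi assms unfolding quasi_uniform_def centre_def by (metis (mono_tags, lifting) someI_ex)

lemma centre_ball: assumes "K \<in> T" shows "cball (centre K) (\<sigma>\<^sup>2 * h) \<subseteq> K"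
proof -
  have "\<sigma>\<^sup>2 * h \<le> \<sigma> * diameter K"
    using diameter_ge[OF assms] \<sigma> by (simp add: power2_eq_square mult.assoc)
  then show ?thesis using centre[OF assms] by (meson order_trans subset_cball)
qed

lemma centre_in: assumes "K \<in> T" shows "centre K \<in> K"
proof -
  have "0 \<le> \<sigma>\<^sup>2 * h" using h_pos by simp
  then have "centre K \<in> cball (centre K) (\<sigma>\<^sup>2 * h)" by simp
  then show ?thesis using centre_ball[OF assms] by blast
qed

lemma cell_subset_cball: "K \<in> T \<Longrightarrow> x \<in> K \<Longrightarrow> K \<subseteq> cball x h"
  using cell_dist by auto

text \<open>The balls of radius \<open>\<sigma>\<^sup>2 * h\<close> about the centres lie in the
  disjoint interiors of the cells, and their total volume is at most that of the large ball. The
  square appears because shape regularity gives the radius \<open>\<sigma> * diameter K\<close> and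
  quasi-uniformity gives \<open>\<sigma> * h \<le> diameter K\<close>.\<close>

lemma packing_finite:
  assumes "S \<subseteq> T" "\<And>K. K \<in> S \<Longrightarrow> K \<subseteq> cball x R" "finite S" "R \<ge> 0"
  shows "real (card S) * (\<sigma>\<^sup>2 * h) ^ DIM('a) \<le> R ^ DIM('a)"
proof -
  let ?B = "\<lambda>K. ball (centre K) (\<sigma>\<^sup>2 * h)"
  have sub: "?B K \<subseteq> interior K" if "K \<in> S" for K
    using centre_ball[of K] that assms(1) ball_subset_cball by (intro interior_maximal) blast+
  have disj: "disjoint_family_on ?B S"
    unfolding disjoint_family_on_def
    using sub disjoint_interiors assms(1) by blast
  have fin: "?B K \<in> lmeasurable" for K by simp
  have sh: "\<sigma>\<^sup>2 * h > 0" using h_pos \<sigma> by simp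
  have "real (card S) * (\<sigma>\<^sup>2 * h) ^ DIM('a) * unit_ball_vol (real DIM('a)) = (\<Sum>K\<in>S. measure lebesgue (?B K))"
    using sh by (simp add: content_ball less_imp_le)
  also have "\<dots> = measure lebesgue (\<Union>K\<in>S. ?B K)"
  proof (rule measure_UNION'[symmetric])
    show "pairwise (\<lambda>K K'. disjnt (?B K) (?B K')) S"
      using disj unfolding disjoint_family_on_def pairwise_def disjnt_def by blast
  qed (use assms(3) in auto)
  also have "\<dots> \<le> measure lebesgue (cball x R)"
  proof (rule measure_mono_fmeasurable)
    show "(\<Union>K\<in>S. ?B K) \<subseteq> cball x R" using sub assms(2) interior_subset by blast
    show "(\<Union>K\<in>S. ?B K) \<in> sets lebesgue" using assms(3) by (intro sets.finite_UN) auto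
  qed simp
  also have "\<dots> = R ^ DIM('a) * unit_ball_vol (real DIM('a))"
    using assms(4) by (simp add: content_cball)
  finally show ?thesis
    using unit_ball_vol_pos[of "real DIM('a)"] by simp
qed

lemma packing:
  assumes "S \<subseteq> T" "\<And>K. K \<in> S \<Longrightarrow> K \<subseteq> cball x R" "R \<ge> 0"
  shows "finite S" "real (card S) \<le> (R / (\<sigma>\<^sup>2 * h)) ^ DIM('a)"
proof -
  have sh: "(\<sigma>\<^sup>2 * h) > 0" using h_pos \<sigma> by simp
  then have sh': "(\<sigma>\<^sup>2 * h) ^ DIM('a) > 0" by simp
  have *: "real (card S') \<le> (R / (\<sigma>\<^sup>2 * h)) ^ DIM('a)" if "finite S'" "S' \<subseteq> S" for S'
    using packing_finite[of S' x R] assms that sh'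
    by (auto simp: power_divide pos_le_divide_eq subset_eq)
  \<comment> \<open>An infinite \<open>S\<close> would have finite subsets of every cardinality,
    against the uniform bound.\<close>
  show "finite S"
  proof (rule ccontr)
    assume "infinite S"
    obtain n :: nat where n: "(R / (\<sigma>\<^sup>2 * h)) ^ DIM('a) < real n" using reals_Archimedean2 by blast
    obtain S' where "S' \<subseteq> S" "card S' = n" "finite S'"
      using infinite_arbitrarily_large[OF \<open>infinite S\<close>] by blast
    then show False using *[of S'] n by auto
  qed
  then show "real (card S) \<le> (R / (\<sigma>\<^sup>2 * h)) ^ DIM('a)" using * by blast
qed

definition near :: "'a set \<Rightarrow> 'a set set" where
  "near S = {K \<in> T. K \<inter> S \<noteq> {}}"

lemma near_subset: assumes "K \<in> near (cball x R)" shows "K \<subseteq> cball x (R + h)"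
proof -
  obtain y where y: "y \<in> K" "y \<in> cball x R" "K \<in> T" using assms unfolding near_def by blast
  show ?thesis
  proof
    fix z assume "z \<in> K"
    then show "z \<in> cball x (R + h)" using cell_dist[OF y(3,1) \<open>z \<in> K\<close>] y(2) dist_triangle[of x z y] by auto
  qed
qed

lemma near_finite: "bounded S \<Longrightarrow> finite (near S)"
proof -
  assume "bounded S"
  then obtain R where R: "R \<ge> 0" "S \<subseteq> cball 0 R"
    using bounded_subset_ballD[of S 0] ball_subset_cball by (meson less_imp_le order_trans)
  have "near S \<subseteq> near (cball 0 R)" using R unfolding near_def by blast
  moreover have "finite (near (cball 0 R))"
    by (rule packing[of _ 0 "R + h"]) (use near_subset R h_pos in \<open>auto simp: near_def\<close>)
  ultimately show ?thesis by (rule finite_subset)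
qed

section \<open>Neighbouring cells and the null set of cell boundaries\<close>

lemma neighbours_T: "K' \<in> neighbours T K \<Longrightarrow> K' \<in> T"
  unfolding neighbours_def by blast

lemma neighbours_meet: assumes "K' \<in> neighbours T K" shows "K \<inter> K' \<noteq> {}"
proof
  assume "K \<inter> K' = {}"
  then have "int DIM('a) = 0" using assms unfolding neighbours_def by auto
  then show False by simp
qed

lemma neighbours_sym: "K \<in> T \<Longrightarrow> K' \<in> neighbours T K \<longleftrightarrow> K' \<in> T \<and> K \<in> neighbours T K'"
  unfolding neighbours_def by (auto simp: Int_commute)

lemma neighbours_subset_near: "neighbours T K \<subseteq> near K"
  using neighbours_meet neighbours_T unfolding near_def by blast

lemma neighbours_finite: "K \<in> T \<Longrightarrow> finite (neighbours T K)"
  using neighbours_subset_near near_finite cell(5) finite_subset by blast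

text \<open>Neighbours meet \<open>K\<close>, hence lie in the ball of radius \<open>2 * h\<close>
  about its centre; packing bounds their number by a constant in which \<open>h\<close>
  cancels.\<close>

lemma neighbours_card: assumes "K \<in> T"
  shows "real (card (neighbours T K)) \<le> (2 / \<sigma>\<^sup>2) ^ DIM('a)"
proof -
  have K: "K \<subseteq> cball (centre K) h" using cell_subset_cball centre_in assms by blast
  have "real (card (neighbours T K)) \<le> ((h + h) / (\<sigma>\<^sup>2 * h)) ^ DIM('a)"
  proof (rule packing)
    show "neighbours T K \<subseteq> T" unfolding neighbours_def by blast
    fix K' assume "K' \<in> neighbours T K"
    then have "K' \<in> near (cball (centre K) h)" using neighbours_subset_near K unfolding near_def by blast
    then show "K' \<subseteq> cball (centre K) (h + h)" by (rule near_subset)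
  qed (use h_pos in auto)
  also have "(h + h) / (\<sigma>\<^sup>2 * h) = 2 / \<sigma>\<^sup>2" using h_pos by (simp add: field_simps)
  finally show ?thesis .
qed

text \<open>Countability makes the skeleton a countable union of null sets and lets measurability be
  checked cell by cell.\<close>

lemma countable_T: "countable T"
proof -
  have "T \<subseteq> (\<Union>n::nat. near (cball 0 (real n)))"
  proof
    fix K assume K: "K \<in> T"
    obtain n :: nat where "norm (centre K) \<le> n" using real_arch_simple by blast
    then show "K \<in> (\<Union>n::nat. near (cball 0 (real n)))"
      using K centre_in[OF K] unfolding near_def by (auto intro!: exI[of _ n])
  qed
  moreover have "countable \<dots>" using near_finite by (intro countable_UN) (auto intro: countable_finite)
  ultimately show ?thesis by (rule countable_subset)
qed

lemma negligible_frontier: "K \<in> T \<Longrightarrow> negligible (frontier K)"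
  using cell(2) negligible_convex_frontier by blast

text \<open>The null set on which a point may belong to several cells. Off it, the choice hidden in
  \<open>eval_broken\<close> has only one possible outcome.\<close>

definition skeleton :: "'a set" where "skeleton = (\<Union>K\<in>T. frontier K)"

lemma negligible_skeleton: "negligible skeleton"
  unfolding skeleton_def using negligible_frontier countable_T
  by (simp add: negligible_iff_null_sets null_sets_UN')

lemma skeleton_borel: "skeleton \<in> sets borel"
  unfolding skeleton_def using countable_T by (intro sets.countable_UN') auto

definition cell_of :: "'a \<Rightarrow> 'a set" where "cell_of x = (SOME K. K \<in> T \<and> x \<in> K)"

lemma cell_of: "cell_of x \<in> T" "x \<in> cell_of x"
  unfolding cell_of_def using cover[of x] by (metis (mono_tags, lifting) someI_ex)+

lemma cell_unique:
  assumes "x \<notin> skeleton" "K \<in> T" "K' \<in> T" "x \<in> K" "x \<in> K'" shows "K = K'"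
proof (rule ccontr)
  assume "K \<noteq> K'"
  moreover have "x \<in> interior K" "x \<in> interior K'"
    using assms cell(4) unfolding skeleton_def frontier_def by (auto simp: closure_closed)
  ultimately show False using disjoint_interiors assms by blast
qed

lemma cell_of_eq: "x \<notin> skeleton \<Longrightarrow> K \<in> T \<Longrightarrow> x \<in> K \<Longrightarrow> cell_of x = K"
  using cell_unique cell_of by blast

text \<open>The disjoint interiors are separated by a hyperplane, and the inequalities pass to the
  cells because a convex body is the closure of its interior.\<close>

lemma separation:
  assumes "K \<in> T" "K' \<in> T" "K \<noteq> K'"
  obtains \<nu> c where "norm \<nu> = 1" "\<And>x. x \<in> K \<Longrightarrow> \<nu> \<bullet> x \<le> c" "\<And>x. x \<in> K' \<Longrightarrow> c \<le> \<nu> \<bullet> x"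
proof -
  have "convex (interior K)" "convex (interior K')" using cell(2) assms by (auto intro: convex_interior)
  then obtain a b where ab: "a \<noteq> 0" "\<forall>x\<in>interior K. a \<bullet> x \<le> b" "\<forall>x\<in>interior K'. b \<le> a \<bullet> x"
    using separating_hyperplane_sets[of "interior K" "interior K'"] cell(6) assms disjoint_interiors by metis
  have 1: "interior K \<subseteq> {x. a \<bullet> x \<le> b}" "interior K' \<subseteq> {x. a \<bullet> x \<ge> b}" using ab by auto
  have "closure (interior K) \<subseteq> {x. a \<bullet> x \<le> b}" "closure (interior K') \<subseteq> {x. a \<bullet> x \<ge> b}"
    using closure_minimal[OF 1(1) closed_halfspace_le] closure_minimal[OF 1(2) closed_halfspace_ge] by blast+
  moreover have "closure (interior K) = K" "closure (interior K') = K'"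
    using convex_closure_interior cell assms by (metis closure_closed)+
  ultimately have 2: "x \<in> K \<Longrightarrow> a \<bullet> x \<le> b" "x \<in> K' \<Longrightarrow> b \<le> a \<bullet> x" for x by auto
  show ?thesis
  proof (rule that[of "a /\<^sub>R norm a" "b / norm a"])
    show "norm (a /\<^sub>R norm a) = 1" using ab by simp
    fix x
    show "x \<in> K \<Longrightarrow> (a /\<^sub>R norm a) \<bullet> x \<le> b / norm a"
      using 2(1)[of x] ab by (simp add: divide_inverse_commute mult_left_mono)
    show "x \<in> K' \<Longrightarrow> b / norm a \<le> (a /\<^sub>R norm a) \<bullet> x"
      using 2(2)[of x] ab by (simp add: divide_inverse_commute mult_left_mono)
  qed
qed

end

text \<open>An intersection of codimension one spans the separating hyperplane, so for a competing
  normal \<open>\<mu>\<close> the functional \<open>\<mu> \<bullet> x\<close> is constant on the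
  whole hyperplane. Hence \<open>\<mu>\<close> is parallel to \<open>\<nu>\<close>, and an interior
  point of \<open>K\<close> fixes the sign. The supremum is attained on the face, which identifies
  the height used by \<open>face_integral\<close>.\<close>

lemma outward_normal_unique:
  fixes K K' :: "'a::euclidean_space set"
  assumes "interior K \<noteq> {}" and "norm \<nu> = 1"
    and K: "\<And>x. x \<in> K \<Longrightarrow> \<nu> \<bullet> x \<le> c" and K': "\<And>x. x \<in> K' \<Longrightarrow> c \<le> \<nu> \<bullet> x"
    and dim: "aff_dim (K \<inter> K') = int DIM('a) - 1"
  shows "outward_normal K K' = \<nu>" "(SUP y\<in>K. \<nu> \<bullet> y) = c"
proof -
  have \<nu>: "\<nu> \<bullet> \<nu> = 1" "\<nu> \<noteq> 0" using assms(2) by (auto simp: norm_eq_1)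
  have H: "\<nu> \<bullet> x = c" if "x \<in> K \<inter> K'" for x using K K' that by (meson IntE order_antisym)
  have ne: "K \<inter> K' \<noteq> {}" using dim by (auto simp: DIM_positive)
  then obtain x0 where x0: "x0 \<in> K \<inter> K'" by blast
  have hull: "affine hull (K \<inter> K') = {x. \<nu> \<bullet> x = c}"
  proof (rule affine_dim_equal)
    show "affine hull (K \<inter> K') \<subseteq> {x. \<nu> \<bullet> x = c}"
      by (rule hull_minimal) (use H affine_hyperplane in auto)
    show "aff_dim (affine hull (K \<inter> K')) = aff_dim {x. \<nu> \<bullet> x = c}"
      using dim \<nu> by simp
  qed (use ne affine_hyperplane in auto)
  obtain q where q: "q \<in> interior K" using assms(1) by blast
  have q': "\<nu> \<bullet> q < c"
  proof -
    obtain e where e: "e > 0" "cball q e \<subseteq> K" using q by (metis mem_interior_cball)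
    have "q + e *\<^sub>R \<nu> \<in> K" using e assms(2) by (auto simp: subset_eq dist_norm)
    then have "\<nu> \<bullet> q + e \<le> c" using K[of "q + e *\<^sub>R \<nu>"] \<nu> by (simp add: inner_add_right)
    then show ?thesis using e by linarith
  qed
  show "outward_normal K K' = \<nu>"
    unfolding outward_normal_def
  proof (rule the_equality)
    show "norm \<nu> = 1 \<and> (\<forall>x\<in>K \<inter> K'. \<forall>y\<in>K. \<nu> \<bullet> (y - x) \<le> 0)"
      using assms(2) H K by (auto simp: inner_diff_right)
    fix \<mu> assume \<mu>: "norm \<mu> = 1 \<and> (\<forall>x\<in>K \<inter> K'. \<forall>y\<in>K. \<mu> \<bullet> (y - x) \<le> 0)"
    have \<mu>\<mu>: "\<mu> \<bullet> \<mu> = 1" using \<mu> by (simp add: norm_eq_1)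
    have "\<mu> \<bullet> (x - x0) = 0" if "x \<in> K \<inter> K'" for x
      using \<mu> that x0 by (smt (verit, ccfv_SIG) IntD1 inner_diff_right)
    then have "K \<inter> K' \<subseteq> {x. \<mu> \<bullet> x = \<mu> \<bullet> x0}" by (auto simp: inner_diff_right)
    then have "affine hull (K \<inter> K') \<subseteq> {x. \<mu> \<bullet> x = \<mu> \<bullet> x0}"
      by (rule hull_minimal) (rule affine_hyperplane)
    then have *: "\<nu> \<bullet> x = c \<Longrightarrow> \<mu> \<bullet> x = \<mu> \<bullet> x0" for x using hull by auto
    \<comment> \<open>Moving from \<open>x0\<close> by the tangential part of \<open>\<mu>\<close>
      stays in the hyperplane, so this part is orthogonal to \<open>\<mu>\<close>; its squared
      length is therefore zero.\<close>
    have "\<nu> \<bullet> (x0 + (\<mu> - (\<nu> \<bullet> \<mu>) *\<^sub>R \<nu>)) = c" using H[OF x0] \<nu> by (simp add: inner_add_right inner_diff_right)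
    from *[OF this] have "\<mu> \<bullet> \<mu> - (\<nu> \<bullet> \<mu>)\<^sup>2 = 0" by (simp add: inner_add_right inner_diff_right power2_eq_square inner_commute)
    then have "(\<nu> \<bullet> \<mu>)\<^sup>2 = 1" using \<mu>\<mu> by simp
    then have "\<nu> \<bullet> \<mu> = 1 \<or> \<nu> \<bullet> \<mu> = -1" by (simp add: power2_eq_1_iff)
    then show "\<mu> = \<nu>"
    proof
      assume "\<nu> \<bullet> \<mu> = 1"
      then have "(\<mu> - \<nu>) \<bullet> (\<mu> - \<nu>) = 0" using \<nu> \<mu>\<mu> by (simp add: inner_diff_left inner_diff_right inner_commute)
      then show ?thesis by simp
    next
      assume "\<nu> \<bullet> \<mu> = -1"
      then have "(\<mu> + \<nu>) \<bullet> (\<mu> + \<nu>) = 0" using \<nu> \<mu>\<mu> by (simp add: inner_add_left inner_add_right inner_commute)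
      then have "\<mu> = - \<nu>" by (simp add: add_eq_0_iff2)
      moreover have "\<mu> \<bullet> (q - x0) \<le> 0" using \<mu> x0 q interior_subset by blast
      ultimately have "\<nu> \<bullet> q \<ge> c" using H[OF x0] by (simp add: inner_diff_right)
      then show ?thesis using q' by linarith
    qed
  qed
  show "(SUP y\<in>K. \<nu> \<bullet> y) = c"
  proof (rule antisym)
    show "(SUP y\<in>K. \<nu> \<bullet> y) \<le> c" using K x0 by (intro cSUP_least) auto
    show "c \<le> (SUP y\<in>K. \<nu> \<bullet> y)" using K x0 H[OF x0] by (intro cSUP_upper2[where x=x0]) (auto simp: bdd_above_def)
  qed
qed

section \<open>The divergence theorem on cells\<close>

text \<open>The face integral with normal and height given explicitly, free of the choices in
  \<open>outward_normal\<close> and in the supremum. It also makes sense for cells that touch in a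
  lower dimension, where it turns out to vanish.\<close>

definition face_int :: "'a::euclidean_space \<Rightarrow> real \<Rightarrow> 'a set \<Rightarrow> ('a \<Rightarrow> real) \<Rightarrow> real" where
  "face_int \<nu> c E g = (\<integral>y. indicator (slab \<nu> c 1) y * (indicator E (hproj \<nu> c y) * g (hproj \<nu> c y)) \<partial>lborel)"

lemma interior_strict:
  fixes K :: "'a::euclidean_space set"
  assumes "norm \<nu> = 1" "\<And>x. x \<in> K \<Longrightarrow> \<nu> \<bullet> x \<le> c" "interior K \<noteq> {}"
  obtains q where "q \<in> K" "\<nu> \<bullet> q < c"
proof -
  obtain q where q: "q \<in> interior K" using assms by blast
  obtain e where e: "e > 0" "cball q e \<subseteq> K" using q by (metis mem_interior_cball)
  have "q + e *\<^sub>R \<nu> \<in> K" using e assms(1) by (auto simp: subset_eq dist_norm)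
  then have "\<nu> \<bullet> q + e \<le> c" using assms(2)[of "q + e *\<^sub>R \<nu>"] assms(1) by (simp add: inner_add_right norm_eq_1)
  then show ?thesis using e q interior_subset that[of q] by fastforce
qed

text \<open>The two orientations use slabs on opposite sides of the hyperplane. Translation by
  \<open>\<nu>\<close> carries one slab onto the other and leaves the projection unchanged.\<close>

lemma face_int_minus:
  assumes \<nu>: "norm \<nu> = 1" and [measurable]: "(\<lambda>x. indicator E x * g x) \<in> borel_measurable borel"
  shows "face_int (- \<nu>) (- c) E g = face_int \<nu> c E g"
proof -
  have \<nu>\<nu>: "\<nu> \<bullet> \<nu> = 1" using \<nu> by (simp add: norm_eq_1)
  have 1: "hproj (- \<nu>) (- c) y = hproj \<nu> c y" for y
    by (simp add: hproj_def algebra_simps)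
  have 2: "hproj \<nu> c (y - \<nu>) = hproj \<nu> c y" for y
    by (simp add: hproj_def inner_diff_right inner_add_right \<nu>\<nu> algebra_simps)
  have 3: "y - \<nu> \<in> slab (- \<nu>) (- c) 1 \<longleftrightarrow> y \<in> slab \<nu> c 1" for y
    by (auto simp: slab_def inner_diff_right \<nu>\<nu>)
  let ?g = "\<lambda>y. indicator (slab (-\<nu>) (-c) 1) y * (indicator E (hproj \<nu> c y) * g (hproj \<nu> c y))"
  have "face_int (- \<nu>) (- c) E g = (\<integral>y. ?g y \<partial>lborel)"
    by (simp add: face_int_def 1)
  also have "\<dots> = (\<integral>y. ?g (- \<nu> + y) \<partial>lborel)"
  proof (rule integral_lborel_shift[symmetric])
    have "(\<lambda>y. (\<lambda>x. indicator E x * g x) (hproj \<nu> c y)) \<in> borel_measurable borel"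
      by (rule measurable_compose[OF hproj_measurable assms(2)])
    from borel_measurable_times[OF borel_measurable_indicator this] show "?g \<in> borel_measurable borel" by simp
  qed
  also have "\<dots> = face_int \<nu> c E g"
    by (simp add: face_int_def 2 3 indicator_def)
  finally show ?thesis .
qed

text \<open>The preimage of a convex set under an affine map is convex, so its frontier is null. A
  point interior to the preimage projects to a point that is interior to \<open>E\<close> relative
  to the hyperplane.\<close>

lemma hproj_interior:
  fixes E :: "'a::euclidean_space set"
  assumes \<nu>: "norm \<nu> = 1" and E: "convex E"
  shows "AE y in lborel. hproj \<nu> c y \<in> E \<longrightarrow> (\<exists>e>0. \<forall>p. \<nu> \<bullet> p = c \<and> dist p (hproj \<nu> c y) < e \<longrightarrow> p \<in> E)"
proof -
  let ?Z = "{y. hproj \<nu> c y \<in> E}"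
  have aff: "hproj \<nu> c (u *\<^sub>R x + v *\<^sub>R y) = u *\<^sub>R hproj \<nu> c x + v *\<^sub>R hproj \<nu> c y" if uv: "u + v = 1" for u v x y
  proof -
    have "c = u * c + v * c" using uv by (metis distrib_right mult_1)
    then have *: "\<nu> \<bullet> (u *\<^sub>R x + v *\<^sub>R y) - c = u * (\<nu> \<bullet> x - c) + v * (\<nu> \<bullet> y - c)"
      by (simp add: inner_add_right algebra_simps)
    show ?thesis unfolding hproj_def * by (simp add: algebra_simps)
  qed
  have "convex ?Z"
    by (rule convexI) (use E in \<open>auto simp: aff convex_def\<close>)
  then have "negligible (frontier ?Z)" by (rule negligible_convex_frontier)
  then have "frontier ?Z \<in> null_sets lborel"
    by (simp add: negligible_iff_null_sets null_sets_completion_iff)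
  then have "AE y in lborel. y \<notin> frontier ?Z" by (rule AE_not_in)
  then show ?thesis
  proof eventually_elim
    case (elim y)
    show ?case
    proof
      assume y: "hproj \<nu> c y \<in> E"
      then have "y \<in> closure ?Z" using closure_subset by fastforce
      then have "y \<in> interior ?Z" using elim by (simp add: frontier_def)
      then obtain e where e: "e > 0" "ball y e \<subseteq> ?Z" by (metis mem_interior)
      show "\<exists>e>0. \<forall>p. \<nu> \<bullet> p = c \<and> dist p (hproj \<nu> c y) < e \<longrightarrow> p \<in> E"
      proof (intro exI[of _ e] conjI allI impI)
        fix p assume p: "\<nu> \<bullet> p = c \<and> dist p (hproj \<nu> c y) < e"
        let ?y = "y + (p - hproj \<nu> c y)"
        have "dist ?y y < e" using p by (simp add: dist_norm)
        then have "?y \<in> ?Z" using e by (auto simp: dist_commute)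
        moreover have "\<nu> \<bullet> ?y = \<nu> \<bullet> y" using p hproj_slab_map(5)[OF \<nu>, of c y] by (simp add: inner_add_right inner_diff_right)
        then have "hproj \<nu> c ?y = p" by (simp add: hproj_def)
        ultimately show "p \<in> E" by simp
      qed (use e in auto)
    qed
  qed
qed

text \<open>The convex hull of a disc around \<open>p\<close> in the hyperplane and a point
  \<open>q\<close> strictly above it contains a short segment from \<open>p\<close> in every
  direction that points strictly upwards. The direction \<open>v\<close> is split into the multiple
  \<open>l\<close> of \<open>q - p\<close> and a tangential remainder \<open>w\<close>, which is
  absorbed by moving \<open>p\<close> within the disc.\<close>

lemma enters_cone:
  fixes p :: "'a::euclidean_space"
  assumes K: "convex K" and q: "q \<in> K" "\<nu> \<bullet> q > c" and p: "\<nu> \<bullet> p = c"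
    and e: "e > 0" "\<And>p'. \<nu> \<bullet> p' = c \<Longrightarrow> dist p' p < e \<Longrightarrow> p' \<in> K" and v: "\<nu> \<bullet> v > 0"
  obtains t0 where "t0 > 0" "\<And>t. 0 < t \<Longrightarrow> t < t0 \<Longrightarrow> p + t *\<^sub>R v \<in> K"
proof -
  define l where "l = (\<nu> \<bullet> v) / (\<nu> \<bullet> (q - p))"
  have qp: "\<nu> \<bullet> (q - p) > 0" using q p by (simp add: inner_diff_right)
  then have l: "l > 0" unfolding l_def using v by simp
  define w where "w = v - l *\<^sub>R (q - p)"
  have \<nu>w: "\<nu> \<bullet> w = 0" using qp unfolding w_def by (simp add: inner_diff_right[of \<nu> v] l_def)
  \<comment> \<open>The first bound keeps the weight \<open>t * l\<close> of \<open>q\<close> below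
    one half, the second keeps the displacement of \<open>p\<close> shorter than
    \<open>e\<close>.\<close>
  define t0 where "t0 = min (1 / (2 * l)) (e / (2 * norm w + 1))"
  have "t0 > 0" using l e unfolding t0_def by (simp add: add_nonneg_pos)
  then show ?thesis
  proof (rule that)
    fix t assume t: "0 < t" "t < t0"
    have tl: "t * l < 1/2" using t l unfolding t0_def by (simp add: field_simps)
    have tw: "t * (2 * norm w + 1) < e" using t unfolding t0_def by (simp add: pos_less_divide_eq add_nonneg_pos)
    define p' where "p' = p + (t / (1 - t * l)) *\<^sub>R w"
    have "t / (1 - t * l) \<le> 2 * t" using t tl by (simp add: field_simps)
    then have "t / (1 - t * l) * norm w \<le> 2 * t * norm w" by (rule mult_right_mono) simp
    also have "\<dots> < e" using tw t by (simp add: algebra_simps)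
    finally have "dist p' p < e" using t tl by (simp add: p'_def dist_norm)
    then have "p' \<in> K" using e(2)[of p'] p \<nu>w by (simp add: p'_def inner_add_right)
    then have "(1 - t * l) *\<^sub>R p' + (t * l) *\<^sub>R q \<in> K"
      using K q tl t l unfolding convex_def by simp
    moreover have "(1 - t * l) *\<^sub>R p' = (1 - t * l) *\<^sub>R p + t *\<^sub>R w"
      using tl by (simp add: p'_def scaleR_add_right)
    then have "(1 - t * l) *\<^sub>R p' + (t * l) *\<^sub>R q = p + t *\<^sub>R v"
      by (simp add: w_def algebra_simps)
    ultimately show "p + t *\<^sub>R v \<in> K" by simp
  qed
qed

lemma AE_not_hyperplane:
  fixes \<nu> :: "'a::euclidean_space"
  assumes "norm \<nu> = 1" shows "AE y in lborel. \<nu> \<bullet> y \<noteq> c"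
proof -
  have "negligible {y. \<nu> \<bullet> y = c}" using assms negligible_hyperplane[of \<nu> c] by fastforce
  moreover have "{y. \<nu> \<bullet> y = c} \<in> sets borel" by measurable
  ultimately have "{y. \<nu> \<bullet> y = c} \<in> null_sets lborel"
    by (simp add: negligible_iff_null_sets null_sets_completion_iff)
  then show ?thesis using AE_not_in by fastforce
qed

text \<open>Points of \<open>K'\<close> that come from \<open>K\<close> under a shift by
  \<open>t\<close> times \<open>a\<close> form a layer of thickness at most
  \<open>t * (a \<bullet> \<nu>)\<close> above the common face. Stretching the unit slab onto the
  slab of that height yields the factor \<open>t * (a \<bullet> \<nu>)\<close>, and the transformed
  integrand converges almost everywhere to that of \<open>face_int\<close>.\<close>

lemma face_limit:
  fixes K K' :: "'a::euclidean_space set"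
  assumes K: "compact K" "convex K" "interior K \<noteq> {}" and K': "compact K'" "convex K'" "interior K' \<noteq> {}"
    and \<nu>: "norm \<nu> = 1" and sepK: "\<And>x. x \<in> K \<Longrightarrow> \<nu> \<bullet> x \<le> c" and sepK': "\<And>x. x \<in> K' \<Longrightarrow> c \<le> \<nu> \<bullet> x"
    and a: "a \<bullet> \<nu> > 0" and \<psi>: "continuous_on UNIV (\<psi> :: 'a \<Rightarrow> real)"
  shows "(\<lambda>n. real (Suc n) * (\<integral>x. indicator K' x * indicator K (x - inverse (real (Suc n)) *\<^sub>R a) * \<psi> x \<partial>lborel))
      \<longlonglongrightarrow> (a \<bullet> \<nu>) * face_int \<nu> c (K \<inter> K') \<psi>"
proof -
  define \<alpha> where "\<alpha> = a \<bullet> \<nu>"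
  have \<alpha>: "\<alpha> > 0" "\<nu> \<bullet> a = \<alpha>" using a by (auto simp: \<alpha>_def inner_commute)
  have \<nu>\<nu>: "\<nu> \<bullet> \<nu> = 1" using \<nu> by (simp add: norm_eq_1)
  define t :: "nat \<Rightarrow> real" where "t n = inverse (real (Suc n))" for n
  have t: "0 < t n" "t n \<le> 1" for n by (auto simp: t_def field_simps)
  have t0: "t \<longlonglongrightarrow> 0" unfolding t_def by (rule LIMSEQ_inverse_real_of_nat)
  have [measurable]: "K \<in> sets borel" "K' \<in> sets borel" "\<psi> \<in> borel_measurable borel"
    using K K' \<psi> by (auto simp: compact_imp_closed intro: borel_measurable_continuous_onI)
  define g where "g n x = indicator K' x * indicator K (x - t n *\<^sub>R a) * \<psi> x" for n x
  have [measurable]: "g n \<in> borel_measurable borel" for n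
    unfolding g_def by measurable
  define G where "G n y = g n (slab_map \<nu> c (t n * \<alpha>) y)" for n y
  define G0 where "G0 y = indicator (slab \<nu> c 1) y * (indicator (K \<inter> K') (hproj \<nu> c y) * \<psi> (hproj \<nu> c y))" for y
  have S: "slab_map \<nu> c (t n * \<alpha>) y = hproj \<nu> c y + t n *\<^sub>R ((\<alpha> * (\<nu> \<bullet> y - c)) *\<^sub>R \<nu>)" for n y
    by (simp add: hproj_slab_map(4)[OF \<nu>])
  \<comment> \<open>Membership of the point in \<open>K'\<close> and of the shifted point in
    \<open>K\<close> bounds the height from below and above, so the integrand lives in the stretched
    slab.\<close>
  have out: "G n y = 0" if "y \<notin> slab \<nu> c 1" for n y
  proof (rule ccontr)
    let ?x = "slab_map \<nu> c (t n * \<alpha>) y"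
    assume "G n y \<noteq> 0"
    then have "?x \<in> K'" "?x - t n *\<^sub>R a \<in> K" by (auto simp: G_def g_def indicator_def split: if_splits)
    from sepK'[OF this(1)] sepK[OF this(2)] have "?x \<in> slab \<nu> c (t n * \<alpha>)"
      by (simp add: slab_def inner_diff_right \<alpha>)
    then show False using hproj_slab_map(2)[OF \<nu>, of "t n * \<alpha>" c y] t \<alpha> that by simp
  qed
  obtain r where r: "\<And>x. x \<in> K' \<Longrightarrow> norm x \<le> r" using K'(1) compact_imp_bounded bounded_iff by metis
  have "bounded (\<psi> ` K')" using K'(1) \<psi> by (meson compact_continuous_image compact_imp_bounded continuous_on_subset subset_UNIV)
  then obtain B where B: "\<And>x. x \<in> K' \<Longrightarrow> \<bar>\<psi> x\<bar> \<le> B" unfolding bounded_iff by (auto simp: real_norm_def)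
  have dom: "norm (G n y) \<le> B * indicator (cball 0 (r + \<alpha> + 1)) y" for n y
  proof (cases "G n y = 0")
    case True
    have "B \<ge> 0" using B K'(3) interior_subset by (meson abs_ge_zero order_trans ex_in_conv subsetD)
    then show ?thesis using True by (simp add: indicator_def)
  next
    case False
    let ?x = "slab_map \<nu> c (t n * \<alpha>) y"
    have x: "?x \<in> K'" using False by (auto simp: G_def g_def indicator_def split: if_splits)
    have y: "y \<in> slab \<nu> c 1" using out False by blast
    \<comment> \<open>Within the unit slab the stretching moves points by at most
      \<open>1 + \<alpha>\<close>, so all supports lie in one ball.\<close>
    have "y = ?x + ((\<nu> \<bullet> y - c) * (1 - t n * \<alpha>)) *\<^sub>R \<nu>"
      by (simp add: slab_map_def algebra_simps)
    then have "norm y \<le> norm ?x + norm (((\<nu> \<bullet> y - c) * (1 - t n * \<alpha>)) *\<^sub>R \<nu>)"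
      by (metis norm_triangle_ineq)
    also have "norm (((\<nu> \<bullet> y - c) * (1 - t n * \<alpha>)) *\<^sub>R \<nu>) \<le> 1 * (1 + \<alpha>)"
    proof -
      have "0 \<le> t n * \<alpha>" "t n * \<alpha> \<le> 1 * \<alpha>" using t[of n] \<alpha> by (auto intro!: mult_right_mono)
      then have "\<bar>1 - t n * \<alpha>\<bar> \<le> 1 + \<alpha>" by linarith
      moreover have "\<bar>\<nu> \<bullet> y - c\<bar> \<le> 1" using y by (auto simp: slab_def)
      ultimately have "\<bar>\<nu> \<bullet> y - c\<bar> * \<bar>1 - t n * \<alpha>\<bar> \<le> 1 * (1 + \<alpha>)" by (intro mult_mono) auto
      then show ?thesis using \<nu> by (simp add: abs_mult)
    qed
    finally have "norm y \<le> r + \<alpha> + 1" using r[OF x] by simp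
    moreover have "norm (G n y) \<le> B" using B[OF x] unfolding G_def g_def
      by (auto simp: indicator_def abs_mult intro: order_trans[OF abs_ge_zero])
    ultimately show ?thesis by simp
  qed
  obtain q where q: "q \<in> K" "\<nu> \<bullet> q < c" using interior_strict[OF \<nu> sepK K(3)] by blast
  obtain q' where q': "q' \<in> K'" "(-\<nu>) \<bullet> q' < - c"
    using interior_strict[of "-\<nu>" K' "-c"] \<nu> sepK' K'(3) by (metis inner_minus_left neg_le_iff_le norm_minus_cancel)
  \<comment> \<open>Relative boundary points of the face and the two bounding hyperplanes of the
    slab are discarded as null sets.\<close>
  have lim: "AE y in lborel. (\<lambda>n. G n y) \<longlonglongrightarrow> G0 y"
    using hproj_interior[OF \<nu> convex_Int[OF K(2) K'(2)], of c] AE_not_hyperplane[OF \<nu>, of c] AE_not_hyperplane[OF \<nu>, of "c + 1"]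
  proof eventually_elim
    case (elim y)
    define p where "p = hproj \<nu> c y"
    define s where "s = \<nu> \<bullet> y - c"
    define v where "v = (\<alpha> * s) *\<^sub>R \<nu>"
    have Gn: "G n y = indicator K' (p + t n *\<^sub>R v) * indicator K (p + t n *\<^sub>R (v - a)) * \<psi> (p + t n *\<^sub>R v)" for n
      unfolding G_def g_def S p_def v_def s_def by (simp add: algebra_simps)
    have limp: "(\<lambda>n. p + t n *\<^sub>R w) \<longlonglongrightarrow> p" for w
      using tendsto_add[OF tendsto_const tendsto_scaleR[OF t0 tendsto_const[of w]], of p] by simp
    have \<nu>p: "\<nu> \<bullet> p = c" unfolding p_def by (rule hproj_slab_map(5)[OF \<nu>])
    show "(\<lambda>n. G n y) \<longlonglongrightarrow> G0 y"
    proof (cases "y \<in> slab \<nu> c 1")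
      case False
      then show ?thesis by (simp add: out G0_def)
    next
      case y: True
      then have s: "0 < s" "s < 1" using elim by (auto simp: slab_def s_def)
      show ?thesis
      proof (cases "p \<in> K \<inter> K'")
        case False
        \<comment> \<open>The cells are closed: if the limit point \<open>p\<close> misses one of
          them, so does the corresponding moving point for large \<open>n\<close>.\<close>
        have "eventually (\<lambda>n. G n y = 0) sequentially"
        proof (cases "p \<in> K")
          case True
          then have "p \<in> - K'" using False by blast
          moreover have "open (- K')" using K' by (simp add: compact_imp_closed open_Compl)
          ultimately have "eventually (\<lambda>n. p + t n *\<^sub>R v \<in> - K') sequentially" using limp topological_tendstoD by blast
          then show ?thesis by eventually_elim (simp add: Gn)
        next
          case False
          moreover have "open (- K)" using K by (simp add: compact_imp_closed open_Compl)
          ultimately have "eventually (\<lambda>n. p + t n *\<^sub>R (v - a) \<in> - K) sequentially" using limp topological_tendstoD by blast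
          then show ?thesis by eventually_elim (simp add: Gn)
        qed
        then have "(\<lambda>n. G n y) \<longlonglongrightarrow> 0" by (rule tendsto_eventually)
        then show ?thesis using False by (simp add: G0_def p_def)
      next
        case True
        then obtain e where e: "e > 0" "\<And>p'. \<nu> \<bullet> p' = c \<Longrightarrow> dist p' p < e \<Longrightarrow> p' \<in> K \<inter> K'"
          using elim(1) unfolding p_def by blast
        \<comment> \<open>For \<open>0 < s < 1\<close> the direction \<open>v\<close> points
          strictly to the side of \<open>K'\<close> and \<open>v - a\<close> strictly to the side of
          \<open>K\<close>, so for small steps both moving points lie in their cells.\<close>
        have "\<nu> \<bullet> v > 0" using \<alpha> s by (simp add: v_def \<nu>\<nu>)
        then obtain t1 where t1: "t1 > 0" "\<And>t. 0 < t \<Longrightarrow> t < t1 \<Longrightarrow> p + t *\<^sub>R v \<in> K'"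
          using enters_cone[OF K'(2) q'(1) _ \<nu>p e(1), of v] q' e(2) by auto
        have "\<alpha> * s < \<alpha>" using \<alpha> s by simp
        then have "(-\<nu>) \<bullet> (v - a) > 0" using \<alpha> by (simp add: v_def \<nu>\<nu> inner_diff_right)
        then obtain t2 where t2: "t2 > 0" "\<And>t. 0 < t \<Longrightarrow> t < t2 \<Longrightarrow> p + t *\<^sub>R (v - a) \<in> K"
          using enters_cone[OF K(2) q(1), of "-c" "-\<nu>" p e "v - a"] q e \<nu>p by auto
        have "eventually (\<lambda>n. t n < min t1 t2) sequentially"
          using t0 t1(1) t2(1) by (intro order_tendstoD(2)) auto
        then have "eventually (\<lambda>n. \<psi> (p + t n *\<^sub>R v) = G n y) sequentially"
          by eventually_elim (simp add: Gn t1 t2 t)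
        moreover have "(\<lambda>n. \<psi> (p + t n *\<^sub>R v)) \<longlonglongrightarrow> \<psi> p"
        proof (rule isCont_tendsto_compose[OF _ limp])
          show "isCont \<psi> p" using \<psi> by (simp add: continuous_on_eq_continuous_at)
        qed
        ultimately have "(\<lambda>n. G n y) \<longlonglongrightarrow> \<psi> p" by (rule Lim_transform_eventually[rotated])
        then show ?thesis using True y by (simp add: G0_def p_def)
      qed
    qed
  qed
  have "(\<lambda>n. \<integral>y. G n y \<partial>lborel) \<longlonglongrightarrow> (\<integral>y. G0 y \<partial>lborel)"
  proof (rule integral_dominated_convergence[where w="\<lambda>y. B * indicator (cball 0 (r + \<alpha> + 1)) y"])
    show "integrable lborel (\<lambda>y::'a. B * indicator (cball 0 (r + \<alpha> + 1)) y)"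
      using emeasure_lborel_cball_finite by (intro integrable_mult_right integrable_real_indicator) auto
    show "G0 \<in> borel_measurable lborel" unfolding G0_def by measurable
    show "G n \<in> borel_measurable lborel" for n unfolding G_def by measurable
  qed (use lim dom in auto)
  then have "(\<lambda>n. \<alpha> * (\<integral>y. G n y \<partial>lborel)) \<longlonglongrightarrow> \<alpha> * (\<integral>y. G0 y \<partial>lborel)" by (rule tendsto_mult_left)
  moreover have "\<alpha> * (\<integral>y. G n y \<partial>lborel) = real (Suc n) * (\<integral>x. g n x \<partial>lborel)" for n
  proof -
    have "(\<integral>x. g n x \<partial>lborel) = t n * \<alpha> * (\<integral>y. G n y \<partial>lborel)"
      unfolding G_def using t \<alpha> by (intro integral_slab_map[OF \<nu>]) auto
    then show ?thesis by (simp add: t_def field_simps)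
  qed
  ultimately show ?thesis unfolding g_def face_int_def G0_def \<alpha>_def t_def by simp
qed


lemma face_integral_eq_face_int:
  fixes K K' :: "'a::euclidean_space set"
  assumes "interior K \<noteq> {}" "norm \<nu> = 1" "\<And>x. x \<in> K \<Longrightarrow> \<nu> \<bullet> x \<le> c" "\<And>x. x \<in> K' \<Longrightarrow> c \<le> \<nu> \<bullet> x"
    and dim: "aff_dim (K \<inter> K') = int DIM('a) - 1"
    and [measurable]: "(\<lambda>x. indicator (K \<inter> K') x * g x) \<in> borel_measurable borel"
  shows "face_integral K K' g = face_int \<nu> c (K \<inter> K') g"
proof -
  have 1: "outward_normal K K' = \<nu>" "(SUP y\<in>K. \<nu> \<bullet> y) = c" using outward_normal_unique[OF assms(1-5)] by auto
  show ?thesis unfolding face_integral_def Let_def 1 set_lebesgue_integral_def real_scaleR_def face_int_def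
    by (rule integral_hyperplane_measure) fact
qed

lemma face_int_cmult: "face_int \<nu> c E (\<lambda>x. r * g x) = r * face_int \<nu> c E g"
proof -
  have "face_int \<nu> c E (\<lambda>x. r * g x) = (\<integral>y. r * (indicator (slab \<nu> c 1) y * (indicator E (hproj \<nu> c y) * g (hproj \<nu> c y))) \<partial>lborel)"
    unfolding face_int_def by (rule Bochner_Integration.integral_cong) (auto simp: algebra_simps)
  then show ?thesis by (simp add: face_int_def)
qed

lemma set_integral_lborel:
  fixes g :: "'a::euclidean_space \<Rightarrow> real"
  assumes "K \<in> sets borel" "g \<in> borel_measurable borel"
  shows "(LINT x:K|lebesgue. g x) = (\<integral>x. indicator K x * g x \<partial>lborel)"
  unfolding set_lebesgue_integral_def real_scaleR_def
  using assms by (intro integral_completion) auto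

section \<open>Faces between cells and the divergence theorem\<close>

context qu_mesh begin

text \<open>One hyperplane serves both orientations of a face: seen from \<open>K'\<close> the
  normal changes its sign but the face integral does not. This lets conservative fluxes
  cancel.\<close>

lemma neighbours_normal:
  assumes K: "K \<in> T" and K': "K' \<in> neighbours T K"
  obtains \<nu> c where "norm \<nu> = 1" "\<And>x. x \<in> K \<Longrightarrow> \<nu> \<bullet> x \<le> c" "\<And>x. x \<in> K' \<Longrightarrow> c \<le> \<nu> \<bullet> x"
    "outward_normal K K' = \<nu>" "outward_normal K' K = - \<nu>"
    "\<And>g. (\<lambda>x. indicator (K \<inter> K') x * g x) \<in> borel_measurable borel \<Longrightarrow> face_integral K K' g = face_int \<nu> c (K \<inter> K') g"
    "\<And>g. (\<lambda>x. indicator (K \<inter> K') x * g x) \<in> borel_measurable borel \<Longrightarrow> face_integral K' K g = face_int \<nu> c (K \<inter> K') g"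
proof -
  have T': "K' \<in> T" "K \<noteq> K'" and dim: "aff_dim (K \<inter> K') = int DIM('a) - 1" using K' unfolding neighbours_def by auto
  then have dim': "aff_dim (K' \<inter> K) = int DIM('a) - 1" by (simp add: Int_commute)
  obtain \<nu> c where s: "norm \<nu> = 1" "\<And>x. x \<in> K \<Longrightarrow> \<nu> \<bullet> x \<le> c" "\<And>x. x \<in> K' \<Longrightarrow> c \<le> \<nu> \<bullet> x"
    using separation[OF K T'] by blast
  have s': "norm (- \<nu>) = 1" "\<And>x. x \<in> K' \<Longrightarrow> (- \<nu>) \<bullet> x \<le> - c" "\<And>x. x \<in> K \<Longrightarrow> - c \<le> (- \<nu>) \<bullet> x"
    using s by auto
  show ?thesis
  proof (rule that[OF s])
    show "outward_normal K K' = \<nu>" using outward_normal_unique(1)[OF cell(6)[OF K] s dim] .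
    show "outward_normal K' K = - \<nu>" using outward_normal_unique(1)[OF cell(6)[OF T'(1)] s' dim'] .
    fix g assume g: "(\<lambda>x. indicator (K \<inter> K') x * (g x :: real)) \<in> borel_measurable borel"
    show "face_integral K K' g = face_int \<nu> c (K \<inter> K') g"
      using face_integral_eq_face_int[OF cell(6)[OF K] s dim] g by blast
    have "face_integral K' K g = face_int (- \<nu>) (- c) (K' \<inter> K) g"
      using face_integral_eq_face_int[OF cell(6)[OF T'(1)] s' dim'] g by (simp add: Int_commute)
    also have "\<dots> = face_int \<nu> c (K \<inter> K') g"
      using face_int_minus[OF s(1), of "K \<inter> K'" g c] g by (simp add: Int_commute)
    finally show "face_integral K' K g = face_int \<nu> c (K \<inter> K') g" .
  qed
qed

lemma face_integral_commute:
  assumes "K \<in> T" "K' \<in> neighbours T K" "(\<lambda>x. indicator (K \<inter> K') x * g x) \<in> borel_measurable borel"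
  shows "face_integral K' K g = face_integral K K' g"
  using neighbours_normal[OF assms(1,2)] assms(3) by metis

text \<open>If the projection hit the intersection on more than a null set, some point of it would
  be interior relative to the hyperplane, and the intersection would have codimension one.\<close>

lemma face_int_non_neighbour:
  assumes K: "K \<in> T" "K' \<in> T" "K \<noteq> K'" and nb: "K' \<notin> neighbours T K"
    and s: "norm \<nu> = 1" "\<And>x. x \<in> K \<Longrightarrow> \<nu> \<bullet> x \<le> c" "\<And>x. x \<in> K' \<Longrightarrow> c \<le> \<nu> \<bullet> x"
  shows "face_int \<nu> c (K \<inter> K') g = 0"
proof -
  have H: "K \<inter> K' \<subseteq> {x. \<nu> \<bullet> x = c}" using s(2,3) by (force intro: order_antisym)
  have "\<nu> \<noteq> 0" using s by auto
  have "AE y in lborel. indicator (slab \<nu> c 1) y * (indicator (K \<inter> K') (hproj \<nu> c y) * g (hproj \<nu> c y)) = 0"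
    using hproj_interior[OF s(1) convex_Int[OF cell(2)[OF K(1)] cell(2)[OF K(2)]], of c]
  proof eventually_elim
    case (elim y)
    have "hproj \<nu> c y \<notin> K \<inter> K'"
    proof
      assume p: "hproj \<nu> c y \<in> K \<inter> K'"
      then obtain e where e: "e > 0" "\<forall>p. \<nu> \<bullet> p = c \<and> dist p (hproj \<nu> c y) < e \<longrightarrow> p \<in> K \<inter> K'" using elim by blast
      let ?D = "{x. \<nu> \<bullet> x = c} \<inter> ball (hproj \<nu> c y) e"
      have D: "?D \<subseteq> K \<inter> K'" using e by (auto simp: dist_commute)
      have "hproj \<nu> c y \<in> ?D" using e hproj_slab_map(5)[OF s(1)] by simp
      then have "aff_dim ?D = aff_dim {x. \<nu> \<bullet> x = c}"
        by (intro aff_dim_convex_Int_open convex_hyperplane open_ball) blast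
      also have "\<dots> = int DIM('a) - 1" using \<open>\<nu> \<noteq> 0\<close> by simp
      finally have "aff_dim (K \<inter> K') \<ge> int DIM('a) - 1" using aff_dim_subset[OF D] by simp
      moreover have "aff_dim (K \<inter> K') \<le> int DIM('a) - 1" using aff_dim_subset[OF H] \<open>\<nu> \<noteq> 0\<close> by simp
      ultimately show False using nb K unfolding neighbours_def by auto
    qed
    then show ?case by simp
  qed
  then show ?thesis unfolding face_int_def by (rule integral_eq_zero_AE)
qed

text \<open>Mass crosses the separating hyperplane only in the direction of the shift. Depending on
  the sign of \<open>a \<bullet> \<nu>\<close>, one of the two integrals is zero and
  \<open>face_limit\<close> evaluates the other; for a shift parallel to the hyperplane only points
  of the hyperplane itself contribute.\<close>

lemma exchange_limit:
  assumes K: "K \<in> T" "K' \<in> T" "K \<noteq> K'" and \<psi>: "continuous_on UNIV \<psi>"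
  shows "(\<lambda>n. real (Suc n) * ((\<integral>x. indicator K' x * indicator K (x - inverse (real (Suc n)) *\<^sub>R a) * \<psi> x \<partial>lborel)
       - (\<integral>x. indicator K x * indicator K' (x - inverse (real (Suc n)) *\<^sub>R a) * \<psi> x \<partial>lborel)))
    \<longlonglongrightarrow> (if K' \<in> neighbours T K then (a \<bullet> outward_normal K K') * face_integral K K' \<psi> else 0)"
proof -
  obtain \<nu> c where s: "norm \<nu> = 1" "\<And>x. x \<in> K \<Longrightarrow> \<nu> \<bullet> x \<le> c" "\<And>x. x \<in> K' \<Longrightarrow> c \<le> \<nu> \<bullet> x"
    using separation[OF K] by blast
  have s': "norm (- \<nu>) = 1" "\<And>x. x \<in> K' \<Longrightarrow> (- \<nu>) \<bullet> x \<le> - c" "\<And>x. x \<in> K \<Longrightarrow> - c \<le> (- \<nu>) \<bullet> x"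
    using s by auto
  have [measurable]: "K \<in> sets borel" "K' \<in> sets borel" "\<psi> \<in> borel_measurable borel"
    using cell K \<psi> by (auto intro: borel_measurable_continuous_onI)
  have m: "(\<lambda>x. indicator (K \<inter> K') x * \<psi> x) \<in> borel_measurable borel" by measurable
  have lim: "(if K' \<in> neighbours T K then (a \<bullet> outward_normal K K') * face_integral K K' \<psi> else 0)
     = (a \<bullet> \<nu>) * face_int \<nu> c (K \<inter> K') \<psi>"
  proof (cases "K' \<in> neighbours T K")
    case True
    then have dim: "aff_dim (K \<inter> K') = int DIM('a) - 1" unfolding neighbours_def by auto
    show ?thesis using True face_integral_eq_face_int[OF cell(6)[OF K(1)] s dim m] outward_normal_unique(1)[OF cell(6)[OF K(1)] s dim] by simp
  qed (simp add: face_int_non_neighbour[OF K _ s])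
  let ?t = "\<lambda>n. inverse (real (Suc n))"
  have t: "?t n > 0" for n by simp
  consider "a \<bullet> \<nu> > 0" | "a \<bullet> \<nu> = 0" | "a \<bullet> \<nu> < 0" by linarith
  then show ?thesis
  proof cases
    case 1
    have z: "(\<lambda>x. indicator K x * indicator K' (x - ?t n *\<^sub>R a) * \<psi> x) = (\<lambda>x. 0)" for n
    proof
      fix x
      have "\<not> (x \<in> K \<and> x - ?t n *\<^sub>R a \<in> K')"
        using s(2)[of x] s(3)[of "x - ?t n *\<^sub>R a"] mult_pos_pos[OF t[of n] 1] by (auto simp: inner_diff_right inner_commute)
      then show "indicator K x * indicator K' (x - ?t n *\<^sub>R a) * \<psi> x = 0" by (auto simp: indicator_def)
    qed
    show ?thesis unfolding lim z
      using face_limit[OF cell(3,2,6)[OF K(1)] cell(3,2,6)[OF K(2)] s 1 \<psi>] by simp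
  next
    case 2
    have z: "(\<integral>x. indicator K x * indicator K' (x - ?t n *\<^sub>R a) * \<psi> x \<partial>lborel) = 0"
      "(\<integral>x. indicator K' x * indicator K (x - ?t n *\<^sub>R a) * \<psi> x \<partial>lborel) = 0" for n
    proof -
      have "AE x in lborel. indicator K x * indicator K' (x - ?t n *\<^sub>R a) * \<psi> x = 0"
        using AE_not_hyperplane[OF s(1), of c]
      proof eventually_elim
        case (elim x)
        have "\<not> (x \<in> K \<and> x - ?t n *\<^sub>R a \<in> K')"
          using s(2)[of x] s(3)[of "x - ?t n *\<^sub>R a"] 2 elim by (auto simp: inner_diff_right inner_commute)
        then show ?case by (auto simp: indicator_def)
      qed
      then show "(\<integral>x. indicator K x * indicator K' (x - ?t n *\<^sub>R a) * \<psi> x \<partial>lborel) = 0" by (rule integral_eq_zero_AE)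
      have "AE x in lborel. indicator K' x * indicator K (x - ?t n *\<^sub>R a) * \<psi> x = 0"
        using AE_not_hyperplane[OF s(1), of c]
      proof eventually_elim
        case (elim x)
        have "\<not> (x \<in> K' \<and> x - ?t n *\<^sub>R a \<in> K)"
          using s(3)[of x] s(2)[of "x - ?t n *\<^sub>R a"] 2 elim by (auto simp: inner_diff_right inner_commute)
        then show ?case by (auto simp: indicator_def)
      qed
      then show "(\<integral>x. indicator K' x * indicator K (x - ?t n *\<^sub>R a) * \<psi> x \<partial>lborel) = 0" by (rule integral_eq_zero_AE)
    qed
    show ?thesis unfolding lim z using 2 by simp
  next
    case 3
    have z: "(\<lambda>x. indicator K' x * indicator K (x - ?t n *\<^sub>R a) * \<psi> x) = (\<lambda>x. 0)" for n
    proof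
      fix x
      have "\<not> (x \<in> K' \<and> x - ?t n *\<^sub>R a \<in> K)"
        using s(3)[of x] s(2)[of "x - ?t n *\<^sub>R a"] mult_pos_neg[OF t[of n] 3] by (auto simp: inner_diff_right inner_commute)
      then show "indicator K' x * indicator K (x - ?t n *\<^sub>R a) * \<psi> x = 0" by (auto simp: indicator_def)
    qed
    \<comment> \<open>The limit is applied with the cells exchanged; the minus sign of the
      difference and that of the reversed normal cancel.\<close>
    have "a \<bullet> (- \<nu>) > 0" using 3 by simp
    from tendsto_minus[OF face_limit[OF cell(3,2,6)[OF K(2)] cell(3,2,6)[OF K(1)] s' this \<psi>]]
    show ?thesis unfolding lim z Int_commute[of K' K] face_int_minus[OF s(1) m]
      by (simp only: Bochner_Integration.integral_zero diff_0 mult_minus_right inner_minus_right minus_minus mult_minus_left)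
  qed
qed

lemma cover_sum:
  assumes "x \<notin> skeleton" "x \<in> S" "bounded S"
  shows "(\<Sum>K\<in>near S. indicator K x) = (1::real)"
proof -
  have *: "indicator K x = (if K = cell_of x then 1 else 0 :: real)" if "K \<in> near S" for K
  proof (cases "x \<in> K")
    case True
    then have "cell_of x = K" using that cell_of_eq[OF assms(1)] unfolding near_def by blast
    then show ?thesis using True by simp
  next
    case False
    then have "K \<noteq> cell_of x" using cell_of(2)[of x] by metis
    then show ?thesis using False by simp
  qed
  have "cell_of x \<in> near S" using cell_of[of x] assms(2) unfolding near_def by blast
  moreover have "(\<Sum>K\<in>near S. indicator K x) = (\<Sum>K\<in>near S. if K = cell_of x then 1 else 0 :: real)"
    by (rule sum.cong[OF refl *])
  ultimately show ?thesis using near_finite[OF assms(3)] by simp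
qed

lemma AE_skeleton: "AE x in lborel. x \<notin> skeleton" "AE x in lborel. x - a \<notin> skeleton"
proof -
  have "skeleton \<in> null_sets lborel" using negligible_skeleton skeleton_borel
    by (simp add: negligible_iff_null_sets null_sets_completion_iff)
  then show "AE x in lborel. x \<notin> skeleton" by (rule AE_not_in)
  have "negligible ((+) a ` skeleton)" using negligible_skeleton by (rule negligible_translation)
  then have n: "negligible ((\<lambda>x. x - a) -` skeleton)"
    by (rule negligible_subset) (auto intro!: image_eqI[of _ "(+) a" "_ - a"])
  have "(\<lambda>x. x - a) \<in> borel_measurable borel" by measurable
  from measurable_sets[OF this skeleton_borel]
  have "(\<lambda>x. x - a) -` skeleton \<inter> space borel \<in> sets borel" .
  then have "(\<lambda>x. x - a) -` skeleton \<in> null_sets lborel" using n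
    by (simp add: negligible_iff_null_sets null_sets_completion_iff)
  then have "AE x in lborel. x \<notin> (\<lambda>x. x - a) -` skeleton" by (rule AE_not_in)
  then show "AE x in lborel. x - a \<notin> skeleton" by simp
qed

text \<open>The integral of the difference quotient of \<open>\<psi>\<close> over \<open>K\<close> is split according to the cell into which a point
  is translated: the points that stay in \<open>K\<close> cancel, and each neighbour contributes its face in the limit.\<close>

theorem divergence_theorem:
  assumes K: "K \<in> T" and D: "\<And>x. GDERIV \<psi> x :> G x" and G: "continuous_on UNIV G"
  shows "(LINT x:K|lebesgue. G x \<bullet> a) = (\<Sum>K'\<in>neighbours T K. (a \<bullet> outward_normal K K') * face_integral K K' \<psi>)"
proof -
  define t :: "nat \<Rightarrow> real" where "t n = inverse (real (Suc n))" for n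
  have t: "0 < t n" "t n \<le> 1" for n by (auto simp: t_def field_simps)
  have t0: "t \<longlonglongrightarrow> 0" unfolding t_def by (rule LIMSEQ_inverse_real_of_nat)
  have hd: "(\<psi> has_derivative (\<lambda>v. G x \<bullet> v)) (at x)" for x using D[of x] by (simp add: gderiv_def inner_commute)
  then have \<psi>: "continuous_on UNIV \<psi>"
    by (meson continuous_at_imp_continuous_on has_derivative_continuous)
  have Ga: "continuous_on UNIV (\<lambda>x. G x \<bullet> a)" using G by (intro continuous_intros)
  have [measurable]: "K \<in> sets borel" "\<psi> \<in> borel_measurable borel" "(\<lambda>x. G x \<bullet> a) \<in> borel_measurable borel"
    using cell K \<psi> Ga by (auto intro: borel_measurable_continuous_onI)
  \<comment> \<open>Contains every shift of \<open>K\<close> by a multiple of \<open>a\<close> with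
    factor at most one in absolute value, so only the finitely many cells meeting \<open>S\<close>
    take part.\<close>
  define S where "S = cball (centre K) (h + norm a)"
  have S: "bounded S" unfolding S_def by simp
  have KS: "K \<subseteq> cball (centre K) h" using cell_subset_cball[OF K centre_in[OF K]] .
  have shiftS: "x + r *\<^sub>R a \<in> S" if "x \<in> K" "\<bar>r\<bar> \<le> 1" for x r
  proof -
    have "dist (centre K) (x + r *\<^sub>R a) \<le> dist (centre K) x + norm (r *\<^sub>R a)"
      using dist_triangle[of "centre K" "x + r *\<^sub>R a" x] by (simp add: dist_norm)
    also have "\<dots> \<le> h + 1 * norm a" using KS that unfolding norm_scaleR
      by (intro add_mono mult_right_mono) auto
    finally show ?thesis by (simp add: S_def)
  qed
  have KinQ: "K \<in> near S" using K KS h_pos cell(7)[OF K] shiftS[of _ 0] unfolding near_def by fastforce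
  have bnd: "\<exists>B. \<forall>x\<in>S. \<bar>\<phi> x\<bar> \<le> B" if "continuous_on UNIV \<phi>" for \<phi> :: "'a \<Rightarrow> real"
  proof -
    have "bounded (\<phi> ` S)" using that unfolding S_def
      by (meson compact_cball compact_continuous_image compact_imp_bounded continuous_on_subset subset_UNIV)
    then show ?thesis unfolding bounded_iff by (auto simp: real_norm_def)
  qed
  obtain B where B: "\<And>x. x \<in> S \<Longrightarrow> \<bar>G x \<bullet> a\<bar> \<le> B" using bnd[OF Ga] by blast
  obtain B' where B': "\<And>x. x \<in> S \<Longrightarrow> \<bar>\<psi> x\<bar> \<le> B'" using bnd[OF \<psi>] by blast
  have intS: "integrable lborel (indicator S :: _ \<Rightarrow> real)"
    unfolding S_def using emeasure_lborel_cball_finite by (intro integrable_real_indicator) auto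
  have integ: "integrable lborel (\<lambda>x. \<phi> x * \<psi> x)"
    if [measurable]: "\<phi> \<in> borel_measurable borel" and "\<And>x. \<bar>\<phi> x\<bar> \<le> indicator S x" for \<phi>
  proof (rule Bochner_Integration.integrable_bound[of _ "\<lambda>x. B' * indicator S x"])
    show "AE x in lborel. norm (\<phi> x * \<psi> x) \<le> norm (B' * indicator S x)"
    proof (rule AE_I2)
      fix x show "norm (\<phi> x * \<psi> x) \<le> norm (B' * indicator S x)"
      proof (cases "x \<in> S")
        case True
        have "\<bar>\<phi> x\<bar> * \<bar>\<psi> x\<bar> \<le> 1 * B'" using that(2)[of x] B'[OF True] True by (intro mult_mono) auto
        then show ?thesis using True by (simp add: abs_mult)
      next
        case False
        then show ?thesis using that(2)[of x] by simp
      qed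
    qed
  qed (use intS in auto)
  define q where "q n x = (\<psi> (x + t n *\<^sub>R a) - \<psi> x) / t n" for n x
  have lim1: "(\<lambda>n. \<integral>x. indicator K x * q n x \<partial>lborel) \<longlonglongrightarrow> (\<integral>x. indicator K x * (G x \<bullet> a) \<partial>lborel)"
  proof (rule integral_dominated_convergence[where w="\<lambda>x. B * indicator S x"])
    show "integrable lborel (\<lambda>y. B * indicator S y)" using intS by simp
    show "(\<lambda>x. indicator K x * q n x) \<in> borel_measurable lborel" for n unfolding q_def by measurable
    show "(\<lambda>x. indicator K x * (G x \<bullet> a)) \<in> borel_measurable lborel" by measurable
    have "(\<lambda>n. q n x) \<longlonglongrightarrow> G x \<bullet> a" for x
    proof -
      have "((\<lambda>r. \<psi> (x + r *\<^sub>R a)) has_derivative (\<lambda>r. G (x + 0 *\<^sub>R a) \<bullet> (r *\<^sub>R a))) (at 0)"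
        by (rule has_derivative_compose[OF _ hd, of "\<lambda>r. x + r *\<^sub>R a"]) (auto intro!: derivative_eq_intros)
      then have "((\<lambda>r. \<psi> (x + r *\<^sub>R a)) has_field_derivative (G x \<bullet> a)) (at 0)"
        by (simp add: has_field_derivative_def mult_commute_abs)
      then have "((\<lambda>r. (\<psi> (x + r *\<^sub>R a) - \<psi> x) / r) \<longlongrightarrow> G x \<bullet> a) (at 0)"
        by (simp add: DERIV_def)
      moreover have "filterlim t (at 0) sequentially"
      proof -
        have "t n \<noteq> 0" for n using t(1)[of n] by simp
        then show ?thesis using t0 by (simp add: filterlim_at)
      qed
      ultimately show ?thesis unfolding q_def by (rule filterlim_compose)
    qed
    then show "AE x in lborel. (\<lambda>n. indicator K x * q n x) \<longlonglongrightarrow> indicator K x * (G x \<bullet> a)"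
      by (intro AE_I2 tendsto_mult_left)
    fix n
    have "\<bar>q n x\<bar> \<le> B" if x: "x \<in> K" for x
    proof -
      \<comment> \<open>The mean value theorem bounds the difference quotient by the directional
        derivative on \<open>S\<close>, which supplies the dominating function.\<close>
      have "\<exists>r\<in>{0<..<t n}. \<psi> (x + t n *\<^sub>R a) - \<psi> (x + 0 *\<^sub>R a) = (G (x + r *\<^sub>R a) \<bullet> ((t n - 0) *\<^sub>R a))"
      proof (rule mvt_simple[of 0 "t n" "\<lambda>r. \<psi> (x + r *\<^sub>R a)" "\<lambda>r s. G (x + r *\<^sub>R a) \<bullet> (s *\<^sub>R a)"])
        fix r :: real
        show "((\<lambda>r. \<psi> (x + r *\<^sub>R a)) has_derivative (\<lambda>s. G (x + r *\<^sub>R a) \<bullet> (s *\<^sub>R a))) (at r within {0..t n})"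
          by (rule has_derivative_at_withinI, rule has_derivative_compose[OF _ hd, of "\<lambda>r. x + r *\<^sub>R a"]) (auto intro!: derivative_eq_intros)
      qed (use t in auto)
      then obtain r where r: "0 < r" "r < t n" "\<psi> (x + t n *\<^sub>R a) - \<psi> x = t n * (G (x + r *\<^sub>R a) \<bullet> a)" by auto
      then have "q n x = G (x + r *\<^sub>R a) \<bullet> a" using t[of n] unfolding q_def by simp
      moreover have "x + r *\<^sub>R a \<in> S" using r t[of n] x by (intro shiftS) auto
      ultimately show ?thesis using B by simp
    qed
    moreover have "K \<subseteq> S" using shiftS[of _ 0] by auto
    moreover have "0 \<le> B" using B[of "centre K"] h_pos by (force simp: S_def intro: order_trans[OF abs_ge_zero])
    ultimately show "AE x in lborel. norm (indicator K x * q n x) \<le> B * indicator S x"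
      by (intro AE_I2) (auto simp: indicator_def)
  qed
  \<comment> \<open>The integral of \<open>\<psi>\<close> over the points of \<open>K1\<close> that
    the shift brings from \<open>K2\<close>.\<close>
  define A where "A n K1 K2 = (\<integral>x. indicator K1 x * indicator K2 (x - t n *\<^sub>R a) * \<psi> x \<partial>lborel)" for n K1 K2
  have intA: "integrable lborel (\<lambda>x. indicator K1 x * indicator K2 (x - t n *\<^sub>R a) * \<psi> x)"
    if "K1 \<in> T" "K2 \<in> T" "K1 = K \<or> K2 = K" for n K1 K2
  proof (rule integ)
    have [measurable]: "K1 \<in> sets borel" "K2 \<in> sets borel" using that cell by auto
    show "(\<lambda>x. indicator K1 x * indicator K2 (x - t n *\<^sub>R a) :: real) \<in> borel_measurable borel" by measurable
    fix x show "\<bar>indicator K1 x * indicator K2 (x - t n *\<^sub>R a)\<bar> \<le> (indicator S x :: real)"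
      using that(3) shiftS[of x 0] shiftS[of "x - t n *\<^sub>R a" "t n"] t[of n] by (auto simp: indicator_def)
  qed
  have nearT: "K' \<in> near S \<Longrightarrow> K' \<in> T" for K' unfolding near_def by blast
  \<comment> \<open>Translation invariance moves the shift from \<open>\<psi>\<close> to the
    indicator of \<open>K\<close>. The shifted integral is then split by the cell reached, the
    unshifted one by the cell of origin.\<close>
  have eq: "(\<integral>x. indicator K x * q n x \<partial>lborel) = (\<Sum>K'\<in>near S - {K}. real (Suc n) * (A n K' K - A n K K'))" for n
  proof -
    have i1: "integrable lborel (\<lambda>x. indicator K (x - t n *\<^sub>R a) * \<psi> x)"
    proof (rule integ, measurable)
      fix x show "\<bar>indicator K (x - t n *\<^sub>R a)\<bar> \<le> (indicator S x :: real)"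
        using shiftS[of "x - t n *\<^sub>R a" "t n"] t[of n] by (auto simp: indicator_def)
    qed
    have i2: "integrable lborel (\<lambda>x. indicator K x * \<psi> x)"
    proof (rule integ, measurable)
      fix x show "\<bar>indicator K x\<bar> \<le> (indicator S x :: real)"
        using shiftS[of x 0] by (auto simp: indicator_def)
    qed
    have e1: "(\<integral>x. indicator K x * \<psi> (x + t n *\<^sub>R a) \<partial>lborel) = (\<integral>x. indicator K (x - t n *\<^sub>R a) * \<psi> x \<partial>lborel)"
      using integral_lborel_shift[of "\<lambda>x. indicator K (x - t n *\<^sub>R a) * \<psi> x" "t n *\<^sub>R a"] by (simp add: add.commute)
    have i3: "integrable lborel (\<lambda>x. indicator K x * \<psi> (x + t n *\<^sub>R a))"
    proof -
      have "integrable (distr lborel borel ((+) (t n *\<^sub>R a))) (\<lambda>x. indicator K (x - t n *\<^sub>R a) * \<psi> x)"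
        using i1 by (simp add: lborel_distr_plus)
      then show ?thesis by (subst (asm) integrable_distr_eq) (auto simp: add.commute)
    qed
    have e2: "(\<integral>x. indicator K (x - t n *\<^sub>R a) * \<psi> x \<partial>lborel) = (\<Sum>K'\<in>near S. A n K' K)"
    proof -
      have "(\<Sum>K'\<in>near S. A n K' K) = (\<integral>x. (\<Sum>K'\<in>near S. indicator K' x * indicator K (x - t n *\<^sub>R a) * \<psi> x) \<partial>lborel)"
        unfolding A_def using intA nearT K by (intro Bochner_Integration.integral_sum[symmetric]) auto
      also have "\<dots> = (\<integral>x. indicator K (x - t n *\<^sub>R a) * \<psi> x \<partial>lborel)"
      proof (rule integral_cong_AE)
        have [measurable]: "K' \<in> near S \<Longrightarrow> K' \<in> sets borel" for K' using nearT cell by blast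
        show "(\<lambda>x. \<Sum>K'\<in>near S. indicator K' x * indicator K (x - t n *\<^sub>R a) * \<psi> x) \<in> borel_measurable lborel" by measurable
        show "AE x in lborel. (\<Sum>K'\<in>near S. indicator K' x * indicator K (x - t n *\<^sub>R a) * \<psi> x) = indicator K (x - t n *\<^sub>R a) * \<psi> x"
          using AE_skeleton(1)
        proof eventually_elim
          case (elim x)
          show ?case
          proof (cases "x - t n *\<^sub>R a \<in> K")
            case True
            then have "x \<in> S" using shiftS[OF True, of "t n"] t[of n] by simp
            from cover_sum[OF elim this S] show ?thesis by (simp add: sum_distrib_right[symmetric])
          qed simp
        qed
      qed measurable
      finally show ?thesis by simp
    qed
    have e3: "(\<integral>x. indicator K x * \<psi> x \<partial>lborel) = (\<Sum>K'\<in>near S. A n K K')"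
    proof -
      have "(\<Sum>K'\<in>near S. A n K K') = (\<integral>x. (\<Sum>K'\<in>near S. indicator K x * indicator K' (x - t n *\<^sub>R a) * \<psi> x) \<partial>lborel)"
        unfolding A_def using intA nearT K by (intro Bochner_Integration.integral_sum[symmetric]) auto
      also have "\<dots> = (\<integral>x. indicator K x * \<psi> x \<partial>lborel)"
      proof (rule integral_cong_AE)
        have [measurable]: "K' \<in> near S \<Longrightarrow> K' \<in> sets borel" for K' using nearT cell by blast
        show "(\<lambda>x. \<Sum>K'\<in>near S. indicator K x * indicator K' (x - t n *\<^sub>R a) * \<psi> x) \<in> borel_measurable lborel" by measurable
        show "AE x in lborel. (\<Sum>K'\<in>near S. indicator K x * indicator K' (x - t n *\<^sub>R a) * \<psi> x) = indicator K x * \<psi> x"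
          using AE_skeleton(2)[of "t n *\<^sub>R a"]
        proof eventually_elim
          case (elim x)
          show ?case
          proof (cases "x \<in> K")
            case True
            then have "x - t n *\<^sub>R a \<in> S" using shiftS[OF True, of "- t n"] t[of n] by simp
            from cover_sum[OF elim this S] show ?thesis
              by (simp add: sum_distrib_right[symmetric] sum_distrib_left[symmetric])
          qed simp
        qed
      qed measurable
      finally show ?thesis by simp
    qed
    have "(\<integral>x. indicator K x * q n x \<partial>lborel) = (\<integral>x. real (Suc n) * (indicator K x * \<psi> (x + t n *\<^sub>R a) - indicator K x * \<psi> x) \<partial>lborel)"
      by (rule Bochner_Integration.integral_cong) (auto simp: q_def t_def field_simps)
    also have "\<dots> = real (Suc n) * ((\<Sum>K'\<in>near S. A n K' K) - (\<Sum>K'\<in>near S. A n K K'))"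
      using i2 i3 by (simp add: e1 e2 e3[symmetric])
    also have "\<dots> = (\<Sum>K'\<in>near S. real (Suc n) * (A n K' K - A n K K'))"
      by (simp only: sum_subtractf sum_distrib_left right_diff_distrib)
    also have "\<dots> = (\<Sum>K'\<in>near S - {K}. real (Suc n) * (A n K' K - A n K K'))"
      using near_finite[OF S] KinQ by (simp add: sum.remove)
    finally show ?thesis .
  qed
  have "(\<lambda>n. \<Sum>K'\<in>near S - {K}. real (Suc n) * (A n K' K - A n K K')) \<longlonglongrightarrow>
    (\<Sum>K'\<in>near S - {K}. if K' \<in> neighbours T K then (a \<bullet> outward_normal K K') * face_integral K K' \<psi> else 0)"
    unfolding A_def t_def
  proof (rule tendsto_sum)
    fix K' assume "K' \<in> near S - {K}"
    then show "(\<lambda>n. real (Suc n) * ((\<integral>x. indicator K' x * indicator K (x - inverse (real (Suc n)) *\<^sub>R a) * \<psi> x \<partial>lborel)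
       - (\<integral>x. indicator K x * indicator K' (x - inverse (real (Suc n)) *\<^sub>R a) * \<psi> x \<partial>lborel)))
      \<longlonglongrightarrow> (if K' \<in> neighbours T K then (a \<bullet> outward_normal K K') * face_integral K K' \<psi> else 0)"
      using nearT by (intro exchange_limit[OF K _ _ \<psi>]) auto
  qed
  then have "(\<integral>x. indicator K x * (G x \<bullet> a) \<partial>lborel) =
    (\<Sum>K'\<in>near S - {K}. if K' \<in> neighbours T K then (a \<bullet> outward_normal K K') * face_integral K K' \<psi> else 0)"
    using lim1 LIMSEQ_unique unfolding eq by blast
  also have "\<dots> = (\<Sum>K'\<in>neighbours T K. (a \<bullet> outward_normal K K') * face_integral K K' \<psi>)"
  proof (rule sum.mono_neutral_cong_right)
    show "finite (near S - {K})" using near_finite[OF S] by simp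
    show "neighbours T K \<subseteq> near S - {K}"
    proof
      fix K' assume K': "K' \<in> neighbours T K"
      then obtain y where "y \<in> K" "y \<in> K'" using neighbours_meet by blast
      then show "K' \<in> near S - {K}" using K' shiftS[of y 0] unfolding neighbours_def near_def by auto
    qed
  qed auto
  finally show ?thesis by (subst set_integral_lborel) auto
qed

end

section \<open>Polynomial spaces and inverse estimates\<close>

definition monomial :: "('a::euclidean_space \<Rightarrow> nat) \<Rightarrow> 'a \<Rightarrow> real" where
  "monomial \<alpha> x = (\<Prod>i\<in>Basis. (x \<bullet> i) ^ \<alpha> i)"

lemma finite_multi_indices [simp]: "finite (multi_indices l :: ('a::euclidean_space \<Rightarrow> nat) set)"
proof -
  have "multi_indices l \<subseteq> ((Basis::'a set) \<rightarrow>\<^sub>E {..l})"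
  proof
    fix \<alpha> :: "'a \<Rightarrow> nat" assume "\<alpha> \<in> multi_indices l"
    then have \<alpha>: "\<alpha> \<in> Basis \<rightarrow>\<^sub>E UNIV" "(\<Sum>i\<in>Basis. \<alpha> i) \<le> l" unfolding multi_indices_def by auto
    have "\<alpha> i \<le> l" if "i \<in> Basis" for i using member_le_sum[of i Basis \<alpha>] \<alpha>(2) that by force
    then show "\<alpha> \<in> Basis \<rightarrow>\<^sub>E {..l}" using \<alpha>(1) by (auto simp: PiE_def)
  qed
  then show ?thesis by (rule finite_subset) (auto intro!: finite_PiE)
qed

lemma poly_space_iff: "p \<in> poly_space l \<longleftrightarrow> (\<exists>c. p = (\<lambda>x. \<Sum>\<alpha>\<in>multi_indices l. c \<alpha> * monomial \<alpha> x))"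
  unfolding poly_space_def monomial_def by auto

lemma monomial_in_poly_space: assumes "\<alpha> \<in> multi_indices l" shows "monomial \<alpha> \<in> poly_space l"
  unfolding poly_space_iff
proof (intro exI ext)
  fix x show "monomial \<alpha> x = (\<Sum>\<beta>\<in>multi_indices l. (if \<beta> = \<alpha> then 1 else 0) * monomial \<beta> x)"
    using assms by (simp add: if_distrib[of "\<lambda>u. u * _"] cong: if_cong)
qed

lemma poly_space_add: assumes "p \<in> poly_space l" "q \<in> poly_space l" shows "(\<lambda>x. p x + q x) \<in> poly_space l"
proof -
  obtain c c' where "p = (\<lambda>x. \<Sum>\<alpha>\<in>multi_indices l. c \<alpha> * monomial \<alpha> x)" "q = (\<lambda>x. \<Sum>\<alpha>\<in>multi_indices l. c' \<alpha> * monomial \<alpha> x)"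
    using assms unfolding poly_space_iff by blast
  then have "(\<lambda>x. p x + q x) = (\<lambda>x. \<Sum>\<alpha>\<in>multi_indices l. (c \<alpha> + c' \<alpha>) * monomial \<alpha> x)"
    by (simp add: distrib_right sum.distrib)
  then show ?thesis unfolding poly_space_iff by (rule exI[of _ "\<lambda>\<alpha>. c \<alpha> + c' \<alpha>"])
qed

lemma poly_space_cmult: assumes "p \<in> poly_space l" shows "(\<lambda>x. r * p x) \<in> poly_space l"
proof -
  obtain c where "p = (\<lambda>x. \<Sum>\<alpha>\<in>multi_indices l. c \<alpha> * monomial \<alpha> x)"
    using assms unfolding poly_space_iff by blast
  then have "(\<lambda>x. r * p x) = (\<lambda>x. \<Sum>\<alpha>\<in>multi_indices l. (r * c \<alpha>) * monomial \<alpha> x)"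
    by (simp add: sum_distrib_left mult.assoc)
  then show ?thesis unfolding poly_space_iff by (rule exI[of _ "\<lambda>\<alpha>. r * c \<alpha>"])
qed

lemma poly_space_zero: "(\<lambda>x. 0) \<in> poly_space l"
  unfolding poly_space_iff by (rule exI[of _ "\<lambda>\<alpha>. 0"]) simp

lemma poly_space_sum: "(\<And>i. i \<in> I \<Longrightarrow> p i \<in> poly_space l) \<Longrightarrow> (\<lambda>x. \<Sum>i\<in>I. p i x) \<in> poly_space l"
  by (induction I rule: infinite_finite_induct) (auto simp: poly_space_zero poly_space_add)

lemma poly_space_diff: assumes "p \<in> poly_space l" "q \<in> poly_space l" shows "(\<lambda>x. p x - q x) \<in> poly_space l"
  using poly_space_add[OF assms(1) poly_space_cmult[OF assms(2), of "-1"]] by simp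

lemma poly_space_mono: assumes "p \<in> poly_space l" "l \<le> m" shows "p \<in> poly_space m"
proof -
  obtain c where p: "p = (\<lambda>x. \<Sum>\<alpha>\<in>multi_indices l. c \<alpha> * monomial \<alpha> x)"
    using assms unfolding poly_space_iff by blast
  have "multi_indices l \<subseteq> (multi_indices m :: ('a \<Rightarrow> nat) set)" using assms(2) unfolding multi_indices_def by auto
  then show ?thesis unfolding p
    by (intro poly_space_sum poly_space_cmult monomial_in_poly_space) auto
qed

lemma poly_space_const: "(\<lambda>x::'a::euclidean_space. r) \<in> poly_space l"
proof -
  have "(\<lambda>i::'a\<in>Basis. 0) \<in> multi_indices l" unfolding multi_indices_def by simp
  then have "(\<lambda>x::'a. r * monomial (\<lambda>i\<in>Basis. 0) x) \<in> poly_space l" by (intro poly_space_cmult monomial_in_poly_space)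
  moreover have "monomial (\<lambda>i\<in>Basis. 0) x = 1" for x :: 'a by (simp add: monomial_def cong: prod.cong)
  ultimately show ?thesis by simp
qed

lemma poly_space_coord: assumes i: "i \<in> Basis" shows "(\<lambda>x. x \<bullet> i) \<in> poly_space 1"
proof -
  have "(\<lambda>j\<in>Basis. if j = i then 1 else 0) \<in> multi_indices 1" using i unfolding multi_indices_def by simp
  then have "monomial (\<lambda>j\<in>Basis. if j = i then 1 else 0) \<in> poly_space 1" by (rule monomial_in_poly_space)
  moreover have "monomial (\<lambda>j\<in>Basis. if j = i then 1 else 0) = (\<lambda>x. x \<bullet> i)"
  proof
    fix x :: 'a
    have "monomial (\<lambda>j\<in>Basis. if j = i then 1 else 0) x = (\<Prod>j\<in>Basis. if j = i then x \<bullet> i else 1)"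
      unfolding monomial_def by (rule prod.cong) auto
    then show "monomial (\<lambda>j\<in>Basis. if j = i then 1 else 0) x = x \<bullet> i" using i by simp
  qed
  ultimately show ?thesis by simp
qed

lemma poly_space_mult:
  assumes "p \<in> poly_space l" "q \<in> poly_space m" shows "(\<lambda>x. p x * q x) \<in> poly_space (l + m)"
proof -
  obtain c c' where p: "p = (\<lambda>x. \<Sum>\<alpha>\<in>multi_indices l. c \<alpha> * monomial \<alpha> x)" and q: "q = (\<lambda>x. \<Sum>\<alpha>\<in>multi_indices m. c' \<alpha> * monomial \<alpha> x)"
    using assms unfolding poly_space_iff by blast
  have eq: "p x * q x = (\<Sum>\<alpha>\<in>multi_indices l. \<Sum>\<beta>\<in>multi_indices m. (c \<alpha> * c' \<beta>) * monomial (\<lambda>i\<in>Basis. \<alpha> i + \<beta> i) x)" for x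
    unfolding p q sum_product
    by (intro sum.cong refl) (simp add: monomial_def power_add prod.distrib)
  have "(\<lambda>i\<in>Basis. \<alpha> i + \<beta> i) \<in> multi_indices (l + m)" if "\<alpha> \<in> multi_indices l" "\<beta> \<in> multi_indices m" for \<alpha> \<beta> :: "'a \<Rightarrow> nat"
    using that unfolding multi_indices_def by (auto simp: sum.distrib)
  then show ?thesis unfolding eq
    by (intro poly_space_sum poly_space_cmult monomial_in_poly_space) auto
qed

lemma poly_space_power: assumes "p \<in> poly_space l" shows "(\<lambda>x. p x ^ n) \<in> poly_space (n * l)"
proof (induction n)
  case (Suc n)
  from poly_space_mult[OF assms Suc] show ?case by simp
qed (simp add: poly_space_const)

lemma poly_space_prod:
  assumes "finite I" "\<And>i. i \<in> I \<Longrightarrow> p i \<in> poly_space (n i)" shows "(\<lambda>x. \<Prod>i\<in>I. p i x) \<in> poly_space (\<Sum>i\<in>I. n i)"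
  using assms by (induction I rule: finite_induct) (auto simp: poly_space_const intro: poly_space_mult)

text \<open>Invariance under dilations and translations allows one reference ball to stand for every
  cell.\<close>

lemma poly_space_affine:
  assumes "p \<in> poly_space l" shows "(\<lambda>x. p (z + r *\<^sub>R x)) \<in> poly_space l"
proof -
  obtain c where p: "p = (\<lambda>x. \<Sum>\<alpha>\<in>multi_indices l. c \<alpha> * monomial \<alpha> x)"
    using assms unfolding poly_space_iff by blast
  have "(\<lambda>x. monomial \<alpha> (z + r *\<^sub>R x)) \<in> poly_space l" if "\<alpha> \<in> multi_indices l" for \<alpha>
  proof -
    have "(\<lambda>x. z \<bullet> i + r * (x \<bullet> i)) \<in> poly_space 1" if "i \<in> Basis" for i
      using that by (intro poly_space_add poly_space_const poly_space_cmult poly_space_coord)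
    then have "(\<lambda>x. (z \<bullet> i + r * (x \<bullet> i)) ^ \<alpha> i) \<in> poly_space (\<alpha> i)" if "i \<in> Basis" for i
      using poly_space_power[of "\<lambda>x. z \<bullet> i + r * (x \<bullet> i)" 1 "\<alpha> i"] that by simp
    then have "(\<lambda>x. \<Prod>i\<in>Basis. (z \<bullet> i + r * (x \<bullet> i)) ^ \<alpha> i) \<in> poly_space (\<Sum>i\<in>Basis. \<alpha> i)"
      by (intro poly_space_prod) auto
    then have "(\<lambda>x. monomial \<alpha> (z + r *\<^sub>R x)) \<in> poly_space (\<Sum>i\<in>Basis. \<alpha> i)" unfolding monomial_def by (simp add: inner_add_left)
    then show ?thesis using that by (auto intro: poly_space_mono simp: multi_indices_def)
  qed
  then show ?thesis unfolding p by (intro poly_space_sum poly_space_cmult) auto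
qed

text \<open>Polynomials arise from constants and coordinates by sums and products; the rule forgets
  the degree and serves properties that do not depend on it.\<close>

lemma poly_space_induct:
  assumes "p \<in> poly_space l"
    and const: "\<And>r. P (\<lambda>x. r)" and coord: "\<And>i. i \<in> Basis \<Longrightarrow> P (\<lambda>x. x \<bullet> i)"
    and add: "\<And>p q. P p \<Longrightarrow> P q \<Longrightarrow> P (\<lambda>x. p x + q x)" and mult: "\<And>p q. P p \<Longrightarrow> P q \<Longrightarrow> P (\<lambda>x. p x * q x)"
  shows "P p"
proof -
  obtain c where p: "p = (\<lambda>x. \<Sum>\<alpha>\<in>multi_indices l. c \<alpha> * monomial \<alpha> x)"
    using assms unfolding poly_space_iff by blast
  have pow: "P (\<lambda>x. (x \<bullet> i) ^ n)" if "i \<in> Basis" for i n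
  proof (induction n)
    case (Suc n)
    from mult[OF coord[OF that] Suc] show ?case by simp
  qed (simp add: const)
  have "P (\<lambda>x. \<Prod>i\<in>I. (x \<bullet> i) ^ \<alpha> i)" if "I \<subseteq> Basis" for I \<alpha>
    using finite_subset[OF that finite_Basis] that by (induction I rule: finite_induct) (auto intro: const mult pow)
  then have m: "P (monomial \<alpha>)" for \<alpha> by (simp add: monomial_def[abs_def])
  have "P (\<lambda>x. \<Sum>\<alpha>\<in>I. c \<alpha> * monomial \<alpha> x)" if "finite I" for I
    using that
  proof (induction I rule: finite_induct)
    case (insert \<alpha> I)
    from add[OF mult[OF const[of "c \<alpha>"] m[of \<alpha>]] insert.IH] show ?case using insert by simp
  qed (simp add: const)
  then show ?thesis unfolding p by simp
qed

section \<open>Gradients of continuously differentiable functions\<close>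

definition C1 :: "('a::euclidean_space \<Rightarrow> real) \<Rightarrow> bool" where
  "C1 p \<longleftrightarrow> (\<forall>x. GDERIV p x :> grad p x) \<and> continuous_on UNIV (grad p)"

lemma grad_eq: assumes "GDERIV p x :> D" shows "grad p x = D"
  unfolding grad_def
proof (rule the_equality, rule assms)
  fix D' assume "GDERIV p x :> D'"
  then have "(\<lambda>v. v \<bullet> D') = (\<lambda>v. v \<bullet> D)" using assms has_derivative_unique unfolding gderiv_def by blast
  from fun_cong[OF this, of "D' - D"] have "(D' - D) \<bullet> (D' - D) = 0" by (simp add: inner_diff_right)
  then show "D' = D" by simp
qed

lemma C1I: assumes "\<And>x. GDERIV p x :> G x" "continuous_on UNIV G" shows "C1 p" "grad p = G"
proof -
  show "grad p = G" by (rule ext) (rule grad_eq[OF assms(1)])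
  then show "C1 p" using assms by (simp add: C1_def)
qed

lemma C1_continuous: "C1 p \<Longrightarrow> continuous_on S p"
  unfolding C1_def gderiv_def by (meson continuous_at_imp_continuous_on has_derivative_continuous)

lemma C1_const: "C1 (\<lambda>x. r)" "grad (\<lambda>x. r) = (\<lambda>x. 0)"
  by (rule C1I, auto intro: GDERIV_const)+

lemma C1_coord: "C1 (\<lambda>x. x \<bullet> i)"
  by (rule C1I[of _ "\<lambda>x. i"]) (auto simp: gderiv_def intro!: derivative_eq_intros)

lemma C1_add: assumes "C1 p" "C1 q" shows "C1 (\<lambda>x. p x + q x)" "grad (\<lambda>x. p x + q x) = (\<lambda>x. grad p x + grad q x)"
  by (rule C1I, use assms in \<open>auto simp: C1_def intro!: GDERIV_add continuous_intros\<close>)+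

lemma C1_mult: assumes "C1 p" "C1 q" shows "C1 (\<lambda>x. p x * q x)" "grad (\<lambda>x. p x * q x) = (\<lambda>x. p x *\<^sub>R grad q x + q x *\<^sub>R grad p x)"
proof -
  have 1: "GDERIV (\<lambda>x. p x * q x) x :> p x *\<^sub>R grad q x + q x *\<^sub>R grad p x" for x
    using assms unfolding C1_def by (auto intro: GDERIV_mult)
  have 2: "continuous_on UNIV (\<lambda>x. p x *\<^sub>R grad q x + q x *\<^sub>R grad p x)"
    using assms C1_continuous[OF assms(1)] C1_continuous[OF assms(2)] unfolding C1_def by (intro continuous_intros) auto
  show "C1 (\<lambda>x. p x * q x)" "grad (\<lambda>x. p x * q x) = (\<lambda>x. p x *\<^sub>R grad q x + q x *\<^sub>R grad p x)"
    using C1I[OF 1 2] by auto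
qed

lemma C1_cmult: assumes "C1 p" shows "C1 (\<lambda>x. r * p x)" "grad (\<lambda>x. r * p x) = (\<lambda>x. r *\<^sub>R grad p x)"
  using C1_mult[OF C1_const(1)[of r] assms] unfolding C1_const(2) by simp_all

lemma C1_sum: assumes "finite I" "\<And>i. i \<in> I \<Longrightarrow> C1 (p i)"
  shows "C1 (\<lambda>x. \<Sum>i\<in>I. p i x) \<and> grad (\<lambda>x. \<Sum>i\<in>I. p i x) = (\<lambda>x. \<Sum>i\<in>I. grad (p i) x)"
  using assms by (induction I rule: finite_induct) (auto simp: C1_const C1_add)

lemma C1_affine: assumes "C1 p" shows "C1 (\<lambda>x. p (z + r *\<^sub>R x))" "grad (\<lambda>x. p (z + r *\<^sub>R x)) = (\<lambda>x. r *\<^sub>R grad p (z + r *\<^sub>R x))"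
proof -
  have 1: "GDERIV (\<lambda>x. p (z + r *\<^sub>R x)) x :> r *\<^sub>R grad p (z + r *\<^sub>R x)" for x
  proof -
    have "(p has_derivative (\<lambda>v. v \<bullet> grad p (z + r *\<^sub>R x))) (at (z + r *\<^sub>R x))"
      using assms by (simp add: C1_def gderiv_def)
    moreover have "((\<lambda>x. z + r *\<^sub>R x) has_derivative (\<lambda>v. r *\<^sub>R v)) (at x)" by (auto intro!: derivative_eq_intros)
    ultimately have "((\<lambda>x. p (z + r *\<^sub>R x)) has_derivative (\<lambda>v. (r *\<^sub>R v) \<bullet> grad p (z + r *\<^sub>R x))) (at x)"
      by (rule has_derivative_compose[rotated])
    then show ?thesis by (simp add: gderiv_def)
  qed
  have 2: "continuous_on UNIV (\<lambda>x. r *\<^sub>R grad p (z + r *\<^sub>R x))"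
    by (rule continuous_on_scaleR, simp, rule continuous_on_compose2[of UNIV "grad p"])
      (use assms in \<open>auto simp: C1_def intro!: continuous_intros\<close>)
  show "C1 (\<lambda>x. p (z + r *\<^sub>R x))" "grad (\<lambda>x. p (z + r *\<^sub>R x)) = (\<lambda>x. r *\<^sub>R grad p (z + r *\<^sub>R x))"
    using C1I[OF 1 2] by auto
qed

lemma poly_space_C1: "p \<in> poly_space l \<Longrightarrow> C1 p"
  by (erule poly_space_induct) (auto intro: C1_const C1_coord C1_add C1_mult)

lemma poly_space_continuous: "p \<in> poly_space l \<Longrightarrow> continuous_on S p"
  using poly_space_C1 C1_continuous by blast

lemma poly_space_measurable: "p \<in> poly_space l \<Longrightarrow> p \<in> borel_measurable borel"
  by (intro borel_measurable_continuous_onI poly_space_continuous)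

lemma poly_space_line: "p \<in> poly_space l \<Longrightarrow> \<exists>q. \<forall>t. p (z + t *\<^sub>R y) = poly q t"
proof (erule poly_space_induct)
  show "\<exists>q. \<forall>t. r = poly q t" for r :: real by (rule exI[of _ "[:r:]"]) simp
  show "\<exists>q. \<forall>t. (z + t *\<^sub>R y) \<bullet> i = poly q t" for i by (rule exI[of _ "[:z \<bullet> i, y \<bullet> i:]"]) (simp add: inner_add_left)
  show "\<exists>q. \<forall>t. p1 (z + t *\<^sub>R y) + p2 (z + t *\<^sub>R y) = poly q t"
    if "\<exists>q. \<forall>t. p1 (z + t *\<^sub>R y) = poly q t" "\<exists>q. \<forall>t. p2 (z + t *\<^sub>R y) = poly q t" for p1 p2
    using that by (metis poly_add)
  show "\<exists>q. \<forall>t. p1 (z + t *\<^sub>R y) * p2 (z + t *\<^sub>R y) = poly q t"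
    if "\<exists>q. \<forall>t. p1 (z + t *\<^sub>R y) = poly q t" "\<exists>q. \<forall>t. p2 (z + t *\<^sub>R y) = poly q t" for p1 p2
    using that by (metis poly_mult)
qed

text \<open>On the line from a point of \<open>S\<close> through \<open>x\<close> the polynomial is
  univariate and has a whole interval of zeros near that point.\<close>

lemma poly_space_eq_0:
  assumes p: "p \<in> poly_space l" and S: "open S" "S \<noteq> {}" "\<And>x. x \<in> S \<Longrightarrow> p x = 0"
  shows "p x = 0"
proof -
  obtain z where z: "z \<in> S" using S by blast
  then obtain e where e: "e > 0" "ball z e \<subseteq> S" using S(1) openE by blast
  obtain q where q: "\<And>t. p (z + t *\<^sub>R (x - z)) = poly q t" using poly_space_line[OF p] by blast
  \<comment> \<open>Parameters below \<open>d\<close> stay in the ball; the added one keeps the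
    denominator positive when \<open>x = z\<close>.\<close>
  define d where "d = e / (norm (x - z) + 1)"
  have d: "d > 0" using e by (simp add: d_def add_nonneg_pos)
  have "poly q t = 0" if t: "t \<in> {0<..<d}" for t
  proof -
    have "t * norm (x - z) \<le> t * (norm (x - z) + 1)" using t by simp
    also have "\<dots> < e" using t by (simp add: d_def pos_less_divide_eq add_nonneg_pos)
    finally have "z + t *\<^sub>R (x - z) \<in> ball z e" using t by (simp add: dist_norm)
    then show ?thesis using e S(3) q[of t] by auto
  qed
  then have "{0<..<d} \<subseteq> {t. poly q t = 0}" by blast
  moreover have "infinite {0<..<d}" using d by simp
  ultimately have "q = 0" using poly_roots_finite[of q] finite_subset by blast
  then show ?thesis using q[of 1] by simp
qed

section \<open>The inner product on a cell and orthonormal bases\<close>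

definition ip :: "'a::euclidean_space set \<Rightarrow> ('a \<Rightarrow> real) \<Rightarrow> ('a \<Rightarrow> real) \<Rightarrow> real" where
  "ip K p q = (\<integral>x. indicator K x * (p x * q x) \<partial>lborel)"

lemma integrable_on_compact:
  fixes f :: "'a::euclidean_space \<Rightarrow> real"
  assumes "compact K" "continuous_on K f" shows "integrable lborel (\<lambda>x. indicator K x * f x)"
  using borel_integrable_compact[OF assms] by simp

lemma integrable_ip:
  assumes "compact K" "p \<in> poly_space l" "q \<in> poly_space m"
  shows "integrable lborel (\<lambda>x. indicator K x * (p x * q x))"
  using assms by (intro integrable_on_compact continuous_intros poly_space_continuous)

lemma ip_commute: "ip K p q = ip K q p"
  unfolding ip_def by (simp add: mult.commute)

lemma ip_cmult: "ip K (\<lambda>x. r * p x) q = r * ip K p q"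
proof -
  have "ip K (\<lambda>x. r * p x) q = (\<integral>x. r * (indicator K x * (p x * q x)) \<partial>lborel)"
    unfolding ip_def by (rule Bochner_Integration.integral_cong) auto
  then show ?thesis by (simp add: ip_def)
qed

lemma ip_add:
  assumes "compact K" "p \<in> poly_space l" "p' \<in> poly_space l'" "q \<in> poly_space m"
  shows "ip K (\<lambda>x. p x + p' x) q = ip K p q + ip K p' q"
  using integrable_ip[OF assms(1,2,4)] integrable_ip[OF assms(1,3,4)]
  unfolding ip_def by (simp add: distrib_right distrib_left)

lemma ip_diff:
  assumes "compact K" "p \<in> poly_space l" "p' \<in> poly_space l'" "q \<in> poly_space m"
  shows "ip K (\<lambda>x. p x - p' x) q = ip K p q - ip K p' q"
  using integrable_ip[OF assms(1,2,4)] integrable_ip[OF assms(1,3,4)]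
  unfolding ip_def by (simp add: left_diff_distrib right_diff_distrib)

lemma ip_zero: "ip K (\<lambda>x. 0) q = 0" unfolding ip_def by simp

lemma ip_sum:
  assumes "compact K" "finite I" "\<And>i. i \<in> I \<Longrightarrow> p i \<in> poly_space l" "q \<in> poly_space m"
  shows "ip K (\<lambda>x. \<Sum>i\<in>I. c i * p i x) q = (\<Sum>i\<in>I. c i * ip K (p i) q)"
  using assms(2,3)
proof (induction I rule: finite_induct)
  case (insert i I)
  have "ip K (\<lambda>x. c i * p i x + (\<Sum>j\<in>I. c j * p j x)) q = ip K (\<lambda>x. c i * p i x) q + ip K (\<lambda>x. \<Sum>j\<in>I. c j * p j x) q"
    using insert assms by (intro ip_add[of _ _ l _ l] poly_space_cmult poly_space_sum) auto
  then show ?case using insert by (simp add: ip_cmult)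
qed (simp add: ip_zero)

lemma continuous_zero_if_AE_zero:
  fixes p :: "'a::euclidean_space \<Rightarrow> real"
  assumes "AE x in lborel. x \<in> S \<longrightarrow> p x = 0" "open S" "continuous_on S p" "x \<in> S"
  shows "p x = 0"
proof (rule ccontr)
  assume x: "p x \<noteq> 0"
  let ?U = "S \<inter> p -` (- {0})"
  have "open ?U" using assms(2,3) by (auto intro: continuous_open_preimage)
  moreover have "?U \<noteq> {}" using x assms by auto
  moreover have "negligible ?U"
  proof -
    have "AE x in lborel. x \<notin> ?U" using assms(1) by eventually_elim auto
    then have "?U \<in> null_sets lborel" using \<open>open ?U\<close> by (subst AE_iff_null_sets) auto
    then show ?thesis by (simp add: negligible_iff_null_sets null_sets_completionI)
  qed
  ultimately show False using open_not_negligible by blast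
qed

text \<open>Definiteness comes from the interior: a continuous function that vanishes almost
  everywhere there is zero there, and for polynomials this extends to all points.\<close>

lemma ip_eq_0:
  assumes K: "compact K" "interior K \<noteq> {}" and p: "p \<in> poly_space l" and "ip K p p = 0"
  shows "p x = 0"
proof (rule poly_space_eq_0[OF p, of "interior K"])
  have "AE x in lborel. indicator K x * (p x * p x) = 0"
    using assms(4) integrable_ip[OF K(1) p p] unfolding ip_def
    by (subst (asm) integral_nonneg_eq_0_iff_AE) auto
  then have "AE x in lborel. x \<in> interior K \<longrightarrow> p x = 0"
    by eventually_elim (use interior_subset[of K] in auto)
  then show "p x = 0" if "x \<in> interior K" for x
    using continuous_zero_if_AE_zero[OF _ open_interior poly_space_continuous[OF p] that] by blast
qed (use K in auto)

text \<open>Gram-Schmidt over the finite set \<open>J\<close>. The residual \<open>r\<close> of a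
  new element is either zero, and nothing is added, or it is normalised and joins the family. The
  last clause is the invariant: every element treated so far is reproduced by its
  coefficients.\<close>

lemma orthonormal_extension:
  assumes K: "compact K" "interior K \<noteq> {}" and J: "finite J" "J \<subseteq> poly_space l"
  shows "\<exists>E. finite E \<and> E \<subseteq> poly_space l \<and> (\<forall>e\<in>E. \<forall>e'\<in>E. ip K e e' = (if e = e' then 1 else 0)) \<and>
    (\<forall>p\<in>J. \<forall>x. p x = (\<Sum>e\<in>E. ip K p e * e x))"
  using J
proof (induction J rule: finite_induct)
  case empty
  show ?case by (intro exI[of _ "{}"]) simp
next
  case (insert p J)
  then have "J \<subseteq> poly_space l" by simp
  from insert.IH[OF this] obtain E where E': "finite E \<and> E \<subseteq> poly_space l \<and> (\<forall>e\<in>E. \<forall>e'\<in>E. ip K e e' = (if e = e' then 1 else 0)) \<and>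
    (\<forall>p\<in>J. \<forall>x. p x = (\<Sum>e\<in>E. ip K p e * e x))" by (elim exE) (rule that)
  then have E: "finite E" "E \<subseteq> poly_space l" "\<And>e e'. e \<in> E \<Longrightarrow> e' \<in> E \<Longrightarrow> ip K e e' = (if e = e' then 1 else 0)"
    by simp_all
  have EJ: "p x = (\<Sum>e\<in>E. ip K p e * e x)" if "p \<in> J" for p x
    using E'[THEN conjunct2, THEN conjunct2, THEN conjunct2, THEN bspec, OF that] by (rule spec)
  have p: "p \<in> poly_space l" using insert by simp
  define r where "r x = p x - (\<Sum>e\<in>E. ip K p e * e x)" for x
  have sum: "(\<lambda>x. \<Sum>e\<in>E. ip K p e * e x) \<in> poly_space l" using E by (intro poly_space_sum poly_space_cmult) auto
  have r: "r \<in> poly_space l" unfolding r_def using poly_space_diff[OF p sum] .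
  have ipr: "ip K r q = ip K p q - (\<Sum>e\<in>E. ip K p e * ip K e q)" if q: "q \<in> poly_space l" for q
  proof -
    have "ip K r q = ip K p q - ip K (\<lambda>x. \<Sum>e\<in>E. ip K p e * e x) q"
      unfolding r_def by (rule ip_diff[OF K(1) p sum q])
    also have "ip K (\<lambda>x. \<Sum>e\<in>E. ip K p e * e x) q = (\<Sum>e\<in>E. ip K p e * ip K e q)"
      by (rule ip_sum[OF K(1) E(1) _ q]) (use E(2) in blast)
    finally show ?thesis .
  qed
  have rE: "ip K r e = 0" if e: "e \<in> E" for e
  proof -
    have "ip K r e = ip K p e - (\<Sum>e'\<in>E. ip K p e' * ip K e' e)"
      using ipr E(2) e by blast
    also have "(\<Sum>e'\<in>E. ip K p e' * ip K e' e) = (\<Sum>e'\<in>E. if e' = e then ip K p e else 0)"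
      by (rule sum.cong) (auto simp: E(3) e)
    finally show ?thesis using E(1) e by simp
  qed
  show ?case
  proof (cases "ip K r r = 0")
    case True
    then have "r x = 0" for x using ip_eq_0[OF K r] by blast
    then have "p x = (\<Sum>e\<in>E. ip K p e * e x)" for x unfolding r_def by (simp add: eq_iff_diff_eq_0[symmetric])
    then have "\<forall>q\<in>insert p J. \<forall>x. q x = (\<Sum>e\<in>E. ip K q e * e x)" using EJ by (intro ballI allI) (elim insertE, simp_all only:)
    then show ?thesis using E' by (intro exI[of _ E] conjI) simp_all
  next
    case False
    moreover have "ip K r r \<ge> 0" unfolding ip_def by (rule Bochner_Integration.integral_nonneg) auto
    ultimately have pos: "ip K r r > 0" by simp
    define n where "n = sqrt (ip K r r)"
    have n: "n > 0" "n * n = ip K r r" using pos by (auto simp: n_def)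
    define e0 where "e0 x = inverse n * r x" for x
    have e0: "e0 \<in> poly_space l" unfolding e0_def by (rule poly_space_cmult[OF r])
    have e0e: "ip K e0 q = inverse n * ip K r q" for q unfolding e0_def by (rule ip_cmult)
    have e01: "ip K e0 e0 = 1"
      unfolding e0e ip_commute[of K r e0] using n by (simp add: field_simps n(2)[symmetric])
    have e0E: "ip K e0 e = 0" if "e \<in> E" for e using rE[OF that] e0e by simp
    then have nin: "e0 \<notin> E" using e01 by force
    \<comment> \<open>The coefficient of \<open>p\<close> along the new direction is the norm of its
      residual, since the remaining components of \<open>p\<close> are orthogonal to
      \<open>e0\<close>.\<close>
    have pe0: "ip K p e0 = n"
    proof -
      have "ip K r e0 = ip K p e0 - (\<Sum>e'\<in>E. ip K p e' * ip K e' e0)"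
        by (rule ipr[OF e0])
      also have "(\<Sum>e'\<in>E. ip K p e' * ip K e' e0) = 0" by (rule sum.neutral) (metis e0E ip_commute mult_zero_right)
      finally have "ip K p e0 = ip K r e0" by simp
      also have "\<dots> = inverse n * ip K r r" using e0e[of r] ip_commute by metis
      also have "\<dots> = n" using n by (simp add: field_simps n(2)[symmetric])
      finally show ?thesis .
    qed
    have "q x = (\<Sum>e\<in>insert e0 E. ip K q e * e x)" if q: "q \<in> insert p J" for q x
    proof (cases "q = p")
      case True
      have "n * e0 x = r x" using n by (simp add: e0_def field_simps)
      then show ?thesis using E(1) nin True pe0 by (simp add: r_def)
    next
      case False
      then have qJ: "q \<in> J" using q by simp
      \<comment> \<open>Elements already reproduced by \<open>E\<close> are orthogonal to the new
        direction, so the additional term vanishes.\<close>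
      have "q = (\<lambda>x. \<Sum>e\<in>E. ip K q e * e x)" by (rule ext) (rule EJ[OF qJ])
      then have "ip K q e0 = ip K (\<lambda>x. \<Sum>e\<in>E. ip K q e * e x) e0" by (rule arg_cong[of _ _ "\<lambda>q. ip K q e0"])
      also have "\<dots> = (\<Sum>e\<in>E. ip K q e * ip K e e0)"
        by (rule ip_sum[OF K(1) E(1) _ e0]) (use E(2) in blast)
      also have "\<dots> = 0" by (rule sum.neutral) (metis e0E ip_commute mult_zero_right)
      finally have "(\<Sum>e\<in>insert e0 E. ip K q e * e x) = (\<Sum>e\<in>E. ip K q e * e x)" using E(1) nin by simp
      from EJ[OF qJ, of x] this[symmetric] show ?thesis by (rule trans)
    qed
    moreover have "ip K e e' = (if e = e' then 1 else 0)" if "e \<in> insert e0 E" "e' \<in> insert e0 E" for e e'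
      using that E(3) e01 e0E nin ip_commute by (metis insertE)
    ultimately show ?thesis using E(1,2) e0 by (intro exI[of _ "insert e0 E"] conjI ballI allI) simp_all
  qed
qed

text \<open>Completeness is stated as reproduction by coefficients, the form in which a basis serves
  both purposes here: representing a linear functional and bounding point values by
  integrals.\<close>

definition orthonormal_basis :: "'a::euclidean_space set \<Rightarrow> nat \<Rightarrow> ('a \<Rightarrow> real) set \<Rightarrow> bool" where
  "orthonormal_basis K l E \<longleftrightarrow> finite E \<and> E \<subseteq> poly_space l \<and>
     (\<forall>e\<in>E. \<forall>e'\<in>E. ip K e e' = (if e = e' then 1 else 0)) \<and>
     (\<forall>p\<in>poly_space l. \<forall>x. p x = (\<Sum>e\<in>E. ip K p e * e x))"

lemma orthonormal_basisD:
  fixes K :: "'a::euclidean_space set"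
  assumes "orthonormal_basis K l E"
  shows "finite E" "E \<subseteq> poly_space l" "\<And>e e'. e \<in> E \<Longrightarrow> e' \<in> E \<Longrightarrow> ip K e e' = (if e = e' then 1 else 0)"
    "\<And>p x. p \<in> poly_space l \<Longrightarrow> p x = (\<Sum>e\<in>E. ip K p e * e x)"
proof -
  show "finite E" "E \<subseteq> poly_space l" "\<And>e e'. e \<in> E \<Longrightarrow> e' \<in> E \<Longrightarrow> ip K e e' = (if e = e' then 1 else 0)"
    using assms unfolding orthonormal_basis_def by simp_all
  fix p :: "'a \<Rightarrow> real" and x assume "p \<in> poly_space l"
  then show "p x = (\<Sum>e\<in>E. ip K p e * e x)"
    by (rule assms[unfolded orthonormal_basis_def, THEN conjunct2, THEN conjunct2, THEN conjunct2, THEN bspec, THEN spec])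
qed

lemma orthonormal_basis_exists:
  assumes K: "compact K" "interior K \<noteq> {}"
  obtains E where "orthonormal_basis K l E"
proof -
  have "monomial ` multi_indices l \<subseteq> poly_space l" using monomial_in_poly_space by blast
  from orthonormal_extension[OF K _ this]
  obtain E where E': "finite E \<and> E \<subseteq> poly_space l \<and> (\<forall>e\<in>E. \<forall>e'\<in>E. ip K e e' = (if e = e' then 1 else 0)) \<and>
    (\<forall>p\<in>monomial ` multi_indices l. \<forall>x. p x = (\<Sum>e\<in>E. ip K p e * e x))" by auto
  then have E: "finite E" "E \<subseteq> poly_space l" "\<And>e e'. e \<in> E \<Longrightarrow> e' \<in> E \<Longrightarrow> ip K e e' = (if e = e' then 1 else 0)"
    by simp_all
  have Em: "monomial \<alpha> x = (\<Sum>e\<in>E. ip K (monomial \<alpha>) e * e x)" if "\<alpha> \<in> multi_indices l" for \<alpha> x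
    using E'[THEN conjunct2, THEN conjunct2, THEN conjunct2, THEN bspec, OF imageI[OF that]] by (rule spec)
  have Ep: "p x = (\<Sum>e\<in>E. ip K p e * e x)" if pin: "p \<in> poly_space l" for p x
  proof -
    obtain c where p: "p = (\<lambda>x. \<Sum>\<alpha>\<in>multi_indices l. c \<alpha> * monomial \<alpha> x)"
      using pin unfolding poly_space_iff by blast
    have "(\<Sum>e\<in>E. ip K p e * e x) = (\<Sum>e\<in>E. (\<Sum>\<alpha>\<in>multi_indices l. c \<alpha> * ip K (monomial \<alpha>) e) * e x)"
      unfolding p using E(2) by (intro sum.cong refl arg_cong2[where f="(*)"] ip_sum[OF K(1)] monomial_in_poly_space) auto
    also have "\<dots> = (\<Sum>\<alpha>\<in>multi_indices l. c \<alpha> * (\<Sum>e\<in>E. ip K (monomial \<alpha>) e * e x))"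
      by (simp only: sum_distrib_right sum_distrib_left mult.assoc) (rule sum.swap)
    also have "\<dots> = p x" unfolding p using Em by (intro sum.cong refl arg_cong2[where f="(*)"]) (rule sym)
    finally show ?thesis by (rule sym)
  qed
  have "orthonormal_basis K l E"
    unfolding orthonormal_basis_def by (intro conjI ballI allI E Ep)
  then show ?thesis by (rule that)
qed

section \<open>Inverse estimates by scaling to a reference ball\<close>

lemma integral_scale:
  fixes g :: "'a::euclidean_space \<Rightarrow> real"
  assumes r: "r > 0" and [measurable]: "g \<in> borel_measurable borel"
  shows "(\<integral>x. g x \<partial>lborel) = r ^ DIM('a) * (\<integral>y. g (z + r *\<^sub>R y) \<partial>lborel)"
proof -
  have "(\<integral>x. g x \<partial>lborel) = (\<integral>x. g x \<partial>(density (distr lborel borel (\<lambda>x. z + r *\<^sub>R x)) (\<lambda>_. ennreal (\<bar>r\<bar> ^ DIM('a)))))"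
    using lborel_affine[of r z] r by simp
  also have "\<dots> = (\<integral>x. r ^ DIM('a) * g x \<partial>(distr lborel borel (\<lambda>x. z + r *\<^sub>R x)))"
    using r by (subst integral_density) auto
  also have "\<dots> = (\<integral>y. r ^ DIM('a) * g (z + r *\<^sub>R y) \<partial>lborel)"
    by (subst integral_distr) auto
  finally show ?thesis by simp
qed

lemma C1_bounded:
  assumes "C1 p" "compact S"
  obtains M where "M \<ge> 0" "\<And>x. x \<in> S \<Longrightarrow> \<bar>p x\<bar> \<le> M" "\<And>x. x \<in> S \<Longrightarrow> norm (grad p x) \<le> M"
proof -
  have "bounded (p ` S)" "bounded (grad p ` S)"
    using assms C1_continuous[OF assms(1)] unfolding C1_def
    by (meson compact_continuous_image compact_imp_bounded continuous_on_subset subset_UNIV)+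
  then obtain a b where ab: "\<And>x. x \<in> S \<Longrightarrow> \<bar>p x\<bar> \<le> a" "\<And>x. x \<in> S \<Longrightarrow> norm (grad p x) \<le> b"
    unfolding bounded_iff by (auto simp: real_norm_def)
  show ?thesis
  proof (rule that[of "max 0 (max a b)"])
    fix x assume "x \<in> S"
    from ab(1)[OF this] ab(2)[OF this]
    show "\<bar>p x\<bar> \<le> max 0 (max a b)" "norm (grad p x) \<le> max 0 (max a b)" by linarith+
  qed simp
qed

text \<open>In an orthonormal basis of the ball of radius \<open>\<rho>\<close>, each coefficient is
  at most the sup norm of the basis element times the L1 norm of \<open>p\<close> on that ball.
  Values and gradients on the unit ball follow term by term.\<close>

lemma reference_inverse:
  assumes "\<rho> > 0"
  shows "\<exists>C\<ge>0. \<forall>p\<in>poly_space l. \<forall>x\<in>cball (0::'a::euclidean_space) 1.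
    \<bar>p x\<bar> \<le> C * (\<integral>y. indicator (cball 0 \<rho>) y * \<bar>p y\<bar> \<partial>lborel) \<and>
    norm (grad p x) \<le> C * (\<integral>y. indicator (cball 0 \<rho>) y * \<bar>p y\<bar> \<partial>lborel)"
proof -
  let ?B = "cball (0::'a) \<rho>"
  have B: "compact ?B" "interior ?B \<noteq> {}" using assms by auto
  obtain E where "orthonormal_basis ?B l E" by (rule orthonormal_basis_exists[OF B])
  note E = orthonormal_basisD[OF this]
  \<comment> \<open>The radius \<open>1 + \<rho>\<close> covers the unit ball, where values are
    estimated, and the ball of radius \<open>\<rho>\<close>, where coefficients are computed. Each
    basis element is bounded once in either role, hence the products \<open>M e * M e\<close>
    below.\<close>
  have "\<forall>e\<in>E. \<exists>M. M \<ge> 0 \<and> (\<forall>x\<in>cball (0::'a) (1 + \<rho>). \<bar>e x\<bar> \<le> M \<and> norm (grad e x) \<le> M)"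
  proof
    fix e assume "e \<in> E"
    then have "C1 e" using E(2) poly_space_C1 by blast
    then obtain M where "M \<ge> 0" "\<And>x. x \<in> cball (0::'a) (1 + \<rho>) \<Longrightarrow> \<bar>e x\<bar> \<le> M"
      "\<And>x. x \<in> cball (0::'a) (1 + \<rho>) \<Longrightarrow> norm (grad e x) \<le> M"
      using C1_bounded[OF _ compact_cball] by blast
    then show "\<exists>M. M \<ge> 0 \<and> (\<forall>x\<in>cball (0::'a) (1 + \<rho>). \<bar>e x\<bar> \<le> M \<and> norm (grad e x) \<le> M)" by blast
  qed
  from bchoice[OF this] obtain M where M': "\<forall>e\<in>E. M e \<ge> 0 \<and> (\<forall>x\<in>cball (0::'a) (1 + \<rho>). \<bar>e x\<bar> \<le> M e \<and> norm (grad e x) \<le> M e)" ..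
  have M: "\<And>e. e \<in> E \<Longrightarrow> M e \<ge> 0" "\<And>e x. e \<in> E \<Longrightarrow> x \<in> cball 0 (1 + \<rho>) \<Longrightarrow> \<bar>e x\<bar> \<le> M e"
    "\<And>e x. e \<in> E \<Longrightarrow> x \<in> cball 0 (1 + \<rho>) \<Longrightarrow> norm (grad e x) \<le> M e" using M' by blast+
  show ?thesis
  proof (intro exI[of _ "\<Sum>e\<in>E. M e * M e"] conjI ballI)
    show "0 \<le> (\<Sum>e\<in>E. M e * M e)" by (intro sum_nonneg) simp
    fix p :: "'a \<Rightarrow> real" and x :: 'a assume p: "p \<in> poly_space l" and x: "x \<in> cball 0 1"
    define J where "J = (\<integral>y. indicator ?B y * \<bar>p y\<bar> \<partial>lborel)"
    have "0 \<le> J" unfolding J_def by (intro Bochner_Integration.integral_nonneg) auto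
    have x': "x \<in> cball 0 (1 + \<rho>)" using x assms by auto
    have ipb: "\<bar>ip ?B p e\<bar> \<le> M e * J" if e: "e \<in> E" for e
    proof -
      have "\<bar>ip ?B p e\<bar> \<le> (\<integral>y. \<bar>indicator ?B y * (p y * e y)\<bar> \<partial>lborel)"
        unfolding ip_def by (rule integral_abs_bound)
      also have "\<dots> \<le> (\<integral>y. M e * (indicator ?B y * \<bar>p y\<bar>) \<partial>lborel)"
      proof (rule integral_mono)
        show "integrable lborel (\<lambda>y. \<bar>indicator ?B y * (p y * e y)\<bar>)"
          using integrable_ip[OF B(1) p, of e l] e E(2) by (intro integrable_abs) auto
        show "integrable lborel (\<lambda>y. M e * (indicator ?B y * \<bar>p y\<bar>))"
          by (intro integrable_mult_right integrable_on_compact[OF B(1)] continuous_intros poly_space_continuous[OF p])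
        fix y show "\<bar>indicator ?B y * (p y * e y)\<bar> \<le> M e * (indicator ?B y * \<bar>p y\<bar>)"
        proof (cases "y \<in> ?B")
          case True
          then have "\<bar>e y\<bar> \<le> M e" using M(2)[OF e, of y] by auto
          then have "\<bar>p y\<bar> * \<bar>e y\<bar> \<le> \<bar>p y\<bar> * M e" by (rule mult_left_mono) simp
          then show ?thesis using True by (simp add: abs_mult mult.commute)
        qed simp
      qed
      finally show ?thesis by (simp add: J_def)
    qed
    have pe: "p = (\<lambda>x. \<Sum>e\<in>E. ip ?B p e * e x)" by (rule ext) (rule E(4)[OF p])
    have "\<bar>p x\<bar> \<le> (\<Sum>e\<in>E. \<bar>ip ?B p e * e x\<bar>)" by (subst E(4)[OF p]) (rule sum_abs)
    also have "\<dots> \<le> (\<Sum>e\<in>E. (M e * J) * M e)"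
      unfolding abs_mult using ipb M x' \<open>0 \<le> J\<close> by (intro sum_mono mult_mono) auto
    also have "\<dots> = (\<Sum>e\<in>E. M e * M e) * J" by (simp add: sum_distrib_right sum_distrib_left mult_ac)
    finally show "\<bar>p x\<bar> \<le> (\<Sum>e\<in>E. M e * M e) * (\<integral>y. indicator ?B y * \<bar>p y\<bar> \<partial>lborel)" unfolding J_def .
    have C1E: "C1 e" if "e \<in> E" for e using E(2) that poly_space_C1 by blast
    have "grad (\<lambda>x. \<Sum>e\<in>E. ip ?B p e * e x) = (\<lambda>x. \<Sum>e\<in>E. grad (\<lambda>x. ip ?B p e * e x) x)"
      using C1_sum[OF E(1), of "\<lambda>e x. ip ?B p e * e x"] C1_cmult(1)[OF C1E] by blast
    then have "grad p x = (\<Sum>e\<in>E. grad (\<lambda>x. ip ?B p e * e x) x)" using arg_cong[OF pe, of "\<lambda>p. grad p x"] by simp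
    also have "\<dots> = (\<Sum>e\<in>E. ip ?B p e *\<^sub>R grad e x)"
      by (intro sum.cong refl) (simp add: C1_cmult(2)[OF C1E])
    finally have "norm (grad p x) \<le> (\<Sum>e\<in>E. norm (ip ?B p e *\<^sub>R grad e x))" using norm_sum by metis
    also have "\<dots> \<le> (\<Sum>e\<in>E. (M e * J) * M e)"
      unfolding norm_scaleR using ipb M x' \<open>0 \<le> J\<close> by (intro sum_mono mult_mono) auto
    also have "\<dots> = (\<Sum>e\<in>E. M e * M e) * J" by (simp add: sum_distrib_right sum_distrib_left mult_ac)
    finally show "norm (grad p x) \<le> (\<Sum>e\<in>E. M e * M e) * (\<integral>y. indicator ?B y * \<bar>p y\<bar> \<partial>lborel)" unfolding J_def .
  qed
qed

text \<open>Scaling by the diameter about the inscribed centre puts the cell into the unit ball and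
  its inscribed ball onto \<open>cball 0 \<sigma>\<close>. These two balls are the same for all
  cells, so the constant sees neither the shape of \<open>K\<close> nor the mesh; the L1 norm over
  the inscribed ball is at most that over \<open>K\<close>.\<close>

lemma inverse_estimates:
  assumes \<sigma>: "\<sigma> > 0"
  shows "\<exists>C\<ge>0. \<forall>T::'a::euclidean_space set set. qu_mesh T \<sigma> \<longrightarrow> (\<forall>K\<in>T. \<forall>p\<in>poly_space l. \<forall>x\<in>K.
    \<bar>p x\<bar> \<le> C / mesh_size T ^ DIM('a) * (\<integral>y. indicator K y * \<bar>p y\<bar> \<partial>lborel) \<and>
    norm (grad p x) \<le> C / mesh_size T ^ (DIM('a) + 1) * (\<integral>y. indicator K y * \<bar>p y\<bar> \<partial>lborel))"
proof -
  obtain C where C0: "C \<ge> 0 \<and> (\<forall>p\<in>poly_space l. \<forall>x\<in>cball (0::'a) 1.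
    \<bar>p x\<bar> \<le> C * (\<integral>y. indicator (cball 0 \<sigma>) y * \<bar>p y\<bar> \<partial>lborel) \<and>
    norm (grad p x) \<le> C * (\<integral>y. indicator (cball 0 \<sigma>) y * \<bar>p y\<bar> \<partial>lborel))"
    using reference_inverse[OF \<sigma>, of l, where 'a='a] by (elim exE) (rule that)
  note C = C0[THEN conjunct1] C0[THEN conjunct2, THEN bspec, THEN bspec]
  \<comment> \<open>One summand for each estimate: replacing the diameter by its lower bound
    \<open>\<sigma> * h\<close> costs \<open>DIM('a)\<close> powers of \<open>\<sigma>\<close> for
    values and one more, from the chain rule, for gradients.\<close>
  define C' where "C' = C / \<sigma> ^ DIM('a) + C / \<sigma> ^ (DIM('a) + 1)"
  show ?thesis
  proof (intro exI[of _ C'] conjI allI impI ballI)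
    show "0 \<le> C'" using C \<sigma> by (simp add: C'_def)
    fix T :: "'a set set" and K and p :: "'a \<Rightarrow> real" and x
    assume T: "qu_mesh T \<sigma>" and K: "K \<in> T" and p: "p \<in> poly_space l" and x: "x \<in> K"
    interpret qu_mesh T \<sigma> by fact
    define D where "D = diameter K"
    define J where "J = (\<integral>y. indicator K y * \<bar>p y\<bar> \<partial>lborel)"
    have J: "J \<ge> 0" unfolding J_def by (intro Bochner_Integration.integral_nonneg) auto
    have D: "D > 0" "\<sigma> * h \<le> D" using diameter_pos diameter_ge K by (auto simp: D_def)
    define z where "z = centre K"
    have z: "z \<in> K" "cball z (\<sigma> * D) \<subseteq> K" using centre_in centre K by (auto simp: z_def D_def)
    define q where "q y = p (z + D *\<^sub>R y)" for y
    have q: "q \<in> poly_space l" unfolding q_def by (rule poly_space_affine[OF p])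
    define y where "y = (x - z) /\<^sub>R D"
    have "norm (x - z) \<le> D" using diameter_bounded_bound[OF cell(5)[OF K] x z(1)] by (simp add: D_def dist_norm)
    then have "norm (x - z) / D \<le> 1" using D by simp
    then have y: "y \<in> cball 0 1" "x = z + D *\<^sub>R y" using D by (simp_all add: y_def divide_inverse mult.commute)
    have [measurable]: "p \<in> borel_measurable borel" "K \<in> sets borel" using poly_space_measurable[OF p] cell(8)[OF K] by auto
    have iK: "integrable lborel (\<lambda>y. indicator K y * \<bar>p y\<bar>)"
      by (intro integrable_on_compact[OF cell(3)[OF K]] continuous_intros poly_space_continuous[OF p])
    have "(\<integral>y. indicator (cball z (\<sigma> * D)) y * \<bar>p y\<bar> \<partial>lborel) =
      D ^ DIM('a) * (\<integral>y. indicator (cball z (\<sigma> * D)) (z + D *\<^sub>R y) * \<bar>p (z + D *\<^sub>R y)\<bar> \<partial>lborel)"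
      using poly_space_measurable[OF p] by (intro integral_scale[OF D(1)] borel_measurable_times borel_measurable_indicator) auto
    moreover have "z + D *\<^sub>R y \<in> cball z (\<sigma> * D) \<longleftrightarrow> y \<in> cball 0 \<sigma>" for y
      using D by (simp add: dist_norm mult.commute)
    ultimately have "D ^ DIM('a) * (\<integral>y. indicator (cball 0 \<sigma>) y * \<bar>q y\<bar> \<partial>lborel) =
      (\<integral>y. indicator (cball z (\<sigma> * D)) y * \<bar>p y\<bar> \<partial>lborel)"
      by (simp add: q_def indicator_def)
    also have "\<dots> \<le> J" unfolding J_def
    proof (rule integral_mono[OF _ iK])
      show "integrable lborel (\<lambda>y. indicator (cball z (\<sigma> * D)) y * \<bar>p y\<bar>)"
        by (intro integrable_on_compact continuous_intros poly_space_continuous[OF p]) simp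
    qed (use z in \<open>auto simp: indicator_def\<close>)
    finally have q1: "(\<integral>y. indicator (cball 0 \<sigma>) y * \<bar>q y\<bar> \<partial>lborel) \<le> J / D ^ DIM('a)"
      using D by (simp add: pos_le_divide_eq mult.commute)
    have hs: "0 < \<sigma> * h" using \<sigma> h_pos by simp
    have "J / D ^ DIM('a) \<le> J / (\<sigma> * h) ^ DIM('a)"
      by (intro divide_left_mono power_mono mult_pos_pos[OF zero_less_power zero_less_power] D hs J less_imp_le[OF hs])
    with q1 have q2: "(\<integral>y. indicator (cball 0 \<sigma>) y * \<bar>q y\<bar> \<partial>lborel) \<le> J / (\<sigma> * h) ^ DIM('a)" by linarith
    have "\<bar>p x\<bar> = \<bar>q y\<bar>" using y by (simp add: q_def)
    also have "\<dots> \<le> C * (J / (\<sigma> * h) ^ DIM('a))" using C(2)[OF q y(1)] mult_left_mono[OF q2 C(1)] by linarith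
    also have "\<dots> = C / \<sigma> ^ DIM('a) / h ^ DIM('a) * J" by (simp add: power_mult_distrib)
    also have "\<dots> \<le> C' / h ^ DIM('a) * J"
      using C(1) \<sigma> h_pos J by (intro mult_right_mono divide_right_mono) (auto simp: C'_def)
    finally show "\<bar>p x\<bar> \<le> C' / h ^ DIM('a) * (\<integral>y. indicator K y * \<bar>p y\<bar> \<partial>lborel)" unfolding J_def .
    have "grad q y = D *\<^sub>R grad p x"
      unfolding q_def C1_affine(2)[OF poly_space_C1[OF p]] y(2)[symmetric] ..
    then have "D * norm (grad p x) = norm (grad q y)" using D by simp
    also have "\<dots> \<le> C * (J / (\<sigma> * h) ^ DIM('a))" using C(2)[OF q y(1)] mult_left_mono[OF q2 C(1)] by linarith
    finally have "norm (grad p x) * D \<le> C * (J / (\<sigma> * h) ^ DIM('a))" by (simp only: mult.commute)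
    then have "norm (grad p x) \<le> C * (J / (\<sigma> * h) ^ DIM('a)) / D" by (simp only: pos_le_divide_eq[OF D(1)])
    also have "\<dots> \<le> C * (J / (\<sigma> * h) ^ DIM('a)) / (\<sigma> * h)"
      using C(1) hs J D \<sigma> h_pos by (intro divide_left_mono mult_nonneg_nonneg divide_nonneg_nonneg) auto
    also have "\<dots> = C / \<sigma> ^ (DIM('a) + 1) / h ^ (DIM('a) + 1) * J" using hs by (simp add: power_mult_distrib field_simps)
    also have "\<dots> \<le> C' / h ^ (DIM('a) + 1) * J"
      using C(1) \<sigma> h_pos J by (intro mult_right_mono divide_right_mono) (auto simp: C'_def)
    finally show "norm (grad p x) \<le> C' / h ^ (DIM('a) + 1) * (\<integral>y. indicator K y * \<bar>p y\<bar> \<partial>lborel)" unfolding J_def .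
  qed
qed

section \<open>The discrete divergence\<close>

text \<open>\<open>Ci\<close> is a parameter so that one value can serve all meshes of a family. The
  inverse estimate is required up to degree \<open>2 * k\<close> because it is also applied to the
  square of a polynomial of degree at most \<open>k\<close>.\<close>

locale dg_discretization = qu_mesh T \<sigma> for T :: "'a::euclidean_space set set" and \<sigma> :: real +
  fixes f :: "real \<Rightarrow> 'a" and F :: "'a num_flux" and k :: nat and C L Ci :: real
  assumes flux: "numerical_flux T k F" and consistent: "consistent_flux T k f F" and lip_flux: "lipschitz_flux C T k F"
    and lip: "L-lipschitz_on UNIV f" and Ci: "Ci \<ge> 0"
    and inverse: "\<And>K p x. K \<in> T \<Longrightarrow> p \<in> poly_space (2 * k) \<Longrightarrow> x \<in> K \<Longrightarrow>
      \<bar>p x\<bar> \<le> Ci / h ^ DIM('a) * (\<integral>y. indicator K y * \<bar>p y\<bar> \<partial>lborel) \<and>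
      norm (grad p x) \<le> Ci / h ^ (DIM('a) + 1) * (\<integral>y. indicator K y * \<bar>p y\<bar> \<partial>lborel)"
begin

text \<open>\<open>C\<close> may be negative; the positive part keeps later bounds monotone in the
  distance.\<close>

definition flux_lip :: real where "flux_lip = max C 0"

lemma L0: "L \<ge> 0" using lip by (rule lipschitz_on_nonneg)

lemma f_lip: "norm (f a - f b) \<le> L * \<bar>a - b\<bar>"
  using lipschitz_onD[OF lip, of a b] by (simp add: dist_norm)

lemma f_continuous: "continuous_on UNIV f"
  using lip by (rule lipschitz_on_continuous_on)

lemma broken_poly_poly: "u \<in> broken_poly T l \<Longrightarrow> K \<in> T \<Longrightarrow> u K \<in> poly_space l"
  unfolding broken_poly_def by (rule PiE_mem)

lemma const_broken: "(\<lambda>K\<in>T. \<lambda>x. c) \<in> broken_poly T l"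
  unfolding broken_poly_def using poly_space_const by auto

lemma AE_lebesgue_skeleton: "AE x in lebesgue. x \<notin> skeleton"
  using AE_skeleton(1) by (rule AE_completion)

text \<open>Off the skeleton \<open>eval_broken\<close> uses the only cell containing the point, so
  pointwise bounds on the two cells bound the essential supremum. Nonnegativity is recorded because
  it permits replacing \<open>C\<close> by \<open>flux_lip\<close>.\<close>

lemma Linf_bound:
  assumes "K \<in> T" "K' \<in> T" "\<delta> \<ge> 0"
    and "\<And>x. x \<in> K \<Longrightarrow> \<bar>u K x - v K x\<bar> \<le> \<delta>" "\<And>x. x \<in> K' \<Longrightarrow> \<bar>u K' x - v K' x\<bar> \<le> \<delta>"
  shows "Linf_norm (K \<union> K') (\<lambda>y. eval_broken T u y - eval_broken T v y) \<in> {0..\<delta>}"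
proof -
  let ?S = "{B. 0 \<le> B \<and> (AE x in lebesgue. x \<in> K \<union> K' \<longrightarrow> \<bar>eval_broken T u x - eval_broken T v x\<bar> \<le> B)}"
  have "AE x in lebesgue. x \<in> K \<union> K' \<longrightarrow> \<bar>eval_broken T u x - eval_broken T v x\<bar> \<le> \<delta>"
    using AE_lebesgue_skeleton
  proof eventually_elim
    case (elim x)
    then show ?case unfolding eval_broken_def cell_of_def[symmetric]
      using cell_of_eq[OF elim assms(1)] cell_of_eq[OF elim assms(2)] assms(4,5)[of x] by auto
  qed
  then have d: "\<delta> \<in> ?S" using assms(3) by simp
  have b: "bdd_below ?S" by (rule bdd_belowI[of _ 0]) simp
  have "Inf ?S \<le> \<delta>" using d b by (rule cInf_lower)
  moreover have "0 \<le> Inf ?S" using d by (intro cInf_greatest) auto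
  ultimately show ?thesis unfolding Linf_norm_def by simp
qed

lemma flux_diff:
  assumes "K \<in> T" "K' \<in> neighbours T K" "\<delta> \<ge> 0" "u \<in> broken_poly T k" "v \<in> broken_poly T k"
    and "\<And>x. x \<in> K \<Longrightarrow> \<bar>u K x - v K x\<bar> \<le> \<delta>" "\<And>x. x \<in> K' \<Longrightarrow> \<bar>u K' x - v K' x\<bar> \<le> \<delta>"
    and x: "x \<in> K \<inter> K'"
  shows "\<bar>F K K' u x - F K K' v x\<bar> \<le> flux_lip * \<delta>"
proof -
  let ?N = "Linf_norm (K \<union> K') (\<lambda>y. eval_broken T u y - eval_broken T v y)"
  have N: "0 \<le> ?N" "?N \<le> \<delta>" using Linf_bound[of K K' \<delta> u v] assms neighbours_T by auto
  have "\<bar>F K K' u x - F K K' v x\<bar> \<le> C * ?N"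
    using lip_flux assms unfolding lipschitz_flux_def by blast
  also have "\<dots> \<le> flux_lip * ?N" using N by (intro mult_right_mono) (auto simp: flux_lip_def)
  also have "\<dots> \<le> flux_lip * \<delta>" using N by (intro mult_left_mono) (auto simp: flux_lip_def)
  finally show ?thesis .
qed

text \<open>Lipschitz continuity compares the flux with that of the constant function
  \<open>c\<close>, and consistency evaluates the latter.\<close>

lemma flux_near_const:
  assumes "K \<in> T" "K' \<in> neighbours T K" "\<delta> \<ge> 0" "u \<in> broken_poly T k"
    and "\<And>x. x \<in> K \<Longrightarrow> \<bar>u K x - c\<bar> \<le> \<delta>" "\<And>x. x \<in> K' \<Longrightarrow> \<bar>u K' x - c\<bar> \<le> \<delta>"
    and x: "x \<in> K \<inter> K'"
  shows "\<bar>F K K' u x - f c \<bullet> outward_normal K K'\<bar> \<le> flux_lip * \<delta>"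
proof -
  let ?v = "\<lambda>K\<in>T. \<lambda>x. c"
  have T': "K' \<in> T" using assms neighbours_T by blast
  have v: "?v \<in> broken_poly T k" by (rule const_broken)
  have vK: "?v K = (\<lambda>x. c)" "?v K' = (\<lambda>x. c)" using assms(1) T' by auto
  have "(\<forall>x\<in>K \<inter> K'. ?v K x = ?v K' x) \<longrightarrow> (\<forall>x\<in>K \<inter> K'. F K K' ?v x = f (?v K x) \<bullet> outward_normal K K')"
    using consistent[unfolded consistent_flux_def, THEN bspec, OF assms(1), THEN bspec, OF assms(2), THEN bspec, OF v] .
  then have "F K K' ?v x = f c \<bullet> outward_normal K K'" using x unfolding vK by blast
  moreover have "\<bar>F K K' u x - F K K' ?v x\<bar> \<le> flux_lip * \<delta>"
    by (rule flux_diff[OF assms(1-4) v _ _ x]) (unfold vK, simp_all add: assms(5,6))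
  ultimately show ?thesis by simp
qed

text \<open>The class of integrands on which face integrals are finite and linear. The indicator
  makes measurability independent of the values off the face, where fluxes are arbitrary.\<close>

definition face_bounded :: "'a set \<Rightarrow> 'a set \<Rightarrow> ('a \<Rightarrow> real) \<Rightarrow> bool" where
  "face_bounded K K' g \<longleftrightarrow> (\<lambda>x. indicator (K \<inter> K') x * g x) \<in> borel_measurable borel \<and> (\<exists>B. \<forall>x\<in>K \<inter> K'. \<bar>g x\<bar> \<le> B)"

lemma face_bounded_continuous:
  assumes "K \<in> T" "K' \<in> T" "continuous_on UNIV g" shows "face_bounded K K' g"
proof -
  have "compact (K \<inter> K')" using cell assms by (simp add: compact_Int)
  then have "bounded (g ` (K \<inter> K'))"
    using assms(3) by (meson compact_continuous_image compact_imp_bounded continuous_on_subset subset_UNIV)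
  then have "\<exists>B. \<forall>x\<in>K \<inter> K'. \<bar>g x\<bar> \<le> B" unfolding bounded_iff by (auto simp: real_norm_def)
  moreover have "(\<lambda>x. indicator (K \<inter> K') x * g x) \<in> borel_measurable borel"
    using assms cell borel_measurable_continuous_onI[OF assms(3)]
    by (intro borel_measurable_times borel_measurable_indicator) auto
  ultimately show ?thesis by (simp add: face_bounded_def)
qed

lemma face_bounded_mult:
  assumes "face_bounded K K' g" "face_bounded K K' g'" shows "face_bounded K K' (\<lambda>x. g x * g' x)"
proof -
  have "(\<lambda>x. indicator (K \<inter> K') x * g x) \<in> borel_measurable borel" "(\<lambda>x. indicator (K \<inter> K') x * g' x) \<in> borel_measurable borel"
    using assms unfolding face_bounded_def by auto
  from borel_measurable_times[OF this]
  have "(\<lambda>x. (indicator (K \<inter> K') x * g x) * (indicator (K \<inter> K') x * g' x)) \<in> borel_measurable borel" .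
  then have 1: "(\<lambda>x. indicator (K \<inter> K') x * (g x * g' x)) \<in> borel_measurable borel"
    by (rule back_subst[of "\<lambda>f. f \<in> borel_measurable borel"]) (auto simp: indicator_def)
  obtain B B' where "\<forall>x\<in>K \<inter> K'. \<bar>g x\<bar> \<le> B" "\<forall>x\<in>K \<inter> K'. \<bar>g' x\<bar> \<le> B'" using assms unfolding face_bounded_def by blast
  then have "\<forall>x\<in>K \<inter> K'. \<bar>g x * g' x\<bar> \<le> B * B'" unfolding abs_mult
    by (intro ballI mult_mono) (auto intro: order_trans[OF abs_ge_zero])
  then show ?thesis using 1 unfolding face_bounded_def by (intro conjI exI)
qed

lemma face_bounded_add:
  assumes "face_bounded K K' g" "face_bounded K K' g'" shows "face_bounded K K' (\<lambda>x. g x + g' x)"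
proof -
  have "(\<lambda>x. indicator (K \<inter> K') x * g x + indicator (K \<inter> K') x * g' x) \<in> borel_measurable borel"
    using assms unfolding face_bounded_def by (intro borel_measurable_add) auto
  then have 1: "(\<lambda>x. indicator (K \<inter> K') x * (g x + g' x)) \<in> borel_measurable borel"
    by (simp add: distrib_left)
  obtain B B' where B: "\<forall>x\<in>K \<inter> K'. \<bar>g x\<bar> \<le> B" "\<forall>x\<in>K \<inter> K'. \<bar>g' x\<bar> \<le> B'" using assms unfolding face_bounded_def by blast
  have "\<forall>x\<in>K \<inter> K'. \<bar>g x + g' x\<bar> \<le> B + B'"
  proof
    fix x assume "x \<in> K \<inter> K'"
    with B have "\<bar>g x\<bar> \<le> B" "\<bar>g' x\<bar> \<le> B'" by auto
    then show "\<bar>g x + g' x\<bar> \<le> B + B'" by linarith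
  qed
  then show ?thesis using 1 unfolding face_bounded_def by blast
qed

lemma face_bounded_const: "K \<in> T \<Longrightarrow> K' \<in> T \<Longrightarrow> face_bounded K K' (\<lambda>x. r)"
  by (rule face_bounded_continuous) auto

text \<open>Comes from comparing \<open>h\<close> times the area of a face with the volume of a ball
  of radius \<open>2 * h\<close>.\<close>

definition face_const :: real where "face_const = unit_ball_vol (real DIM('a)) * 2 ^ DIM('a)"

lemma face_const: "face_const \<ge> 0" unfolding face_const_def by (simp add: less_imp_le)

text \<open>The prism of height \<open>h\<close> over a face, obtained by stretching the prism of
  height one, fits into the ball of radius \<open>2 * h\<close> about the centre of
  \<open>K\<close>. Hence the area of a face is at most
  \<open>face_const * h ^ (DIM('a) - 1)\<close>, whatever its shape.\<close>

lemma face_int_props: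
  assumes K: "K \<in> T" "K' \<in> T" and s: "norm \<nu> = 1" "\<And>x. x \<in> K \<Longrightarrow> \<nu> \<bullet> x \<le> c" "\<And>x. x \<in> K' \<Longrightarrow> c \<le> \<nu> \<bullet> x"
  shows "face_bounded K K' g \<Longrightarrow> integrable lborel (\<lambda>y. indicator (slab \<nu> c 1) y * (indicator (K \<inter> K') (hproj \<nu> c y) * g (hproj \<nu> c y)))"
    and "face_bounded K K' g \<Longrightarrow> (\<And>x. x \<in> K \<inter> K' \<Longrightarrow> \<bar>g x\<bar> \<le> B) \<Longrightarrow> B \<ge> 0 \<Longrightarrow> \<bar>face_int \<nu> c (K \<inter> K') g\<bar> \<le> B * face_const * h ^ (DIM('a) - 1)"
proof -
  let ?E = "K \<inter> K'"
  have [measurable]: "?E \<in> sets borel" using cell K by auto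
  define R where "R t x = (indicator (slab \<nu> c t) x * indicator ?E (hproj \<nu> c x) :: real)" for t and x :: 'a
  have Rm [measurable]: "R t \<in> borel_measurable borel" for t unfolding R_def by measurable
  have Rb: "R t x \<le> indicator (cball (centre K) (h + t)) x" if "t \<ge> 0" for t x
  proof (cases "R t x = 0")
    case False
    then have x: "x \<in> slab \<nu> c t" "hproj \<nu> c x \<in> K" by (auto simp: R_def indicator_def split: if_splits)
    have "dist (centre K) x \<le> dist (centre K) (hproj \<nu> c x) + dist (hproj \<nu> c x) x" by (rule dist_triangle)
    also have "dist (centre K) (hproj \<nu> c x) \<le> h" using cell_dist[OF K(1) centre_in[OF K(1)] x(2)] .
    also have "dist (hproj \<nu> c x) x \<le> t" using x(1) s(1) by (simp add: hproj_def dist_norm slab_def)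
    finally show ?thesis by (simp add: R_def indicator_def)
  qed simp
  have R0: "0 \<le> R t x" for t x by (simp add: R_def)
  have icb: "integrable lborel (indicator (cball (centre K) r) :: 'a \<Rightarrow> real)" for r
    using emeasure_lborel_cball_finite by (intro integrable_real_indicator) auto
  have Ri: "integrable lborel (R t)" if "t \<ge> 0" for t
    by (rule Bochner_Integration.integrable_bound[OF icb[of "h + t"]]) (use Rb[OF that] R0 in auto)
  have R1: "(\<integral>y. R 1 y \<partial>lborel) \<le> face_const * h ^ (DIM('a) - 1)"
  proof -
    have "(\<integral>x. R h x \<partial>lborel) = h * (\<integral>y. R h (slab_map \<nu> c h y) \<partial>lborel)"
      by (rule integral_slab_map[OF s(1) h_pos]) measurable
    also have "(\<lambda>y. R h (slab_map \<nu> c h y)) = R 1"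
      by (rule ext) (simp add: R_def indicator_def hproj_slab_map(1)[OF s(1)] hproj_slab_map(2)[OF s(1) h_pos])
    finally have "h * (\<integral>y. R 1 y \<partial>lborel) = (\<integral>x. R h x \<partial>lborel)" by simp
    also have "\<dots> \<le> (\<integral>x. indicator (cball (centre K) (h + h)) x \<partial>lborel)"
      using h_pos by (intro integral_mono Ri icb Rb) auto
    also have "\<dots> = measure lebesgue (cball (centre K) (h + h))" by simp
    also have "\<dots> = face_const * h ^ DIM('a)"
    proof -
      have "(h + h) ^ DIM('a) = 2 ^ DIM('a) * h ^ DIM('a)" by (simp only: mult_2[symmetric] power_mult_distrib)
      moreover have "measure lebesgue (cball (centre K) (h + h)) = unit_ball_vol (real DIM('a)) * (h + h) ^ DIM('a)"
        using h_pos content_cball[of "h + h" "centre K"] by simp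
      ultimately show ?thesis by (simp only: face_const_def mult.assoc)
    qed
    also have "\<dots> = h * (face_const * h ^ (DIM('a) - 1))" using DIM_positive[where 'a='a] by (simp add: power_eq_if)
    finally show ?thesis using h_pos by simp
  qed
  assume g: "face_bounded K K' g"
  define G where "G y = indicator (slab \<nu> c 1) y * (indicator ?E (hproj \<nu> c y) * g (hproj \<nu> c y))" for y
  have Gm: "G \<in> borel_measurable borel"
  proof -
    have "(\<lambda>x. indicator ?E x * g x) \<in> borel_measurable borel" using g unfolding face_bounded_def by blast
    from borel_measurable_times[OF borel_measurable_indicator measurable_compose[OF hproj_measurable this]]
    show ?thesis unfolding G_def by simp
  qed
  have Gb: "\<bar>G y\<bar> \<le> B * R 1 y" if "\<And>x. x \<in> ?E \<Longrightarrow> \<bar>g x\<bar> \<le> B" for B y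
    using that[of "hproj \<nu> c y"] by (auto simp: G_def R_def indicator_def)
  have Gi: "integrable lborel G"
  proof -
    obtain B where B: "\<forall>x\<in>?E. \<bar>g x\<bar> \<le> B" using g unfolding face_bounded_def by blast
    then have "norm (G y) \<le> norm (B * R 1 y)" for y using Gb[of B y] by (auto intro: order_trans)
    then show ?thesis by (intro Bochner_Integration.integrable_bound[of _ "\<lambda>y. B * R 1 y" G]) (use Ri Gm in auto)
  qed
  then show "integrable lborel (\<lambda>y. indicator (slab \<nu> c 1) y * (indicator ?E (hproj \<nu> c y) * g (hproj \<nu> c y)))"
    unfolding G_def .
  assume B: "\<And>x. x \<in> ?E \<Longrightarrow> \<bar>g x\<bar> \<le> B" "B \<ge> 0"
  have "\<bar>face_int \<nu> c ?E g\<bar> \<le> (\<integral>y. \<bar>G y\<bar> \<partial>lborel)" unfolding face_int_def G_def[symmetric] by (rule integral_abs_bound)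
  also have "\<dots> \<le> (\<integral>y. B * R 1 y \<partial>lborel)"
    using Gi Ri Gb[OF B(1)] by (intro integral_mono) auto
  also have "\<dots> = B * (\<integral>y. R 1 y \<partial>lborel)" by simp
  also have "\<dots> \<le> B * (face_const * h ^ (DIM('a) - 1))" using R1 B(2) by (rule mult_left_mono)
  finally show "\<bar>face_int \<nu> c ?E g\<bar> \<le> B * face_const * h ^ (DIM('a) - 1)" by (simp only: mult.assoc)
qed

text \<open>Packages the hyperplane of a face with the evaluation of \<open>face_integral\<close>,
  so that several integrands can be treated with one choice of normal and height.\<close>

definition face_plane :: "'a set \<Rightarrow> 'a set \<Rightarrow> 'a \<Rightarrow> real \<Rightarrow> bool" where
  "face_plane K K' \<nu> c \<longleftrightarrow> norm \<nu> = 1 \<and> (\<forall>x\<in>K. \<nu> \<bullet> x \<le> c) \<and> (\<forall>x\<in>K'. c \<le> \<nu> \<bullet> x) \<and>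
     (\<forall>g. face_bounded K K' g \<longrightarrow> face_integral K K' g = face_int \<nu> c (K \<inter> K') g)"

lemma face_plane_exists:
  assumes "K \<in> T" "K' \<in> neighbours T K" shows "\<exists>\<nu> c. face_plane K K' \<nu> c"
proof (rule neighbours_normal[OF assms])
  fix \<nu> c
  assume 1: "norm \<nu> = 1" and 2: "\<And>x. x \<in> K \<Longrightarrow> \<nu> \<bullet> x \<le> c" and 3: "\<And>x. x \<in> K' \<Longrightarrow> c \<le> \<nu> \<bullet> x"
    and 4: "\<And>g. (\<lambda>x. indicator (K \<inter> K') x * g x) \<in> borel_measurable borel \<Longrightarrow> face_integral K K' g = face_int \<nu> c (K \<inter> K') g"
  show ?thesis unfolding face_plane_def face_bounded_def
    by (intro exI[of _ \<nu>] exI[of _ c] conjI ballI allI impI 1 2 3 4) simp_all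
qed

lemma face_planeD:
  assumes "face_plane K K' \<nu> c"
  shows "norm \<nu> = 1" "\<And>x. x \<in> K \<Longrightarrow> \<nu> \<bullet> x \<le> c" "\<And>x. x \<in> K' \<Longrightarrow> c \<le> \<nu> \<bullet> x"
    "\<And>g. face_bounded K K' g \<Longrightarrow> face_integral K K' g = face_int \<nu> c (K \<inter> K') g"
  using assms unfolding face_plane_def by simp_all

lemma face_integral_bound:
  assumes K: "K \<in> T" "K' \<in> neighbours T K" and g: "face_bounded K K' g" and B: "\<And>x. x \<in> K \<inter> K' \<Longrightarrow> \<bar>g x\<bar> \<le> B" "B \<ge> 0"
  shows "\<bar>face_integral K K' g\<bar> \<le> B * face_const * h ^ (DIM('a) - 1)"
proof -
  obtain \<nu> c where pl: "face_plane K K' \<nu> c" using face_plane_exists[OF K] by blast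
  note s = face_planeD(1-3)[OF pl] and e' = face_planeD(4)[OF pl]
  show ?thesis unfolding e'[OF g] by (rule face_int_props(2)[OF K(1) neighbours_T[OF K(2)] s g B])
qed

lemma face_integral_add:
  assumes K: "K \<in> T" "K' \<in> neighbours T K" and g: "face_bounded K K' g" "face_bounded K K' g'"
  shows "face_integral K K' (\<lambda>x. g x + g' x) = face_integral K K' g + face_integral K K' g'"
proof -
  obtain \<nu> c where pl: "face_plane K K' \<nu> c" using face_plane_exists[OF K] by blast
  note s = face_planeD(1-3)[OF pl] and e' = face_planeD(4)[OF pl]
  show ?thesis unfolding e'[OF g(1)] e'[OF g(2)] e'[OF face_bounded_add[OF g]] face_int_def
    using face_int_props(1)[OF K(1) neighbours_T[OF K(2)] s g(1)] face_int_props(1)[OF K(1) neighbours_T[OF K(2)] s g(2)]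
    by (simp add: distrib_left)
qed

lemma face_integral_cmult:
  assumes K: "K \<in> T" "K' \<in> neighbours T K" and g: "face_bounded K K' g"
  shows "face_integral K K' (\<lambda>x. r * g x) = r * face_integral K K' g"
proof -
  obtain \<nu> c where pl: "face_plane K K' \<nu> c" using face_plane_exists[OF K] by blast
  note s = face_planeD(1-3)[OF pl] and e' = face_planeD(4)[OF pl]
  have "face_bounded K K' (\<lambda>x. r * g x)"
    using face_bounded_mult[OF face_bounded_const g] K neighbours_T by blast
  then show ?thesis by (simp only: e' g face_int_cmult)
qed

lemma face_integral_sum:
  assumes K: "K \<in> T" "K' \<in> neighbours T K" and "finite I" "\<And>i. i \<in> I \<Longrightarrow> face_bounded K K' (g i)"
  shows "face_bounded K K' (\<lambda>x. \<Sum>i\<in>I. r i * g i x) \<and> face_integral K K' (\<lambda>x. \<Sum>i\<in>I. r i * g i x) = (\<Sum>i\<in>I. r i * face_integral K K' (g i))"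
  using assms(3,4)
proof (induction I rule: finite_induct)
  case empty
  have z: "face_bounded K K' (\<lambda>x. 0)" using face_bounded_const K neighbours_T by blast
  then show ?case using face_integral_cmult[OF K z, of 0] by simp
next
  case (insert i I)
  have 1: "face_bounded K K' (\<lambda>x. r i * g i x)"
    using face_bounded_mult[OF face_bounded_const insert.prems[of i]] K neighbours_T by blast
  have IH: "face_bounded K K' (\<lambda>x. \<Sum>i\<in>I. r i * g i x)" "face_integral K K' (\<lambda>x. \<Sum>i\<in>I. r i * g i x) = (\<Sum>i\<in>I. r i * face_integral K K' (g i))"
    using insert by auto
  show ?case using insert.hyps face_bounded_add[OF 1 IH(1)] face_integral_add[OF K 1 IH(1)] IH(2)
      face_integral_cmult[OF K insert.prems[of i]] by simp
qed

lemma flux_bounded: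
  assumes K: "K \<in> T" "K' \<in> neighbours T K" and u: "u \<in> broken_poly T k"
  shows "face_bounded K K' (F K K' u)"
proof -
  have K': "K' \<in> T" using K neighbours_T by blast
  have m: "F K K' u \<in> borel_measurable (restrict_space borel (K \<inter> K'))"
    using flux K u unfolding numerical_flux_def by blast
  have "K \<inter> K' \<inter> space borel \<in> sets borel" using cell K K' by simp
  from borel_measurable_restrict_space_iff[OF this, of "F K K' u"] m
  have 1: "(\<lambda>x. indicator (K \<inter> K') x * F K K' u x) \<in> borel_measurable borel" by (simp add: mult.commute)
  have "\<exists>B\<ge>0. \<forall>x\<in>Q. \<bar>u Q x\<bar> \<le> B" if Q: "Q \<in> T" for Q
    using C1_bounded[OF poly_space_C1[OF broken_poly_poly[OF u Q]] cell(3)[OF Q]] by metis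
  then obtain B B' where B: "B \<ge> 0" "\<forall>x\<in>K. \<bar>u K x\<bar> \<le> B" "B' \<ge> 0" "\<forall>x\<in>K'. \<bar>u K' x\<bar> \<le> B'" using K K' by metis
  define \<delta> where "\<delta> = B + B'"
  have d: "\<delta> \<ge> 0" "\<And>x. x \<in> K \<Longrightarrow> \<bar>u K x - 0\<bar> \<le> \<delta>" "\<And>x. x \<in> K' \<Longrightarrow> \<bar>u K' x - 0\<bar> \<le> \<delta>"
    using B by (force simp: \<delta>_def)+
  have "\<bar>F K K' u x\<bar> \<le> flux_lip * \<delta> + \<bar>f 0 \<bullet> outward_normal K K'\<bar>" if "x \<in> K \<inter> K'" for x
    using flux_near_const[OF K d(1) u d(2,3) that] by linarith
  then show ?thesis using 1 unfolding face_bounded_def by blast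
qed

section \<open>Well-posedness of the discrete divergence\<close>

lemma fgrad_integrable:
  assumes K: "K \<in> T" and u: "u \<in> broken_poly T k" and p: "C1 p"
  shows "integrable lborel (\<lambda>x. indicator K x * (f (u K x) \<bullet> grad p x))"
    "(\<lambda>x. f (u K x) \<bullet> grad p x) \<in> borel_measurable borel"
proof -
  have "continuous_on UNIV (\<lambda>x. f (u K x))"
    using continuous_on_compose2[OF f_continuous poly_space_continuous[OF broken_poly_poly[OF u K]]] by auto
  then have c: "continuous_on UNIV (\<lambda>x. f (u K x) \<bullet> grad p x)"
    using p unfolding C1_def by (intro continuous_intros) auto
  then show "(\<lambda>x. f (u K x) \<bullet> grad p x) \<in> borel_measurable borel" by (rule borel_measurable_continuous_onI)
  show "integrable lborel (\<lambda>x. indicator K x * (f (u K x) \<bullet> grad p x))"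
    using cell(3)[OF K] continuous_on_subset[OF c] by (intro integrable_on_compact) auto
qed

text \<open>The defining functional of \<open>dg_div\<close> localised to one cell and one test
  polynomial.\<close>

definition rhs :: "'a broken \<Rightarrow> 'a set \<Rightarrow> ('a \<Rightarrow> real) \<Rightarrow> real" where
  "rhs u K p = - (\<integral>x. indicator K x * (f (u K x) \<bullet> grad p x) \<partial>lborel)
     + (\<Sum>K'\<in>neighbours T K. face_integral K K' (\<lambda>x. F K K' u x * p x))"

text \<open>Linearity in the test function is what allows the functional to be represented by its
  values on an orthonormal basis.\<close>

lemma rhs_sum:
  assumes K: "K \<in> T" and u: "u \<in> broken_poly T k" and I: "finite I" "\<And>i. i \<in> I \<Longrightarrow> C1 (p i)"
  shows "rhs u K (\<lambda>x. \<Sum>i\<in>I. r i * p i x) = (\<Sum>i\<in>I. r i * rhs u K (p i))"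
proof -
  have g: "grad (\<lambda>x. \<Sum>i\<in>I. r i * p i x) x = (\<Sum>i\<in>I. r i *\<^sub>R grad (p i) x)" for x
  proof -
    have "grad (\<lambda>x. \<Sum>i\<in>I. r i * p i x) x = (\<Sum>i\<in>I. grad (\<lambda>x. r i * p i x) x)"
      using C1_sum[OF I(1), of "\<lambda>i x. r i * p i x"] C1_cmult(1)[OF I(2)] by auto
    also have "\<dots> = (\<Sum>i\<in>I. r i *\<^sub>R grad (p i) x)" using C1_cmult(2)[OF I(2)] by (intro sum.cong) auto
    finally show ?thesis .
  qed
  have 1: "(\<integral>x. indicator K x * (f (u K x) \<bullet> grad (\<lambda>x. \<Sum>i\<in>I. r i * p i x) x) \<partial>lborel)
      = (\<Sum>i\<in>I. r i * (\<integral>x. indicator K x * (f (u K x) \<bullet> grad (p i) x) \<partial>lborel))"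
  proof -
    have "(\<lambda>x. indicator K x * (f (u K x) \<bullet> grad (\<lambda>x. \<Sum>i\<in>I. r i * p i x) x))
      = (\<lambda>x. \<Sum>i\<in>I. r i * (indicator K x * (f (u K x) \<bullet> grad (p i) x)))"
      unfolding g by (rule ext) (simp add: inner_sum_right sum_distrib_left mult_ac)
    then show ?thesis using fgrad_integrable(1)[OF K u I(2)] by (simp add: Bochner_Integration.integral_sum)
  qed
  have 2: "face_integral K K' (\<lambda>x. F K K' u x * (\<Sum>i\<in>I. r i * p i x)) = (\<Sum>i\<in>I. r i * face_integral K K' (\<lambda>x. F K K' u x * p i x))"
    if K': "K' \<in> neighbours T K" for K'
  proof -
    have "face_bounded K K' (\<lambda>x. F K K' u x * p i x)" if "i \<in> I" for i
      using K neighbours_T[OF K'] C1_continuous[OF I(2)[OF that]]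
      by (intro face_bounded_mult flux_bounded[OF K K' u] face_bounded_continuous)
    from face_integral_sum[OF K K' I(1) this, where r=r, THEN conjunct2]
    show ?thesis by (simp only: sum_distrib_left mult.left_commute)
  qed
  have "(\<Sum>K'\<in>neighbours T K. face_integral K K' (\<lambda>x. F K K' u x * (\<Sum>i\<in>I. r i * p i x)))
    = (\<Sum>i\<in>I. r i * (\<Sum>K'\<in>neighbours T K. face_integral K K' (\<lambda>x. F K K' u x * p i x)))"
    unfolding sum_distrib_left[of _ _ "neighbours T K"] by (subst sum.swap) (rule sum.cong[OF refl 2])
  then show ?thesis unfolding rhs_def 1 by (simp only: distrib_left sum.distrib sum_negf mult_minus_right)
qed

lemma ip_set_integral:
  assumes "K \<in> T" "p \<in> poly_space l" "q \<in> poly_space m"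
  shows "(LINT x:K|lebesgue. p x * q x) = ip K p q"
  unfolding ip_def using assms cell(8) poly_space_measurable by (intro set_integral_lborel borel_measurable_times) auto

text \<open>Justifies the definite description in \<open>dg_div\<close>. A solution exists because a
  linear functional on the polynomials of a cell is represented by its values on an orthonormal
  basis; two solutions differ on each cell by a polynomial orthogonal to itself.\<close>

lemma dg_div:
  assumes u: "u \<in> broken_poly T k"
  shows "dg_div T f F l u \<in> broken_poly T l"
    and "K \<in> T \<Longrightarrow> p \<in> poly_space l \<Longrightarrow> ip K (dg_div T f F l u K) p = rhs u K p"
proof -
  define P where "P w \<longleftrightarrow> w \<in> broken_poly T l \<and>
     (\<forall>v\<in>broken_poly T l. \<forall>K\<in>T.
        (LINT x:K|lebesgue. w K x * v K x) =
          - (LINT x:K|lebesgue. f (u K x) \<bullet> grad (v K) x)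
          + (\<Sum>K'\<in>neighbours T K. face_integral K K' (\<lambda>x. F K K' u x * v K x)))" for w
  define Q where "Q w \<longleftrightarrow> w \<in> broken_poly T l \<and> (\<forall>K\<in>T. \<forall>p\<in>poly_space l. ip K (w K) p = rhs u K p)" for w
  \<comment> \<open>Broken test functions reduce to single polynomials on single cells: the same
    polynomial placed on all cells is an admissible test function.\<close>
  have PQ: "P w \<longleftrightarrow> Q w" for w
  proof -
    have eq: "((LINT x:K|lebesgue. w K x * v K x) =
          - (LINT x:K|lebesgue. f (u K x) \<bullet> grad (v K) x)
          + (\<Sum>K'\<in>neighbours T K. face_integral K K' (\<lambda>x. F K K' u x * v K x)))
      \<longleftrightarrow> ip K (w K) (v K) = rhs u K (v K)" if "w \<in> broken_poly T l" "v \<in> broken_poly T l" "K \<in> T" for v K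
      using ip_set_integral[OF that(3) broken_poly_poly[OF that(1,3)] broken_poly_poly[OF that(2,3)]]
        set_integral_lborel[OF cell(8)[OF that(3)] fgrad_integrable(2)[OF that(3) u poly_space_C1[OF broken_poly_poly[OF that(2,3)]]]]
      unfolding rhs_def by simp
    show ?thesis
    proof
      assume P: "P w"
      show "Q w" unfolding Q_def
      proof (intro conjI ballI)
        show w: "w \<in> broken_poly T l" using P unfolding P_def by blast
        fix K and p :: "'a \<Rightarrow> real" assume K: "K \<in> T" and p: "p \<in> poly_space l"
        have v: "(\<lambda>K\<in>T. p) \<in> broken_poly T l" unfolding broken_poly_def using p by auto
        have "(\<lambda>K\<in>T. p) K = p" using K by simp
        then show "ip K (w K) p = rhs u K p"
          using P[unfolded P_def, THEN conjunct2, THEN bspec, OF v, THEN bspec, OF K] eq[OF w v K] by simp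
      qed
    next
      assume Q: "Q w"
      then have w: "w \<in> broken_poly T l" unfolding Q_def by blast
      then show "P w" unfolding P_def using eq[OF w] Q[unfolded Q_def, THEN conjunct2] broken_poly_poly by simp
    qed
  qed
  have "\<forall>K\<in>T. \<exists>E. orthonormal_basis K l E" using orthonormal_basis_exists cell(3,6) by metis
  from bchoice[OF this] obtain E where E: "\<And>K. K \<in> T \<Longrightarrow> orthonormal_basis K l (E K)" by blast
  \<comment> \<open>The Riesz representative on each cell, with the values of the functional on the
    basis as coefficients.\<close>
  define w where "w = (\<lambda>K\<in>T. \<lambda>x. \<Sum>e\<in>E K. rhs u K e * e x)"
  have "Q w" unfolding Q_def
  proof (intro conjI ballI)
    show "w \<in> broken_poly T l"
      unfolding broken_poly_def w_def
    proof (rule restrict_PiE_iff[THEN iffD2], intro ballI)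
      fix K assume "K \<in> T"
      note E = orthonormal_basisD[OF E[OF this]]
      show "(\<lambda>x. \<Sum>e\<in>E K. rhs u K e * e x) \<in> poly_space l" using E(2) by (intro poly_space_sum poly_space_cmult) auto
    qed
    fix K and p :: "'a \<Rightarrow> real" assume K: "K \<in> T" and p: "p \<in> poly_space l"
    note E = orthonormal_basisD[OF E[OF K]]
    have C1E: "C1 e" if "e \<in> E K" for e using E(2) that poly_space_C1 by blast
    have "ip K (w K) p = (\<Sum>e\<in>E K. rhs u K e * ip K e p)"
      unfolding w_def using K E(1,2) p cell(3)[OF K] by (simp, intro ip_sum) auto
    also have "\<dots> = (\<Sum>e\<in>E K. ip K p e * rhs u K e)" by (simp add: ip_commute[of K p] mult.commute)
    also have "\<dots> = rhs u K (\<lambda>x. \<Sum>e\<in>E K. ip K p e * e x)"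
      using rhs_sum[OF K u E(1), of "\<lambda>e. e"] C1E by simp
    also have "(\<lambda>x. \<Sum>e\<in>E K. ip K p e * e x) = p" by (rule ext, rule E(4)[OF p, symmetric])
    finally show "ip K (w K) p = rhs u K p" .
  qed
  moreover have "w1 = w2" if Q1: "Q w1" and Q2: "Q w2" for w1 w2
  proof (rule PiE_ext)
    show "w1 \<in> (\<Pi>\<^sub>E K\<in>T. poly_space l)" "w2 \<in> (\<Pi>\<^sub>E K\<in>T. poly_space l)"
      using Q1 Q2 unfolding Q_def broken_poly_def by blast+
    fix K assume K: "K \<in> T"
    have p: "w1 K \<in> poly_space l" "w2 K \<in> poly_space l" using Q1 Q2 broken_poly_poly K unfolding Q_def by blast+
    have d: "(\<lambda>x. w1 K x - w2 K x) \<in> poly_space l" by (rule poly_space_diff[OF p])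
    have "ip K (\<lambda>x. w1 K x - w2 K x) (\<lambda>x. w1 K x - w2 K x) = ip K (w1 K) (\<lambda>x. w1 K x - w2 K x) - ip K (w2 K) (\<lambda>x. w1 K x - w2 K x)"
      by (rule ip_diff[OF cell(3)[OF K] p d])
    also have "\<dots> = 0" using Q1 Q2 K d unfolding Q_def by simp
    finally have "w1 K x - w2 K x = 0" for x using ip_eq_0[OF cell(3)[OF K] cell(6)[OF K] d] by blast
    then show "w1 K = w2 K" by (simp add: fun_eq_iff)
  qed
  ultimately have "\<exists>!w. Q w" by blast
  moreover have "dg_div T f F l u = (THE w. Q w)"
    unfolding dg_div_def using PQ unfolding P_def by simp
  ultimately have "Q (dg_div T f F l u)" by (metis theI')
  then show "dg_div T f F l u \<in> broken_poly T l" "K \<in> T \<Longrightarrow> p \<in> poly_space l \<Longrightarrow> ip K (dg_div T f F l u K) p = rhs u K p"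
    unfolding Q_def by blast+
qed

section \<open>Size of the discrete divergence near a constant state\<close>

definition face_count :: real where "face_count = (2 / \<sigma>\<^sup>2) ^ DIM('a)"

lemma face_count: "face_count \<ge> 0" unfolding face_count_def by simp

text \<open>For the constant vector \<open>f c\<close> the divergence theorem turns the volume
  integral into face integrals with the exact normal flux. On each face the two fluxes differ by at
  most \<open>flux_lip * \<delta>\<close>; the numbers and areas of faces give the remaining
  factors.\<close>

lemma flux_consistency:
  assumes K: "K \<in> T" and u: "u \<in> broken_poly T k" and \<delta>: "\<delta> \<ge> 0" "\<And>x. x \<in> K \<Longrightarrow> \<bar>u K x - c\<bar> \<le> \<delta>"
    "\<And>K' x. K' \<in> neighbours T K \<Longrightarrow> x \<in> K' \<Longrightarrow> \<bar>u K' x - c\<bar> \<le> \<delta>"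
    and p: "C1 p" and M: "\<And>x. x \<in> K \<Longrightarrow> \<bar>p x\<bar> \<le> M" "M \<ge> 0"
  shows "\<bar>(\<Sum>K'\<in>neighbours T K. face_integral K K' (\<lambda>x. F K K' u x * p x)) - (\<integral>x. indicator K x * (f c \<bullet> grad p x) \<partial>lborel)\<bar>
    \<le> face_count * face_const * flux_lip * h ^ (DIM('a) - 1) * \<delta> * M"
proof -
  have "(LINT x:K|lebesgue. grad p x \<bullet> f c) = (\<Sum>K'\<in>neighbours T K. (f c \<bullet> outward_normal K K') * face_integral K K' p)"
    using p unfolding C1_def by (intro divergence_theorem[OF K]) auto
  moreover have "(LINT x:K|lebesgue. grad p x \<bullet> f c) = (\<integral>x. indicator K x * (grad p x \<bullet> f c) \<partial>lborel)"
    using p unfolding C1_def by (intro set_integral_lborel[OF cell(8)[OF K]] borel_measurable_continuous_onI continuous_intros) auto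
  ultimately have e: "(\<integral>x. indicator K x * (f c \<bullet> grad p x) \<partial>lborel) = (\<Sum>K'\<in>neighbours T K. (f c \<bullet> outward_normal K K') * face_integral K K' p)"
    by (simp add: inner_commute)
  have b: "\<bar>face_integral K K' (\<lambda>x. F K K' u x * p x) - (f c \<bullet> outward_normal K K') * face_integral K K' p\<bar> \<le> flux_lip * \<delta> * M * face_const * h ^ (DIM('a) - 1)"
    if K': "K' \<in> neighbours T K" for K'
  proof -
    let ?r = "- (f c \<bullet> outward_normal K K')"
    have T': "K' \<in> T" using K' neighbours_T by blast
    have fp: "face_bounded K K' p" using face_bounded_continuous[OF K T' C1_continuous[OF p]] .
    have f1: "face_bounded K K' (\<lambda>x. F K K' u x * p x)" by (rule face_bounded_mult[OF flux_bounded[OF K K' u] fp])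
    have f2: "face_bounded K K' (\<lambda>x. ?r * p x)" by (rule face_bounded_mult[OF face_bounded_const[OF K T'] fp])
    have "face_integral K K' (\<lambda>x. F K K' u x * p x) - (f c \<bullet> outward_normal K K') * face_integral K K' p
      = face_integral K K' (\<lambda>x. F K K' u x * p x + ?r * p x)"
      unfolding face_integral_add[OF K K' f1 f2] face_integral_cmult[OF K K' fp] by simp
    moreover have "\<bar>F K K' u x * p x + ?r * p x\<bar> \<le> flux_lip * \<delta> * M" if x: "x \<in> K \<inter> K'" for x
    proof -
      have "\<bar>F K K' u x + ?r\<bar> \<le> flux_lip * \<delta>" using flux_near_const[OF K K' \<delta>(1) u \<delta>(2) \<delta>(3)[OF K'] x] by simp
      then have "\<bar>F K K' u x + ?r\<bar> * \<bar>p x\<bar> \<le> flux_lip * \<delta> * M" using M x \<delta>(1) by (intro mult_mono) (auto simp: flux_lip_def)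
      then show ?thesis by (simp only: abs_mult[symmetric] distrib_right)
    qed
    ultimately show ?thesis
      using face_integral_bound[OF K K' face_bounded_add[OF f1 f2], of "flux_lip * \<delta> * M"] M(2) \<delta>(1) by (simp add: flux_lip_def)
  qed
  have "\<bar>(\<Sum>K'\<in>neighbours T K. face_integral K K' (\<lambda>x. F K K' u x * p x)) - (\<integral>x. indicator K x * (f c \<bullet> grad p x) \<partial>lborel)\<bar>
    \<le> (\<Sum>K'\<in>neighbours T K. \<bar>face_integral K K' (\<lambda>x. F K K' u x * p x) - (f c \<bullet> outward_normal K K') * face_integral K K' p\<bar>)"
    unfolding e sum_subtractf[symmetric] by (rule sum_abs)
  also have "\<dots> \<le> (\<Sum>K'\<in>neighbours T K. flux_lip * \<delta> * M * face_const * h ^ (DIM('a) - 1))" using b by (rule sum_mono)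
  also have "\<dots> = real (card (neighbours T K)) * (flux_lip * \<delta> * M * face_const * h ^ (DIM('a) - 1))" by simp
  also have "\<dots> \<le> face_count * (flux_lip * \<delta> * M * face_const * h ^ (DIM('a) - 1))"
    using neighbours_card[OF K] M(2) \<delta>(1) face_const h_pos unfolding face_count_def by (intro mult_right_mono mult_nonneg_nonneg) (auto simp: flux_lip_def)
  finally show ?thesis by (simp add: mult_ac)
qed

definition ball_const :: real where "ball_const = unit_ball_vol (real DIM('a))"

lemma ball_const: "ball_const \<ge> 0" unfolding ball_const_def by (simp add: less_imp_le)

lemma cell_volume: assumes "K \<in> T" shows "(\<integral>x. indicator K x \<partial>lborel) \<le> ball_const * h ^ DIM('a)"
proof -
  have "(\<integral>x. indicator K x \<partial>lborel) \<le> (\<integral>x. (indicator (cball (centre K) h) x :: real) \<partial>(lborel :: 'a measure))"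
  proof (rule integral_mono)
    show "integrable lborel (indicator K :: 'a \<Rightarrow> real)" using integrable_on_compact[OF cell(3)[OF assms], of "\<lambda>x. 1"] by simp
    show "integrable lborel (indicator (cball (centre K) h) :: 'a \<Rightarrow> real)"
      using integrable_on_compact[OF compact_cball[of "centre K" h], of "\<lambda>x. 1"] by simp
    fix x show "indicator K x \<le> (indicator (cball (centre K) h) x :: real)"
      using cell_subset_cball[OF assms centre_in[OF assms]] by (auto simp: indicator_def)
  qed
  also have "\<dots> = measure lebesgue (cball (centre K) h)" by simp
  also have "\<dots> = ball_const * h ^ DIM('a)" using h_pos content_cball[of h "centre K"] by (simp add: ball_const_def)
  finally show ?thesis .
qed

lemma integral_cell_bound:
  assumes K: "K \<in> T" and g: "continuous_on UNIV g" and M: "\<And>x. x \<in> K \<Longrightarrow> \<bar>g x\<bar> \<le> M" "M \<ge> 0"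
  shows "\<bar>\<integral>x. indicator K x * g x \<partial>lborel\<bar> \<le> M * ball_const * h ^ DIM('a)"
proof -
  have c: "compact K" by (rule cell(3)[OF K])
  have i: "integrable lborel (\<lambda>x. indicator K x * g x)" using integrable_on_compact[OF c continuous_on_subset[OF g]] by auto
  have "\<bar>\<integral>x. indicator K x * g x \<partial>lborel\<bar> \<le> (\<integral>x. \<bar>indicator K x * g x\<bar> \<partial>lborel)" by (rule integral_abs_bound)
  also have "\<dots> \<le> (\<integral>x. indicator K x * M \<partial>lborel)"
    using i integrable_on_compact[OF c, of "\<lambda>x. M"] M by (intro integral_mono integrable_abs) (auto simp: indicator_def)
  also have "\<dots> = (\<integral>x. indicator K x \<partial>lborel) * M" by simp
  also have "\<dots> \<le> (ball_const * h ^ DIM('a)) * M" using cell_volume[OF K] M(2) by (rule mult_right_mono)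
  finally show ?thesis by (simp add: mult_ac)
qed

text \<open>The outer \<open>Ci\<close> comes from the inverse estimate for a square. The first
  summand comes from the volume term, with a second \<open>Ci\<close> for the gradient; the second
  summand comes from the faces.\<close>

definition div_const :: real where "div_const = Ci * (L * Ci * ball_const * ball_const + face_count * face_const * flux_lip)"

lemma div_const: "div_const \<ge> 0" unfolding div_const_def using Ci L0 ball_const face_count face_const by (simp add: flux_lip_def)

text \<open>By the divergence theorem the fluxes may be replaced by their differences to those of
  the constant \<open>c\<close>. Testing with \<open>w\<close> itself bounds its square integral by
  a multiple of \<open>\<delta>\<close> times its maximum \<open>S\<close>, while the inverse
  estimate for the square of \<open>w\<close> bounds \<open>S * S\<close> by that integral. Dividing
  by \<open>S\<close> leaves a bound linear in \<open>\<delta>\<close>, with the factor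
  \<open>1 / h\<close> typical of a first derivative.\<close>

lemma dg_div_bound:
  assumes K: "K \<in> T" and u: "u \<in> broken_poly T k" and \<delta>: "\<delta> \<ge> 0" "\<And>x. x \<in> K \<Longrightarrow> \<bar>u K x - c\<bar> \<le> \<delta>"
    "\<And>K' x. K' \<in> neighbours T K \<Longrightarrow> x \<in> K' \<Longrightarrow> \<bar>u K' x - c\<bar> \<le> \<delta>" and l: "l \<le> k" and x: "x \<in> K"
  shows "\<bar>dg_div T f F l u K x\<bar> \<le> div_const / h * \<delta>"
proof -
  define w where "w = dg_div T f F l u K"
  have w: "w \<in> poly_space l" unfolding w_def using dg_div(1)[OF u] broken_poly_poly K by blast
  have w2k: "w \<in> poly_space (2 * k)" by (rule poly_space_mono[OF w]) (use l in simp)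
  have C1w: "C1 w" using w by (rule poly_space_C1)
  have "continuous_on K (\<lambda>x. \<bar>w x\<bar>)" by (intro continuous_intros poly_space_continuous[OF w])
  \<comment> \<open>The inverse estimate for the square of \<open>w\<close> is evaluated at a
    maximum point.\<close>
  from continuous_attains_sup[OF cell(3)[OF K] cell(7)[OF K] this]
  obtain y where y: "y \<in> K" and yS: "\<forall>x\<in>K. \<bar>w x\<bar> \<le> \<bar>w y\<bar>" by (elim bexE) (rule that)
  define S where "S = \<bar>w y\<bar>"
  define d where "d = DIM('a)"
  have d: "h ^ d = h * h ^ (d - 1)" "h ^ d > 0" "h ^ (d - 1) > 0"
    proof -
    have "d = Suc (d - 1)" unfolding d_def using DIM_positive[where 'a='a] by (metis Suc_pred')
    then show "h ^ d = h * h ^ (d - 1)" by (metis power_Suc)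
  qed (use h_pos in simp_all)
  have S: "S \<ge> 0" "\<And>x. x \<in> K \<Longrightarrow> \<bar>w x\<bar> \<le> S" unfolding S_def by (rule abs_ge_zero, rule bspec[OF yS])
  have gw: "norm (grad w x) \<le> Ci * ball_const * S / h" if "x \<in> K" for x
  proof -
    have "\<bar>\<integral>x. indicator K x * \<bar>w x\<bar> \<partial>lborel\<bar> \<le> S * ball_const * h ^ d"
      unfolding d_def using S by (intro integral_cell_bound[OF K] continuous_intros poly_space_continuous[OF w]) auto
    then have 1: "(\<integral>x. indicator K x * \<bar>w x\<bar> \<partial>lborel) \<le> S * ball_const * h ^ d" by linarith
    have "norm (grad w x) \<le> Ci / h ^ (d + 1) * (\<integral>x. indicator K x * \<bar>w x\<bar> \<partial>lborel)"
      using inverse[OF K w2k that] unfolding d_def by simp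
    also have "\<dots> \<le> Ci / h ^ (d + 1) * (S * ball_const * h ^ d)" using 1 Ci h_pos by (intro mult_left_mono) auto
    also have "\<dots> = Ci * ball_const * S / h" using h_pos by (simp add: field_simps)
    finally show ?thesis .
  qed
  \<comment> \<open>Subtracting the constant flux leaves the factor \<open>\<delta>\<close>; the
    gradient of \<open>w\<close> costs \<open>1 / h\<close> by the inverse estimate.\<close>
  have 1: "\<bar>\<integral>x. indicator K x * ((f (u K x) - f c) \<bullet> grad w x) \<partial>lborel\<bar> \<le> (L * \<delta> * (Ci * ball_const * S / h)) * ball_const * h ^ d"
    unfolding d_def
  proof (rule integral_cell_bound[OF K])
    have "continuous_on UNIV (\<lambda>x. f (u K x))"
      using continuous_on_compose2[OF f_continuous poly_space_continuous[OF broken_poly_poly[OF u K]]] by auto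
    then show "continuous_on UNIV (\<lambda>x. (f (u K x) - f c) \<bullet> grad w x)"
      using C1w unfolding C1_def by (intro continuous_intros) auto
    show "0 \<le> L * \<delta> * (Ci * ball_const * S / h)" using L0 \<delta>(1) Ci ball_const S h_pos by simp
    fix x assume x: "x \<in> K"
    have "\<bar>(f (u K x) - f c) \<bullet> grad w x\<bar> \<le> norm (f (u K x) - f c) * norm (grad w x)" by (rule Cauchy_Schwarz_ineq2)
    also have "\<dots> \<le> (L * \<delta>) * (Ci * ball_const * S / h)"
    proof (rule mult_mono)
      show "norm (f (u K x) - f c) \<le> L * \<delta>" using f_lip[of "u K x" c] mult_left_mono[OF \<delta>(2)[OF x] L0] by linarith
    qed (use gw[OF x] L0 \<delta>(1) in auto)
    finally show "\<bar>(f (u K x) - f c) \<bullet> grad w x\<bar> \<le> L * \<delta> * (Ci * ball_const * S / h)" .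
  qed
  have 2: "\<bar>(\<Sum>K'\<in>neighbours T K. face_integral K K' (\<lambda>x. F K K' u x * w x)) - (\<integral>x. indicator K x * (f c \<bullet> grad w x) \<partial>lborel)\<bar>
    \<le> face_count * face_const * flux_lip * h ^ (d - 1) * \<delta> * S"
    unfolding d_def using S by (intro flux_consistency[OF K u \<delta> C1w])
  have "(\<integral>x. indicator K x * ((f (u K x) - f c) \<bullet> grad w x) \<partial>lborel)
     = (\<integral>x. indicator K x * (f (u K x) \<bullet> grad w x) \<partial>lborel) - (\<integral>x. indicator K x * (f c \<bullet> grad w x) \<partial>lborel)"
  proof -
    have "continuous_on UNIV (\<lambda>x. f c \<bullet> grad w x)" using C1w unfolding C1_def by (intro continuous_intros) auto
    then have "integrable lborel (\<lambda>x. indicator K x * (f c \<bullet> grad w x))"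
      using integrable_on_compact[OF cell(3)[OF K]] continuous_on_subset by blast
    then show ?thesis using fgrad_integrable(1)[OF K u C1w] by (simp add: inner_diff_left right_diff_distrib)
  qed
  then have "ip K w w = - (\<integral>x. indicator K x * ((f (u K x) - f c) \<bullet> grad w x) \<partial>lborel) +
     ((\<Sum>K'\<in>neighbours T K. face_integral K K' (\<lambda>x. F K K' u x * w x)) - (\<integral>x. indicator K x * (f c \<bullet> grad w x) \<partial>lborel))"
    using dg_div(2)[OF u K w] unfolding w_def[symmetric] rhs_def by simp
  then have ipw: "ip K w w \<le> (L * \<delta> * (Ci * ball_const * S / h)) * ball_const * h ^ d + face_count * face_const * flux_lip * h ^ (d - 1) * \<delta> * S"
    using 1 2 by linarith
  have "(\<lambda>x. w x * w x) \<in> poly_space (2 * k)"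
    by (rule poly_space_mono[OF poly_space_mult[OF w w]]) (use l in simp)
  from inverse[OF K this y] have "\<bar>w y * w y\<bar> \<le> Ci / h ^ d * (\<integral>x. indicator K x * \<bar>w x * w x\<bar> \<partial>lborel)" unfolding d_def by blast
  then have "S * S \<le> Ci / h ^ d * ip K w w" by (simp add: S_def abs_mult ip_def)
  also have "\<dots> \<le> Ci / h ^ d * ((L * \<delta> * (Ci * ball_const * S / h)) * ball_const * h ^ d + face_count * face_const * flux_lip * h ^ (d - 1) * \<delta> * S)"
    using ipw Ci d by (intro mult_left_mono) auto
  also have "\<dots> = (div_const / h * \<delta>) * S"
    using h_pos d(3) unfolding div_const_def d(1) by (simp add: field_simps)
  finally have SS: "S * S \<le> (div_const / h * \<delta>) * S" .
  have "S \<le> div_const / h * \<delta>"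
  proof (cases "S = 0")
    case True
    then show ?thesis using div_const h_pos \<delta>(1) by simp
  next
    case False
    then have "S > 0" using S(1) by simp
    from SS this show ?thesis by (rule mult_right_le_imp_le)
  qed
  then show ?thesis using S(2)[OF x] unfolding w_def by linarith
qed

end

section \<open>Runge--Kutta stages and the one-step estimate\<close>

lemma face_integral_cong:
  assumes "\<And>x. x \<in> K \<inter> K' \<Longrightarrow> g x = g' x" shows "face_integral K K' g = face_integral K K' g'"
proof -
  have "(\<lambda>x. indicator (K \<inter> K') x *\<^sub>R g x) = (\<lambda>x. indicator (K \<inter> K') x *\<^sub>R g' x)"
    using assms by (auto simp: indicator_def fun_eq_iff)
  then show ?thesis unfolding face_integral_def set_lebesgue_integral_def by simp
qed

locale sdrkdg = dg_discretization T \<sigma> f F k C L Ci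
  for T :: "'a::euclidean_space set set" and \<sigma> :: real
  and f :: "real \<Rightarrow> 'a" and F :: "'a num_flux" and k :: nat and C L Ci :: real +
  fixes s :: nat and A :: "nat \<Rightarrow> nat \<Rightarrow> real" and b :: "nat \<Rightarrow> real" and d :: "nat \<Rightarrow> nat \<Rightarrow> nat" and e :: "nat \<Rightarrow> nat"
    and \<tau> lam :: real
  assumes rk: "explicit_RK s A b" and degrees: "stage_degrees k s d e"
    and \<tau>: "\<tau> > 0" and cfl: "\<tau> / mesh_size T \<le> lam"
begin

lemma lam: "\<tau> \<le> lam * h" "lam > 0"
proof -
  show 1: "\<tau> \<le> lam * h" using cfl h_pos by (simp add: pos_divide_le_eq)
  then have "0 < lam * h" using \<tau> by linarith
  then show "lam > 0" using h_pos by (simp add: zero_less_mult_iff)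
qed

lemma sum_b: "(\<Sum>i=1..s. b i) = 1" using rk unfolding explicit_RK_def by blast

lemma degrees_le:
  shows "i \<in> {1..s} \<Longrightarrow> j \<in> {1..<i} \<Longrightarrow> d i j \<le> k" "i \<in> {1..s} \<Longrightarrow> e i \<le> k"
proof -
  show "d i j \<le> k" if "i \<in> {1..s}" "j \<in> {1..<i}"
    using degrees that unfolding stage_degrees_def by fastforce
  show "e i \<le> k" if "i \<in> {1..s}"
  proof (cases "i = s")
    case True
    then show ?thesis using degrees unfolding stage_degrees_def by simp
  next
    case False
    then have "i \<in> {1..<s}" using that by auto
    then show ?thesis using degrees unfolding stage_degrees_def by fastforce
  qed
qed

text \<open>The bound concerns cells contained in the ball, so passing from a cell to its neighbours
  costs \<open>h\<close> in the radius. This tracks the discrete domain of dependence.\<close>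

definition good :: "'a broken \<Rightarrow> real \<Rightarrow> real \<Rightarrow> 'a \<Rightarrow> real \<Rightarrow> bool" where
  "good u c \<delta> x0 r \<longleftrightarrow> (\<forall>K\<in>T. K \<subseteq> cball x0 r \<longrightarrow> (\<forall>x\<in>K. \<bar>u K x - c\<bar> \<le> \<delta>))"

lemma goodD: "good u c \<delta> x0 r \<Longrightarrow> K \<in> T \<Longrightarrow> K \<subseteq> cball x0 r \<Longrightarrow> x \<in> K \<Longrightarrow> \<bar>u K x - c\<bar> \<le> \<delta>"
  unfolding good_def by blast

lemma neighbour_subset_cball:
  assumes "K' \<in> neighbours T K" "K \<subseteq> cball x0 r" shows "K' \<subseteq> cball x0 (r + h)"
proof -
  have "K' \<in> near (cball x0 r)" using neighbours_subset_near assms unfolding near_def by blast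
  then show ?thesis by (rule near_subset)
qed

text \<open>\<open>lam\<close> bounds the ratio of \<open>\<tau>\<close> to \<open>h\<close>, so a
  stage update with discrete divergences of size \<open>div_const / h * D\<close> changes values by
  at most \<open>stage_growth * D\<close>.\<close>

definition stage_growth :: real where "stage_growth = lam * div_const * (\<Sum>i\<in>{1..s}. \<Sum>j\<in>{1..s}. \<bar>A i j\<bar>)"

lemma stage_growth: "stage_growth \<ge> 0" unfolding stage_growth_def using lam div_const by (intro mult_nonneg_nonneg sum_nonneg) auto

definition stages :: "'a broken \<Rightarrow> (nat \<Rightarrow> 'a broken) \<Rightarrow> bool" where
  "stages u U \<longleftrightarrow> (\<forall>i\<in>{1..s}. U i =
           (\<lambda>K\<in>T. \<lambda>x. u K x - \<tau> * (\<Sum>j=1..<i. A i j * dg_div T f F (d i j) (U j) K x)))"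

lemma stage_broken:
  assumes u: "u \<in> broken_poly T k" and U: "stages u U"
  shows "i \<in> {1..s} \<Longrightarrow> U i \<in> broken_poly T k"
proof (induction i rule: less_induct)
  case (less i)
  have Ui: "U i = (\<lambda>K\<in>T. \<lambda>x. u K x - \<tau> * (\<Sum>j=1..<i. A i j * dg_div T f F (d i j) (U j) K x))"
    using U less.prems unfolding stages_def by blast
  show ?case unfolding Ui broken_poly_def
  proof (rule restrict_PiE_iff[THEN iffD2], intro ballI)
    fix K assume K: "K \<in> T"
    show "(\<lambda>x. u K x - \<tau> * (\<Sum>j=1..<i. A i j * dg_div T f F (d i j) (U j) K x)) \<in> poly_space k"
    proof (intro poly_space_diff poly_space_cmult poly_space_sum broken_poly_poly[OF u K])
      fix j assume j: "j \<in> {1..<i}"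
      then have "U j \<in> broken_poly T k" using less by auto
      then have "dg_div T f F (d i j) (U j) K \<in> poly_space (d i j)" using dg_div(1) broken_poly_poly K by blast
      then show "dg_div T f F (d i j) (U j) K \<in> poly_space k"
        by (rule poly_space_mono) (rule degrees_le(1)[OF less.prems j])
    qed
  qed
qed

text \<open>A stage uses the earlier stages on the cell and its neighbours, so the radius shrinks by
  \<open>h\<close> per stage while the deviation grows by the factor
  \<open>1 + stage_growth\<close>.\<close>

lemma stage_good:
  assumes u: "u \<in> broken_poly T k" and U: "stages u U" and g: "good u c \<delta> x0 r" and \<delta>: "\<delta> \<ge> 0"
  shows "i \<in> {1..s} \<Longrightarrow> good (U i) c ((1 + stage_growth) ^ i * \<delta>) x0 (r - real i * h)"
proof (induction i rule: less_induct)
  case (less i)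
  have Ui: "U i = (\<lambda>K\<in>T. \<lambda>x. u K x - \<tau> * (\<Sum>j=1..<i. A i j * dg_div T f F (d i j) (U j) K x))"
    using U less.prems unfolding stages_def by blast
  \<comment> \<open>Dominates the deviations of all earlier stages and of \<open>u\<close> itself;
    for \<open>i = 1\<close> it equals \<open>\<delta>\<close>.\<close>
  define D where "D = (1 + stage_growth) ^ (i - 1) * \<delta>"
  have D: "D \<ge> 0" using stage_growth \<delta> by (simp add: D_def)
  show ?case unfolding good_def
  proof (intro ballI impI)
    fix K x assume K: "K \<in> T" and Kr: "K \<subseteq> cball x0 (r - real i * h)" and x: "x \<in> K"
    have bj: "\<bar>dg_div T f F (d i j) (U j) K x\<bar> \<le> div_const / h * D" if j: "j \<in> {1..<i}" for j
    proof -
      have js: "j \<in> {1..s}" "j < i" using j less.prems by auto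
      note gj = less.IH[OF js(2,1)]
      have le: "(1 + stage_growth) ^ j * \<delta> \<le> D" unfolding D_def using stage_growth \<delta> js(2) by (intro mult_right_mono power_increasing) auto
      \<comment> \<open>Room for the neighbours: stage \<open>j\<close> is controlled on a radius
        larger by at least \<open>h\<close>.\<close>
      have hle: "(r - real i * h) + h \<le> r - real j * h"
      proof -
        have "(real j + 1) * h \<le> real i * h" using js(2) h_pos by (intro mult_right_mono) auto
        then show ?thesis by (simp add: algebra_simps)
      qed
      show ?thesis
      proof (rule dg_div_bound[OF K stage_broken[OF u U js(1)] D _ _ degrees_le(1)[OF less.prems j] x])
        fix y assume "y \<in> K"
        moreover have "K \<subseteq> cball x0 (r - real j * h)" using Kr hle h_pos by (meson add_increasing2 less_imp_le order_trans order_refl subset_cball)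
        ultimately have "\<bar>U j K y - c\<bar> \<le> (1 + stage_growth) ^ j * \<delta>" using goodD[OF gj K] by blast
        then show "\<bar>U j K y - c\<bar> \<le> D" using le by linarith
      next
        fix K' y assume K': "K' \<in> neighbours T K" and y: "y \<in> K'"
        have "K' \<subseteq> cball x0 (r - real j * h)" using neighbour_subset_cball[OF K' Kr] hle by (meson order_trans subset_cball)
        then have "\<bar>U j K' y - c\<bar> \<le> (1 + stage_growth) ^ j * \<delta>" using goodD[OF gj neighbours_T[OF K']] y by blast
        then show "\<bar>U j K' y - c\<bar> \<le> D" using le by linarith
      qed
    qed
    have "\<bar>\<Sum>j=1..<i. A i j * dg_div T f F (d i j) (U j) K x\<bar> \<le> (\<Sum>j=1..<i. \<bar>A i j\<bar> * (div_const / h * D))"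
      by (intro order_trans[OF sum_abs] sum_mono) (unfold abs_mult, intro mult_left_mono bj, simp_all)
    also have "\<dots> = (\<Sum>j=1..<i. \<bar>A i j\<bar>) * (div_const / h * D)" by (simp only: sum_distrib_right)
    also have "\<dots> \<le> (\<Sum>i\<in>{1..s}. \<Sum>j\<in>{1..s}. \<bar>A i j\<bar>) * (div_const / h * D)"
    proof (rule mult_right_mono)
      have "(\<Sum>j=1..<i. \<bar>A i j\<bar>) \<le> (\<Sum>j\<in>{1..s}. \<bar>A i j\<bar>)" using less.prems by (intro sum_mono2) auto
      also have "\<dots> \<le> (\<Sum>i\<in>{1..s}. \<Sum>j\<in>{1..s}. \<bar>A i j\<bar>)"
        using less.prems by (intro member_le_sum) (auto intro: sum_nonneg)
      finally show "(\<Sum>j=1..<i. \<bar>A i j\<bar>) \<le> (\<Sum>i\<in>{1..s}. \<Sum>j\<in>{1..s}. \<bar>A i j\<bar>)" .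
    qed (use div_const h_pos D in simp)
    finally have 1: "\<bar>\<Sum>j=1..<i. A i j * dg_div T f F (d i j) (U j) K x\<bar> \<le> (\<Sum>i\<in>{1..s}. \<Sum>j\<in>{1..s}. \<bar>A i j\<bar>) * (div_const / h * D)" .
    have "\<tau> * \<bar>\<Sum>j=1..<i. A i j * dg_div T f F (d i j) (U j) K x\<bar> \<le> (lam * h) * ((\<Sum>i\<in>{1..s}. \<Sum>j\<in>{1..s}. \<bar>A i j\<bar>) * (div_const / h * D))"
      using lam \<tau> h_pos by (intro mult_mono[OF lam(1) 1]) auto
    also have "\<dots> = stage_growth * D" using h_pos by (simp add: stage_growth_def)
    finally have 2: "\<bar>\<tau> * (\<Sum>j=1..<i. A i j * dg_div T f F (d i j) (U j) K x)\<bar> \<le> stage_growth * D" using \<tau> by (simp add: abs_mult)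
    have "K \<subseteq> cball x0 r" using Kr h_pos by (meson diff_left_mono diff_zero mult_nonneg_nonneg of_nat_0_le_iff less_imp_le order_trans subset_cball diff_le_self diff_le_eq le_add_same_cancel1)
    then have 3: "\<bar>u K x - c\<bar> \<le> \<delta>" using goodD[OF g K] x by blast
    have "1 * \<delta> \<le> D" unfolding D_def using stage_growth \<delta> by (intro mult_right_mono one_le_power) auto
    moreover have "(1 + stage_growth) ^ i * \<delta> = D + stage_growth * D"
    proof -
      have "i = Suc (i - 1)" using less.prems by simp
      then have "(1 + stage_growth) ^ i = (1 + stage_growth) * (1 + stage_growth) ^ (i - 1)" by (metis power_Suc)
      then show ?thesis by (simp add: D_def algebra_simps)
    qed
    ultimately have 4: "\<delta> + stage_growth * D \<le> (1 + stage_growth) ^ i * \<delta>" by linarith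
    have "U i K x - c = (u K x - c) - \<tau> * (\<Sum>j=1..<i. A i j * dg_div T f F (d i j) (U j) K x)" unfolding Ui using K by simp
    then show "\<bar>U i K x - c\<bar> \<le> (1 + stage_growth) ^ i * \<delta>" using 2 3 4 by linarith
  qed
qed

definition stage_const :: real where "stage_const = (1 + stage_growth) ^ s"

lemma stage_const: "stage_const \<ge> 0" unfolding stage_const_def using stage_growth by simp

definition Gflux :: "(nat \<Rightarrow> 'a broken) \<Rightarrow> 'a set \<Rightarrow> 'a set \<Rightarrow> 'a \<Rightarrow> real" where
  "Gflux U K K' x = (\<Sum>i=1..s. b i * F K K' (U i) x)"

definition flux_const :: real where "flux_const = (\<Sum>i=1..s. \<bar>b i\<bar>) * (face_count * face_const * flux_lip * stage_const)"

lemma flux_const: "flux_const \<ge> 0" unfolding flux_const_def using face_count face_const stage_const by (intro mult_nonneg_nonneg sum_nonneg) (auto simp: flux_lip_def)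

lemma step_broken:
  assumes u: "u \<in> broken_poly T k" and U: "stages u U"
    and u': "u' = (\<lambda>K\<in>T. \<lambda>x. u K x - \<tau> * (\<Sum>i=1..s. b i * dg_div T f F (e i) (U i) K x))"
  shows "u' \<in> broken_poly T k"
  unfolding u' broken_poly_def
proof (rule restrict_PiE_iff[THEN iffD2], intro ballI)
  fix K assume K: "K \<in> T"
  show "(\<lambda>x. u K x - \<tau> * (\<Sum>i=1..s. b i * dg_div T f F (e i) (U i) K x)) \<in> poly_space k"
  proof (intro poly_space_diff poly_space_cmult poly_space_sum broken_poly_poly[OF u K])
    fix i assume i: "i \<in> {1..s}"
    have "dg_div T f F (e i) (U i) K \<in> poly_space (e i)" using dg_div(1) stage_broken[OF u U i] broken_poly_poly K by blast
    then show "dg_div T f F (e i) (U i) K \<in> poly_space k" by (rule poly_space_mono) (rule degrees_le(2)[OF i])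
  qed
qed

section \<open>Conservation, consistency and cancellation for one time step\<close>

context
  fixes u U u'
  assumes u: "u \<in> broken_poly T k" and U: "stages u U"
    and u': "u' = (\<lambda>K\<in>T. \<lambda>x. u K x - \<tau> * (\<Sum>i=1..s. b i * dg_div T f F (e i) (U i) K x))"
begin

lemma Gflux_mult:
  assumes K: "K \<in> T" "K' \<in> neighbours T K" and p: "continuous_on UNIV p"
  shows "face_bounded K K' (\<lambda>x. Gflux U K K' x * p x)"
    "face_integral K K' (\<lambda>x. Gflux U K K' x * p x) = (\<Sum>i=1..s. b i * face_integral K K' (\<lambda>x. F K K' (U i) x * p x))"
proof -
  have fb: "face_bounded K K' (\<lambda>x. F K K' (U i) x * p x)" if "i \<in> {1..s}" for i
    by (rule face_bounded_mult[OF flux_bounded[OF K stage_broken[OF u U that]] face_bounded_continuous[OF K(1) neighbours_T[OF K(2)] p]])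
  have eq: "(\<lambda>x. Gflux U K K' x * p x) = (\<lambda>x. \<Sum>i\<in>{1..s}. b i * (F K K' (U i) x * p x))"
    unfolding Gflux_def by (simp only: sum_distrib_right mult.assoc)
  have fin: "finite {1..s}" by simp
  show "face_bounded K K' (\<lambda>x. Gflux U K K' x * p x)"
    "face_integral K K' (\<lambda>x. Gflux U K K' x * p x) = (\<Sum>i=1..s. b i * face_integral K K' (\<lambda>x. F K K' (U i) x * p x))"
    unfolding eq using face_integral_sum[OF K fin fb] by auto
qed

lemma Gflux_antisym:
  assumes "K \<in> T" "K' \<in> neighbours T K" "x \<in> K \<inter> K'" shows "Gflux U K' K x = - Gflux U K K' x"
proof -
  have "F K' K (U i) x = - F K K' (U i) x" if "i \<in> {1..s}" for i
    using flux assms stage_broken[OF u U that] unfolding numerical_flux_def by fastforce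
  then have "Gflux U K' K x = (\<Sum>i=1..s. b i * (- F K K' (U i) x))" unfolding Gflux_def by (intro sum.cong) auto
  then show ?thesis unfolding Gflux_def by (simp add: sum_negf)
qed

text \<open>The constant one lies in \<open>poly_space l\<close> for every \<open>l\<close> and has
  zero gradient, so the volume term drops out whatever degree a stage uses: cell averages do not see
  the mixture of degrees.\<close>

lemma cell_balance:
  assumes K: "K \<in> T"
  shows "(\<integral>x. indicator K x * (u' K x - u K x) \<partial>lborel) = - \<tau> * (\<Sum>K'\<in>neighbours T K. face_integral K K' (Gflux U K K'))"
proof -
  define w where "w i = dg_div T f F (e i) (U i) K" for i
  have w: "w i \<in> poly_space (e i)" if "i \<in> {1..s}" for i
    unfolding w_def using dg_div(1) stage_broken[OF u U that] broken_poly_poly K by blast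
  have one: "(\<lambda>x. 1) \<in> poly_space l" for l :: nat by (rule poly_space_const)
  have iw: "(\<integral>x. indicator K x * w i x \<partial>lborel) = (\<Sum>K'\<in>neighbours T K. face_integral K K' (F K K' (U i)))"
    if i: "i \<in> {1..s}" for i
  proof -
    have "ip K (w i) (\<lambda>x. 1) = rhs (U i) K (\<lambda>x. 1)"
      unfolding w_def by (rule dg_div(2)[OF stage_broken[OF u U i] K one])
    then show ?thesis by (simp add: ip_def rhs_def C1_const(2))
  qed
  have "indicator K x * (u' K x - u K x) = - \<tau> * (\<Sum>i=1..s. b i * (indicator K x * w i x))" for x
    unfolding u' w_def using K by (simp add: sum_distrib_left mult.left_commute sum_negf)
  then have "(\<integral>x. indicator K x * (u' K x - u K x) \<partial>lborel) = - \<tau> * (\<integral>x. (\<Sum>i=1..s. b i * (indicator K x * w i x)) \<partial>lborel)"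
    by simp
  also have "(\<integral>x. (\<Sum>i=1..s. b i * (indicator K x * w i x)) \<partial>lborel) = (\<Sum>i=1..s. b i * (\<integral>x. indicator K x * w i x \<partial>lborel))"
  proof -
    have "integrable lborel (\<lambda>x. indicator K x * w i x)" if "i \<in> {1..s}" for i
      using poly_space_continuous[OF w[OF that]] by (intro integrable_on_compact[OF cell(3)[OF K]])
    then show ?thesis by (subst Bochner_Integration.integral_sum) auto
  qed
  also have "\<dots> = (\<Sum>i=1..s. b i * (\<Sum>K'\<in>neighbours T K. face_integral K K' (F K K' (U i))))"
    by (intro sum.cong refl arg_cong2[where f="(*)"] iw)
  also have "\<dots> = (\<Sum>K'\<in>neighbours T K. \<Sum>i=1..s. b i * face_integral K K' (F K K' (U i)))"
    unfolding sum_distrib_left by (rule sum.swap)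
  also have "\<dots> = (\<Sum>K'\<in>neighbours T K. face_integral K K' (Gflux U K K'))"
    using Gflux_mult(2)[OF K, of _ "\<lambda>x. 1"] by (intro sum.cong) auto
  finally show ?thesis .
qed

text \<open>The radius \<open>(real s + 2) * h\<close> leaves at least \<open>2 * h\<close> after at
  most \<open>s\<close> stages, enough for \<open>K\<close> and its neighbours.\<close>

lemma Gflux_consistency:
  assumes K: "K \<in> T" and \<delta>: "\<delta> \<ge> 0" and g: "good u c \<delta> (centre K) ((real s + 2) * h)"
    and p: "C1 p" and M: "\<And>x. x \<in> K \<Longrightarrow> \<bar>p x\<bar> \<le> M" "M \<ge> 0"
  shows "\<bar>(\<Sum>K'\<in>neighbours T K. face_integral K K' (\<lambda>x. Gflux U K K' x * p x)) - (\<integral>x. indicator K x * (f c \<bullet> grad p x) \<partial>lborel)\<bar>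
    \<le> flux_const * h ^ (DIM('a) - 1) * \<delta> * M"
proof -
  define I where "I = (\<integral>x. indicator K x * (f c \<bullet> grad p x) \<partial>lborel)"
  define S where "S i = (\<Sum>K'\<in>neighbours T K. face_integral K K' (\<lambda>x. F K K' (U i) x * p x))" for i
  have Si: "\<bar>S i - I\<bar> \<le> face_count * face_const * flux_lip * stage_const * h ^ (DIM('a) - 1) * \<delta> * M" if i: "i \<in> {1..s}" for i
  proof -
    have le: "(1 + stage_growth) ^ i * \<delta> \<le> stage_const * \<delta>" unfolding stage_const_def using stage_growth \<delta> i by (intro mult_right_mono power_increasing) auto
    have gi: "good (U i) c ((1 + stage_growth) ^ i * \<delta>) (centre K) ((real s + 2) * h - real i * h)" by (rule stage_good[OF u U g \<delta> i])
    have "real i * h \<le> real s * h" using i h_pos by (intro mult_right_mono) auto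
    then have r: "h + h \<le> (real s + 2) * h - real i * h" by (simp add: algebra_simps)
    have Kh: "K \<subseteq> cball (centre K) h" using cell_subset_cball[OF K centre_in[OF K]] .
    have "\<bar>S i - I\<bar> \<le> face_count * face_const * flux_lip * h ^ (DIM('a) - 1) * (stage_const * \<delta>) * M"
      unfolding S_def I_def
    proof (rule flux_consistency[OF K stage_broken[OF u U i] _ _ _ p M])
      show "0 \<le> stage_const * \<delta>" using stage_const \<delta> by simp
      fix y assume "y \<in> K"
      moreover have "K \<subseteq> cball (centre K) ((real s + 2) * h - real i * h)"
        using Kh subset_cball[of h "(real s + 2) * h - real i * h" "centre K"] r h_pos by auto
      ultimately have "\<bar>U i K y - c\<bar> \<le> (1 + stage_growth) ^ i * \<delta>" using goodD[OF gi K] by blast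
      then show "\<bar>U i K y - c\<bar> \<le> stage_const * \<delta>" using le by linarith
    next
      fix K' y assume K': "K' \<in> neighbours T K" and y: "y \<in> K'"
      have "K' \<subseteq> cball (centre K) ((real s + 2) * h - real i * h)" using neighbour_subset_cball[OF K' Kh] subset_cball[OF r] by blast
      then have "\<bar>U i K' y - c\<bar> \<le> (1 + stage_growth) ^ i * \<delta>" using goodD[OF gi neighbours_T[OF K']] y by blast
      then show "\<bar>U i K' y - c\<bar> \<le> stage_const * \<delta>" using le by linarith
    qed
    then show ?thesis by (simp only: mult_ac)
  qed
  have "(\<Sum>K'\<in>neighbours T K. face_integral K K' (\<lambda>x. Gflux U K K' x * p x)) = (\<Sum>K'\<in>neighbours T K. \<Sum>i=1..s. b i * face_integral K K' (\<lambda>x. F K K' (U i) x * p x))"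
    using Gflux_mult(2)[OF K _ C1_continuous[OF p]] by (intro sum.cong) auto
  also have "\<dots> = (\<Sum>i=1..s. b i * S i)" unfolding S_def sum_distrib_left by (rule sum.swap)
  \<comment> \<open>The weights of a consistent Runge-Kutta method sum to one, so the single term
    \<open>I\<close> can be distributed over the stages.\<close>
  finally have "(\<Sum>K'\<in>neighbours T K. face_integral K K' (\<lambda>x. Gflux U K K' x * p x)) - I = (\<Sum>i=1..s. b i * S i) - (\<Sum>i=1..s. b i) * I"
    unfolding sum_b by simp
  also have "\<dots> = (\<Sum>i=1..s. b i * (S i - I))" by (simp only: sum_distrib_right sum_subtractf right_diff_distrib)
  finally have "\<bar>(\<Sum>K'\<in>neighbours T K. face_integral K K' (\<lambda>x. Gflux U K K' x * p x)) - I\<bar> \<le> (\<Sum>i=1..s. \<bar>b i * (S i - I)\<bar>)" by (simp only: sum_abs)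
  also have "\<dots> \<le> (\<Sum>i=1..s. \<bar>b i\<bar> * (face_count * face_const * flux_lip * stage_const * h ^ (DIM('a) - 1) * \<delta> * M))"
    unfolding abs_mult using Si by (intro sum_mono mult_left_mono) auto
  also have "\<dots> = flux_const * h ^ (DIM('a) - 1) * \<delta> * M" unfolding flux_const_def sum_distrib_right[symmetric] by (simp only: mult_ac)
  finally show ?thesis unfolding I_def .
qed

text \<open>On \<open>Q\<close> the face contributions form an antisymmetric matrix, since the flux
  changes sign and the face integral does not. A face leading out of \<open>Q\<close> contributes
  nothing because \<open>p\<close> vanishes on the outer cell and hence on the face.\<close>

lemma Gflux_cancel:
  assumes Q: "finite Q" "Q \<subseteq> T" and p: "continuous_on UNIV p" and 0: "\<And>K x. K \<in> T \<Longrightarrow> K \<notin> Q \<Longrightarrow> x \<in> K \<Longrightarrow> p x = 0"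
  shows "(\<Sum>K\<in>Q. \<Sum>K'\<in>neighbours T K. face_integral K K' (\<lambda>x. Gflux U K K' x * p x)) = 0"
proof -
  define a where "a K K' = (if K' \<in> neighbours T K then face_integral K K' (\<lambda>x. Gflux U K K' x * p x) else 0)" for K K'
  have z: "a K K' = 0" if "K \<in> Q" "K' \<notin> Q" for K K'
  proof (cases "K' \<in> neighbours T K")
    case True
    have K: "K \<in> T" "K' \<in> T" using that Q True neighbours_T by auto
    have "\<bar>face_integral K K' (\<lambda>x. Gflux U K K' x * p x)\<bar> \<le> 0 * face_const * h ^ (DIM('a) - 1)"
      using 0[OF K(2) that(2)] by (intro face_integral_bound[OF K(1) True Gflux_mult(1)[OF K(1) True p]]) auto
    then show ?thesis by (simp add: a_def)
  qed (simp add: a_def)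
  have anti: "a K' K = - a K K'" if "K \<in> Q" "K' \<in> Q" for K K'
  proof (cases "K' \<in> neighbours T K")
    case True
    have K: "K \<in> T" using that Q by auto
    have K': "K \<in> neighbours T K'" using neighbours_sym[OF K] True by blast
    have "face_integral K' K (\<lambda>x. Gflux U K' K x * p x) = face_integral K' K (\<lambda>x. -1 * (Gflux U K K' x * p x))"
      using Gflux_antisym[OF K True] by (intro face_integral_cong) auto
    also have "\<dots> = face_integral K K' (\<lambda>x. -1 * (Gflux U K K' x * p x))"
    proof (rule face_integral_commute[OF K True])
      have "face_bounded K K' (\<lambda>x. -1 * (Gflux U K K' x * p x))"
        by (rule face_bounded_mult[OF face_bounded_const Gflux_mult(1)[OF K True p]]) (use K neighbours_T[OF True] in auto)
      then show "(\<lambda>x. indicator (K \<inter> K') x * (-1 * (Gflux U K K' x * p x))) \<in> borel_measurable borel"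
        unfolding face_bounded_def by blast
    qed
    also have "\<dots> = -1 * face_integral K K' (\<lambda>x. Gflux U K K' x * p x)"
      by (rule face_integral_cmult[OF K True Gflux_mult(1)[OF K True p]])
    finally show ?thesis using True K' by (simp add: a_def)
  next
    case False
    then have "K \<notin> neighbours T K'" using neighbours_sym that Q by blast
    then show ?thesis using False by (simp add: a_def)
  qed
  have "(\<Sum>K'\<in>neighbours T K. face_integral K K' (\<lambda>x. Gflux U K K' x * p x)) = (\<Sum>K'\<in>Q. a K K')" if K: "K \<in> Q" for K
  proof -
    have fin: "finite (neighbours T K)" using neighbours_finite K Q by blast
    have "(\<Sum>K'\<in>neighbours T K. face_integral K K' (\<lambda>x. Gflux U K K' x * p x)) = (\<Sum>K'\<in>neighbours T K \<union> Q. a K K')"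
      using fin Q by (intro sum.mono_neutral_cong_left) (auto simp: a_def)
    also have "\<dots> = (\<Sum>K'\<in>Q. a K K')" using fin Q z[OF K] by (intro sum.mono_neutral_right) auto
    finally show ?thesis .
  qed
  then have "(\<Sum>K\<in>Q. \<Sum>K'\<in>neighbours T K. face_integral K K' (\<lambda>x. Gflux U K K' x * p x)) = (\<Sum>K\<in>Q. \<Sum>K'\<in>Q. a K K')"
    by (rule sum.cong[OF refl])
  moreover have "(\<Sum>K\<in>Q. \<Sum>K'\<in>Q. a K K') = (\<Sum>K'\<in>Q. \<Sum>K\<in>Q. a K K')" by (rule sum.swap)
  moreover have "(\<Sum>K'\<in>Q. \<Sum>K\<in>Q. a K K') = - (\<Sum>K'\<in>Q. \<Sum>K\<in>Q. a K' K)"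
    unfolding sum_negf[symmetric] by (intro sum.cong refl anti)
  ultimately show ?thesis by linarith
qed

text \<open>Subtracting the constant \<open>pK K\<close> leaves the gradient of \<open>p\<close>
  unchanged. Hence the oscillation \<open>M\<close> enters only the error, while the main term keeps
  the full gradient.\<close>

lemma weak_step:
  assumes Q: "finite Q" "Q \<subseteq> T" and p: "C1 p" and 0: "\<And>K x. K \<in> T \<Longrightarrow> K \<notin> Q \<Longrightarrow> x \<in> K \<Longrightarrow> p x = 0"
    and M: "\<And>K x. K \<in> Q \<Longrightarrow> x \<in> K \<Longrightarrow> \<bar>p x - pK K\<bar> \<le> M" "M \<ge> 0"
    and \<delta>: "\<And>K. K \<in> Q \<Longrightarrow> \<delta> K \<ge> 0" and g: "\<And>K. K \<in> Q \<Longrightarrow> good u (c K) (\<delta> K) (centre K) ((real s + 2) * h)"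
  shows "\<bar>(\<Sum>K\<in>Q. pK K * (\<integral>x. indicator K x * (u' K x - u K x) \<partial>lborel)) - \<tau> * (\<Sum>K\<in>Q. (\<integral>x. indicator K x * (f (c K) \<bullet> grad p x) \<partial>lborel))\<bar>
    \<le> \<tau> * (flux_const * h ^ (DIM('a) - 1) * M) * (\<Sum>K\<in>Q. \<delta> K)"
proof -
  define S where "S K q = (\<Sum>K'\<in>neighbours T K. face_integral K K' (\<lambda>x. Gflux U K K' x * q x))" for K q
  define I where "I K = (\<integral>x. indicator K x * (f (c K) \<bullet> grad p x) \<partial>lborel)" for K
  have cp: "continuous_on UNIV p" by (rule C1_continuous[OF p])
  have KT: "K \<in> T" if "K \<in> Q" for K using Q that by blast
  have 1: "pK K * (\<integral>x. indicator K x * (u' K x - u K x) \<partial>lborel) = \<tau> * S K (\<lambda>x. p x - pK K) - \<tau> * S K p" if K: "K \<in> Q" for K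
  proof -
    have "S K (\<lambda>x. p x - pK K) = S K p - pK K * (\<Sum>K'\<in>neighbours T K. face_integral K K' (Gflux U K K'))"
    proof -
      have "face_integral K K' (\<lambda>x. Gflux U K K' x * (p x - pK K)) = face_integral K K' (\<lambda>x. Gflux U K K' x * p x) - pK K * face_integral K K' (Gflux U K K')"
        if K': "K' \<in> neighbours T K" for K'
      proof -
        have fb: "face_bounded K K' (Gflux U K K')" using Gflux_mult(1)[OF KT[OF K] K', of "\<lambda>x. 1"] by simp
        have fb1: "face_bounded K K' (\<lambda>x. Gflux U K K' x * p x)" by (rule Gflux_mult(1)[OF KT[OF K] K' cp])
        have fb2: "face_bounded K K' (\<lambda>x. (- pK K) * Gflux U K K' x)"
          by (rule face_bounded_mult[OF face_bounded_const[OF KT[OF K] neighbours_T[OF K']] fb])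
        have "face_integral K K' (\<lambda>x. Gflux U K K' x * (p x - pK K)) = face_integral K K' (\<lambda>x. Gflux U K K' x * p x + (- pK K) * Gflux U K K' x)"
          by (simp add: algebra_simps)
        also have "\<dots> = face_integral K K' (\<lambda>x. Gflux U K K' x * p x) + (- pK K) * face_integral K K' (Gflux U K K')"
          unfolding face_integral_add[OF KT[OF K] K' fb1 fb2] face_integral_cmult[OF KT[OF K] K' fb] ..
        finally show ?thesis by simp
      qed
      then show ?thesis unfolding S_def by (simp add: sum_subtractf sum_distrib_left)
    qed
    then have "\<tau> * S K (\<lambda>x. p x - pK K) = \<tau> * S K p - \<tau> * (pK K * (\<Sum>K'\<in>neighbours T K. face_integral K K' (Gflux U K K')))" by (simp only: right_diff_distrib)
    then show ?thesis unfolding cell_balance[OF KT[OF K]] by simp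
  qed
  have "(\<Sum>K\<in>Q. S K p) = 0" unfolding S_def by (rule Gflux_cancel[OF Q cp 0])
  then have "(\<Sum>K\<in>Q. pK K * (\<integral>x. indicator K x * (u' K x - u K x) \<partial>lborel)) = \<tau> * (\<Sum>K\<in>Q. S K (\<lambda>x. p x - pK K))"
    by (simp add: 1 sum_subtractf sum_distrib_left[symmetric])
  then have "\<bar>(\<Sum>K\<in>Q. pK K * (\<integral>x. indicator K x * (u' K x - u K x) \<partial>lborel)) - \<tau> * (\<Sum>K\<in>Q. I K)\<bar> = \<tau> * \<bar>\<Sum>K\<in>Q. (S K (\<lambda>x. p x - pK K) - I K)\<bar>"
    using \<tau> by (simp add: sum_subtractf right_diff_distrib[symmetric] abs_mult)
  also have "\<dots> \<le> \<tau> * (\<Sum>K\<in>Q. flux_const * h ^ (DIM('a) - 1) * \<delta> K * M)"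
  proof (intro mult_left_mono order_trans[OF sum_abs] sum_mono)
    fix K assume K: "K \<in> Q"
    have "C1 (\<lambda>x. p x + (- pK K))" "grad (\<lambda>x. p x + (- pK K)) = grad p"
      by (rule C1_add(1)[OF p C1_const(1)]) (simp only: C1_add(2)[OF p C1_const(1)] C1_const(2) add_0_right)
    then have c1: "C1 (\<lambda>x. p x - pK K)" and gr: "grad (\<lambda>x. p x - pK K) = grad p" by simp_all
    show "\<bar>S K (\<lambda>x. p x - pK K) - I K\<bar> \<le> flux_const * h ^ (DIM('a) - 1) * \<delta> K * M"
      using Gflux_consistency[OF KT[OF K] \<delta>[OF K] g[OF K] c1 M(1)[OF K] M(2)] unfolding gr S_def I_def by blast
  qed (use \<tau> in simp)
  also have "\<dots> = \<tau> * (flux_const * h ^ (DIM('a) - 1) * M) * (\<Sum>K\<in>Q. \<delta> K)" unfolding sum_distrib_left by (intro sum.cong refl) (simp only: mult_ac)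
  finally show ?thesis unfolding I_def .
qed

text \<open>\<open>Ci\<close> converts local L1 distances into pointwise bounds. The power bounds
  the number of patches of radius \<open>(real s + 2) * h\<close> that contain a given cell.\<close>

definition step_const :: real where "step_const = flux_const * Ci * ((real s + 3) / \<sigma>\<^sup>2) ^ DIM('a)"

text \<open>The deviation on a patch is bounded by a sum of local L1 distances. Exchanging the
  summations counts each cell once for every patch containing it, and packing bounds this
  multiplicity.\<close>

lemma weak_step_L1:
  assumes Q: "finite Q" "Q \<subseteq> T" and p: "C1 p" and 0: "\<And>K x. K \<in> T \<Longrightarrow> K \<notin> Q \<Longrightarrow> x \<in> K \<Longrightarrow> p x = 0"
    and M: "\<And>K x. K \<in> Q \<Longrightarrow> x \<in> K \<Longrightarrow> \<bar>p x - pK K\<bar> \<le> M * h" "M \<ge> 0"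
    and Q': "finite Q'" "Q' \<subseteq> T" "\<And>K K'. K \<in> Q \<Longrightarrow> K' \<in> T \<Longrightarrow> K' \<subseteq> cball (centre K) ((real s + 2) * h) \<Longrightarrow> K' \<in> Q'"
    and \<omega>: "\<And>K K'. K \<in> Q \<Longrightarrow> K' \<in> T \<Longrightarrow> K' \<subseteq> cball (centre K) ((real s + 2) * h) \<Longrightarrow> \<bar>c K' - c K\<bar> \<le> \<omega>" "\<omega> \<ge> 0"
  shows "\<bar>(\<Sum>K\<in>Q. pK K * (\<integral>x. indicator K x * (u' K x - u K x) \<partial>lborel)) - \<tau> * (\<Sum>K\<in>Q. (\<integral>x. indicator K x * (f (c K) \<bullet> grad p x) \<partial>lborel))\<bar>
    \<le> \<tau> * step_const * M * (\<Sum>K\<in>Q'. (\<integral>x. indicator K x * \<bar>u K x - c K\<bar> \<partial>lborel) + \<omega> * ball_const * h ^ DIM('a))"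
proof -
  define R where "R = (real s + 2) * h"
  have R: "R \<ge> 0" using h_pos by (simp add: R_def)
  define Bl where "Bl K = {K'\<in>T. K' \<subseteq> cball (centre K) R}" for K
  define X where "X K = (\<integral>x. indicator K x * \<bar>u K x - c K\<bar> \<partial>lborel) + \<omega> * ball_const * h ^ DIM('a)" for K
  define Y where "Y K K' = (\<integral>x. indicator K' x * \<bar>u K' x - c K\<bar> \<partial>lborel)" for K K'
  \<comment> \<open>A sum over the patch dominates the maximum and is ready for the exchange of
    summations.\<close>
  define \<delta> where "\<delta> K = (\<Sum>K'\<in>Bl K. Ci / h ^ DIM('a) * Y K K')" for K
  have KT: "K \<in> T" if "K \<in> Q" for K using Q that by blast
  have Blf: "finite (Bl K)" for K by (rule packing(1)[of _ "centre K" R]) (use R in \<open>auto simp: Bl_def\<close>)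
  have BlQ: "Bl K \<subseteq> Q'" if "K \<in> Q" for K using Q'(3)[OF that] unfolding Bl_def R_def by blast
  have Y0: "Y K K' \<ge> 0" for K K' unfolding Y_def by (intro Bochner_Integration.integral_nonneg) auto
  have X0: "X K \<ge> 0" for K unfolding X_def using \<omega>(2) ball_const h_pos by (intro add_nonneg_nonneg Bochner_Integration.integral_nonneg) auto
  have hd: "h ^ DIM('a) > 0" using h_pos by simp
  have \<delta>0: "\<delta> K \<ge> 0" for K unfolding \<delta>_def using Ci hd Y0 by (intro sum_nonneg mult_nonneg_nonneg) auto
  have up: "(\<lambda>x. u K x - a) \<in> poly_space (2 * k)" if "K \<in> T" for K a
    by (rule poly_space_mono[of _ k]) (auto intro: poly_space_diff poly_space_const broken_poly_poly[OF u that])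
  have g: "good u (c K) (\<delta> K) (centre K) R" for K
    unfolding good_def
  proof (intro ballI impI)
    fix K' x assume K': "K' \<in> T" "K' \<subseteq> cball (centre K) R" and x: "x \<in> K'"
    have "\<bar>u K' x - c K\<bar> \<le> Ci / h ^ DIM('a) * Y K K'" unfolding Y_def using inverse[OF K'(1) up[OF K'(1)] x] by blast
    also have "\<dots> \<le> \<delta> K" unfolding \<delta>_def using K' Blf Ci hd Y0
      by (intro member_le_sum[of K' "Bl K" "\<lambda>K'. Ci / h ^ DIM('a) * Y K K'"]) (auto simp: Bl_def)
    finally show "\<bar>u K' x - c K\<bar> \<le> \<delta> K" .
  qed
  \<comment> \<open>Passing from the constant of the central cell to that of the cell itself costs
    \<open>\<omega>\<close> times the cell volume.\<close>
  have YX: "Y K K' \<le> X K'" if K: "K \<in> Q" and K': "K' \<in> Bl K" for K K'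
  proof -
    have T': "K' \<in> T" using K' by (simp add: Bl_def)
    have om: "\<bar>c K' - c K\<bar> \<le> \<omega>" using \<omega>(1)[OF K T'] K' by (simp add: Bl_def R_def)
    have ic: "integrable lborel (\<lambda>x. indicator K' x * g x)" if "continuous_on UNIV g" for g :: "'a \<Rightarrow> real"
      using that continuous_on_subset by (intro integrable_on_compact[OF cell(3)[OF T']]) blast
    have i1: "integrable lborel (\<lambda>x. indicator K' x * \<bar>u K' x - a\<bar>)" for a
      by (intro ic continuous_intros poly_space_continuous[OF broken_poly_poly[OF u T']])
    have i2: "integrable lborel (\<lambda>x. indicator K' x * \<omega>)" by (intro ic continuous_intros)
    have "Y K K' \<le> (\<integral>x. indicator K' x * \<bar>u K' x - c K'\<bar> + indicator K' x * \<omega> \<partial>lborel)"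
      unfolding Y_def using om by (intro integral_mono i1 Bochner_Integration.integrable_add i2) (auto simp: indicator_def)
    also have "\<dots> = (\<integral>x. indicator K' x * \<bar>u K' x - c K'\<bar> \<partial>lborel) + (\<integral>x. indicator K' x \<partial>lborel) * \<omega>"
      using Bochner_Integration.integral_add[OF i1 i2] by simp
    also have "\<dots> \<le> X K'" unfolding X_def using mult_right_mono[OF cell_volume[OF T'] \<omega>(2)] by (simp add: mult_ac)
    finally show ?thesis .
  qed
  have S1: "h ^ DIM('a) * (\<Sum>K\<in>Q. \<delta> K) = Ci * (\<Sum>K\<in>Q. \<Sum>K'\<in>Bl K. Y K K')"
    unfolding \<delta>_def sum_distrib_left using h_pos by (intro sum.cong refl) simp
  have S2: "Ci * (\<Sum>K\<in>Q. \<Sum>K'\<in>Bl K. Y K K') \<le> Ci * (\<Sum>K\<in>Q. \<Sum>K'\<in>Bl K. X K')"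
    using YX Ci by (intro mult_left_mono sum_mono) auto
  have "(\<Sum>K\<in>Q. \<Sum>K'\<in>Bl K. X K') = (\<Sum>K\<in>Q. \<Sum>K'\<in>Q'. if K' \<in> Bl K then X K' else 0)"
  proof (rule sum.cong[OF refl])
    fix K assume "K \<in> Q"
    then have "Q' \<inter> Bl K = Bl K" using BlQ by blast
    then show "(\<Sum>K'\<in>Bl K. X K') = (\<Sum>K'\<in>Q'. if K' \<in> Bl K then X K' else 0)"
      using sum.inter_restrict[OF Q'(1), of X "Bl K"] by simp
  qed
  also have "\<dots> = (\<Sum>K'\<in>Q'. \<Sum>K\<in>Q. if K' \<in> Bl K then X K' else 0)" by (rule sum.swap)
  also have "\<dots> \<le> (\<Sum>K'\<in>Q'. ((real s + 3) / \<sigma>\<^sup>2) ^ DIM('a) * X K')"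
  proof (rule sum_mono)
    fix K' assume "K' \<in> Q'"
    then have T': "K' \<in> T" using Q' by blast
    let ?P = "{K\<in>Q. K' \<in> Bl K}"
    have "(\<Sum>K\<in>Q. if K' \<in> Bl K then X K' else 0) = (\<Sum>K\<in>?P. X K')" by (rule sum.inter_filter[OF Q(1), symmetric])
    also have "\<dots> = real (card ?P) * X K'" by simp
    \<comment> \<open>A cell whose patch contains \<open>K'\<close> has its centre within
      \<open>R\<close> of the centre of \<open>K'\<close>, hence lies in the ball of radius
      \<open>R + h\<close> about the latter.\<close>
    also have "\<dots> \<le> ((R + h) / (\<sigma>\<^sup>2 * h)) ^ DIM('a) * X K'"
    proof (rule mult_right_mono[OF _ X0])
      show "real (card ?P) \<le> ((R + h) / (\<sigma>\<^sup>2 * h)) ^ DIM('a)"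
      proof (rule packing(2))
        show "?P \<subseteq> T" using Q by blast
        show "0 \<le> R + h" using R h_pos by simp
        fix K assume K: "K \<in> ?P"
        then have KT': "K \<in> T" using Q by blast
        have "centre K' \<in> cball (centre K) R" using K centre_in[OF T'] by (auto simp: Bl_def)
        then have "K \<in> near (cball (centre K') R)" using centre_in[OF KT'] KT' by (auto simp: near_def dist_commute)
        then show "K \<subseteq> cball (centre K') (R + h)" by (rule near_subset)
      qed
    qed
    also have "(R + h) / (\<sigma>\<^sup>2 * h) = (real s + 3) / \<sigma>\<^sup>2"
    proof -
      have "R + h = (real s + 3) * h" by (simp add: R_def algebra_simps)
      then show ?thesis using h_pos by (simp only: nonzero_mult_divide_mult_cancel_right[OF less_imp_neq[OF h_pos, symmetric]])
    qed
    finally show "(\<Sum>K\<in>Q. if K' \<in> Bl K then X K' else 0) \<le> ((real s + 3) / \<sigma>\<^sup>2) ^ DIM('a) * X K'" .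
  qed
  also have "\<dots> = ((real s + 3) / \<sigma>\<^sup>2) ^ DIM('a) * (\<Sum>K'\<in>Q'. X K')" by (simp only: sum_distrib_left)
  finally have "(\<Sum>K\<in>Q. \<Sum>K'\<in>Bl K. X K') \<le> ((real s + 3) / \<sigma>\<^sup>2) ^ DIM('a) * (\<Sum>K'\<in>Q'. X K')" .
  from mult_left_mono[OF this Ci]
  have S: "h ^ DIM('a) * (\<Sum>K\<in>Q. \<delta> K) \<le> Ci * (((real s + 3) / \<sigma>\<^sup>2) ^ DIM('a) * (\<Sum>K'\<in>Q'. X K'))"
    using S1 S2 by linarith
  have "\<bar>(\<Sum>K\<in>Q. pK K * (\<integral>x. indicator K x * (u' K x - u K x) \<partial>lborel)) - \<tau> * (\<Sum>K\<in>Q. (\<integral>x. indicator K x * (f (c K) \<bullet> grad p x) \<partial>lborel))\<bar>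
    \<le> \<tau> * (flux_const * h ^ (DIM('a) - 1) * (M * h)) * (\<Sum>K\<in>Q. \<delta> K)"
    using M h_pos \<delta>0 g unfolding R_def by (intro weak_step[OF Q p 0]) auto
  also have "\<dots> = \<tau> * flux_const * M * ((h * h ^ (DIM('a) - 1)) * (\<Sum>K\<in>Q. \<delta> K))" by (simp only: mult_ac)
  \<comment> \<open>Oscillation and face area together supply the power of \<open>h\<close> that the
    inverse estimate consumes.\<close>
  also have "h * h ^ (DIM('a) - 1) = h ^ DIM('a)" by (metis DIM_positive Suc_pred' power_Suc)
  also have "\<tau> * flux_const * M * (h ^ DIM('a) * (\<Sum>K\<in>Q. \<delta> K)) \<le> \<tau> * flux_const * M * (Ci * (((real s + 3) / \<sigma>\<^sup>2) ^ DIM('a) * (\<Sum>K'\<in>Q'. X K')))"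
    using \<tau> flux_const M(2) by (intro mult_left_mono[OF S]) auto
  also have "\<dots> = \<tau> * step_const * M * (\<Sum>K'\<in>Q'. X K')" by (simp only: step_const_def mult_ac)
  finally show ?thesis unfolding X_def .
qed

end

end

section \<open>Space-time integrals of piecewise defined functions\<close>

lemma has_integral_prism:
  fixes p :: "'a::euclidean_space \<Rightarrow> real"
  assumes p: "integrable lborel p" and ab: "\<alpha> \<le> \<beta>"
  shows "has_bochner_integral lborel (\<lambda>z. p (fst z) * indicator {\<alpha>..<\<beta>} (snd z)) ((\<beta> - \<alpha>) * (\<integral>x. p x \<partial>lborel))"
proof -
  let ?f = "\<lambda>z::'a \<times> real. p (fst z) * indicator {\<alpha>..<\<beta>} (snd z)"
  have pm [measurable]: "p \<in> borel_measurable borel" using p by auto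
  have m: "?f \<in> borel_measurable (lborel \<Otimes>\<^sub>M lborel)" by measurable
  have ii: "integrable lborel (indicator {\<alpha>..<\<beta>} :: real \<Rightarrow> real)" using ab by (intro integrable_real_indicator) auto
  have vi: "measure lborel {\<alpha>..<\<beta>} = \<beta> - \<alpha>" using ab by simp
  have i: "integrable (lborel \<Otimes>\<^sub>M lborel) ?f"
  proof (rule lborel_pair.Fubini_integrable[OF m])
    have "(\<lambda>x. \<integral>t. norm (?f (x, t)) \<partial>lborel) = (\<lambda>x. \<bar>p x\<bar> * (\<beta> - \<alpha>))"
      by (rule ext) (simp add: abs_mult vi)
    then show "integrable lborel (\<lambda>x. \<integral>t. norm (?f (x, t)) \<partial>lborel)" using p by simp
    show "AE x in lborel. integrable lborel (\<lambda>t. ?f (x, t))" using ii by simp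
  qed
  have "integral\<^sup>L (lborel \<Otimes>\<^sub>M lborel) ?f = (\<integral>x. \<integral>t. ?f (x, t) \<partial>lborel \<partial>lborel)"
    using lborel_pair.integral_fst'[OF i] by simp
  also have "\<dots> = (\<integral>x. p x * (\<beta> - \<alpha>) \<partial>lborel)" by (simp add: vi)
  also have "\<dots> = (\<beta> - \<alpha>) * (\<integral>x. p x \<partial>lborel)" by simp
  finally show ?thesis using i unfolding has_bochner_integral_iff lborel_prod by simp
qed

lemma time_index: assumes "\<tau> > 0" "0 \<le> t"
  shows "nat \<lfloor>t / \<tau>\<rfloor> = n \<longleftrightarrow> t \<in> {real n * \<tau>..<(real n + 1) * \<tau>}"
proof -
  have "nat \<lfloor>t / \<tau>\<rfloor> = n \<longleftrightarrow> \<lfloor>t / \<tau>\<rfloor> = int n" using assms by (auto simp: nat_eq_iff)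
  also have "\<dots> \<longleftrightarrow> real n \<le> t / \<tau> \<and> t / \<tau> < real n + 1" by (simp add: floor_eq_iff)
  also have "\<dots> \<longleftrightarrow> t \<in> {real n * \<tau>..<(real n + 1) * \<tau>}" using assms by (simp add: pos_le_divide_eq pos_divide_less_eq)
  finally show ?thesis .
qed

text \<open>Functions built with \<open>cell_of\<close> are arbitrary on the skeleton; completeness
  lets them inherit the integral of a Borel function that agrees almost everywhere.\<close>

lemma has_integral_completion:
  fixes f g :: "'a::euclidean_space \<Rightarrow> real"
  assumes "has_bochner_integral lborel f I" "AE x in lebesgue. f x = g x"
  shows "has_bochner_integral lebesgue g I"
proof -
  have f: "has_bochner_integral lebesgue f I"
    using assms(1) unfolding has_bochner_integral_iff
    by (metis borel_measurable_integrable integrable_completion integral_completion)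
  then have m: "f \<in> borel_measurable lebesgue" by (auto simp: has_bochner_integral_iff)
  then have "g \<in> borel_measurable lebesgue" using assms(2) by (rule borel_measurable_AE)
  then show ?thesis using f assms(2) m has_bochner_integral_cong_AE by blast
qed

lemma continuous_lebesgue_measurable: "continuous_on UNIV g \<Longrightarrow> (g :: 'a::euclidean_space \<Rightarrow> real) \<in> borel_measurable lebesgue"
  by (intro measurable_completion) (auto intro: borel_measurable_continuous_onI)

context qu_mesh begin

lemma AE_cell: "AE x in lebesgue. x \<notin> skeleton" "AE z in (lebesgue :: ('a \<times> real) measure). fst z \<notin> skeleton"
proof -
  show "AE x in lebesgue. x \<notin> skeleton" by (rule AE_completion) (rule AE_skeleton)
  have [measurable]: "skeleton \<in> sets borel" by (rule skeleton_borel)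
  have "AE z in lborel \<Otimes>\<^sub>M (lborel :: real measure). fst z \<notin> skeleton"
  proof (rule lborel_pair.AE_pair_measure)
    show "{z \<in> space (lborel \<Otimes>\<^sub>M (lborel :: real measure)). fst z \<notin> skeleton} \<in> sets (lborel \<Otimes>\<^sub>M lborel)" by measurable
    show "AE x in lborel. AE t in (lborel :: real measure). fst (x, t) \<notin> skeleton"
      using AE_skeleton(1) by eventually_elim simp
  qed
  then show "AE z in (lebesgue :: ('a \<times> real) measure). fst z \<notin> skeleton"
    unfolding lborel_prod by (rule AE_completion)
qed

text \<open>Off the null skeleton the set where \<open>cell_of\<close> equals \<open>K\<close> is
  \<open>K\<close> itself, and completeness absorbs the arbitrary choice on the skeleton.\<close>

lemma cell_of_measurable:
  "cell_of \<in> lebesgue \<rightarrow>\<^sub>M count_space T" "(\<lambda>z. cell_of (fst z)) \<in> (lebesgue :: ('a \<times> real) measure) \<rightarrow>\<^sub>M count_space T"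
proof -
  have iff: "x \<in> K \<longleftrightarrow> cell_of x = K" if "x \<notin> skeleton" "K \<in> T" for x K
    using cell_of(2)[of x] cell_of_eq[OF that] by metis
  have K: "K \<in> sets lebesgue" if "K \<in> T" for K using cell(8)[OF that] by simp
  show "cell_of \<in> lebesgue \<rightarrow>\<^sub>M count_space T"
    unfolding measurable_count_space_eq_countable[OF countable_T]
  proof (intro conjI ballI)
    show "cell_of \<in> space lebesgue \<rightarrow> T" using cell_of by auto
    fix K assume T': "K \<in> T"
    show "cell_of -` {K} \<inter> space lebesgue \<in> sets lebesgue"
    proof (rule completion.in_sets_AE[OF _ K[OF T']])
      show "AE x in lebesgue. (x \<in> K) = (x \<in> cell_of -` {K} \<inter> space lebesgue)"
        using AE_cell(1) by eventually_elim (use iff[OF _ T'] in simp)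
    qed simp
  qed
  have Kf: "{z :: 'a \<times> real. fst z \<in> K} \<in> sets lebesgue" if "K \<in> T" for K
  proof -
    have "closed (fst -` K :: ('a \<times> real) set)" by (rule closed_vimage_fst[OF cell(4)[OF that]])
    then have "fst -` K \<in> sets (borel :: ('a \<times> real) measure)" by (rule borel_closed)
    then show ?thesis by (simp add: vimage_def)
  qed
  show "(\<lambda>z. cell_of (fst z)) \<in> (lebesgue :: ('a \<times> real) measure) \<rightarrow>\<^sub>M count_space T"
    unfolding measurable_count_space_eq_countable[OF countable_T]
  proof (intro conjI ballI)
    show "(\<lambda>z. cell_of (fst z)) \<in> space (lebesgue :: ('a \<times> real) measure) \<rightarrow> T" using cell_of by auto
    fix K assume T': "K \<in> T"
    show "(\<lambda>z. cell_of (fst z)) -` {K} \<inter> space (lebesgue :: ('a \<times> real) measure) \<in> sets lebesgue"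
    proof (rule completion.in_sets_AE[OF _ Kf[OF T']])
      show "AE z in (lebesgue :: ('a \<times> real) measure). (z \<in> {z. fst z \<in> K}) = (z \<in> (\<lambda>z. cell_of (fst z)) -` {K} \<inter> space lebesgue)"
        using AE_cell(2) by eventually_elim (use iff[OF _ T'] in simp)
    qed simp
  qed
qed

lemma cellwise_measurable:
  fixes a :: "'a set \<Rightarrow> 'a \<Rightarrow> real"
  assumes "\<And>K. K \<in> T \<Longrightarrow> continuous_on UNIV (a K)"
  shows "(\<lambda>x. a (cell_of x) x) \<in> borel_measurable lebesgue"
  by (rule measurable_compose_countable'[where f=a, OF _ cell_of_measurable(1) countable_T])
    (rule continuous_lebesgue_measurable[OF assms])

lemma slabwise_measurable:
  fixes a :: "nat \<Rightarrow> 'a set \<Rightarrow> 'a \<Rightarrow> real"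
  assumes "\<And>n K. K \<in> T \<Longrightarrow> continuous_on UNIV (a n K)"
  shows "(\<lambda>z. a (nat \<lfloor>snd z / \<tau>\<rfloor>) (cell_of (fst z)) (fst z)) \<in> borel_measurable (lebesgue :: ('a \<times> real) measure)"
proof -
  have 1: "(\<lambda>z. a n (cell_of (fst z)) (fst z)) \<in> borel_measurable (lebesgue :: ('a \<times> real) measure)" for n
  proof (rule measurable_compose_countable'[where f="\<lambda>K z. a n K (fst z)", OF _ cell_of_measurable(2) countable_T])
    fix K assume "K \<in> T"
    then have "continuous_on UNIV (\<lambda>z::'a \<times> real. a n K (fst z))"
      by (rule continuous_on_compose2[OF assms[of K n] continuous_on_fst[OF continuous_on_id]]) simp_all
    then show "(\<lambda>z. a n K (fst z)) \<in> borel_measurable (lebesgue :: ('a \<times> real) measure)" by (rule continuous_lebesgue_measurable)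
  qed
  have 2: "(\<lambda>z :: 'a \<times> real. nat \<lfloor>snd z / \<tau>\<rfloor>) \<in> lebesgue \<rightarrow>\<^sub>M count_space UNIV"
  proof (rule measurable_completion)
    have "snd \<in> borel_measurable (borel :: ('a \<times> real) measure)"
      by (intro borel_measurable_continuous_onI continuous_on_snd continuous_on_id)
    moreover have "(\<lambda>t. nat \<lfloor>t / \<tau>\<rfloor>) \<in> borel \<rightarrow>\<^sub>M count_space UNIV" by measurable
    ultimately have "(\<lambda>z :: 'a \<times> real. nat \<lfloor>snd z / \<tau>\<rfloor>) \<in> borel \<rightarrow>\<^sub>M count_space UNIV" by (rule measurable_compose)
    then show "(\<lambda>z :: 'a \<times> real. nat \<lfloor>snd z / \<tau>\<rfloor>) \<in> lborel \<rightarrow>\<^sub>M count_space UNIV" by simp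
  qed
  show ?thesis by (rule measurable_compose_countable'[where f="\<lambda>n z. a n (cell_of (fst z)) (fst z)", OF 1 2]) simp
qed

lemma indicator_cell_of:
  assumes "x \<notin> skeleton" "K \<in> T" shows "indicator K x = (if K = cell_of x then 1 else 0 :: real)"
  using cell_of_eq[OF assms] cell_of(2)[of x] by (metis indicator_simps)

lemma sum_indicator_cell_of:
  fixes a :: "'a set \<Rightarrow> real"
  assumes "x \<notin> skeleton" "finite Q" "Q \<subseteq> T" "\<And>K. K \<in> T \<Longrightarrow> K \<notin> Q \<Longrightarrow> x \<in> K \<Longrightarrow> a K = 0"
  shows "(\<Sum>K\<in>Q. indicator K x * a K) = a (cell_of x)"
proof -
  have "(\<Sum>K\<in>Q. indicator K x * a K) = (\<Sum>K\<in>Q. if K = cell_of x then a (cell_of x) else 0)"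
    using assms(1,3) indicator_cell_of by (intro sum.cong refl) (auto simp: subset_eq)
  also have "\<dots> = a (cell_of x)" using assms(2,4) cell_of[of x] by (simp add: sum.delta')
  finally show ?thesis .
qed

lemma cellwise_integral:
  fixes a :: "'a set \<Rightarrow> 'a \<Rightarrow> real"
  assumes Q: "finite Q" "Q \<subseteq> T" and c: "\<And>K. K \<in> Q \<Longrightarrow> continuous_on UNIV (a K)"
    and 0: "\<And>K x. K \<in> T \<Longrightarrow> K \<notin> Q \<Longrightarrow> x \<in> K \<Longrightarrow> a K x = 0"
  shows "has_bochner_integral lebesgue (\<lambda>x. a (cell_of x) x) (\<Sum>K\<in>Q. \<integral>x. indicator K x * a K x \<partial>lborel)"
proof (rule has_integral_completion)
  have "integrable lborel (\<lambda>x. indicator K x * a K x)" if "K \<in> Q" for K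
  proof (rule integrable_on_compact)
    show "compact K" using cell(3) Q that by blast
    show "continuous_on K (a K)" using c[OF that] continuous_on_subset by blast
  qed
  then show "has_bochner_integral lborel (\<lambda>x. \<Sum>K\<in>Q. indicator K x * a K x) (\<Sum>K\<in>Q. \<integral>x. indicator K x * a K x \<partial>lborel)"
    by (intro has_bochner_integral_sum has_bochner_integral_integrable)
  show "AE x in lebesgue. (\<Sum>K\<in>Q. indicator K x * a K x) = a (cell_of x) x"
    using AE_cell(1) by eventually_elim (rule sum_indicator_cell_of[OF _ Q 0])
qed

text \<open>Almost everywhere the integrand is a finite sum over prisms, a cell times one half-open
  time step; \<open>Q\<close> and \<open>N\<close> truncate in space and time.\<close>

lemma slabwise_integral:
  fixes a :: "nat \<Rightarrow> 'a set \<Rightarrow> 'a \<Rightarrow> real"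
  assumes Q: "finite Q" "Q \<subseteq> T" and \<tau>: "\<tau> > 0" and c: "\<And>n K. K \<in> Q \<Longrightarrow> continuous_on UNIV (a n K)"
    and 0: "\<And>n K x. K \<in> T \<Longrightarrow> K \<notin> Q \<Longrightarrow> x \<in> K \<Longrightarrow> a n K x = 0"
    and N: "\<And>n K x. K \<in> T \<Longrightarrow> n \<ge> N \<Longrightarrow> x \<in> K \<Longrightarrow> a n K x = 0"
  shows "has_bochner_integral (lebesgue :: ('a \<times> real) measure) (\<lambda>z. indicator {z. 0 \<le> snd z} z * a (nat \<lfloor>snd z / \<tau>\<rfloor>) (cell_of (fst z)) (fst z))
    (\<tau> * (\<Sum>n<N. \<Sum>K\<in>Q. \<integral>x. indicator K x * a n K x \<partial>lborel))"
proof (rule has_integral_completion)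
  have i: "integrable lborel (\<lambda>x. indicator K x * a n K x)" if "K \<in> Q" for n K
  proof (rule integrable_on_compact)
    show "compact K" using cell(3) Q that by blast
    show "continuous_on K (a n K)" using c[OF that] continuous_on_subset by blast
  qed
  have "has_bochner_integral lborel (\<lambda>z::'a \<times> real. indicator K (fst z) * a n K (fst z) * indicator {real n * \<tau>..<(real n + 1) * \<tau>} (snd z))
     (\<tau> * (\<integral>x. indicator K x * a n K x \<partial>lborel))" if "K \<in> Q" for n K
    using has_integral_prism[OF i[OF that, of n], of "real n * \<tau>" "(real n + 1) * \<tau>"] \<tau> by (simp add: algebra_simps)
  then have "has_bochner_integral lborel (\<lambda>z::'a \<times> real. \<Sum>n<N. \<Sum>K\<in>Q. indicator K (fst z) * a n K (fst z) * indicator {real n * \<tau>..<(real n + 1) * \<tau>} (snd z))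
     (\<Sum>n<N. \<Sum>K\<in>Q. \<tau> * (\<integral>x. indicator K x * a n K x \<partial>lborel))" by (intro has_bochner_integral_sum)
  then show "has_bochner_integral lborel (\<lambda>z::'a \<times> real. \<Sum>n<N. \<Sum>K\<in>Q. indicator K (fst z) * a n K (fst z) * indicator {real n * \<tau>..<(real n + 1) * \<tau>} (snd z))
     (\<tau> * (\<Sum>n<N. \<Sum>K\<in>Q. \<integral>x. indicator K x * a n K x \<partial>lborel))" by (simp only: sum_distrib_left)
  show "AE z in (lebesgue :: ('a \<times> real) measure). (\<Sum>n<N. \<Sum>K\<in>Q. indicator K (fst z) * a n K (fst z) * indicator {real n * \<tau>..<(real n + 1) * \<tau>} (snd z))
     = indicator {z. 0 \<le> snd z} z * a (nat \<lfloor>snd z / \<tau>\<rfloor>) (cell_of (fst z)) (fst z)"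
    using AE_cell(2)
  proof eventually_elim
    case (elim z)
    define n0 where "n0 = nat \<lfloor>snd z / \<tau>\<rfloor>"
    have "(\<Sum>n<N. \<Sum>K\<in>Q. indicator K (fst z) * a n K (fst z) * indicator {real n * \<tau>..<(real n + 1) * \<tau>} (snd z))
      = (\<Sum>n<N. a n (cell_of (fst z)) (fst z) * indicator {real n * \<tau>..<(real n + 1) * \<tau>} (snd z))"
      unfolding sum_distrib_right[symmetric]
      by (intro sum.cong refl arg_cong2[where f="(*)"] sum_indicator_cell_of[OF elim Q 0])
    also have "\<dots> = indicator {z. 0 \<le> snd z} z * a n0 (cell_of (fst z)) (fst z)"
    proof (cases "0 \<le> snd z")
      case True
      have "indicator {real n * \<tau>..<(real n + 1) * \<tau>} (snd z) = (if n = n0 then 1 else 0 :: real)" for n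
        using time_index[OF \<tau> True, of n] unfolding n0_def indicator_def by auto
      then have "(\<Sum>n<N. a n (cell_of (fst z)) (fst z) * indicator {real n * \<tau>..<(real n + 1) * \<tau>} (snd z))
        = (\<Sum>n<N. if n = n0 then a n0 (cell_of (fst z)) (fst z) else 0)" by (intro sum.cong refl) simp
      also have "\<dots> = a n0 (cell_of (fst z)) (fst z)" using N[OF cell_of(1) _ cell_of(2), of n0 "fst z"] by (simp add: sum.delta')
      finally show ?thesis using True by simp
    next
      case False
      have "indicator {real n * \<tau>..<(real n + 1) * \<tau>} (snd z) = (0 :: real)" for n
      proof -
        have "0 \<le> real n * \<tau>" using \<tau> by simp
        then show ?thesis using False by simp
      qed
      then show ?thesis using False by simp
    qed
    finally show ?case unfolding n0_def .
  qed
qed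

end

section \<open>The discrete weak formulation\<close>

text \<open>Measurability provides continuous functions converging almost everywhere. Truncation at
  \<open>M\<close> preserves continuity and the limit, and supplies a dominating function on the
  compact set \<open>B\<close>.\<close>

lemma continuous_L1_approximation:
  fixes v :: "'b::euclidean_space \<Rightarrow> real"
  assumes v: "v \<in> borel_measurable lebesgue" and M: "AE z in lebesgue. \<bar>v z\<bar> \<le> M" "M \<ge> 0"
    and B: "compact B" and \<epsilon>: "\<epsilon> > 0"
  obtains \<gamma> where "continuous_on UNIV \<gamma>" "\<And>z. \<bar>\<gamma> z\<bar> \<le> M" "(\<integral>z. indicator B z * \<bar>v z - \<gamma> z\<bar> \<partial>lebesgue) \<le> \<epsilon>"
proof -
  have "v measurable_on UNIV" using v by (subst measurable_on_iff_borel_measurable) auto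
  then obtain N g where N: "negligible N" and g: "\<And>n. continuous_on UNIV (g n)" "\<And>z. z \<notin> N \<Longrightarrow> (\<lambda>n. g n z) \<longlonglongrightarrow> v z"
    unfolding measurable_on_def by auto
  define c where "c n z = max (- M) (min M (g n z))" for n z
  have c: "continuous_on UNIV (c n)" "\<bar>c n z\<bar> \<le> M" for n z
    unfolding c_def using g(1)[of n] M(2) by (auto intro!: continuous_intros)
  have Bl: "B \<in> sets lebesgue" using B by (simp add: compact_imp_closed)
  have iB: "integrable lebesgue (indicator B :: 'b \<Rightarrow> real)"
    using lmeasurable_compact[OF B] by (intro integrable_real_indicator) (auto simp: fmeasurable_def)
  have "(\<lambda>n. \<integral>z. indicator B z * \<bar>v z - c n z\<bar> \<partial>lebesgue) \<longlonglongrightarrow> (\<integral>z. 0 \<partial>(lebesgue :: 'b measure))"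
  proof (rule integral_dominated_convergence[where w="\<lambda>z. 2 * M * indicator B z"])
    show "integrable lebesgue (\<lambda>z::'b. 2 * M * indicator B z)" using iB by simp
    show "(\<lambda>z. indicator B z * \<bar>v z - c n z\<bar>) \<in> borel_measurable lebesgue" for n
      using v continuous_lebesgue_measurable[OF c(1)] Bl by (intro borel_measurable_times borel_measurable_indicator borel_measurable_abs borel_measurable_diff) auto
    have "AE z in lebesgue. z \<notin> N" using N by (simp add: negligible_iff_null_sets AE_not_in)
    then show "AE z in lebesgue. (\<lambda>n. indicator B z * \<bar>v z - c n z\<bar>) \<longlonglongrightarrow> 0"
      using M(1)
    proof eventually_elim
      case (elim z)
      have "(\<lambda>n. c n z) \<longlonglongrightarrow> max (- M) (min M (v z))" unfolding c_def by (intro tendsto_intros g(2) elim(1))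
      also have "max (- M) (min M (v z)) = v z" using elim(2) by auto
      finally have "(\<lambda>n. indicator B z * \<bar>v z - c n z\<bar>) \<longlonglongrightarrow> indicator B z * \<bar>v z - v z\<bar>" by (intro tendsto_intros)
      then show ?case by simp
    qed
    show "AE z in lebesgue. norm (indicator B z * \<bar>v z - c n z\<bar>) \<le> 2 * M * indicator B z" for n
      using M(1)
    proof eventually_elim
      case (elim z)
      then have "\<bar>v z - c n z\<bar> \<le> 2 * M" using c(2)[of n z] by linarith
      then show ?case by (auto simp: indicator_def)
    qed
  qed simp
  then have "eventually (\<lambda>n. (\<integral>z. indicator B z * \<bar>v z - c n z\<bar> \<partial>lebesgue) < \<epsilon>) sequentially"
    using \<epsilon> by (intro order_tendstoD(2)) simp_all
  then obtain n where "(\<integral>z. indicator B z * \<bar>v z - c n z\<bar> \<partial>lebesgue) < \<epsilon>" by (auto simp: eventually_sequentially)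
  then show ?thesis using that[of "c n"] c[of n] by simp
qed

lemma summation_by_parts:
  fixes p a :: "nat \<Rightarrow> real"
  shows "(\<Sum>n<N. p n * (a (Suc n) - a n)) = p N * a N - p 0 * a 0 - (\<Sum>n<N. (p (Suc n) - p n) * a (Suc n))"
  by (induction N) (auto simp: algebra_simps)

lemma indicator_integral_cmult:
  "(\<integral>x. indicator K x * (g x * r) \<partial>lborel) = r * (\<integral>x. indicator K x * g x \<partial>lborel :: real)"
proof -
  have "(\<lambda>x. indicator K x * (g x * r)) = (\<lambda>x. r * (indicator K x * g x))" by (simp add: fun_eq_iff)
  then show ?thesis by (simp only: integral_mult_right_zero)
qed

text \<open>The sequence of discretisations together with one test function and its derivatives. The
  bounds \<open>h1\<close> and \<open>dt1\<close>, available for a tail of the sequence, keep all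
  cells and time levels involved in one fixed box.\<close>

locale lax_wendroff =
  fixes T :: "nat \<Rightarrow> 'a::euclidean_space set set" and \<sigma> :: real and f :: "real \<Rightarrow> 'a" and F :: "nat \<Rightarrow> 'a num_flux"
    and k :: nat and C L Ci :: real and s :: nat and A b d e and dt :: "nat \<Rightarrow> real" and lam :: real
    and uh :: "nat \<Rightarrow> nat \<Rightarrow> 'a broken" and u0 :: "'a \<Rightarrow> real" and u :: "'a \<times> real \<Rightarrow> real" and M :: real
    and \<phi> :: "'a \<times> real \<Rightarrow> real" and gx :: "'a \<times> real \<Rightarrow> 'a" and gt :: "'a \<times> real \<Rightarrow> real" and R0 Bd :: real
  assumes rk: "\<And>m. sdrkdg (T m) \<sigma> f (F m) k C L Ci s A b d e (dt m) lam"
    and h1: "\<And>m. mesh_size (T m) \<le> 1" and dt1: "\<And>m. dt m \<le> 1"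
    and h0: "(\<lambda>m. mesh_size (T m)) \<longlonglongrightarrow> 0" and dt0: "dt \<longlonglongrightarrow> 0"
    and scheme: "\<And>m. sdRKDG_solution (T m) f (F m) k s A b d e (dt m) (uh m)"
    and u0i: "\<And>R. set_integrable lebesgue (cball 0 R) u0"
    and init: "approximates_initial (\<lambda>m. eval_broken (T m) (uh m 0)) u0"
    and bounded: "\<And>m x t. 0 \<le> t \<Longrightarrow> \<bar>space_time (T m) (dt m) (uh m) (x, t)\<bar> \<le> M"
    and conv: "AE z in lebesgue. 0 \<le> snd z \<longrightarrow> (\<lambda>m. space_time (T m) (dt m) (uh m) z) \<longlonglongrightarrow> u z"
    and cgx: "continuous_on UNIV gx" and cgt: "continuous_on UNIV gt" and c\<phi>: "continuous_on UNIV \<phi>"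
    and dx: "\<And>x t. GDERIV (\<lambda>y. \<phi> (y, t)) x :> gx (x, t)"
    and dtt: "\<And>x t. ((\<lambda>r. \<phi> (x, r)) has_real_derivative gt (x, t)) (at t)"
    and supp: "\<And>x t. R0 < norm x \<or> R0 < \<bar>t\<bar> \<Longrightarrow> \<phi> (x, t) = 0 \<and> gx (x, t) = 0 \<and> gt (x, t) = 0"
    and bd: "\<And>z. \<bar>\<phi> z\<bar> \<le> Bd" "\<And>z. norm (gx z) \<le> Bd" "\<And>z. \<bar>gt z\<bar> \<le> Bd" and R0: "R0 \<ge> 0"
begin

lemma qm: "qu_mesh (T m) \<sigma>" using rk[of m] unfolding sdrkdg_def dg_discretization_def by blast

lemma dgm: "dg_discretization (T m) \<sigma> f (F m) k C L Ci" using rk[of m] unfolding sdrkdg_def by blast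

definition cel where "cel m x = qu_mesh.cell_of (T m) x"
definition ctr :: "'a set \<Rightarrow> 'a" where "ctr K = qu_mesh.centre \<sigma> K"
definition idx :: "nat \<Rightarrow> real \<Rightarrow> nat" where "idx m t = nat \<lfloor>t / dt m\<rfloor>"
definition w where "w m z = uh m (idx m (snd z)) (cel m (fst z)) (fst z)"
definition tn where "tn m n = real n * dt m"
text \<open>The node, a cell centre at a time level, at which \<open>\<gamma>\<close> is sampled for
  the space-time point \<open>z\<close>.\<close>

definition zeta where "zeta m z = (ctr (cel m (fst z)), tn m (idx m (snd z)))"
definition S :: "('a \<times> real) set" where "S = {z. 0 \<le> snd z}"
text \<open>A generous margin: the cells of \<open>Q' m\<close> reach at most the radius
  \<open>R0 + real s + 4\<close>, and the times involved stay below \<open>R0 + 3\<close>.\<close>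

definition R1 :: real where "R1 = R0 + real s + 8"
definition Bx :: "('a \<times> real) set" where "Bx = cball 0 R1 \<times> {0..R1}"
text \<open>Extension by zero to negative times, about which the convergence says nothing.\<close>

definition v where "v z = indicator S z * u z"

abbreviation "hm m \<equiv> mesh_size (T m)"

lemma dt_pos: "dt m > 0" using rk[of m] by (rule sdrkdg.\<tau>)
lemma h_pos: "hm m > 0" using qm by (rule qu_mesh.h_pos)
lemma Bd0: "Bd \<ge> 0" using bd(1)[of undefined] by linarith
lemma M0: "M \<ge> 0" using bounded[of 0 undefined undefined] by simp
lemma L0: "L \<ge> 0" using dgm[of undefined] by (rule dg_discretization.L0)
lemma f_lip: "norm (f r - f r') \<le> L * \<bar>r - r'\<bar>" using dgm[of undefined] by (rule dg_discretization.f_lip)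
lemma f_cont: "continuous_on UNIV f" using dgm[of undefined] by (rule dg_discretization.f_continuous)

lemma space_time_eq: "space_time (T m) (dt m) (uh m) z = w m z"
  unfolding space_time_def w_def eval_broken_def idx_def cel_def qu_mesh.cell_of_def[OF qm] by (simp add: case_prod_unfold)

lemma eval_eq: "eval_broken (T m) (uh m n) x = uh m n (cel m x) x"
  unfolding eval_broken_def cel_def qu_mesh.cell_of_def[OF qm] ..

lemma w_bound: "z \<in> S \<Longrightarrow> \<bar>w m z\<bar> \<le> M"
  using bounded[of "snd z" m "fst z"] unfolding space_time_eq S_def by simp

lemma eval_bound: "\<bar>uh m 0 (cel m x) x\<bar> \<le> M"
  using w_bound[of "(x, 0)" m] unfolding w_def S_def idx_def by simp

lemma Bx: "compact Bx" "Bx \<in> sets lebesgue" "integrable lebesgue (indicator Bx :: _ \<Rightarrow> real)" "Bx \<subseteq> S"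
proof -
  show 1: "compact Bx" unfolding Bx_def by (intro compact_Times) auto
  show "Bx \<in> sets lebesgue" using 1 by (simp add: compact_imp_closed)
  then show "integrable lebesgue (indicator Bx :: _ \<Rightarrow> real)"
    using lmeasurable_compact[OF 1] by (intro integrable_real_indicator) (auto simp: fmeasurable_def)
  show "Bx \<subseteq> S" unfolding Bx_def S_def by auto
qed

lemma S_meas: "S \<in> sets lebesgue"
proof -
  have "closed (snd -` {0..} :: ('a \<times> real) set)" by (rule closed_vimage_snd) simp
  then have "snd -` {0..} \<in> sets (borel :: ('a \<times> real) measure)" by (rule borel_closed)
  moreover have "S = snd -` {0..}" unfolding S_def by auto
  ultimately show ?thesis by simp
qed

lemma step:
  assumes "uh m n \<in> broken_poly (T m) k"
  obtains U where "sdrkdg.stages (T m) f (F m) s A d (dt m) (uh m n) U"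
    "uh m (Suc n) = (\<lambda>K\<in>T m. \<lambda>x. uh m n K x - dt m * (\<Sum>i=1..s. b i * dg_div (T m) f (F m) (e i) (U i) K x))"
proof -
  have "sdRKDG_step (T m) f (F m) s A b d e (dt m) (uh m n) (uh m (Suc n))"
    using scheme[of m] unfolding sdRKDG_solution_def by blast
  then show ?thesis unfolding sdRKDG_step_def sdrkdg.stages_def[OF rk, symmetric] using that by blast
qed

lemma broken: "uh m n \<in> broken_poly (T m) k"
proof (induction n)
  case 0
  then show ?case using scheme[of m] unfolding sdRKDG_solution_def by blast
next
  case (Suc n)
  obtain U where "sdrkdg.stages (T m) f (F m) s A d (dt m) (uh m n) U"
    "uh m (Suc n) = (\<lambda>K\<in>T m. \<lambda>x. uh m n K x - dt m * (\<Sum>i=1..s. b i * dg_div (T m) f (F m) (e i) (U i) K x))"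
    by (rule step[OF Suc])
  then show ?case by (rule sdrkdg.step_broken[OF rk Suc])
qed

lemma uh_cont: "K \<in> T m \<Longrightarrow> continuous_on UNIV (uh m n K)"
  using dg_discretization.broken_poly_poly[OF dgm broken] poly_space_continuous by blast

lemma cel: "cel m x \<in> T m" "x \<in> cel m x"
  unfolding cel_def using qu_mesh.cell_of[OF qm] by blast+

lemma ctr_dist: "K \<in> T m \<Longrightarrow> x \<in> K \<Longrightarrow> dist (ctr K) x \<le> hm m"
  unfolding ctr_def using qu_mesh.cell_dist[OF qm] qu_mesh.centre_in[OF qm] by blast

lemma ctr_norm: "K \<in> T m \<Longrightarrow> x \<in> K \<Longrightarrow> norm x \<le> norm (ctr K) + hm m" "K \<in> T m \<Longrightarrow> x \<in> K \<Longrightarrow> norm (ctr K) \<le> norm x + hm m"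
  using ctr_dist[of K m x] norm_triangle_ineq2[of x "ctr K"] norm_triangle_ineq2[of "ctr K" x]
  by (auto simp: dist_norm norm_minus_commute)

lemma idx_time: assumes "0 \<le> t" shows "tn m (idx m t) \<le> t" "t < tn m (idx m t) + dt m"
  using time_index[OF dt_pos assms, of m "idx m t"] unfolding idx_def tn_def by (auto simp: algebra_simps)

lemma tn_nonneg: "0 \<le> tn m n" unfolding tn_def using dt_pos[of m] by simp

lemma tn_Suc: "tn m (Suc n) = tn m n + dt m" unfolding tn_def by (simp add: algebra_simps)

lemma zeta_dist: assumes "z \<in> S" shows "dist (zeta m z) z \<le> hm m + dt m"
proof -
  have "dist (zeta m z) z \<le> dist (ctr (cel m (fst z))) (fst z) + dist (tn m (idx m (snd z))) (snd z)"
    unfolding zeta_def dist_prod_def using sqrt_sum_squares_le_sum[of "dist (ctr (cel m (fst z))) (fst z)" "dist (tn m (idx m (snd z))) (snd z)"] by simp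
  then show ?thesis using ctr_dist[OF cel(1) cel(2), of m "fst z"] idx_time[of "snd z" m] assms unfolding S_def by (auto simp: dist_real_def)
qed

lemma hdt0: "(\<lambda>m. r * hm m + q * dt m) \<longlonglongrightarrow> 0"
  using tendsto_add[OF tendsto_mult_left[OF h0, of r] tendsto_mult_left[OF dt0, of q]] by simp

lemma zeta_lim: assumes "z \<in> S" shows "(\<lambda>m. zeta m z) \<longlonglongrightarrow> z"
proof -
  have "(\<lambda>m. dist (zeta m z) z) \<longlonglongrightarrow> 0"
    by (rule Lim_null_comparison[OF _ hdt0[of 1 1]]) (use zeta_dist[OF assms] in auto)
  then show ?thesis by (rule tendsto_dist_iff[THEN iffD2])
qed

lemma w_meas: "w m \<in> borel_measurable lebesgue"
proof -
  have "w m = (\<lambda>z. uh m (nat \<lfloor>snd z / dt m\<rfloor>) (qu_mesh.cell_of (T m) (fst z)) (fst z))"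
    by (rule ext) (simp only: w_def cel_def idx_def)
  then show ?thesis using qu_mesh.slabwise_measurable[OF qm, of m "uh m" "dt m"] uh_cont by simp
qed

lemma v_lim: "AE z in lebesgue. (\<lambda>m. indicator S z * w m z) \<longlonglongrightarrow> v z"
  using conv unfolding space_time_eq
proof eventually_elim
  case (elim z)
  then show ?case unfolding v_def S_def by (cases "0 \<le> snd z") auto
qed

text \<open>Measurability is inherited from the numerical solutions through the almost everywhere
  limit.\<close>

lemma v_meas: "v \<in> borel_measurable lebesgue"
proof (rule borel_measurable_AE)
  show "(\<lambda>z. lim (\<lambda>m. indicator S z * w m z)) \<in> borel_measurable lebesgue"
    by (rule borel_measurable_lim_metric, rule borel_measurable_times[OF borel_measurable_indicator[OF S_meas] w_meas])
  show "AE z in lebesgue. lim (\<lambda>m. indicator S z * w m z) = v z"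
    using v_lim by eventually_elim (rule limI)
qed

lemma v_bound: "AE z in lebesgue. \<bar>v z\<bar> \<le> M"
  using v_lim
proof eventually_elim
  case (elim z)
  have "\<bar>indicator S z * w m z\<bar> \<le> M" for m using w_bound[of z m] M0 by (auto simp: indicator_def)
  then show ?case using tendsto_rabs[OF elim] by (intro LIMSEQ_le_const2) auto
qed

lemma \<phi>_lip_x: "\<bar>\<phi> (x, t) - \<phi> (y, t)\<bar> \<le> Bd * dist x y"
proof -
  have "norm (\<phi> (x, t) - \<phi> (y, t)) \<le> Bd * norm (x - y)"
  proof (rule differentiable_bound[of UNIV "\<lambda>y. \<phi> (y, t)" "\<lambda>x v. v \<bullet> gx (x, t)" Bd])
    show "((\<lambda>y. \<phi> (y, t)) has_derivative (\<lambda>v. v \<bullet> gx (x, t))) (at x within UNIV)" for x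
      using dx[of t x] by (simp add: gderiv_def)
    show "onorm (\<lambda>v. v \<bullet> gx (x, t)) \<le> Bd" for x
    proof (rule onorm_le)
      fix v
      have "norm (v \<bullet> gx (x, t)) \<le> norm v * norm (gx (x, t))" by (simp add: Cauchy_Schwarz_ineq2)
      also have "\<dots> \<le> norm v * Bd" by (intro mult_left_mono bd) simp
      finally show "norm (v \<bullet> gx (x, t)) \<le> Bd * norm v" by (simp add: mult.commute)
    qed
  qed auto
  then show ?thesis by (simp add: dist_norm)
qed

lemma \<phi>_C1: "C1 (\<lambda>x. \<phi> (x, t))" "grad (\<lambda>x. \<phi> (x, t)) = (\<lambda>x. gx (x, t))"
proof -
  have "continuous_on UNIV (\<lambda>x. gx (x, t))" by (rule continuous_on_compose2[OF cgx]) (auto intro!: continuous_intros)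
  then show "C1 (\<lambda>x. \<phi> (x, t))" "grad (\<lambda>x. \<phi> (x, t)) = (\<lambda>x. gx (x, t))" using C1I[OF dx] by blast+
qed

text \<open>A backward quotient, because summation by parts pairs the increment from level
  \<open>n\<close> to \<open>Suc n\<close> with the solution at level \<open>Suc n\<close>. Level 0
  enters as a boundary term instead, hence the value 0 there.\<close>

definition Dd where "Dd m n K = (if n = 0 then 0 else (\<phi> (ctr K, tn m n) - \<phi> (ctr K, tn m (n - 1))) / dt m)"

lemma Dd_mvt:
  assumes "n \<noteq> 0" shows "\<exists>\<xi>. tn m n - dt m \<le> \<xi> \<and> \<xi> \<le> tn m n \<and> Dd m n K = gt (ctr K, \<xi>)"
proof -
  have t: "tn m n = tn m (n - 1) + dt m" using tn_Suc[of m "n - 1"] assms by simp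
  then have "tn m (n - 1) < tn m n" using dt_pos[of m] by simp
  then obtain \<xi> where "tn m (n - 1) < \<xi>" "\<xi> < tn m n" "\<phi> (ctr K, tn m n) - \<phi> (ctr K, tn m (n - 1)) = (tn m n - tn m (n - 1)) * gt (ctr K, \<xi>)"
    using MVT2[of "tn m (n - 1)" "tn m n" "\<lambda>r. \<phi> (ctr K, r)" "\<lambda>r. gt (ctr K, r)"] dtt by blast
  then show ?thesis using t dt_pos[of m] assms unfolding Dd_def by (intro exI[of _ \<xi>]) auto
qed

lemma Dd_bound: "\<bar>Dd m n K\<bar> \<le> Bd"
proof (cases "n = 0")
  case True
  then show ?thesis using Bd0 by (simp add: Dd_def)
next
  case False
  then show ?thesis using Dd_mvt[of n m K] bd(3) by force
qed

text \<open>A time level strictly beyond the support of \<open>\<phi>\<close>; the added one makes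
  the inequality strict.\<close>

definition Nm where "Nm m = nat \<lceil>R0 / dt m\<rceil> + 1"

lemma Nm: "tn m (Nm m) > R0" "tn m (Nm m) \<le> R0 + 2"
proof -
  have r: "R0 / dt m \<ge> 0" using R0 dt_pos[of m] by simp
  then have n: "real (nat \<lceil>R0 / dt m\<rceil>) = of_int \<lceil>R0 / dt m\<rceil>" by simp
  have "R0 / dt m \<le> of_int \<lceil>R0 / dt m\<rceil>" "of_int \<lceil>R0 / dt m\<rceil> \<le> R0 / dt m + 1" by linarith+
  moreover have "real (Nm m) = of_int \<lceil>R0 / dt m\<rceil> + 1" unfolding Nm_def using n by simp
  ultimately have a: "R0 / dt m < real (Nm m)" "real (Nm m) \<le> R0 / dt m + 2" by linarith+
  show "tn m (Nm m) > R0" using a(1) dt_pos[of m] unfolding tn_def by (simp add: pos_divide_less_eq)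
  have "real (Nm m) * dt m \<le> (R0 / dt m + 2) * dt m" using a(2) dt_pos[of m] by (intro mult_right_mono) auto
  also have "\<dots> = R0 + 2 * dt m" using dt_pos[of m] by (simp add: field_simps)
  finally show "tn m (Nm m) \<le> R0 + 2" unfolding tn_def using dt1[of m] by linarith
qed

lemma tn_mono: "n \<le> n' \<Longrightarrow> tn m n \<le> tn m n'"
  unfolding tn_def using dt_pos[of m] by (intro mult_right_mono) auto

text \<open>\<open>Q m\<close> contains every cell on which \<open>\<phi>\<close> can be nonzero,
  and \<open>Q' m\<close> also the patches around these cells.\<close>

definition Q where "Q m = qu_mesh.near (T m) (cball 0 R0)"
definition Q' where "Q' m = qu_mesh.near (T m) (cball 0 (R0 + real s + 3))"

lemma Q: "finite (Q m)" "Q m \<subseteq> T m" "finite (Q' m)" "Q' m \<subseteq> T m"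
  unfolding Q_def Q'_def using qu_mesh.near_finite[OF qm] qu_mesh.near_def[OF qm] by auto

lemma not_Q: "K \<in> T m \<Longrightarrow> K \<notin> Q m \<Longrightarrow> x \<in> K \<Longrightarrow> R0 < norm x"
  unfolding Q_def qu_mesh.near_def[OF qm] by force

lemma ctr_in: "K \<in> T m \<Longrightarrow> ctr K \<in> K" unfolding ctr_def using qu_mesh.centre_in[OF qm] by blast

lemma Q_norm: "K \<in> Q m \<Longrightarrow> x \<in> K \<Longrightarrow> norm x \<le> R0 + 1"
  using qu_mesh.near_subset[OF qm, of K m 0 R0] h1[of m] unfolding Q_def by fastforce

lemma Q'_norm: "K \<in> Q' m \<Longrightarrow> x \<in> K \<Longrightarrow> norm x \<le> R0 + real s + 4"
  using qu_mesh.near_subset[OF qm, of K m 0 "R0 + real s + 3"] h1[of m] unfolding Q'_def by fastforce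

lemma Q_Q': assumes "K \<in> Q m" "K' \<in> T m" "K' \<subseteq> cball (ctr K) ((real s + 2) * hm m)" shows "K' \<in> Q' m" "dist (ctr K') (ctr K) \<le> (real s + 2) * hm m"
proof -
  have c: "ctr K' \<in> K'" "ctr K \<in> K" using ctr_in assms Q by blast+
  then show d: "dist (ctr K') (ctr K) \<le> (real s + 2) * hm m" using assms(3) by (auto simp: dist_commute)
  also have "\<dots> \<le> (real s + 2) * 1" using h1[of m] by (intro mult_left_mono) auto
  finally have "norm (ctr K') \<le> norm (ctr K) + (real s + 2)" using norm_triangle_ineq2[of "ctr K'" "ctr K"] by (simp add: dist_norm)
  then have "norm (ctr K') \<le> R0 + real s + 3" using Q_norm[OF assms(1) c(2)] by simp
  then show "K' \<in> Q' m" using c(1) assms(2) unfolding Q'_def qu_mesh.near_def[OF qm] by auto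
qed

text \<open>\<open>I0\<close>, \<open>I1\<close> and \<open>I2\<close> are the discrete counterparts
  of the three integrals of the weak formulation. In \<open>I2\<close> the flux is evaluated at
  \<open>\<gamma>\<close> instead of the numerical solution; \<open>Er\<close> measures the distance
  between the two.\<close>

definition I0 where "I0 m = (\<integral>x. uh m 0 (cel m x) x * \<phi> (ctr (cel m x), 0) \<partial>lebesgue)"
definition I1 where "I1 m = (\<integral>z. indicator S z * (w m z * Dd m (idx m (snd z)) (cel m (fst z))) \<partial>lebesgue)"
definition I2 where "I2 \<gamma> m = (\<integral>z. indicator S z * (f (\<gamma> (zeta m z)) \<bullet> gx (fst z, tn m (idx m (snd z)))) \<partial>lebesgue)"
definition Er where "Er \<gamma> m = (\<integral>z. indicator Bx z * \<bar>w m z - \<gamma> (zeta m z)\<bar> \<partial>lebesgue)"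

lemma I0_sum:
  "has_bochner_integral lebesgue (\<lambda>x. uh m 0 (cel m x) x * \<phi> (ctr (cel m x), 0))
     (\<Sum>K\<in>Q m. \<phi> (ctr K, 0) * (\<integral>x. indicator K x * uh m 0 K x \<partial>lborel))"
proof -
  have "has_bochner_integral lebesgue (\<lambda>x. uh m 0 (cel m x) x * \<phi> (ctr (cel m x), 0))
     (\<Sum>K\<in>Q m. \<integral>x. indicator K x * (uh m 0 K x * \<phi> (ctr K, 0)) \<partial>lborel)"
    unfolding cel_def
  proof (rule qu_mesh.cellwise_integral[OF qm Q(1,2), where a="\<lambda>K x. uh m 0 K x * \<phi> (ctr K, 0)"])
    fix K assume "K \<in> Q m"
    then show "continuous_on UNIV (\<lambda>x. uh m 0 K x * \<phi> (ctr K, 0))" using uh_cont Q by (intro continuous_intros) blast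
  next
    fix K x assume "K \<in> T m" "K \<notin> Q m"
    then show "uh m 0 K x * \<phi> (ctr K, 0) = 0" using supp[of "ctr K" 0] not_Q[OF _ _ ctr_in] by simp
  qed
  also have "(\<Sum>K\<in>Q m. \<integral>x. indicator K x * (uh m 0 K x * \<phi> (ctr K, 0)) \<partial>lborel) = (\<Sum>K\<in>Q m. \<phi> (ctr K, 0) * (\<integral>x. indicator K x * uh m 0 K x \<partial>lborel))"
    by (simp only: indicator_integral_cmult)
  finally show ?thesis .
qed

lemma I1_sum:
  "has_bochner_integral lebesgue (\<lambda>z. indicator S z * (w m z * Dd m (idx m (snd z)) (cel m (fst z))))
     (\<Sum>n<Nm m. \<Sum>K\<in>Q m. (\<phi> (ctr K, tn m (Suc n)) - \<phi> (ctr K, tn m n)) * (\<integral>x. indicator K x * uh m (Suc n) K x \<partial>lborel))"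
proof -
  have "has_bochner_integral lebesgue (\<lambda>z. indicator S z * (w m z * Dd m (idx m (snd z)) (cel m (fst z))))
     (dt m * (\<Sum>n<Suc (Nm m). \<Sum>K\<in>Q m. \<integral>x. indicator K x * (uh m n K x * Dd m n K) \<partial>lborel))"
    unfolding cel_def idx_def w_def S_def
  proof (rule qu_mesh.slabwise_integral[OF qm Q(1,2) dt_pos, where a="\<lambda>n K x. uh m n K x * Dd m n K"])
    fix K n assume "K \<in> Q m"
    then show "continuous_on UNIV (\<lambda>x. uh m n K x * Dd m n K)" using uh_cont Q by (intro continuous_intros) blast
  next
    fix n K x assume "K \<in> T m" "K \<notin> Q m"
    then show "uh m n K x * Dd m n K = 0" using supp[of "ctr K"] not_Q[OF _ _ ctr_in] unfolding Dd_def by simp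
  next
    \<comment> \<open>The quotient at level \<open>n\<close> also involves level
      \<open>n - 1\<close>, so the cutoff is one level beyond \<open>Nm m\<close>.\<close>
    fix n K x assume n: "Suc (Nm m) \<le> n"
    have "Nm m \<le> n - 1" "Nm m \<le> n" using n by linarith+
    then have "R0 < tn m n" "R0 < tn m (n - 1)"
      using Nm(1)[of m] tn_mono[of "Nm m" n m] tn_mono[of "Nm m" "n - 1" m] by linarith+
    then have "R0 < \<bar>tn m n\<bar>" "R0 < \<bar>tn m (n - 1)\<bar>" by linarith+
    then show "uh m n K x * Dd m n K = 0" using supp[of "ctr K"] unfolding Dd_def by simp
  qed
  also have "dt m * (\<Sum>n<Suc (Nm m). \<Sum>K\<in>Q m. \<integral>x. indicator K x * (uh m n K x * Dd m n K) \<partial>lborel)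
     = (\<Sum>n<Suc (Nm m). \<Sum>K\<in>Q m. dt m * Dd m n K * (\<integral>x. indicator K x * uh m n K x \<partial>lborel))"
    unfolding sum_distrib_left by (simp only: indicator_integral_cmult mult.assoc)
  \<comment> \<open>The term at level 0 vanishes by the convention for \<open>Dd\<close>, which
    makes the index shift exact.\<close>
  also have "\<dots> = (\<Sum>n<Nm m. \<Sum>K\<in>Q m. dt m * Dd m (Suc n) K * (\<integral>x. indicator K x * uh m (Suc n) K x \<partial>lborel))"
    by (subst sum.lessThan_Suc_shift) (simp add: Dd_def)
  also have "\<dots> = (\<Sum>n<Nm m. \<Sum>K\<in>Q m. (\<phi> (ctr K, tn m (Suc n)) - \<phi> (ctr K, tn m n)) * (\<integral>x. indicator K x * uh m (Suc n) K x \<partial>lborel))"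
    using dt_pos[of m] by (simp add: Dd_def)
  finally show ?thesis .
qed

lemma f\<gamma>_cont: assumes "continuous_on UNIV \<gamma>" shows "continuous_on UNIV (\<lambda>z. f (\<gamma> z))"
  by (rule continuous_on_compose2[OF f_cont assms]) simp

lemma I2_sum:
  "has_bochner_integral lebesgue (\<lambda>z. indicator S z * (f (\<gamma> (zeta m z)) \<bullet> gx (fst z, tn m (idx m (snd z)))))
     (dt m * (\<Sum>n<Nm m. \<Sum>K\<in>Q m. \<integral>x. indicator K x * (f (\<gamma> (ctr K, tn m n)) \<bullet> gx (x, tn m n)) \<partial>lborel))"
  unfolding cel_def idx_def S_def zeta_def fst_conv snd_conv
proof (rule qu_mesh.slabwise_integral[OF qm Q(1,2) dt_pos, where a="\<lambda>n K x. f (\<gamma> (ctr K, tn m n)) \<bullet> gx (x, tn m n)"])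
  fix K n
  have "continuous_on UNIV (\<lambda>x. gx (x, tn m n))" by (rule continuous_on_compose2[OF cgx]) (auto intro!: continuous_intros)
  then show "continuous_on UNIV (\<lambda>x. f (\<gamma> (ctr K, tn m n)) \<bullet> gx (x, tn m n))" by (intro continuous_intros)
next
  fix n K x assume "K \<in> T m" "K \<notin> Q m" "x \<in> K"
  then show "f (\<gamma> (ctr K, tn m n)) \<bullet> gx (x, tn m n) = 0" using supp[of x] not_Q by simp
next
  fix n K x assume n: "Nm m \<le> n"
  have "R0 < \<bar>tn m n\<bar>" using Nm(1)[of m] tn_mono[OF n, of m] by linarith
  then show "f (\<gamma> (ctr K, tn m n)) \<bullet> gx (x, tn m n) = 0" using supp[of x] by simp
qed

lemma Er_integrable:
  assumes \<gamma>: "continuous_on UNIV \<gamma>" "\<And>z. \<bar>\<gamma> z\<bar> \<le> M"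
  shows "(\<lambda>z. indicator Bx z * \<bar>w m z - \<gamma> (zeta m z)\<bar>) \<in> borel_measurable lebesgue"
    "\<bar>indicator Bx z * \<bar>w m z - \<gamma> (zeta m z)\<bar>\<bar> \<le> 2 * M * indicator Bx z"
    "integrable lebesgue (\<lambda>z. indicator Bx z * \<bar>w m z - \<gamma> (zeta m z)\<bar>)"
proof -
  have z: "(\<lambda>z. \<gamma> (zeta m z)) \<in> borel_measurable lebesgue"
    unfolding zeta_def cel_def idx_def
    by (rule qu_mesh.slabwise_measurable[OF qm, where a="\<lambda>n K x. \<gamma> (ctr K, tn m n)"]) simp
  then show m: "(\<lambda>z. indicator Bx z * \<bar>w m z - \<gamma> (zeta m z)\<bar>) \<in> borel_measurable lebesgue"
    using w_meas Bx(2) by (intro borel_measurable_times borel_measurable_indicator borel_measurable_abs borel_measurable_diff)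
  have b: "\<bar>indicator Bx z * \<bar>w m z - \<gamma> (zeta m z)\<bar>\<bar> \<le> 2 * M * indicator Bx z" for z
  proof (cases "z \<in> Bx")
    case True
    then have "\<bar>w m z\<bar> \<le> M" using Bx(4) w_bound by blast
    then show ?thesis using \<gamma>(2)[of "zeta m z"] True by simp
  qed simp
  then show "\<bar>indicator Bx z * \<bar>w m z - \<gamma> (zeta m z)\<bar>\<bar> \<le> 2 * M * indicator Bx z" .
  show "integrable lebesgue (\<lambda>z. indicator Bx z * \<bar>w m z - \<gamma> (zeta m z)\<bar>)"
    by (rule Bochner_Integration.integrable_bound[of _ "\<lambda>z. 2 * M * indicator Bx z"]) (use Bx(3) m b M0 in \<open>auto intro!: AE_I2\<close>)
qed

text \<open>The arguments exhibit the uniformity: the constant depends on \<open>\<sigma>\<close>,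
  on \<open>C\<close>, \<open>L\<close>, \<open>Ci\<close>, on the Runge-Kutta coefficients and on
  the CFL number, but not on \<open>m\<close>.\<close>

definition Cf where "Cf = sdrkdg.step_const TYPE('a) \<sigma> C L Ci s A b lam"
text \<open>\<open>R0 + 2\<close> bounds the time span. The last factor bounds the number of cells
  of \<open>Q' m\<close> after multiplication by \<open>hm m ^ DIM('a)\<close>, the scale of a cell
  volume.\<close>

definition Vol where "Vol = (R0 + 2) * dg_discretization.ball_const TYPE('a) * ((R0 + real s + 4) / \<sigma>\<^sup>2) ^ DIM('a)"

end

section \<open>The discrete balance and its error\<close>

context lax_wendroff begin

lemma Cf_nonneg: "Cf \<ge> 0"
proof -
  interpret sdrkdg "T 0" \<sigma> f "F 0" k C L Ci s A b d e "dt 0" lam by (rule rk)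
  \<comment> \<open>\<open>step_const\<close> is defined in a context that assumes a time step, so
    one step is exhibited to unfold it.\<close>
  obtain U where "stages (uh 0 0) U" "uh 0 (Suc 0) = (\<lambda>K\<in>T 0. \<lambda>x. uh 0 0 K x - dt 0 * (\<Sum>i=1..s. b i * dg_div (T 0) f (F 0) (e i) (U i) K x))"
    by (rule step[OF broken])
  note * = step_const_def[OF broken this]
  show ?thesis unfolding Cf_def * using flux_const Ci by (intro mult_nonneg_nonneg) auto
qed

lemma step_estimate:
  assumes \<omega>: "\<And>K K'. K \<in> Q m \<Longrightarrow> K' \<in> T m \<Longrightarrow> K' \<subseteq> cball (ctr K) ((real s + 2) * hm m) \<Longrightarrow> \<bar>\<gamma> (ctr K', tn m n) - \<gamma> (ctr K, tn m n)\<bar> \<le> \<omega>" "\<omega> \<ge> 0"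
  shows "\<bar>(\<Sum>K\<in>Q m. \<phi> (ctr K, tn m n) * ((\<integral>x. indicator K x * uh m (Suc n) K x \<partial>lborel) - (\<integral>x. indicator K x * uh m n K x \<partial>lborel)))
      - dt m * (\<Sum>K\<in>Q m. \<integral>x. indicator K x * (f (\<gamma> (ctr K, tn m n)) \<bullet> gx (x, tn m n)) \<partial>lborel)\<bar>
    \<le> dt m * Cf * Bd * (\<Sum>K\<in>Q' m. (\<integral>x. indicator K x * \<bar>uh m n K x - \<gamma> (ctr K, tn m n)\<bar> \<partial>lborel) + \<omega> * dg_discretization.ball_const TYPE('a) * hm m ^ DIM('a))"
proof -
  obtain U where U: "sdrkdg.stages (T m) f (F m) s A d (dt m) (uh m n) U"
    "uh m (Suc n) = (\<lambda>K\<in>T m. \<lambda>x. uh m n K x - dt m * (\<Sum>i=1..s. b i * dg_div (T m) f (F m) (e i) (U i) K x))"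
    by (rule step[OF broken])
  have "\<bar>(\<Sum>K\<in>Q m. \<phi> (ctr K, tn m n) * (\<integral>x. indicator K x * (uh m (Suc n) K x - uh m n K x) \<partial>lborel))
      - dt m * (\<Sum>K\<in>Q m. \<integral>x. indicator K x * (f (\<gamma> (ctr K, tn m n)) \<bullet> grad (\<lambda>x. \<phi> (x, tn m n)) x) \<partial>lborel)\<bar>
    \<le> dt m * Cf * Bd * (\<Sum>K\<in>Q' m. (\<integral>x. indicator K x * \<bar>uh m n K x - \<gamma> (ctr K, tn m n)\<bar> \<partial>lborel) + \<omega> * dg_discretization.ball_const TYPE('a) * hm m ^ DIM('a))"
    unfolding Cf_def
  proof (rule sdrkdg.weak_step_L1[OF rk broken U Q(1,2) \<phi>_C1(1) _ _ Bd0 Q(3,4) _ _ \<omega>(2)])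
    fix K x assume "K \<in> T m" "K \<notin> Q m" "x \<in> K"
    then show "\<phi> (x, tn m n) = 0" using supp[of x] not_Q by blast
  next
    fix K x assume K: "K \<in> Q m" "x \<in> K"
    then have "dist (ctr K) x \<le> hm m" using ctr_dist Q(2) by blast
    then have "Bd * dist x (ctr K) \<le> Bd * hm m" using Bd0 by (intro mult_left_mono) (auto simp: dist_commute)
    then show "\<bar>\<phi> (x, tn m n) - \<phi> (ctr K, tn m n)\<bar> \<le> Bd * hm m" using \<phi>_lip_x[of x "tn m n" "ctr K"] by linarith
  next
    fix K K' assume K: "K \<in> Q m" "K' \<in> T m" "K' \<subseteq> cball (qu_mesh.centre \<sigma> K) ((real s + 2) * hm m)"
    then show "K' \<in> Q' m" using Q_Q'(1) unfolding ctr_def by blast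
    show "\<bar>\<gamma> (ctr K', tn m n) - \<gamma> (ctr K, tn m n)\<bar> \<le> \<omega>" using \<omega>(1) K unfolding ctr_def by blast
  qed
  moreover have "(\<integral>x. indicator K x * (uh m (Suc n) K x - uh m n K x) \<partial>lborel) = (\<integral>x. indicator K x * uh m (Suc n) K x \<partial>lborel) - (\<integral>x. indicator K x * uh m n K x \<partial>lborel)"
    if "K \<in> Q m" for K
  proof -
    have K: "K \<in> T m" using that Q by blast
    have i: "integrable lborel (\<lambda>x. indicator K x * uh m n K x)" for n
      by (rule integrable_on_compact[OF qu_mesh.cell(3)[OF qm K]]) (rule continuous_on_subset[OF uh_cont[OF K]], simp)
    show ?thesis using Bochner_Integration.integral_diff[OF i i] by (simp only: right_diff_distrib)
  qed
  ultimately show ?thesis unfolding \<phi>_C1(2) by (simp cong: sum.cong)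
qed

text \<open>The double sum is the space-time integral of a function cut off outside
  \<open>Q' m\<close> and from level \<open>Nm m\<close> on; wherever this function is nonzero, the
  point lies in \<open>Bx\<close>.\<close>

lemma Er_sum:
  assumes \<gamma>: "continuous_on UNIV \<gamma>" "\<And>z. \<bar>\<gamma> z\<bar> \<le> M"
  shows "dt m * (\<Sum>n<Nm m. \<Sum>K\<in>Q' m. \<integral>x. indicator K x * \<bar>uh m n K x - \<gamma> (ctr K, tn m n)\<bar> \<partial>lborel) \<le> Er \<gamma> m"
proof -
  define a where "a n K x = (if K \<in> Q' m \<and> n < Nm m then \<bar>uh m n K x - \<gamma> (ctr K, tn m n)\<bar> else 0)" for n K x
  have hb: "has_bochner_integral lebesgue (\<lambda>z. indicator S z * a (idx m (snd z)) (cel m (fst z)) (fst z))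
     (dt m * (\<Sum>n<Nm m. \<Sum>K\<in>Q' m. \<integral>x. indicator K x * a n K x \<partial>lborel))"
    unfolding cel_def idx_def S_def
  proof (rule qu_mesh.slabwise_integral[OF qm Q(3,4) dt_pos, where a=a])
    fix K n assume "K \<in> Q' m"
    then have "continuous_on UNIV (uh m n K)" using uh_cont Q by blast
    then show "continuous_on UNIV (a n K)" unfolding a_def[abs_def] by (cases "K \<in> Q' m \<and> n < Nm m") (auto intro!: continuous_intros)
  qed (auto simp: a_def)
  have "dt m * (\<Sum>n<Nm m. \<Sum>K\<in>Q' m. \<integral>x. indicator K x * \<bar>uh m n K x - \<gamma> (ctr K, tn m n)\<bar> \<partial>lborel)
    = dt m * (\<Sum>n<Nm m. \<Sum>K\<in>Q' m. \<integral>x. indicator K x * a n K x \<partial>lborel)"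
    by (intro arg_cong2[where f="(*)"] sum.cong refl Bochner_Integration.integral_cong) (auto simp: a_def)
  also have "\<dots> = (\<integral>z. indicator S z * a (idx m (snd z)) (cel m (fst z)) (fst z) \<partial>lebesgue)"
    using hb by (simp add: has_bochner_integral_iff)
  also have "\<dots> \<le> Er \<gamma> m" unfolding Er_def
  proof (rule integral_mono)
    show "integrable lebesgue (\<lambda>z. indicator S z * a (idx m (snd z)) (cel m (fst z)) (fst z))" using hb by (simp add: has_bochner_integral_iff)
    show "integrable lebesgue (\<lambda>z. indicator Bx z * \<bar>w m z - \<gamma> (zeta m z)\<bar>)" by (rule Er_integrable(3)[OF \<gamma>])
    fix z
    show "indicator S z * a (idx m (snd z)) (cel m (fst z)) (fst z) \<le> indicator Bx z * \<bar>w m z - \<gamma> (zeta m z)\<bar>"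
    proof (cases "z \<in> S \<and> cel m (fst z) \<in> Q' m \<and> idx m (snd z) < Nm m")
      case True
      have "norm (fst z) \<le> R1" using Q'_norm[OF _ cel(2)] True unfolding R1_def by force
      moreover have "tn m (Suc (idx m (snd z))) \<le> tn m (Nm m)" using True by (intro tn_mono) simp
      then have "snd z \<le> R1" using idx_time(2)[of "snd z" m] True Nm(2)[of m] unfolding tn_Suc S_def R1_def by auto
      ultimately have "z \<in> Bx" using True unfolding Bx_def S_def by (cases z) auto
      then show ?thesis using True by (simp add: a_def w_def zeta_def)
    next
      case False
      then have z0: "indicator S z * a (idx m (snd z)) (cel m (fst z)) (fst z) = 0" by (auto simp: a_def indicator_def)
      show ?thesis unfolding z0 by simp
    qed
  qed
  finally show ?thesis .
qed

lemma volume_bound: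
  assumes "\<omega> \<ge> 0"
  shows "dt m * (\<Sum>n<Nm m. \<Sum>K\<in>Q' m. \<omega> * dg_discretization.ball_const TYPE('a) * hm m ^ DIM('a)) \<le> \<omega> * Vol"
proof -
  interpret dg_discretization "T m" \<sigma> f "F m" k C L Ci by (rule dgm)
  let ?r = "R0 + real s + 4"
  have hh: "hm m > 0" by (rule h_pos)
  have c: "real (card (Q' m)) \<le> (?r / (\<sigma>\<^sup>2 * hm m)) ^ DIM('a)"
  proof (rule packing(2))
    show "Q' m \<subseteq> T m" by (rule Q)
    show "K \<subseteq> cball 0 ?r" if "K \<in> Q' m" for K using Q'_norm[OF that] by auto
    show "0 \<le> ?r" using R0 by simp
  qed
  have "hm m ^ DIM('a) * real (card (Q' m)) \<le> hm m ^ DIM('a) * (?r / (\<sigma>\<^sup>2 * hm m)) ^ DIM('a)" using c hh by (intro mult_left_mono) auto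
  also have "\<dots> = (?r / \<sigma>\<^sup>2) ^ DIM('a)" using hh by (simp add: power_mult_distrib[symmetric])
  finally have c': "hm m ^ DIM('a) * real (card (Q' m)) \<le> (?r / \<sigma>\<^sup>2) ^ DIM('a)" .
  have "dt m * (\<Sum>n<Nm m. \<Sum>K\<in>Q' m. \<omega> * ball_const * hm m ^ DIM('a)) = tn m (Nm m) * (\<omega> * ball_const * (hm m ^ DIM('a) * real (card (Q' m))))"
    by (simp add: tn_def mult_ac)
  also have "\<dots> \<le> (R0 + 2) * (\<omega> * ball_const * (?r / \<sigma>\<^sup>2) ^ DIM('a))"
    using Nm(2)[of m] c' assms ball_const R0 hh by (intro mult_mono mult_left_mono mult_nonneg_nonneg) auto
  also have "\<dots> = \<omega> * Vol" unfolding Vol_def by (simp only: mult_ac)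
  finally show ?thesis .
qed

text \<open>In the summation by parts the upper boundary term vanishes because level
  \<open>Nm m\<close> lies beyond the support of \<open>\<phi>\<close>, and the lower one is
  \<open>I0 m\<close>. What remains is the accumulation of the one-step errors.\<close>

lemma balance:
  assumes \<gamma>: "continuous_on UNIV \<gamma>" "\<And>z. \<bar>\<gamma> z\<bar> \<le> M"
    and \<omega>: "\<And>K K' n. K \<in> Q m \<Longrightarrow> K' \<in> T m \<Longrightarrow> K' \<subseteq> cball (ctr K) ((real s + 2) * hm m) \<Longrightarrow> n < Nm m \<Longrightarrow>
      \<bar>\<gamma> (ctr K', tn m n) - \<gamma> (ctr K, tn m n)\<bar> \<le> \<omega>" "\<omega> \<ge> 0"
  shows "\<bar>I0 m + I1 m + I2 \<gamma> m\<bar> \<le> Cf * Bd * (Er \<gamma> m + \<omega> * Vol)"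
proof -
  define a where "a n K = (\<integral>x. indicator K x * uh m n K x \<partial>lborel)" for n K
  define p where "p n K = \<phi> (ctr K, tn m n)" for n K
  define g where "g n K = (\<integral>x. indicator K x * (f (\<gamma> (ctr K, tn m n)) \<bullet> gx (x, tn m n)) \<partial>lborel)" for n K
  define X where "X n K = (\<integral>x. indicator K x * \<bar>uh m n K x - \<gamma> (ctr K, tn m n)\<bar> \<partial>lborel)" for n K
  define V where "V = \<omega> * dg_discretization.ball_const TYPE('a) * hm m ^ DIM('a)"
  have I0: "I0 m = (\<Sum>K\<in>Q m. p 0 K * a 0 K)" unfolding I0_def p_def a_def using I0_sum[of m] by (simp add: has_bochner_integral_iff tn_def)
  have I1: "I1 m = (\<Sum>n<Nm m. \<Sum>K\<in>Q m. (p (Suc n) K - p n K) * a (Suc n) K)" unfolding I1_def p_def a_def using I1_sum[of m] by (simp only: has_bochner_integral_iff)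
  have I2: "I2 \<gamma> m = dt m * (\<Sum>n<Nm m. \<Sum>K\<in>Q m. g n K)" unfolding I2_def g_def using I2_sum[of \<gamma> m] by (simp only: has_bochner_integral_iff)
  have "R0 < \<bar>tn m (Nm m)\<bar>" using Nm(1)[of m] by linarith
  then have pN: "p (Nm m) K = 0" for K unfolding p_def using supp[of "ctr K" "tn m (Nm m)"] by blast
  have "(\<Sum>n<Nm m. \<Sum>K\<in>Q m. p n K * (a (Suc n) K - a n K)) = (\<Sum>K\<in>Q m. \<Sum>n<Nm m. p n K * (a (Suc n) K - a n K))"
    by (rule sum.swap)
  also have "\<dots> = (\<Sum>K\<in>Q m. - (p 0 K * a 0 K) - (\<Sum>n<Nm m. (p (Suc n) K - p n K) * a (Suc n) K))"
    by (rule sum.cong[OF refl], subst summation_by_parts) (simp add: pN)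
  also have "\<dots> = - (I0 m) - (\<Sum>K\<in>Q m. \<Sum>n<Nm m. (p (Suc n) K - p n K) * a (Suc n) K)" unfolding I0 by (simp only: sum_subtractf sum_negf)
  also have "(\<Sum>K\<in>Q m. \<Sum>n<Nm m. (p (Suc n) K - p n K) * a (Suc n) K) = I1 m" unfolding I1 by (rule sum.swap)
  finally have P: "(\<Sum>n<Nm m. \<Sum>K\<in>Q m. p n K * (a (Suc n) K - a n K)) = - I0 m - I1 m" .
  have st: "\<bar>(\<Sum>K\<in>Q m. p n K * (a (Suc n) K - a n K)) - dt m * (\<Sum>K\<in>Q m. g n K)\<bar> \<le> dt m * Cf * Bd * (\<Sum>K\<in>Q' m. X n K + V)" if "n < Nm m" for n
    unfolding p_def a_def g_def X_def V_def using \<omega> that by (intro step_estimate) auto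
  have "I0 m + I1 m + I2 \<gamma> m = - (\<Sum>n<Nm m. (\<Sum>K\<in>Q m. p n K * (a (Suc n) K - a n K)) - dt m * (\<Sum>K\<in>Q m. g n K))"
    unfolding sum_subtractf P I2 sum_distrib_left by simp
  then have "\<bar>I0 m + I1 m + I2 \<gamma> m\<bar> \<le> (\<Sum>n<Nm m. \<bar>(\<Sum>K\<in>Q m. p n K * (a (Suc n) K - a n K)) - dt m * (\<Sum>K\<in>Q m. g n K)\<bar>)"
    by (simp only: abs_minus_cancel sum_abs)
  also have "\<dots> \<le> (\<Sum>n<Nm m. dt m * Cf * Bd * (\<Sum>K\<in>Q' m. X n K + V))" using st by (intro sum_mono) auto
  also have "\<dots> = Cf * Bd * (dt m * (\<Sum>n<Nm m. \<Sum>K\<in>Q' m. X n K) + dt m * (\<Sum>n<Nm m. \<Sum>K\<in>Q' m. V))"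
    unfolding sum.distrib sum_distrib_left[symmetric] distrib_left by (simp only: mult_ac)
  also have "\<dots> \<le> Cf * Bd * (Er \<gamma> m + \<omega> * Vol)"
    using Er_sum[OF \<gamma>, of m] volume_bound[OF \<omega>(2), of m] Cf_nonneg Bd0 unfolding X_def V_def
    by (intro mult_left_mono add_mono) auto
  finally show ?thesis .
qed

section \<open>Passage to the limit\<close>

lemma AE_pos: "AE z in (lebesgue :: ('a \<times> real) measure). snd z \<noteq> 0"
proof -
  have "AE z in lborel. ((0, 1) :: 'a \<times> real) \<bullet> z \<noteq> 0" by (rule AE_not_hyperplane) (simp add: norm_Pair)
  then have "AE z in (lborel :: ('a \<times> real) measure). snd z \<noteq> 0" by (simp add: inner_prod_def)
  then show ?thesis by (rule AE_completion)
qed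

lemma v_limit_S: "AE z in lebesgue. z \<in> S \<longrightarrow> (\<lambda>m. w m z) \<longlonglongrightarrow> v z"
  using v_lim by eventually_elim auto

lemma isCont_lim: "continuous_on UNIV g \<Longrightarrow> (\<lambda>m. X m) \<longlonglongrightarrow> x \<Longrightarrow> (\<lambda>m. g (X m)) \<longlonglongrightarrow> g x"
  by (rule continuous_on_tendsto_compose[of UNIV g]) auto

lemma Er_lim:
  assumes \<gamma>: "continuous_on UNIV \<gamma>" "\<And>z. \<bar>\<gamma> z\<bar> \<le> M"
  shows "Er \<gamma> \<longlonglongrightarrow> (\<integral>z. indicator Bx z * \<bar>v z - \<gamma> z\<bar> \<partial>lebesgue)"
  unfolding Er_def[abs_def]
proof (rule integral_dominated_convergence[where w="\<lambda>z. 2 * M * indicator Bx z"])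
  show "integrable lebesgue (\<lambda>z. 2 * M * indicator Bx z)" using Bx(3) by simp
  show "(\<lambda>z. indicator Bx z * \<bar>v z - \<gamma> z\<bar>) \<in> borel_measurable lebesgue"
    using v_meas continuous_lebesgue_measurable[OF \<gamma>(1)] Bx(2) by (intro borel_measurable_times borel_measurable_indicator borel_measurable_abs borel_measurable_diff)
  show "(\<lambda>z. indicator Bx z * \<bar>w m z - \<gamma> (zeta m z)\<bar>) \<in> borel_measurable lebesgue" for m by (rule Er_integrable(1)[OF \<gamma>])
  show "AE z in lebesgue. norm (indicator Bx z * \<bar>w m z - \<gamma> (zeta m z)\<bar>) \<le> 2 * M * indicator Bx z" for m
    using Er_integrable(2)[OF \<gamma>] by (intro AE_I2) (simp only: real_norm_def)
  show "AE z in lebesgue. (\<lambda>m. indicator Bx z * \<bar>w m z - \<gamma> (zeta m z)\<bar>) \<longlonglongrightarrow> indicator Bx z * \<bar>v z - \<gamma> z\<bar>"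
    using v_limit_S
  proof eventually_elim
    case (elim z)
    show ?case
    proof (cases "z \<in> Bx")
      case True
      then have "z \<in> S" using Bx(4) by blast
      then have "(\<lambda>m. \<bar>w m z - \<gamma> (zeta m z)\<bar>) \<longlonglongrightarrow> \<bar>v z - \<gamma> z\<bar>"
        using elim zeta_lim isCont_lim[OF \<gamma>(1)] by (intro tendsto_intros) auto
      then show ?thesis using True by simp
    qed simp
  qed
qed

lemma time_point_lim: assumes "z \<in> S" shows "(\<lambda>m. tn m (idx m (snd z))) \<longlonglongrightarrow> snd z"
proof -
  have "(\<lambda>m. snd (zeta m z)) \<longlonglongrightarrow> snd z" by (rule tendsto_snd[OF zeta_lim[OF assms]])
  then show ?thesis by (simp add: zeta_def)
qed

lemma support_Bx:
  assumes "z \<in> S" "norm (fst z) \<le> R0 + 1" "snd z \<le> R0 + 3" shows "z \<in> Bx"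
  using assms unfolding Bx_def S_def R1_def by (cases z) auto

text \<open>Only \<open>\<gamma>\<close> and \<open>gx\<close> are sampled here, so continuity gives
  convergence at every point, and the Lipschitz bound of \<open>f\<close> gives the dominating
  function.\<close>

lemma I2_lim:
  assumes \<gamma>: "continuous_on UNIV \<gamma>" "\<And>z. \<bar>\<gamma> z\<bar> \<le> M"
  shows "I2 \<gamma> \<longlonglongrightarrow> (\<integral>z. indicator S z * (f (\<gamma> z) \<bullet> gx z) \<partial>lebesgue)"
  unfolding I2_def[abs_def]
proof (rule integral_dominated_convergence[where w="\<lambda>z. (norm (f 0) + L * M) * Bd * indicator Bx z"])
  show "integrable lebesgue (\<lambda>z. (norm (f 0) + L * M) * Bd * indicator Bx z)" using Bx(3) by simp
  have "continuous_on UNIV (\<lambda>z. f (\<gamma> z) \<bullet> gx z)" using f\<gamma>_cont[OF \<gamma>(1)] cgx by (intro continuous_intros)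
  then show "(\<lambda>z. indicator S z * (f (\<gamma> z) \<bullet> gx z)) \<in> borel_measurable lebesgue"
    using S_meas by (intro borel_measurable_times borel_measurable_indicator continuous_lebesgue_measurable)
  show "(\<lambda>z. indicator S z * (f (\<gamma> (zeta m z)) \<bullet> gx (fst z, tn m (idx m (snd z))))) \<in> borel_measurable lebesgue" for m
    using I2_sum[of \<gamma> m] by (auto simp: has_bochner_integral_iff)
  show "AE z in lebesgue. (\<lambda>m. indicator S z * (f (\<gamma> (zeta m z)) \<bullet> gx (fst z, tn m (idx m (snd z))))) \<longlonglongrightarrow> indicator S z * (f (\<gamma> z) \<bullet> gx z)"
  proof (rule AE_I2)
    fix z :: "'a \<times> real"
    show "(\<lambda>m. indicator S z * (f (\<gamma> (zeta m z)) \<bullet> gx (fst z, tn m (idx m (snd z))))) \<longlonglongrightarrow> indicator S z * (f (\<gamma> z) \<bullet> gx z)"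
    proof (cases "z \<in> S")
      case True
      have "(\<lambda>m. gx (fst z, tn m (idx m (snd z)))) \<longlonglongrightarrow> gx (fst z, snd z)"
        by (rule isCont_lim[OF cgx]) (intro tendsto_intros time_point_lim[OF True])
      then have "(\<lambda>m. f (\<gamma> (zeta m z)) \<bullet> gx (fst z, tn m (idx m (snd z)))) \<longlonglongrightarrow> f (\<gamma> z) \<bullet> gx z"
        using isCont_lim[OF f\<gamma>_cont[OF \<gamma>(1)] zeta_lim[OF True]] by (intro tendsto_inner) auto
      then show ?thesis using True by simp
    qed simp
  qed
  show "AE z in lebesgue. norm (indicator S z * (f (\<gamma> (zeta m z)) \<bullet> gx (fst z, tn m (idx m (snd z))))) \<le> (norm (f 0) + L * M) * Bd * indicator Bx z" for m
  proof (rule AE_I2)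
    fix z :: "'a \<times> real"
    let ?g = "gx (fst z, tn m (idx m (snd z)))"
    show "norm (indicator S z * (f (\<gamma> (zeta m z)) \<bullet> ?g)) \<le> (norm (f 0) + L * M) * Bd * indicator Bx z"
    proof (cases "z \<in> S \<and> ?g \<noteq> 0")
      case True
      then have "norm (fst z) \<le> R0" "\<bar>tn m (idx m (snd z))\<bar> \<le> R0" using supp[of "fst z" "tn m (idx m (snd z))"] by force+
      moreover have "snd z < tn m (idx m (snd z)) + dt m" using True idx_time(2) unfolding S_def by simp
      ultimately have zB: "z \<in> Bx" using True dt1[of m] by (intro support_Bx) auto
      have "norm (f (\<gamma> (zeta m z))) \<le> norm (f 0) + norm (f (\<gamma> (zeta m z)) - f 0)" using norm_triangle_ineq[of "f 0" "f (\<gamma> (zeta m z)) - f 0"] by simp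
      also have "norm (f (\<gamma> (zeta m z)) - f 0) \<le> L * \<bar>\<gamma> (zeta m z) - 0\<bar>" by (rule f_lip)
      also have "\<dots> \<le> L * M" using \<gamma>(2) L0 by (intro mult_left_mono) auto
      finally have "norm (f (\<gamma> (zeta m z))) * norm ?g \<le> (norm (f 0) + L * M) * Bd" using bd(2) L0 M0 by (intro mult_mono) auto
      then have "\<bar>f (\<gamma> (zeta m z)) \<bullet> ?g\<bar> \<le> (norm (f 0) + L * M) * Bd" using Cauchy_Schwarz_ineq2 order_trans by blast
      then show ?thesis using True zB by simp
    next
      case False
      then have "indicator S z * (f (\<gamma> (zeta m z)) \<bullet> ?g) = 0" by auto
      moreover have "0 \<le> (norm (f 0) + L * M) * Bd * indicator Bx z" using L0 M0 Bd0 by (intro mult_nonneg_nonneg add_nonneg_nonneg) auto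
      ultimately show ?thesis by (simp only: norm_zero)
    qed
  qed
qed

text \<open>The mean value theorem writes the quotient as \<open>gt\<close> at a point within
  \<open>hm m + 2 * dt m\<close> of \<open>z\<close>. Positive time ensures that the level is
  eventually not 0, where \<open>Dd\<close> has its conventional value.\<close>

lemma Dd_lim:
  assumes z: "0 < snd z" shows "(\<lambda>m. Dd m (idx m (snd z)) (cel m (fst z))) \<longlonglongrightarrow> gt z"
proof (rule tendstoI)
  fix \<epsilon> :: real assume \<epsilon>: "\<epsilon> > 0"
  have zS: "z \<in> S" using z by (simp add: S_def)
  obtain \<delta> where \<delta>: "\<delta> > 0" "\<And>z'. dist z' z < \<delta> \<Longrightarrow> dist (gt z') (gt z) < \<epsilon>"
    using cgt \<epsilon> unfolding continuous_on_iff by (metis UNIV_I)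
  have "eventually (\<lambda>m. 1 * hm m + 2 * dt m < \<delta>) sequentially" using hdt0[of 1 2] \<delta>(1) by (rule order_tendstoD(2))
  moreover have "eventually (\<lambda>m. dt m < snd z) sequentially" using dt0 z by (rule order_tendstoD(2))
  ultimately show "eventually (\<lambda>m. dist (Dd m (idx m (snd z)) (cel m (fst z))) (gt z) < \<epsilon>) sequentially"
  proof eventually_elim
    case (elim m)
    have t: "tn m (idx m (snd z)) \<le> snd z" "snd z < tn m (idx m (snd z)) + dt m" using idx_time[of "snd z" m] z by auto
    have "idx m (snd z) \<noteq> 0"
    proof
      assume "idx m (snd z) = 0"
      then show False using t(2) elim(2) by (simp add: tn_def)
    qed
    then obtain \<xi> where \<xi>: "tn m (idx m (snd z)) - dt m \<le> \<xi>" "\<xi> \<le> tn m (idx m (snd z))" "Dd m (idx m (snd z)) (cel m (fst z)) = gt (ctr (cel m (fst z)), \<xi>)"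
      using Dd_mvt by blast
    have "dist (ctr (cel m (fst z)), \<xi>) z \<le> dist (ctr (cel m (fst z))) (fst z) + dist \<xi> (snd z)"
      unfolding dist_prod_def using sqrt_sum_squares_le_sum[of "dist (ctr (cel m (fst z))) (fst z)" "dist \<xi> (snd z)"] by simp
    also have "dist (ctr (cel m (fst z))) (fst z) \<le> hm m" by (rule ctr_dist[OF cel])
    also have "dist \<xi> (snd z) \<le> 2 * dt m" using \<xi>(1,2) t dt_pos[of m] by (auto simp: dist_real_def)
    finally have "dist (ctr (cel m (fst z)), \<xi>) z < \<delta>" using elim(1) by linarith
    then show ?case using \<delta>(2) \<xi>(3) by simp
  qed
qed

text \<open>Points at time zero are left out as a null set, since \<open>Dd\<close> stays 0
  there.\<close>

lemma I1_lim: "I1 \<longlonglongrightarrow> (\<integral>z. indicator S z * (u z * gt z) \<partial>lebesgue)"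
proof -
  have "I1 \<longlonglongrightarrow> (\<integral>z. v z * gt z \<partial>lebesgue)"
    unfolding I1_def[abs_def]
  proof (rule integral_dominated_convergence[where w="\<lambda>z. M * Bd * indicator Bx z"])
    show "integrable lebesgue (\<lambda>z. M * Bd * indicator Bx z)" using Bx(3) by simp
    show "(\<lambda>z. v z * gt z) \<in> borel_measurable lebesgue"
      using v_meas continuous_lebesgue_measurable[OF cgt] by (rule borel_measurable_times)
    show "(\<lambda>z. indicator S z * (w m z * Dd m (idx m (snd z)) (cel m (fst z)))) \<in> borel_measurable lebesgue" for m
      using I1_sum[of m] by (auto simp: has_bochner_integral_iff)
    show "AE z in lebesgue. (\<lambda>m. indicator S z * (w m z * Dd m (idx m (snd z)) (cel m (fst z)))) \<longlonglongrightarrow> v z * gt z"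
      using v_limit_S AE_pos
    proof eventually_elim
      case (elim z)
      show ?case
      proof (cases "z \<in> S")
        case True
        then have "0 < snd z" using elim(2) by (simp add: S_def)
        then have "(\<lambda>m. w m z * Dd m (idx m (snd z)) (cel m (fst z))) \<longlonglongrightarrow> v z * gt z"
          using elim(1) True Dd_lim by (intro tendsto_mult) auto
        then show ?thesis using True by simp
      qed (simp add: v_def)
    qed
    show "AE z in lebesgue. norm (indicator S z * (w m z * Dd m (idx m (snd z)) (cel m (fst z)))) \<le> M * Bd * indicator Bx z" for m
    proof (rule AE_I2)
      fix z :: "'a \<times> real"
      let ?D = "Dd m (idx m (snd z)) (cel m (fst z))"
      show "norm (indicator S z * (w m z * ?D)) \<le> M * Bd * indicator Bx z"
      proof (cases "z \<in> S \<and> ?D \<noteq> 0")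
        case True
        \<comment> \<open>A nonzero quotient forces the centre and the earlier of the two levels to
          stay within \<open>R0\<close>; as cell sizes and time steps are at most one, the point
          itself lies in \<open>Bx\<close>.\<close>
        have c: "norm (ctr (cel m (fst z))) \<le> R0" and t: "tn m (idx m (snd z) - 1) \<le> R0"
        proof -
          show "norm (ctr (cel m (fst z))) \<le> R0"
          proof (rule ccontr)
            assume "\<not> norm (ctr (cel m (fst z))) \<le> R0"
            then show False using supp[of "ctr (cel m (fst z))"] True unfolding Dd_def by (auto split: if_splits)
          qed
          show "tn m (idx m (snd z) - 1) \<le> R0"
          proof (rule ccontr)
            assume a: "\<not> tn m (idx m (snd z) - 1) \<le> R0"
            moreover have "tn m (idx m (snd z) - 1) \<le> tn m (idx m (snd z))" by (rule tn_mono) simp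
            ultimately have "R0 < \<bar>tn m (idx m (snd z) - 1)\<bar>" "R0 < \<bar>tn m (idx m (snd z))\<bar>" by linarith+
            then show False using supp[of "ctr (cel m (fst z))"] True unfolding Dd_def by (auto split: if_splits)
          qed
        qed
        have "Dd m 0 (cel m (fst z)) = 0" by (simp add: Dd_def)
        then have "idx m (snd z) \<noteq> 0" using True by metis
        then have "tn m (idx m (snd z)) = tn m (idx m (snd z) - 1) + dt m" using tn_Suc[of m "idx m (snd z) - 1"] by simp
        then have "snd z \<le> R0 + 3" using t dt1[of m] idx_time(2)[of "snd z" m] True by (simp add: S_def)
        moreover have "norm (fst z) \<le> R0 + 1" using ctr_norm(1)[OF cel, of "fst z" m] c h1[of m] by linarith
        ultimately have zB: "z \<in> Bx" using True by (intro support_Bx) auto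
        have "\<bar>w m z\<bar> * \<bar>?D\<bar> \<le> M * Bd" using w_bound[of z m] True Dd_bound M0 by (intro mult_mono) auto
        then show ?thesis using True zB by (simp add: abs_mult)
      next
        case False
        then have "indicator S z * (w m z * ?D) = 0" by auto
        moreover have "0 \<le> M * Bd * indicator Bx z" using M0 Bd0 by (intro mult_nonneg_nonneg) auto
        ultimately show ?thesis by (simp only: norm_zero)
      qed
    qed
  qed
  then show ?thesis by (simp add: v_def mult.assoc)
qed

text \<open>Convergence almost everywhere in space-time carries no information on the null set at
  time zero, so this term rests on \<open>init\<close>. The error splits into the initial error
  times \<open>\<phi>\<close> and \<open>u0\<close> times the oscillation of \<open>\<phi>\<close>
  over a cell; the latter is of order \<open>hm m\<close> because \<open>u0\<close> is locally
  integrable.\<close>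

lemma I0_lim: "I0 \<longlonglongrightarrow> (\<integral>x. u0 x * \<phi> (x, 0) \<partial>lebesgue)"
proof -
  let ?B = "cball (0::'a) R1"
  define Z where "Z = (\<integral>x. indicator ?B x * \<bar>u0 x\<bar> \<partial>lebesgue)"
  define E where "E m = (\<integral>x. indicator ?B x * \<bar>uh m 0 (cel m x) x - u0 x\<bar> \<partial>lebesgue)" for m
  have Bl: "?B \<in> sets lebesgue" by simp
  have iB: "integrable lebesgue (indicator ?B :: 'a \<Rightarrow> real)"
    using lmeasurable_cball by (intro integrable_real_indicator) (auto simp: fmeasurable_def)
  have iu: "integrable lebesgue (\<lambda>x. indicator ?B x * u0 x)" using u0i[of R1] by (simp add: set_integrable_def)
  have em: "(\<lambda>x. uh m 0 (cel m x) x) \<in> borel_measurable lebesgue" for m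
    unfolding cel_def by (rule qu_mesh.cellwise_measurable[OF qm]) (rule uh_cont)
  have ie: "integrable lebesgue (\<lambda>x. indicator ?B x * uh m 0 (cel m x) x)" for m
  proof (rule Bochner_Integration.integrable_bound[of _ "\<lambda>x. M * indicator ?B x"])
    show "(\<lambda>x. indicator ?B x * uh m 0 (cel m x) x) \<in> borel_measurable lebesgue"
      using em Bl by (intro borel_measurable_times borel_measurable_indicator)
    show "AE x in lebesgue. norm (indicator ?B x * uh m 0 (cel m x) x) \<le> norm (M * indicator ?B x)"
      using eval_bound[of m] M0 by (intro AE_I2) (auto simp: indicator_def)
  qed (use iB in simp)
  have E0: "E \<longlonglongrightarrow> 0"
    using init unfolding approximates_initial_def eval_eq set_lebesgue_integral_def E_def[abs_def] real_scaleR_def by blast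
  have iE: "integrable lebesgue (\<lambda>x. indicator ?B x * \<bar>uh m 0 (cel m x) x - u0 x\<bar>)" for m
  proof -
    have "integrable lebesgue (\<lambda>x. \<bar>indicator ?B x * uh m 0 (cel m x) x - indicator ?B x * u0 x\<bar>)"
      by (intro integrable_abs Bochner_Integration.integrable_diff ie iu)
    moreover have "\<bar>indicator ?B x * uh m 0 (cel m x) x - indicator ?B x * u0 x\<bar> = indicator ?B x * \<bar>uh m 0 (cel m x) x - u0 x\<bar>" for x
      by (simp add: indicator_def)
    ultimately show ?thesis by simp
  qed
  have iZ: "integrable lebesgue (\<lambda>x. indicator ?B x * \<bar>u0 x\<bar>)"
    using integrable_abs[OF iu] by (simp add: abs_mult)
  have i\<phi>: "integrable lebesgue (\<lambda>x. u0 x * \<phi> (x, 0))"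
  proof -
    have "continuous_on UNIV (\<lambda>x. \<phi> (x, 0))" by (rule continuous_on_compose2[OF c\<phi>]) (auto intro!: continuous_intros)
    then have m: "(\<lambda>x. \<phi> (x, 0)) \<in> borel_measurable lebesgue" by (rule continuous_lebesgue_measurable)
    have "integrable lebesgue (\<lambda>x. (indicator ?B x * u0 x) * \<phi> (x, 0))"
    proof (rule Bochner_Integration.integrable_bound[of _ "\<lambda>x. Bd * (indicator ?B x * u0 x)"])
      show "integrable lebesgue (\<lambda>x. Bd * (indicator ?B x * u0 x))" using iu by simp
      show "(\<lambda>x. (indicator ?B x * u0 x) * \<phi> (x, 0)) \<in> borel_measurable lebesgue"
        using borel_measurable_integrable[OF iu] m by (rule borel_measurable_times)
      show "AE x in lebesgue. norm ((indicator ?B x * u0 x) * \<phi> (x, 0)) \<le> norm (Bd * (indicator ?B x * u0 x))"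
        using bd(1) Bd0 by (intro AE_I2) (auto simp: abs_mult mult.commute[of Bd] intro!: mult_left_mono)
    qed
    moreover have "(indicator ?B x * u0 x) * \<phi> (x, 0) = u0 x * \<phi> (x, 0)" for x
      using supp[of x 0] by (cases "x \<in> ?B") (auto simp: R1_def)
    ultimately show ?thesis by simp
  qed
  have bound: "norm (I0 m - (\<integral>x. u0 x * \<phi> (x, 0) \<partial>lebesgue)) \<le> Bd * E m + Bd * hm m * Z" for m
  proof -
    have i1: "integrable lebesgue (\<lambda>x. uh m 0 (cel m x) x * \<phi> (ctr (cel m x), 0))" using I0_sum[of m] by (simp add: has_bochner_integral_iff)
    have "I0 m - (\<integral>x. u0 x * \<phi> (x, 0) \<partial>lebesgue) = (\<integral>x. uh m 0 (cel m x) x * \<phi> (ctr (cel m x), 0) - u0 x * \<phi> (x, 0) \<partial>lebesgue)"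
      unfolding I0_def using i1 i\<phi> by simp
    also have "norm \<dots> \<le> (\<integral>x. norm (uh m 0 (cel m x) x * \<phi> (ctr (cel m x), 0) - u0 x * \<phi> (x, 0)) \<partial>lebesgue)"
      by (rule integral_norm_bound)
    also have "\<dots> \<le> (\<integral>x. Bd * (indicator ?B x * \<bar>uh m 0 (cel m x) x - u0 x\<bar>) + Bd * hm m * (indicator ?B x * \<bar>u0 x\<bar>) \<partial>lebesgue)"
    proof (rule integral_mono)
      show "integrable lebesgue (\<lambda>x. norm (uh m 0 (cel m x) x * \<phi> (ctr (cel m x), 0) - u0 x * \<phi> (x, 0)))"
        using i1 i\<phi> by (intro integrable_norm Bochner_Integration.integrable_diff)
      show "integrable lebesgue (\<lambda>x. Bd * (indicator ?B x * \<bar>uh m 0 (cel m x) x - u0 x\<bar>) + Bd * hm m * (indicator ?B x * \<bar>u0 x\<bar>))"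
        using iE iZ by (intro Bochner_Integration.integrable_add integrable_mult_right)
      fix x
      let ?a = "uh m 0 (cel m x) x" and ?p = "\<phi> (ctr (cel m x), 0)"
      show "norm (?a * ?p - u0 x * \<phi> (x, 0)) \<le> Bd * (indicator ?B x * \<bar>?a - u0 x\<bar>) + Bd * hm m * (indicator ?B x * \<bar>u0 x\<bar>)"
      proof (cases "x \<in> ?B")
        case True
        have "\<bar>?p - \<phi> (x, 0)\<bar> \<le> Bd * hm m"
          using \<phi>_lip_x[of "ctr (cel m x)" 0 x] mult_left_mono[OF ctr_dist[OF cel, of m x] Bd0] by linarith
        then have "\<bar>u0 x\<bar> * \<bar>?p - \<phi> (x, 0)\<bar> \<le> \<bar>u0 x\<bar> * (Bd * hm m)" by (rule mult_left_mono) simp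
        moreover have "\<bar>?a - u0 x\<bar> * \<bar>?p\<bar> \<le> \<bar>?a - u0 x\<bar> * Bd" using bd(1) by (rule mult_left_mono) simp
        moreover have "?a * ?p - u0 x * \<phi> (x, 0) = (?a - u0 x) * ?p + u0 x * (?p - \<phi> (x, 0))" by (simp add: algebra_simps)
        then have "\<bar>?a * ?p - u0 x * \<phi> (x, 0)\<bar> \<le> \<bar>?a - u0 x\<bar> * \<bar>?p\<bar> + \<bar>u0 x\<bar> * \<bar>?p - \<phi> (x, 0)\<bar>"
          by (metis abs_mult abs_triangle_ineq)
        ultimately have "\<bar>?a * ?p - u0 x * \<phi> (x, 0)\<bar> \<le> \<bar>?a - u0 x\<bar> * Bd + \<bar>u0 x\<bar> * (Bd * hm m)" by linarith
        then show ?thesis using True by (simp add: mult_ac)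
      next
        case False
        then have x: "norm x > R1" by simp
        then have "norm (ctr (cel m x)) > R0" using ctr_norm(1)[OF cel, of x m] h1[of m] by (simp add: R1_def)
        moreover have "norm x > R0" using x by (simp add: R1_def)
        ultimately show ?thesis using supp[of x 0] supp[of "ctr (cel m x)" 0] False by simp
      qed
    qed
    also have "\<dots> = Bd * E m + Bd * hm m * Z" unfolding E_def Z_def using iE[of m] iZ by simp
    finally show ?thesis .
  qed
  have "(\<lambda>m. Bd * E m + Bd * hm m * Z) \<longlonglongrightarrow> Bd * 0 + Bd * 0 * Z" by (intro tendsto_intros E0 h0)
  then have lim0: "(\<lambda>m. Bd * E m + Bd * hm m * Z) \<longlonglongrightarrow> 0" by simp
  have "(\<lambda>m. I0 m - (\<integral>x. u0 x * \<phi> (x, 0) \<partial>lebesgue)) \<longlonglongrightarrow> 0"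
    by (rule Lim_null_comparison[OF _ lim0], rule always_eventually, rule allI, rule bound)
  then show ?thesis by (rule LIM_zero_cancel)
qed

lemma Vol_nonneg: "Vol \<ge> 0"
  unfolding Vol_def using R0 dg_discretization.ball_const[OF dgm] by (intro mult_nonneg_nonneg) auto

text \<open>The order of choices matters: \<open>\<gamma>\<close> is fixed for the given
  \<open>\<epsilon>\<close>, and then \<open>m\<close> tends to infinity. Uniform continuity of
  \<open>\<gamma>\<close> on \<open>Bx\<close> eventually permits
  \<open>\<omega> = \<epsilon>\<close>, and the limit of \<open>Er\<close> is at most
  \<open>\<epsilon>\<close>. Only in the limit is \<open>\<gamma>\<close> exchanged for
  \<open>u\<close> in the flux, at the cost \<open>L * Bd * \<epsilon>\<close>.\<close>

lemma weak_form_bound: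
  assumes \<epsilon>: "\<epsilon> > 0"
  shows "\<bar>(\<integral>x. u0 x * \<phi> (x, 0) \<partial>lebesgue) + (\<integral>z. indicator S z * (u z * gt z) \<partial>lebesgue) + (\<integral>z. indicator S z * (f (u z) \<bullet> gx z) \<partial>lebesgue)\<bar>
    \<le> (Cf * Bd * (1 + Vol) + L * Bd) * \<epsilon>"
proof -
  obtain \<gamma> where \<gamma>: "continuous_on UNIV \<gamma>" "\<And>z. \<bar>\<gamma> z\<bar> \<le> M" and ap: "(\<integral>z. indicator Bx z * \<bar>v z - \<gamma> z\<bar> \<partial>lebesgue) \<le> \<epsilon>"
    using continuous_L1_approximation[OF v_meas v_bound M0 Bx(1) \<epsilon>] by metis
  have "uniformly_continuous_on Bx \<gamma>" using \<gamma>(1) Bx(1) by (intro compact_uniformly_continuous) (auto intro: continuous_on_subset)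
  then obtain \<delta> where \<delta>: "\<delta> > 0" "\<And>z z'. z \<in> Bx \<Longrightarrow> z' \<in> Bx \<Longrightarrow> dist z' z < \<delta> \<Longrightarrow> dist (\<gamma> z') (\<gamma> z) < \<epsilon>"
    unfolding uniformly_continuous_on_def using \<epsilon> by metis
  have "eventually (\<lambda>m. (real s + 2) * hm m + 0 * dt m < \<delta>) sequentially" using hdt0 \<delta>(1) by (rule order_tendstoD(2))
  then have ev: "eventually (\<lambda>m. \<bar>I0 m + I1 m + I2 \<gamma> m\<bar> \<le> Cf * Bd * (Er \<gamma> m + \<epsilon> * Vol)) sequentially"
  proof eventually_elim
    case (elim m)
    show ?case
    proof (rule balance[OF \<gamma>])
      fix K K' n assume K: "K \<in> Q m" "K' \<in> T m" "K' \<subseteq> cball (ctr K) ((real s + 2) * hm m)" and n: "n < Nm m"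
      have KT: "K \<in> T m" using K Q by blast
      have K': "K' \<in> Q' m" "dist (ctr K') (ctr K) \<le> (real s + 2) * hm m" using Q_Q'[OF K] by auto
      have t: "0 \<le> tn m n" "tn m n \<le> R1" using tn_nonneg tn_mono[of n "Nm m" m] n Nm(2)[of m] by (auto simp: R1_def)
      have "norm (ctr K') \<le> R1" "norm (ctr K) \<le> R1"
        using Q'_norm[OF K'(1) ctr_in[OF K(2)]] Q_norm[OF K(1) ctr_in[OF KT]] by (auto simp: R1_def)
      then have "(ctr K', tn m n) \<in> Bx" "(ctr K, tn m n) \<in> Bx" using t unfolding Bx_def by auto
      moreover have "dist (ctr K', tn m n) (ctr K, tn m n) < \<delta>" using K'(2) elim by (simp add: dist_prod_def)
      ultimately have "dist (\<gamma> (ctr K', tn m n)) (\<gamma> (ctr K, tn m n)) < \<epsilon>" by (intro \<delta>(2))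
      then show "\<bar>\<gamma> (ctr K', tn m n) - \<gamma> (ctr K, tn m n)\<bar> \<le> \<epsilon>" by (simp add: dist_real_def)
    qed (use \<epsilon> in simp)
  qed
  define W0 where "W0 = (\<integral>x. u0 x * \<phi> (x, 0) \<partial>lebesgue)"
  define W1 where "W1 = (\<integral>z. indicator S z * (u z * gt z) \<partial>lebesgue)"
  define W2 where "W2 = (\<integral>z. indicator S z * (f (u z) \<bullet> gx z) \<partial>lebesgue)"
  define G2 where "G2 = (\<integral>z. indicator S z * (f (\<gamma> z) \<bullet> gx z) \<partial>lebesgue)"
  define Ea where "Ea = (\<integral>z. indicator Bx z * \<bar>v z - \<gamma> z\<bar> \<partial>lebesgue)"
  have "(\<lambda>m. \<bar>I0 m + I1 m + I2 \<gamma> m\<bar>) \<longlonglongrightarrow> \<bar>W0 + W1 + G2\<bar>"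
    unfolding W0_def W1_def G2_def by (intro tendsto_intros I0_lim I1_lim I2_lim[OF \<gamma>])
  moreover have "(\<lambda>m. Cf * Bd * (Er \<gamma> m + \<epsilon> * Vol)) \<longlonglongrightarrow> Cf * Bd * (Ea + \<epsilon> * Vol)"
    unfolding Ea_def by (intro tendsto_intros Er_lim[OF \<gamma>])
  ultimately have "\<bar>W0 + W1 + G2\<bar> \<le> Cf * Bd * (Ea + \<epsilon> * Vol)"
    using ev by (intro tendsto_le[OF sequentially_bot]) auto
  also have "\<dots> \<le> Cf * Bd * (\<epsilon> + \<epsilon> * Vol)" using ap Cf_nonneg Bd0 unfolding Ea_def by (intro mult_left_mono add_right_mono) auto
  finally have 1: "\<bar>W0 + W1 + G2\<bar> \<le> Cf * Bd * (\<epsilon> + \<epsilon> * Vol)" .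
  have Bz: "z \<in> Bx" if "z \<in> S" "gx z \<noteq> 0" for z
  proof -
    have "norm (fst z) \<le> R0" "\<bar>snd z\<bar> \<le> R0" using supp[of "fst z" "snd z"] that by force+
    then show ?thesis using that R0 by (intro support_Bx) auto
  qed
  have vb: "integrable lebesgue (\<lambda>z. indicator Bx z * \<bar>v z - \<gamma> z\<bar>)"
  proof (rule Bochner_Integration.integrable_bound[of _ "\<lambda>z. 2 * M * indicator Bx z"])
    show "integrable lebesgue (\<lambda>z. 2 * M * indicator Bx z)" using Bx(3) by simp
    show "(\<lambda>z. indicator Bx z * \<bar>v z - \<gamma> z\<bar>) \<in> borel_measurable lebesgue"
      using v_meas continuous_lebesgue_measurable[OF \<gamma>(1)] Bx(2) by (intro borel_measurable_times borel_measurable_indicator borel_measurable_abs borel_measurable_diff)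
    show "AE z in lebesgue. norm (indicator Bx z * \<bar>v z - \<gamma> z\<bar>) \<le> norm (2 * M * indicator Bx z)"
      using v_bound
    proof eventually_elim
      case (elim z)
      then have "\<bar>v z - \<gamma> z\<bar> \<le> 2 * M" using \<gamma>(2)[of z] by linarith
      then show ?case using M0 by (auto simp: indicator_def)
    qed
  qed
  \<comment> \<open>On \<open>S\<close> the extension \<open>v\<close> agrees with \<open>u\<close>,
    and within \<open>S\<close> the gradient \<open>gx\<close> vanishes outside \<open>Bx\<close>,
    so the difference of fluxes is controlled by the L1 distance already estimated.\<close>
  have pt: "\<bar>indicator S z * ((f (u z) - f (\<gamma> z)) \<bullet> gx z)\<bar> \<le> L * Bd * (indicator Bx z * \<bar>v z - \<gamma> z\<bar>)" for z
  proof (cases "z \<in> S \<and> gx z \<noteq> 0")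
    case True
    have "\<bar>(f (u z) - f (\<gamma> z)) \<bullet> gx z\<bar> \<le> norm (f (u z) - f (\<gamma> z)) * norm (gx z)" by (rule Cauchy_Schwarz_ineq2)
    also have "\<dots> \<le> (L * \<bar>u z - \<gamma> z\<bar>) * Bd" using L0 by (intro mult_mono f_lip bd) auto
    finally show ?thesis using True Bz by (simp add: v_def mult_ac)
  next
    case False
    then have "indicator S z * ((f (u z) - f (\<gamma> z)) \<bullet> gx z) = 0" by auto
    then show ?thesis using L0 Bd0 by (simp only: abs_zero mult_nonneg_nonneg indicator_pos_le abs_ge_zero)
  qed
  have fm: "(\<lambda>z. indicator S z * ((f (v z) - f (\<gamma> z)) \<bullet> gx z)) \<in> borel_measurable lebesgue"
  proof -
    have "f \<in> borel_measurable borel" by (rule borel_measurable_continuous_onI[OF f_cont])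
    then have "(\<lambda>z. f (v z)) \<in> borel_measurable lebesgue" by (rule measurable_compose[OF v_meas])
    moreover have "(\<lambda>z. f (\<gamma> z)) \<in> borel_measurable lebesgue" "gx \<in> borel_measurable lebesgue"
      using f\<gamma>_cont[OF \<gamma>(1)] cgx by (auto intro!: measurable_completion borel_measurable_continuous_onI)
    ultimately show ?thesis using S_meas by (intro borel_measurable_times borel_measurable_indicator borel_measurable_inner borel_measurable_diff)
  qed
  \<comment> \<open>Measurability is known for \<open>v\<close>; the indicator of \<open>S\<close>
    makes the integrands with \<open>v\<close> and \<open>u\<close> equal everywhere.\<close>
  have "(\<lambda>z. indicator S z * ((f (v z) - f (\<gamma> z)) \<bullet> gx z)) = (\<lambda>z. indicator S z * ((f (u z) - f (\<gamma> z)) \<bullet> gx z))"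
    by (auto simp: fun_eq_iff v_def indicator_def)
  with fm have fm': "(\<lambda>z. indicator S z * ((f (u z) - f (\<gamma> z)) \<bullet> gx z)) \<in> borel_measurable lebesgue" by simp
  have id: "integrable lebesgue (\<lambda>z. indicator S z * ((f (u z) - f (\<gamma> z)) \<bullet> gx z))"
    by (rule Bochner_Integration.integrable_bound[OF integrable_mult_right[OF vb, of "L * Bd"] fm'])
      (rule AE_I2, unfold real_norm_def, rule order_trans[OF pt abs_ge_self])
  have ig: "integrable lebesgue (\<lambda>z. indicator S z * (f (\<gamma> z) \<bullet> gx z))"
  proof -
    have c: "continuous_on UNIV (\<lambda>z. f (\<gamma> z) \<bullet> gx z)" using f\<gamma>_cont[OF \<gamma>(1)] cgx by (intro continuous_intros)
    have "integrable lborel (\<lambda>z. indicator Bx z * (f (\<gamma> z) \<bullet> gx z))" by (rule integrable_on_compact[OF Bx(1)]) (rule continuous_on_subset[OF c], simp)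
    then have "integrable lebesgue (\<lambda>z. indicator Bx z * (f (\<gamma> z) \<bullet> gx z))" by (subst integrable_completion) auto
    moreover have "indicator Bx z * (f (\<gamma> z) \<bullet> gx z) = indicator S z * (f (\<gamma> z) \<bullet> gx z)" for z
      using Bz[of z] Bx(4) by (cases "gx z = 0") (auto simp: indicator_def)
    ultimately show ?thesis by simp
  qed
  have "W2 - G2 = (\<integral>z. indicator S z * ((f (u z) - f (\<gamma> z)) \<bullet> gx z) \<partial>lebesgue)"
  proof -
    have "(\<lambda>z. indicator S z * (f (u z) \<bullet> gx z)) = (\<lambda>z. indicator S z * ((f (u z) - f (\<gamma> z)) \<bullet> gx z) + indicator S z * (f (\<gamma> z) \<bullet> gx z))"
      by (simp add: fun_eq_iff inner_diff_left algebra_simps)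
    then show ?thesis unfolding W2_def G2_def using Bochner_Integration.integral_add[OF id ig] by simp
  qed
  then have "\<bar>W2 - G2\<bar> \<le> (\<integral>z. \<bar>indicator S z * ((f (u z) - f (\<gamma> z)) \<bullet> gx z)\<bar> \<partial>lebesgue)" using integral_abs_bound by metis
  also have "\<dots> \<le> (\<integral>z. L * Bd * (indicator Bx z * \<bar>v z - \<gamma> z\<bar>) \<partial>lebesgue)"
    by (rule integral_mono[OF integrable_abs[OF id] integrable_mult_right[OF vb] pt])
  also have "\<dots> = L * Bd * Ea" unfolding Ea_def by simp
  also have "\<dots> \<le> L * Bd * \<epsilon>" using ap L0 Bd0 unfolding Ea_def by (intro mult_left_mono) auto
  finally have 2: "\<bar>W2 - G2\<bar> \<le> L * Bd * \<epsilon>" .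
  have "\<bar>W0 + W1 + W2\<bar> \<le> \<bar>W0 + W1 + G2\<bar> + \<bar>W2 - G2\<bar>" by linarith
  also have "\<dots> \<le> Cf * Bd * (\<epsilon> + \<epsilon> * Vol) + L * Bd * \<epsilon>" using 1 2 by (rule add_mono)
  also have "\<dots> = (Cf * Bd * (1 + Vol) + L * Bd) * \<epsilon>" by (simp add: algebra_simps)
  finally show ?thesis unfolding W0_def W1_def W2_def .
qed

lemma weak_form:
  "(\<integral>x. u0 x * \<phi> (x, 0) \<partial>lebesgue) + (\<integral>z. indicator S z * (u z * gt z) \<partial>lebesgue) + (\<integral>z. indicator S z * (f (u z) \<bullet> gx z) \<partial>lebesgue) = 0"
  (is "?W = 0")
proof -
  define c where "c = Cf * Bd * (1 + Vol) + L * Bd"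
  have c: "c \<ge> 0" unfolding c_def using Cf_nonneg Bd0 L0 Vol_nonneg by (intro add_nonneg_nonneg mult_nonneg_nonneg) auto
  have "\<bar>?W\<bar> \<le> 0"
  proof (rule field_le_epsilon)
    fix r :: real assume r: "r > 0"
    have "\<bar>?W\<bar> \<le> c * (r / (c + 1))" unfolding c_def by (rule weak_form_bound) (use r c in \<open>simp add: c_def[symmetric]\<close>)
    also have "\<dots> \<le> r" using r c by (simp add: pos_divide_le_eq mult.commute)
    finally show "\<bar>?W\<bar> \<le> 0 + r" by simp
  qed
  then show ?thesis by simp
qed

end

section \<open>The Lax--Wendroff theorem\<close>

text \<open>Collects the partial derivatives as continuous functions with one common bound and one
  support radius. Off the support \<open>\<phi>\<close> is locally zero, so its Frechet derivative
  vanishes there too.\<close>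

lemma test_function_calculus:
  fixes \<phi> :: "'a::euclidean_space \<times> real \<Rightarrow> real"
  assumes "test_function \<phi>"
  obtains gx :: "'a \<times> real \<Rightarrow> 'a" and gt and R0 Bd :: real where
    "continuous_on UNIV gx" "continuous_on UNIV gt" "continuous_on UNIV \<phi>"
    "\<And>x t. GDERIV (\<lambda>y. \<phi> (y, t)) x :> gx (x, t)"
    "\<And>x t. ((\<lambda>r. \<phi> (x, r)) has_real_derivative gt (x, t)) (at t)"
    "\<And>x t. R0 < norm x \<or> R0 < \<bar>t\<bar> \<Longrightarrow> \<phi> (x, t) = 0 \<and> gx (x, t) = 0 \<and> gt (x, t) = 0"
    "\<And>z. \<bar>\<phi> z\<bar> \<le> Bd" "\<And>z. norm (gx z) \<le> Bd" "\<And>z. \<bar>gt z\<bar> \<le> Bd" "R0 \<ge> 0"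
proof -
  define D where "D z = frechet_derivative \<phi> (at z)" for z
  have "C_k (Suc 0) \<phi>" using assms unfolding test_function_def by blast
  then have df: "\<And>z. \<phi> differentiable (at z)" and Dc: "\<And>i. i \<in> Basis \<Longrightarrow> continuous_on UNIV (\<lambda>z. D z i)"
    by (auto simp: D_def)
  have D: "(\<phi> has_derivative D z) (at z)" for z
    unfolding D_def using df frechet_derivative_works by blast
  then have lin: "linear (D z)" for z by (meson has_derivative_linear)
  have c\<phi>: "continuous_on UNIV \<phi>" using D by (meson continuous_at_imp_continuous_on has_derivative_continuous)
  define gx where "gx z = (\<Sum>i\<in>Basis. D z (i, 0) *\<^sub>R i)" for z :: "'a \<times> real"
  define gt where "gt z = D z (0, 1)" for z
  have cgx: "continuous_on UNIV gx" unfolding gx_def[abs_def]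
    by (intro continuous_on_sum continuous_on_scaleR continuous_on_const Dc) (auto simp: Basis_prod_def)
  have cgt: "continuous_on UNIV gt" unfolding gt_def[abs_def] by (intro Dc) (auto simp: Basis_prod_def)
  have Dx: "D z (v, 0) = v \<bullet> gx z" for z v
  proof -
    have "(v, 0::real) = (\<Sum>i\<in>Basis. (v \<bullet> i) *\<^sub>R (i, 0))"
      by (simp add: prod_eq_iff fst_sum snd_sum euclidean_representation)
    then have "D z (v, 0) = D z (\<Sum>i\<in>Basis. (v \<bullet> i) *\<^sub>R (i, 0))" by (rule arg_cong)
    also have "\<dots> = (\<Sum>i\<in>Basis. (v \<bullet> i) * D z (i, 0))" by (simp only: linear_sum[OF lin] linear_scale[OF lin] real_scaleR_def)
    also have "\<dots> = v \<bullet> gx z" unfolding gx_def by (simp add: inner_sum_right mult.commute)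
    finally show ?thesis .
  qed
  have dx: "GDERIV (\<lambda>y. \<phi> (y, t)) x :> gx (x, t)" for x t
  proof -
    have "((\<lambda>y. (y, t)) has_derivative (\<lambda>v. (v, 0))) (at x)" by (auto intro!: derivative_eq_intros)
    from has_derivative_compose[OF this D] show ?thesis by (simp add: gderiv_def Dx)
  qed
  have dt: "((\<lambda>r. \<phi> (x, r)) has_real_derivative gt (x, t)) (at t)" for x t
  proof -
    have "((\<lambda>r. (x, r)) has_derivative (\<lambda>r. (0, r))) (at t)" by (auto intro!: derivative_eq_intros)
    from has_derivative_compose[OF this D] have "((\<lambda>r. \<phi> (x, r)) has_derivative (\<lambda>r. D (x, t) (0, r))) (at t)" .
    moreover have "D (x, t) (0, r) = gt (x, t) * r" for r
      using linear_scale[OF lin, of "(x, t)" r "(0, 1)"] by (simp add: gt_def mult.commute)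
    ultimately show ?thesis by (simp add: has_field_derivative_def)
  qed
  define K where "K = closure {z. \<phi> z \<noteq> 0}"
  have K: "compact K" using assms unfolding test_function_def K_def by blast
  have z: "\<phi> z = 0 \<and> gx z = 0 \<and> gt z = 0" if "z \<notin> K" for z
  proof -
    have o: "open (- K)" using K by (simp add: compact_imp_closed open_Compl)
    have z0: "\<phi> y = 0" if "y \<in> - K" for y using that closure_subset[of "{z. \<phi> z \<noteq> 0}"] unfolding K_def by auto
    have "((\<lambda>_. 0) has_derivative (\<lambda>_. 0)) (at z)" by simp
    then have "(\<phi> has_derivative (\<lambda>_. 0)) (at z)"
      by (rule has_derivative_transform_within_open[OF _ o]) (use that z0 in auto)
    then have "D z = (\<lambda>_. 0)" using D has_derivative_unique by blast
    then show ?thesis using z0 that by (simp add: gx_def gt_def)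
  qed
  obtain R0 where R0: "R0 \<ge> 0" "\<And>z. z \<in> K \<Longrightarrow> norm z \<le> R0"
    using compact_imp_bounded[OF K] unfolding bounded_pos by (meson less_imp_le)
  have supp: "\<phi> (x, t) = 0 \<and> gx (x, t) = 0 \<and> gt (x, t) = 0" if "R0 < norm x \<or> R0 < \<bar>t\<bar>" for x t
  proof -
    have "norm x \<le> norm (x, t)" "\<bar>t\<bar> \<le> norm (x, t)" using norm_fst_le[of x t] norm_snd_le[of t x] by auto
    then have "(x, t) \<notin> K" using R0(2)[of "(x, t)"] that by force
    then show ?thesis by (rule z)
  qed
  have bnd: "\<exists>B. \<forall>z. norm (g z) \<le> B" if "continuous_on UNIV g" "\<And>z. z \<notin> K \<Longrightarrow> g z = 0" for g :: "'a \<times> real \<Rightarrow> 'c::real_normed_vector"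
  proof -
    have "bounded (g ` K)" using that(1) K by (meson compact_continuous_image compact_imp_bounded continuous_on_subset subset_UNIV)
    then obtain B where B: "B > 0" "\<And>z. z \<in> K \<Longrightarrow> norm (g z) \<le> B" unfolding bounded_pos by auto
    have "norm (g z) \<le> B" for z using B that(2)[of z] by (cases "z \<in> K") auto
    then show ?thesis by blast
  qed
  obtain B1 where B1: "\<And>z. norm (\<phi> z) \<le> B1" using bnd[OF c\<phi>] z by blast
  obtain B2 where B2: "\<And>z. norm (gx z) \<le> B2" using bnd[OF cgx] z by blast
  obtain B3 where B3: "\<And>z. norm (gt z) \<le> B3" using bnd[OF cgt] z by blast
  define Bd where "Bd = max B1 (max B2 B3)"
  have bd: "\<bar>\<phi> z\<bar> \<le> Bd" "norm (gx z) \<le> Bd" "\<bar>gt z\<bar> \<le> Bd" for z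
    using B1[of z] B2[of z] B3[of z] unfolding Bd_def by auto
  show ?thesis by (rule that[OF cgx cgt c\<phi> dx dt supp bd R0(1)])
qed

theorem theorem3p1:
  fixes f :: "real \<Rightarrow> 'a::euclidean_space"
    and u0 :: "'a \<Rightarrow> real"
    and u :: "'a \<times> real \<Rightarrow> real"
    and T :: "nat \<Rightarrow> 'a set set"
    and dt :: "nat \<Rightarrow> real"
    and F :: "nat \<Rightarrow> 'a num_flux"
    and uh :: "nat \<Rightarrow> nat \<Rightarrow> 'a broken"
    and k s :: nat
    and A :: "nat \<Rightarrow> nat \<Rightarrow> real" and b :: "nat \<Rightarrow> real"
    and d :: "nat \<Rightarrow> nat \<Rightarrow> nat" and e :: "nat \<Rightarrow> nat"
    and \<sigma> C lam0 :: real
  assumes degree: "k \<ge> 1"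
    and rk: "explicit_RK s A b"
    and stages: "stage_degrees k s d e"
    and meshes: "\<And>m. mesh (T m)"
    and sigma_pos: "\<sigma> > 0"
    and quasi_unif: "\<And>m. quasi_uniform \<sigma> (T m)"
    and f_lipschitz: "\<exists>L. L-lipschitz_on UNIV f"
    and flux: "\<And>m. numerical_flux (T m) k (F m)"
    and flux_consistent: "\<And>m. consistent_flux (T m) k f (F m)"
    and flux_lipschitz: "\<And>m. lipschitz_flux C (T m) k (F m)"
    and dt_pos: "\<And>m. dt m > 0"
    and cfl: "\<And>m. dt m / mesh_size (T m) \<le> lam0"
    and h_to_0: "(\<lambda>m. mesh_size (T m)) \<longlonglongrightarrow> 0"
    and dt_to_0: "dt \<longlonglongrightarrow> 0"
    and scheme: "\<And>m. sdRKDG_solution (T m) f (F m) k s A b d e (dt m) (uh m)"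
    and u0_loc_integrable: "\<And>R. set_integrable lebesgue (cball 0 R) u0"
    and initial: "approximates_initial (\<lambda>m. eval_broken (T m) (uh m 0)) u0"
    and convergence: "converges_boundedly_ae (\<lambda>m. space_time (T m) (dt m) (uh m)) u"
  shows "weak_solution f u0 u"
  unfolding weak_solution_def
proof (intro allI impI)
  fix \<phi> :: "'a \<times> real \<Rightarrow> real" assume "test_function \<phi>"
  then obtain gx :: "'a \<times> real \<Rightarrow> 'a" and gt and R0 Bd :: real where \<phi>:
    "continuous_on UNIV gx" "continuous_on UNIV gt" "continuous_on UNIV \<phi>"
    "\<And>x t. GDERIV (\<lambda>y. \<phi> (y, t)) x :> gx (x, t)"
    "\<And>x t. ((\<lambda>r. \<phi> (x, r)) has_real_derivative gt (x, t)) (at t)"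
    "\<And>x t. R0 < norm x \<or> R0 < \<bar>t\<bar> \<Longrightarrow> \<phi> (x, t) = 0 \<and> gx (x, t) = 0 \<and> gt (x, t) = 0"
    "\<And>z. \<bar>\<phi> z\<bar> \<le> Bd" "\<And>z. norm (gx z) \<le> Bd" "\<And>z. \<bar>gt z\<bar> \<le> Bd" "R0 \<ge> 0"
    by (rule test_function_calculus) blast
  obtain L where L: "L-lipschitz_on UNIV f" using f_lipschitz by blast
  have qm: "qu_mesh (T m) \<sigma>" for m using meshes quasi_unif sigma_pos by (rule qu_mesh.intro)
  \<comment> \<open>Obtained from \<open>\<sigma>\<close> and \<open>k\<close> alone, before any
    mesh is considered, so that one constant serves the whole sequence.\<close>
  from inverse_estimates[OF sigma_pos, of "2 * k", where 'a='a]
  obtain Ci where Ci: "Ci \<ge> 0 \<and> (\<forall>T::'a set set. qu_mesh T \<sigma> \<longrightarrow> (\<forall>K\<in>T. \<forall>p\<in>poly_space (2 * k). \<forall>x\<in>K.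
    \<bar>p x\<bar> \<le> Ci / mesh_size T ^ DIM('a) * (\<integral>y. indicator K y * \<bar>p y\<bar> \<partial>lborel) \<and>
    norm (grad p x) \<le> Ci / mesh_size T ^ (DIM('a) + 1) * (\<integral>y. indicator K y * \<bar>p y\<bar> \<partial>lborel)))"
    by (elim exE) (rule that)
  have dg_discretization: "dg_discretization (T m) \<sigma> f (F m) k C L Ci" for m
  proof (intro dg_discretization.intro qm dg_discretization_axioms.intro flux flux_consistent flux_lipschitz L)
    show "Ci \<ge> 0" using Ci by (rule conjunct1)
    fix K :: "'a set" and p :: "'a \<Rightarrow> real" and x assume "K \<in> T m" "p \<in> poly_space (2 * k)" "x \<in> K"
    then show "\<bar>p x\<bar> \<le> Ci / mesh_size (T m) ^ DIM('a) * (\<integral>y. indicator K y * \<bar>p y\<bar> \<partial>lborel) \<and>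
      norm (grad p x) \<le> Ci / mesh_size (T m) ^ (DIM('a) + 1) * (\<integral>y. indicator K y * \<bar>p y\<bar> \<partial>lborel)"
      by (rule Ci[THEN conjunct2, THEN spec, THEN mp, OF qm, THEN bspec, THEN bspec, THEN bspec])
  qed
  have rk': "sdrkdg (T m) \<sigma> f (F m) k C L Ci s A b d e (dt m) lam0" for m
    by (intro sdrkdg.intro dg_discretization sdrkdg_axioms.intro rk stages dt_pos cfl)
  have "eventually (\<lambda>m. mesh_size (T m) < 1 \<and> dt m < 1) sequentially"
    using order_tendstoD(2)[OF h_to_0, of 1] order_tendstoD(2)[OF dt_to_0, of 1] by (intro eventually_conj) auto
  \<comment> \<open>Passing to a tail keeps all limits and makes mesh sizes and time steps at most
    one.\<close>
  then obtain m0 where m0: "\<And>m. m \<ge> m0 \<Longrightarrow> mesh_size (T m) < 1 \<and> dt m < 1" by (auto simp: eventually_sequentially)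
  obtain M where M: "\<And>m x t. 0 \<le> t \<Longrightarrow> \<bar>space_time (T m) (dt m) (uh m) (x, t)\<bar> \<le> M"
    and ae: "AE z in lebesgue. 0 \<le> snd z \<longrightarrow> (\<lambda>m. space_time (T m) (dt m) (uh m) z) \<longlonglongrightarrow> u z"
    using convergence unfolding converges_boundedly_ae_def by blast
  interpret lax_wendroff "\<lambda>m. T (m + m0)" \<sigma> f "\<lambda>m. F (m + m0)" k C L Ci s A b d e "\<lambda>m. dt (m + m0)" lam0 "\<lambda>m. uh (m + m0)" u0 u M \<phi> gx gt R0 Bd
  proof (intro lax_wendroff.intro rk' scheme u0_loc_integrable M \<phi>)
    show "mesh_size (T (m + m0)) \<le> 1" "dt (m + m0) \<le> 1" for m using m0[of "m + m0"] by auto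
    show "(\<lambda>m. mesh_size (T (m + m0))) \<longlonglongrightarrow> 0" using h_to_0 by (rule LIMSEQ_ignore_initial_segment)
    show "(\<lambda>m. dt (m + m0)) \<longlonglongrightarrow> 0" using dt_to_0 by (rule LIMSEQ_ignore_initial_segment)
    show "approximates_initial (\<lambda>m. eval_broken (T (m + m0)) (uh (m + m0) 0)) u0"
      using initial unfolding approximates_initial_def by (intro allI LIMSEQ_ignore_initial_segment) blast
    show "AE z in lebesgue. 0 \<le> snd z \<longrightarrow> (\<lambda>m. space_time (T (m + m0)) (dt (m + m0)) (uh (m + m0)) z) \<longlonglongrightarrow> u z"
      using ae by eventually_elim (auto intro: LIMSEQ_ignore_initial_segment)
  qed
  have dt: "deriv (\<lambda>r. \<phi> (x, r)) t = gt (x, t)" for x t by (rule DERIV_imp_deriv) (rule \<phi>(5))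
  have gr: "grad (\<lambda>y. \<phi> (y, t)) x = gx (x, t)" for x t by (rule grad_eq) (rule \<phi>(4))
  have S: "indicator (UNIV \<times> {0..}) z = (indicator S z :: real)" for z :: "'a \<times> real"
    by (cases z) (auto simp: S_def indicator_def)
  have 1: "(LINT (x, t):UNIV \<times> {0..}|lebesgue. u (x, t) * deriv (\<lambda>r. \<phi> (x, r)) t) = (\<integral>z. indicator S z * (u z * gt z) \<partial>lebesgue)"
    unfolding set_lebesgue_integral_def S dt by (simp add: case_prod_unfold)
  have 2: "(LINT (x, t):UNIV \<times> {0..}|lebesgue. f (u (x, t)) \<bullet> grad (\<lambda>y. \<phi> (y, t)) x) = (\<integral>z. indicator S z * (f (u z) \<bullet> gx z) \<partial>lebesgue)"
    unfolding set_lebesgue_integral_def S gr by (simp add: case_prod_unfold)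
  show "(LINT x|lebesgue. u0 x * \<phi> (x, 0))
        + (LINT (x, t):UNIV \<times> {0..}|lebesgue. u (x, t) * deriv (\<lambda>r. \<phi> (x, r)) t)
        + (LINT (x, t):UNIV \<times> {0..}|lebesgue. f (u (x, t)) \<bullet> grad (\<lambda>y. \<phi> (y, t)) x) = 0"
    unfolding 1 2 by (rule weak_form)
qed

end
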